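(* Let $2\le n\le m$. There exists a constant $c_1=c_1(n)>0$, depending only on $n$, such that the following holds. Let $\Omega\subset\mathbb{R}^n$ be a domain, let $\omega$ be a bounded $n$-volume form in $\mathbb{R}^m$, and let $f:\Omega\to\mathbb{R}^m$ be a finite distortion $\omega$-curve with distortion function $K_f$ such that the pair $(f,\omega)$ satisfies condition (D). If $\exp(\lambda K_f)\in L^1_{loc}(\Omega)$ for some $\lambda>0$, then $$\star f^*\omega\,\log^a(e+\star f^*\omega)\in L^1_{loc}(\Omega)\quad\text{and}\quad |Df(x)|^n\log^{a-1}(e+|Df(x)|)\in L^1_{loc}(\Omega)$$ for all $a<c_1\lambda\dfrac{|\omega|_{inf}}{|\omega|_{\ell_1}}$.
   Context: An $n$-volume form on $\mathbb{R}^m$ is a smooth, non-vanishing, closed differential $n$-form $\omega=\sum_I\phi_I\,dx_I$, the sum being over multi-indices $I=(i_1,\dots,i_n)$, $1\le i_1<\dots<i_n\le m$, with $dx_I=dx_{i_1}\wedge\dots\wedge dx_{i_n}$. It is called bounded if all the (not identically zero) functions $\phi_I$ are bounded on $\mathbb{R}^m$ and there is a constant $c>0$ such that for every $x\in\mathbb{R}^m$ there is a multi-index $I_x$ with $|\phi_{I_x}(x)|>c$. The pointwise comass norm is $\|\omega\|(p)=\sup\{|\omega_p(v_1,\dots,v_n)|: v_1,\dots,v_n\in\mathbb{R}^m,\ |v_i|\le 1\}$. Set $|\omega|_{\ell_1}=\sup_{x\in\mathbb{R}^m}\sum_I|\phi_I(x)|$ and $|\omega|_{inf}=\inf\{\|\omega\|(x):x\in\mathbb{R}^m\}$.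 Let $H_\omega$ be the set of multi-indices $I$ such that $\phi_I$ is not identically zero. For a Sobolev map $f$ and an $n$-form $\eta$, $\star f^*\eta$ denotes the real-valued function with $(\star f^*\eta)\,dx_1\wedge\dots\wedge dx_n=f^*\eta$ (pullback computed with weak derivatives). $|Df(x)|$ is the operator norm of the weak differential; $\log^a t=(\log t)^a$. Finite distortion $\omega$-curve: a map $f\in W^{1,1}_{loc}(\Omega,\mathbb{R}^m)$ such that $\star f^*\omega\in L^1_{loc}(\Omega)$ and there is a measurable function $K_f\ge 1$, finite almost everywhere (the distortion function), with $(\|\omega\|\circ f)(x)\,|Df(x)|^n\le K_f(x)\,(\star f^*\omega)(x)$ for almost every $x\in\Omega$. Condition (D): let $E_f$ be the set of $x\in\Omega$ for which there exists a sequence $x_k\to x$ such that $\star f^*dx_I(x_k)\to\infty$ for some $I\in H_\omega$. The pair $(f,\omega)$ satisfies condition (D) if $E_f$ can be covered by countably many open balls $\{B_i\}_{i=1}^\infty$ such that on each $B_i$ there is a multi-index $I_i\in H_\omega$ with $\star f^*dx_{I_i}\ge\max_{I\in H_\omega}\{\star f^*dx_I\}$. *)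

theory Defs
  imports "HOL-Analysis.Analysis"
begin

text \<open>
  The domain side is \<^typ>\<open>real ^ 'n\<close> with \<open>n = CARD('n)\<close>; the linear order on the finite
  type \<open>'n\<close> is the order of the coordinates \<open>x\<^sub>1, \<dots>, x\<^sub>n\<close>.  The target dimension \<open>m\<close> is a natural
  number, because constants have to be chosen independently of it: \<open>\<real>\<^sup>m\<close> is the carrier of the
  library's \<^term>\<open>Euclidean_space m\<close>, i.e. the real sequences vanishing from index \<open>m\<close> on.
  Target coordinates are numbered \<open>0, \<dots>, m - 1\<close>.
\<close>

abbreviation Rm :: "nat \<Rightarrow> (nat \<Rightarrow> real) set" where
  "Rm m \<equiv> topspace (Euclidean_space m)"

definition enorm :: "nat \<Rightarrow> (nat \<Rightarrow> real) \<Rightarrow> real" where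
  "enorm m y = L2_set y {..<m}"


subsection \<open>Volume forms\<close>

text \<open>
  A multi-index \<open>i\<^sub>1 < \<dots> < i\<^sub>n\<close> is a strictly increasing map from \<open>'n\<close> to \<open>{0, \<dots>, m - 1}\<close>.
  An \<open>n\<close>-form \<open>\<Sum>\<^sub>I \<phi>\<^sub>I dx\<^sub>I\<close> is given by its coefficient functions; only the values \<open>\<phi> I y\<close>
  for multi-indices \<open>I\<close> and \<open>y \<in> \<real>\<^sup>m\<close> matter.
\<close>

definition multi_indices :: "nat \<Rightarrow> ('n::{finite,linorder} \<Rightarrow> nat) set" where
  "multi_indices m = {I. strict_mono I \<and> range I \<subseteq> {..<m}}"

type_synonym 'n form = "('n \<Rightarrow> nat) \<Rightarrow> (nat \<Rightarrow> real) \<Rightarrow> real"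

text \<open>\<open>(dx\<^bsub>i\<^sub>1\<^esub> \<and> \<dots> \<and> dx\<^bsub>i\<^sub>n\<^esub>)(v\<^sub>1, \<dots>, v\<^sub>n)\<close>, normalised so that it is the plain minor, without \<open>1/n!\<close>.\<close>

definition dx :: "('n::{finite,linorder} \<Rightarrow> nat) \<Rightarrow> ('n \<Rightarrow> nat \<Rightarrow> real) \<Rightarrow> real" where
  "dx I v = det (\<chi> k l. v l (I k))"

definition form_eval ::
  "nat \<Rightarrow> ('n::{finite,linorder}) form \<Rightarrow> (nat \<Rightarrow> real) \<Rightarrow> ('n \<Rightarrow> nat \<Rightarrow> real) \<Rightarrow> real" where
  "form_eval m \<phi> y v = (\<Sum>I\<in>multi_indices m. \<phi> I y * dx I v)"

text \<open>\<open>C\<^sup>k\<close> on \<open>\<real>\<^sup>m\<close>: the partial derivatives up to order \<open>k\<close> exist and are continuous.\<close>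

primrec Ck_target :: "nat \<Rightarrow> nat \<Rightarrow> ((nat \<Rightarrow> real) \<Rightarrow> real) \<Rightarrow> bool" where
  "Ck_target m 0 h \<longleftrightarrow> continuous_map (Euclidean_space m) euclideanreal h"
| "Ck_target m (Suc k) h \<longleftrightarrow> continuous_map (Euclidean_space m) euclideanreal h \<and>
     (\<forall>j<m. \<exists>g. (\<forall>y\<in>Rm m. ((\<lambda>t. h (y(j := t))) has_real_derivative g y) (at (y j))) \<and>
        Ck_target m k g)"

definition smooth_target :: "nat \<Rightarrow> ((nat \<Rightarrow> real) \<Rightarrow> real) \<Rightarrow> bool" where
  "smooth_target m h \<longleftrightarrow> (\<forall>k. Ck_target m k h)"

definition pderiv_target :: "nat \<Rightarrow> ((nat \<Rightarrow> real) \<Rightarrow> real) \<Rightarrow> (nat \<Rightarrow> real) \<Rightarrow> real" where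
  "pderiv_target j h y = deriv (\<lambda>t. h (y(j := t))) (y j)"

definition increasing_enum :: "nat set \<Rightarrow> ('n::{finite,linorder} \<Rightarrow> nat)" where
  "increasing_enum S = (THE I. strict_mono I \<and> range I = S)"

text \<open>
  \<open>d\<omega> = 0\<close>: the coefficient of \<open>dx\<^sub>J\<close>, \<open>J = {j\<^sub>0 < \<dots> < j\<^sub>n}\<close>, in \<open>d\<omega> = \<Sum>\<^sub>I \<Sum>\<^sub>j \<partial>\<^sub>j\<phi>\<^sub>I dx\<^sub>j \<and> dx\<^sub>I\<close> is
  \<open>\<Sum>\<^sub>s (-1)\<^sup>s \<partial>\<^bsub>j\<^sub>s\<^esub> \<phi>\<^bsub>J - {j\<^sub>s}\<^esub>\<close>, and \<open>s\<close> is the number of elements of \<open>J\<close> below \<open>j\<^sub>s\<close>.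
\<close>

definition closed_form :: "nat \<Rightarrow> ('n::{finite,linorder}) form \<Rightarrow> bool" where
  "closed_form m \<phi> \<longleftrightarrow>
     (\<forall>J. J \<subseteq> {..<m} \<and> card J = CARD('n) + 1 \<longrightarrow>
        (\<forall>y\<in>Rm m. (\<Sum>j\<in>J. (-1) ^ card {i\<in>J. i < j} *
            pderiv_target j (\<phi> (increasing_enum (J - {j}))) y) = 0))"

definition volume_form :: "nat \<Rightarrow> ('n::{finite,linorder}) form \<Rightarrow> bool" where
  "volume_form m \<phi> \<longleftrightarrow>
     (\<forall>I\<in>multi_indices m. smooth_target m (\<phi> I)) \<and>
     (\<forall>y\<in>Rm m. \<exists>I\<in>multi_indices m. \<phi> I y \<noteq> 0) \<and>
     closed_form m \<phi>"

definition bounded_volume_form :: "nat \<Rightarrow> ('n::{finite,linorder}) form \<Rightarrow> bool" where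
  "bounded_volume_form m \<phi> \<longleftrightarrow>
     volume_form m \<phi> \<and>
     (\<forall>I\<in>multi_indices m. bounded (\<phi> I ` Rm m)) \<and>
     (\<exists>c>0. \<forall>y\<in>Rm m. \<exists>I\<in>multi_indices m. \<bar>\<phi> I y\<bar> > c)"

definition comass :: "nat \<Rightarrow> ('n::{finite,linorder}) form \<Rightarrow> (nat \<Rightarrow> real) \<Rightarrow> real" where
  "comass m \<phi> y = Sup {\<bar>form_eval m \<phi> y v\<bar> | v. \<forall>l. v l \<in> Rm m \<and> enorm m (v l) \<le> 1}"

definition l1_norm :: "nat \<Rightarrow> ('n::{finite,linorder}) form \<Rightarrow> real" where
  "l1_norm m \<phi> = (SUP y\<in>Rm m. \<Sum>I\<in>multi_indices m. \<bar>\<phi> I y\<bar>)"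

definition inf_norm :: "nat \<Rightarrow> ('n::{finite,linorder}) form \<Rightarrow> real" where
  "inf_norm m \<phi> = (INF y\<in>Rm m. comass m \<phi> y)"

definition nonzero_indices :: "nat \<Rightarrow> ('n::{finite,linorder}) form \<Rightarrow> ('n \<Rightarrow> nat) set" where
  "nonzero_indices m \<phi> = {I \<in> multi_indices m. \<exists>y\<in>Rm m. \<phi> I y \<noteq> 0}"


subsection \<open>Local Sobolev maps\<close>

definition L1_loc :: "(real ^ 'n) set \<Rightarrow> (real ^ 'n \<Rightarrow> real) \<Rightarrow> bool" where
  "L1_loc \<Omega> u \<longleftrightarrow> (\<forall>K. compact K \<and> K \<subseteq> \<Omega> \<longrightarrow> u absolutely_integrable_on K)"

primrec Ck_domain :: "nat \<Rightarrow> (real ^ 'n \<Rightarrow> real) \<Rightarrow> bool" where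
  "Ck_domain 0 h \<longleftrightarrow> continuous_on UNIV h"
| "Ck_domain (Suc k) h \<longleftrightarrow> continuous_on UNIV h \<and>
     (\<forall>l. \<exists>g. (\<forall>x. ((\<lambda>t. h (x + t *\<^sub>R axis l 1)) has_real_derivative g x) (at 0)) \<and>
        Ck_domain k g)"

definition pderiv_domain :: "'n \<Rightarrow> (real ^ 'n \<Rightarrow> real) \<Rightarrow> real ^ 'n \<Rightarrow> real" where
  "pderiv_domain l h x = deriv (\<lambda>t. h (x + t *\<^sub>R axis l 1)) 0"

text \<open>\<open>C\<^sub>c\<^sup>\<infinity>(\<Omega>)\<close>, each function being extended by \<open>0\<close> to the whole space.\<close>

definition test_function :: "(real ^ 'n) set \<Rightarrow> (real ^ 'n \<Rightarrow> real) \<Rightarrow> bool" where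
  "test_function \<Omega> \<psi> \<longleftrightarrow>
     (\<forall>k. Ck_domain k \<psi>) \<and> (\<exists>K. compact K \<and> K \<subseteq> \<Omega> \<and> (\<forall>x. x \<notin> K \<longrightarrow> \<psi> x = 0))"

definition weak_pderiv ::
  "(real ^ 'n) set \<Rightarrow> 'n \<Rightarrow> (real ^ 'n \<Rightarrow> real) \<Rightarrow> (real ^ 'n \<Rightarrow> real) \<Rightarrow> bool" where
  "weak_pderiv \<Omega> l u g \<longleftrightarrow>
     (\<forall>\<psi>. test_function \<Omega> \<psi> \<longrightarrow>
        (LINT x:\<Omega>|lebesgue. u x * pderiv_domain l \<psi> x) = - (LINT x:\<Omega>|lebesgue. g x * \<psi> x))"

text \<open>
  \<open>f \<in> W\<^bsup>1,1\<^esup>\<^bsub>loc\<^esub>(\<Omega>, \<real>\<^sup>m)\<close> with weak differential \<open>Df\<close>, where \<open>Df x l \<in> \<real>\<^sup>m\<close> is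
  \<open>\<partial>\<^sub>l f (x) = Df(x) e\<^sub>l\<close>.  The weak differential is only determined almost everywhere, so the
  representative \<open>Df\<close> is kept as a parameter.
\<close>

definition W11_loc ::
  "nat \<Rightarrow> (real ^ 'n) set \<Rightarrow> (real ^ 'n \<Rightarrow> nat \<Rightarrow> real) \<Rightarrow> (real ^ 'n \<Rightarrow> 'n \<Rightarrow> nat \<Rightarrow> real) \<Rightarrow> bool"
  where
  "W11_loc m \<Omega> f Df \<longleftrightarrow>
     (\<forall>x\<in>\<Omega>. f x \<in> Rm m) \<and>
     (\<forall>x\<in>\<Omega>. \<forall>l. Df x l \<in> Rm m) \<and>
     (\<forall>i<m. L1_loc \<Omega> (\<lambda>x. f x i)) \<and>
     (\<forall>i<m. \<forall>l. L1_loc \<Omega> (\<lambda>x. Df x l i) \<and> weak_pderiv \<Omega> l (\<lambda>x. f x i) (\<lambda>x. Df x l i))"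

text \<open>Operator norm of the linear map \<open>h \<mapsto> \<Sum>\<^sub>l h\<^sub>l A\<^sub>l\<close> from \<open>\<real>\<^sup>n\<close> to \<open>\<real>\<^sup>m\<close>, both Euclidean.\<close>

definition op_norm :: "nat \<Rightarrow> ('n::finite \<Rightarrow> nat \<Rightarrow> real) \<Rightarrow> real" where
  "op_norm m A = (SUP h\<in>{h :: (real, 'n) vec. norm h \<le> 1}. enorm m (\<lambda>i. \<Sum>l\<in>UNIV. h $ l * A l i))"

text \<open>
  \<open>\<star>f\<^sup>*\<omega>(x) = (f\<^sup>*\<omega>)\<^sub>x(e\<^sub>1, \<dots>, e\<^sub>n) = \<omega>\<^bsub>f(x)\<^esub>(Df(x) e\<^sub>1, \<dots>, Df(x) e\<^sub>n)\<close>;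
  for the constant form \<open>dx\<^sub>I\<close> this is \<open>dx I (Df x)\<close>.
\<close>

definition star_pullback ::
  "nat \<Rightarrow> ('n::{finite,linorder}) form \<Rightarrow> ((real, 'n) vec \<Rightarrow> nat \<Rightarrow> real) \<Rightarrow>
   ((real, 'n) vec \<Rightarrow> 'n \<Rightarrow> nat \<Rightarrow> real) \<Rightarrow> (real, 'n) vec \<Rightarrow> real" where
  "star_pullback m \<phi> f Df x = form_eval m \<phi> (f x) (Df x)"


subsection \<open>Finite distortion curves and condition (D)\<close>

definition finite_distortion_curve ::
  "nat \<Rightarrow> ('n::{finite,linorder}) form \<Rightarrow> (real, 'n) vec set \<Rightarrow> ((real, 'n) vec \<Rightarrow> nat \<Rightarrow> real) \<Rightarrow>
   ((real, 'n) vec \<Rightarrow> 'n \<Rightarrow> nat \<Rightarrow> real) \<Rightarrow> ((real, 'n) vec \<Rightarrow> ereal) \<Rightarrow> bool" where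
  "finite_distortion_curve m \<phi> \<Omega> f Df K \<longleftrightarrow>
     W11_loc m \<Omega> f Df \<and>
     L1_loc \<Omega> (star_pullback m \<phi> f Df) \<and>
     K \<in> borel_measurable (lebesgue_on \<Omega>) \<and>
     (\<forall>x\<in>\<Omega>. 1 \<le> K x) \<and>
     (AE x in lebesgue_on \<Omega>. K x < \<infinity>) \<and>
     (AE x in lebesgue_on \<Omega>.
        ereal (comass m \<phi> (f x) * op_norm m (Df x) ^ CARD('n))
          \<le> K x * ereal (star_pullback m \<phi> f Df x))"

definition blowup_set ::
  "nat \<Rightarrow> ('n::{finite,linorder}) form \<Rightarrow> (real, 'n) vec set \<Rightarrow>
   ((real, 'n) vec \<Rightarrow> 'n \<Rightarrow> nat \<Rightarrow> real) \<Rightarrow> (real, 'n) vec set" where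
  "blowup_set m \<phi> \<Omega> Df =
     {x \<in> \<Omega>. \<exists>I\<in>nonzero_indices m \<phi>. \<exists>X :: nat \<Rightarrow> (real, 'n) vec.
        (\<forall>k. X k \<in> \<Omega>) \<and> X \<longlonglongrightarrow> x \<and> filterlim (\<lambda>k. dx I (Df (X k))) at_top sequentially}"

text \<open>
  The balls need not lie in \<open>\<Omega>\<close>, and the cover may be a finite or (if the blow-up set is empty)
  an empty family.  The inequality between the minors of the weak differential is understood
  almost everywhere.
\<close>

definition condition_D ::
  "nat \<Rightarrow> ('n::{finite,linorder}) form \<Rightarrow> (real, 'n) vec set \<Rightarrow>
   ((real, 'n) vec \<Rightarrow> 'n \<Rightarrow> nat \<Rightarrow> real) \<Rightarrow> bool" where
  "condition_D m \<phi> \<Omega> Df \<longleftrightarrow>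
     (\<exists>\<B>. countable \<B> \<and> (\<forall>B\<in>\<B>. \<exists>z. \<exists>r>0. B = ball z r) \<and> blowup_set m \<phi> \<Omega> Df \<subseteq> \<Union>\<B> \<and>
        (\<forall>B\<in>\<B>. \<exists>I\<in>nonzero_indices m \<phi>. AE x in lebesgue_on (B \<inter> \<Omega>).
           dx I (Df x) \<ge> (MAX J\<in>nonzero_indices m \<phi>. dx J (Df x))))"

end

theory Submission
  imports Defs "HOL-Computational_Algebra.Polynomial"
begin

text \<open>
  Locally, \<open>\<omega>\<close> has a primitive obtained by the Poincare homotopy, and \<open>\<star>f\<^sup>*\<omega>\<close> integrates against a cut-off
  \<open>\<psi>\<close> to a boundary term, provided \<open>f\<close> is Lipschitz. In general \<open>f\<close> is replaced by mollifications whose scale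
  at \<open>x\<close> is comparable to the distance of \<open>x\<close> to the complement of the superlevel set \<open>U\<^sub>t\<close> of the maximal
  function of \<open>g \<approx> |Df|\<close>: they are of Lipschitz constant of order \<open>t\<close> and agree with \<open>f\<close> off \<open>U\<^sub>t\<close> in the limit.
  With the weak type inequality this bounds the integral of \<open>\<psi> \<star>f\<^sup>*\<omega>\<close> over \<open>{g > t}\<close> by
  \<open>C(n) |\<omega>|\<^bsub>\<ell>\<^sub>1\<^esub> t\<^bsup>n-1\<^esup> \<integral>\<^bsub>{g > t/2}\<^esub> g \<psi>\<close> up to lower order terms. Multiplying by the increments of
  \<open>log\<^sup>a t\<close> and summing over \<open>t = 2\<^sup>k\<close> gives \<open>\<integral> \<psi> \<star>f\<^sup>*\<omega> log\<^sup>a g\<close> on the left and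
  \<open>a C(n) |\<omega>|\<^bsub>\<ell>\<^sub>1\<^esub> \<integral> \<psi> g\<^sup>n log\<^bsup>a-1\<^esup> g\<close> on the right. Since \<open>g\<^sup>n\<close> is at most of the order of
  \<open>K\<^sub>f \<star>f\<^sup>*\<omega> / |\<omega>|\<^bsub>inf\<^esub>\<close>, and \<open>\<lambda> K\<^sub>f\<close> is at most of the order of \<open>log g\<close> except where \<open>exp (\<lambda> K\<^sub>f)\<close>
  dominates every power of \<open>g\<close> in use, the right-hand side is absorbed if \<open>a\<close> is below the stated threshold.
\<close>

subsection \<open>Minors and closed forms\<close>

text \<open>Stokes is not directly available for \<open>f\<close>: \<open>g\<close> and the Jacobian
  are integrable, but the n-th power of \<open>g\<close> is only known to be at most a constant
  times K times the Jacobian. Two gains carry the truncation. The primitive is bounded by a multiple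
  of the norm of the map, and the smoothed map grows only like t^(1-gam),
  \<open>gam = 1 / (2 * n)\<close>, since its derivative in the scale is interpolated between the
  bounds t and s^(-n); boundary terms are thus of order t^(n-gam). On the other side the power n -
  gam/2 of \<open>g\<close> is integrable, because exponential integrability of K beats every power
  of \<open>g\<close>. All lower order terms therefore have finite sums over the levels. That the
  integral of \<open>\<psi> * jacobian + boundary_term\<close> vanishes is a by-product: a nonzero
  value would bound the level terms \<open>V k\<close> from below, whereas the sums of
  \<open>V k / (k + 2)\<close> are bounded and the harmonic series diverges. Absorption requires
  finite quantities, so sums stop at a level T, with bounds uniform in T. The linear dependence of
  the threshold on \<open>a\<close> comes from the factor \<open>a\<close> in the derivative of the
  power \<open>a\<close>.\<close>

lemma dx_leibniz:
  "dx I v = (\<Sum>p | p permutes UNIV. of_int (sign p) * (\<Prod>l\<in>UNIV. v l (I (p l))))"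
proof -
  have "dx I v = det (transpose (\<chi> k l. v l (I k)))"
    by (simp add: dx_def det_transpose)
  then show ?thesis
    by (simp add: det_def transpose_def)
qed

lemma dx_update:
  "dx I (v(l := u)) =
     (\<Sum>p | p permutes UNIV. of_int (sign p) * (u (I (p l)) * (\<Prod>k\<in>UNIV - {l}. v k (I (p k)))))"
proof -
  have "(\<Prod>k\<in>UNIV. (v(l := u)) k (I (p k))) = u (I (p l)) * (\<Prod>k\<in>UNIV - {l}. v k (I (p k)))" for p
    by (simp add: prod.remove[of UNIV l])
  then show ?thesis
    by (simp add: dx_leibniz)
qed

lemma dx_permute:
  assumes "p permutes (UNIV :: 'n::{finite,linorder} set)"
  shows "dx I (v \<circ> p) = of_int (sign p) * dx (I :: 'n \<Rightarrow> nat) v"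
  using det_permute_columns[OF assms, of "\<chi> k l. v l (I k)"] by (simp add: dx_def)

lemma dx_swap:
  assumes "l \<noteq> k"
  shows "dx I (v(l := a, k := b)) = - dx I (v(l := b, k := a))"
proof -
  have "v(l := a, k := b) = (v(l := b, k := a)) \<circ> Transposition.transpose l k"
    using assms by (auto simp: fun_eq_iff Transposition.transpose_def)
  then show ?thesis
    using assms by (simp add: dx_permute permutes_swap_id sign_swap_id)
qed

lemma abs_le_enorm: "j < m \<Longrightarrow> \<bar>y j\<bar> \<le> enorm m y"
  using member_le_L2_set[of "{..<m}" j "\<lambda>i. \<bar>y i\<bar>"] by (simp add: enorm_def L2_set_def)

lemma enorm_nonneg [simp]: "0 \<le> enorm m y"
  by (simp add: enorm_def L2_set_nonneg)

text \<open>The count of n! products takes the place of Hadamard's inequality. The factor depends on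
  n alone, so it may enter the constant of the theorem.\<close>

lemma abs_dx_le:
  assumes "range I \<subseteq> {..<m}"
  shows "\<bar>dx (I :: 'n::{finite,linorder} \<Rightarrow> nat) v\<bar> \<le> fact CARD('n) * (\<Prod>l\<in>UNIV. enorm m (v l))"
proof -
  have "\<bar>dx I v\<bar> \<le> (\<Sum>p | p permutes (UNIV :: 'n set). \<bar>of_int (sign p) * (\<Prod>l\<in>UNIV. v l (I (p l)))\<bar>)"
    unfolding dx_leibniz by (rule sum_abs)
  also have "\<dots> \<le> (\<Sum>p | p permutes (UNIV :: 'n set). \<Prod>l\<in>UNIV. enorm m (v l))"
  proof (rule sum_mono)
    fix p :: "'n \<Rightarrow> 'n"
    have "(\<Prod>l\<in>UNIV. \<bar>v l (I (p l))\<bar>) \<le> (\<Prod>l\<in>UNIV. enorm m (v l))"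
      using assms by (intro prod_mono) (auto intro!: abs_le_enorm)
    then show "\<bar>of_int (sign p) * (\<Prod>l\<in>UNIV. v l (I (p l)))\<bar> \<le> (\<Prod>l\<in>UNIV. enorm m (v l))"
      by (simp add: abs_mult abs_prod sign_def)
  qed
  also have "\<dots> = fact CARD('n) * (\<Prod>l\<in>UNIV. enorm m (v l))"
    by (simp add: card_permutations)
  finally show ?thesis .
qed

text \<open>The cofactor of the entry in row \<open>k\<close> and column \<open>l\<close> of the
  matrix of a minor. It sees neither the index \<open>I k\<close> nor the vector \<open>w l\<close>,
  so either of them may be replaced without changing it.\<close>

definition row_cofactor ::
  "'n::{finite,linorder} \<Rightarrow> ('n \<Rightarrow> nat) \<Rightarrow> 'n \<Rightarrow> ('n \<Rightarrow> nat \<Rightarrow> real) \<Rightarrow> real" where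
  "row_cofactor k I l w =
     (\<Sum>p | p permutes UNIV \<and> p l = k. of_int (sign p) * (\<Prod>l'\<in>UNIV - {l}. w l' (I (p l'))))"

text \<open>Every permutation takes the value \<open>k\<close> at exactly one slot \<open>l\<close>,
  so the terms of the determinant split according to that slot. The new index \<open>i\<close> may
  break monotonicity; the minors are defined for arbitrary index maps precisely so that such
  intermediate maps are allowed.\<close>

lemma dx_row_expansion:
  "dx (I(k := i)) w = (\<Sum>l\<in>UNIV. w l i * row_cofactor k I l w)"
proof -
  let ?P = "{p :: 'a \<Rightarrow> 'a. p permutes UNIV}"
  let ?t = "\<lambda>p. of_int (sign p) * (\<Prod>l\<in>UNIV. w l ((I(k := i)) (p l))) :: real"
  have "(\<Sum>l\<in>UNIV. w l i * row_cofactor k I l w) = (\<Sum>l\<in>UNIV. \<Sum>p | p \<in> ?P \<and> p l = k. ?t p)"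
  proof (rule sum.cong[OF refl])
    fix l :: 'a
    have "w l i * (of_int (sign p) * (\<Prod>l'\<in>UNIV - {l}. w l' (I (p l')))) = ?t p"
      if "p permutes UNIV" "p l = k" for p
    proof -
      have "(\<Prod>l'\<in>UNIV - {l}. w l' ((I(k := i)) (p l'))) = (\<Prod>l'\<in>UNIV - {l}. w l' (I (p l')))"
        using that permutes_inj[OF that(1)] by (intro prod.cong) (auto simp: inj_def)
      then show ?thesis
        using that(2) by (simp add: prod.remove[of UNIV l])
    qed
    then show "w l i * row_cofactor k I l w = (\<Sum>p | p \<in> ?P \<and> p l = k. ?t p)"
      unfolding row_cofactor_def sum_distrib_left by (intro sum.cong) auto
  qed
  also have "\<dots> = (\<Sum>l\<in>UNIV. \<Sum>p\<in>?P. if p l = k then ?t p else 0)"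
    by (rule sum.cong[OF refl], rule sum.inter_filter) (simp add: finite_permutations)
  also have "\<dots> = (\<Sum>p\<in>?P. \<Sum>l\<in>UNIV. if p l = k then ?t p else 0)"
    by (rule sum.swap)
  also have "\<dots> = (\<Sum>p\<in>?P. ?t p)"
  proof (rule sum.cong[OF refl])
    fix p :: "'a \<Rightarrow> 'a" assume "p \<in> ?P"
    then have "(p l = k) = (l = Hilbert_Choice.inv p k)" for l
      by (metis mem_Collect_eq permutes_inverses)
    then show "(\<Sum>l\<in>UNIV. if p l = k then ?t p else 0) = ?t p"
      by simp
  qed
  finally show ?thesis
    by (simp add: dx_leibniz)
qed

lemma row_cofactor_update_same: "row_cofactor k I l (w(l := u)) = row_cofactor k I l w"
  unfolding row_cofactor_def by (intro sum.cong refl arg_cong2[where f = "(*)"] prod.cong) auto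

text \<open>Composition with the transposition of \<open>l\<close> and \<open>l'\<close> matches the
  permutations sending \<open>l\<close> to \<open>k\<close> with those sending \<open>l'\<close> to
  \<open>k\<close>, and flips the sign.\<close>

lemma row_cofactor_update_swap:
  assumes "l \<noteq> l'"
  shows "row_cofactor k I l' (w(l := u)) = - row_cofactor k I l (w(l' := u))"
proof -
  let ?s = "Transposition.transpose l l'"
  have s: "?s permutes UNIV" "sign ?s = - 1"
    using assms by (auto simp: permutes_swap_id sign_swap_id)
  have term_eq: "of_int (sign (p \<circ> ?s)) * (\<Prod>j\<in>UNIV - {l'}. (w(l := u)) j (I ((p \<circ> ?s) j)))
     = - (of_int (sign p) * (\<Prod>j\<in>UNIV - {l}. (w(l' := u)) j (I (p j))) :: real)"
    if "p permutes UNIV" for p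
  proof -
    have "(\<Prod>j\<in>UNIV - {l'}. (w(l := u)) j (I ((p \<circ> ?s) j))) = (\<Prod>j\<in>UNIV - {l}. (w(l' := u)) j (I (p j)))"
    proof (rule prod.reindex_bij_witness[of _ ?s ?s])
      fix j assume "j \<in> UNIV - {l'}"
      then show "(w(l' := u)) (?s j) (I (p (?s j))) = (w(l := u)) j (I ((p \<circ> ?s) j))"
        using assms by (auto simp: Transposition.transpose_def)
    qed (use assms in \<open>auto simp: Transposition.transpose_def split: if_splits\<close>)
    moreover have "sign (p \<circ> ?s) = - sign p"
      using s that by (metis finite sign_compose permutation_permutes mult_minus1_right)
    ultimately show ?thesis
      by simp
  qed
  have "row_cofactor k I l' (w(l := u)) =
    (\<Sum>p | p permutes UNIV \<and> p l = k. of_int (sign (p \<circ> ?s)) * (\<Prod>j\<in>UNIV - {l'}. (w(l := u)) j (I ((p \<circ> ?s) j))))"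
    unfolding row_cofactor_def
    by (rule sum.reindex_bij_witness[of _ "\<lambda>p. p \<circ> ?s" "\<lambda>p. p \<circ> ?s"])
       (auto simp: permutes_compose[OF s(1)] comp_assoc)
  also have "\<dots> = - row_cofactor k I l (w(l' := u))"
    unfolding row_cofactor_def sum_negf[symmetric] by (intro sum.cong refl term_eq) auto
  finally show ?thesis .
qed

text \<open>The value of \<open>dx\<^sub>j \<and> dx\<^sub>I\<close> on the vectors \<open>u, w\<^sub>1, \<dots>, w\<^sub>n\<close>.\<close>

definition wedge1 ::
  "nat \<Rightarrow> ('n::{finite,linorder} \<Rightarrow> nat) \<Rightarrow> (nat \<Rightarrow> real) \<Rightarrow> ('n \<Rightarrow> nat \<Rightarrow> real) \<Rightarrow> real" where
  "wedge1 j I u w = u j * dx I w - (\<Sum>l\<in>UNIV. w l j * dx I (w(l := u)))"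

text \<open>Exchanging two one-forms in a wedge product changes the sign. After expansion along row
  \<open>k\<close>, the two single sums exchange their roles, and the double sum \<open>D\<close> is
  antisymmetric in \<open>i\<close> and \<open>j\<close> because the slots \<open>l\<close> and
  \<open>l'\<close> can be swapped in the cofactors.\<close>

lemma wedge1_antisym: "wedge1 j (I(k := i)) u w + wedge1 i (I(k := j)) u w = 0"
proof -
  let ?C = "row_cofactor k I"
  have expand: "dx (I(k := i)) (w(l := u)) = u i * ?C l w + (\<Sum>l'\<in>UNIV - {l}. w l' i * ?C l' (w(l := u)))"
    for i l
    unfolding dx_row_expansion
    by (simp add: sum.remove[of UNIV l] row_cofactor_update_same)
  define D where "D i j = (\<Sum>l\<in>UNIV. \<Sum>l'\<in>UNIV - {l}. w l j * (w l' i * ?C l' (w(l := u))))" for i j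
  have w: "wedge1 j (I(k := i)) u w
      = (\<Sum>l\<in>UNIV. u j * (w l i * ?C l w)) - (\<Sum>l\<in>UNIV. u i * (w l j * ?C l w)) - D i j" for i j
    unfolding wedge1_def expand D_def
    by (simp add: dx_row_expansion sum_distrib_left distrib_left sum.distrib mult.left_commute[of "u i"])
  have "D j i = (\<Sum>l\<in>UNIV. \<Sum>l'\<in>UNIV. if l' \<noteq> l then w l i * (w l' j * ?C l' (w(l := u))) else 0)"
    unfolding D_def by (intro sum.cong[OF refl] sum.mono_neutral_cong_left) auto
  also have "\<dots> = (\<Sum>l\<in>UNIV. \<Sum>l'\<in>UNIV. if l' \<noteq> l then w l' i * (w l j * ?C l (w(l' := u))) else 0)"
    by (subst sum.swap) (intro sum.cong refl, auto)
  also have "\<dots> = (\<Sum>l\<in>UNIV. \<Sum>l'\<in>UNIV. if l' \<noteq> l then - (w l j * (w l' i * ?C l' (w(l := u)))) else 0)"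
  proof (intro sum.cong refl)
    fix l l' :: 'a
    show "(if l' \<noteq> l then w l' i * (w l j * ?C l (w(l' := u))) else 0)
        = (if l' \<noteq> l then - (w l j * (w l' i * ?C l' (w(l := u)))) else 0)"
      using row_cofactor_update_swap[of l' l k I w u] by (cases "l' = l") simp_all
  qed
  also have "\<dots> = (\<Sum>l\<in>UNIV. \<Sum>l'\<in>UNIV - {l}. - (w l j * (w l' i * ?C l' (w(l := u)))))"
    by (intro sum.cong[OF refl] sum.mono_neutral_cong_right) auto
  also have "\<dots> = - D i j"
    unfolding D_def by (simp add: sum_negf)
  finally show ?thesis
    unfolding w by simp
qed

text \<open>A repeated factor: for equal indices, antisymmetry says that twice the value is
  zero.\<close>

lemma wedge1_range: "j \<in> range I \<Longrightarrow> wedge1 j I u w = 0"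
  using wedge1_antisym[of "I k" I k "I k" u w for k] by (auto simp: fun_upd_triv)

section \<open>Increasing enumerations and the exterior derivative\<close>

lemma card_less_image_strict_mono:
  fixes I :: "'n::{finite,linorder} \<Rightarrow> nat"
  assumes "strict_mono I"
  shows "card {i \<in> range I. i < I k} = card {..<k}"
proof -
  have "{i \<in> range I. i < I k} = I ` {..<k}"
    using strict_mono_less[OF assms] by auto
  then show ?thesis
    using card_image[OF inj_on_subset[OF strict_mono_imp_inj_on[OF assms] subset_UNIV]] by simp
qed

lemma strict_mono_range_unique:
  fixes I I' :: "'n::{finite,linorder} \<Rightarrow> nat"
  assumes "strict_mono I" "strict_mono I'" "range I = range I'"
  shows "I = I'"
proof
  fix k
  have eq: "card {i \<in> range I. i < I k} = card {i \<in> range I. i < I' k}"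
    using card_less_image_strict_mono[OF assms(1), of k]
      card_less_image_strict_mono[OF assms(2), of k] assms(3) by simp
  have less: "card {i \<in> range I. i < a} < card {i \<in> range I. i < b}" if "a < b" "a \<in> range I" for a b
    using that by (intro psubset_card_mono) auto
  show "I k = I' k"
  proof (rule linorder_cases[of "I k" "I' k"])
    assume "I k < I' k"
    then show ?thesis using less[of "I k" "I' k"] eq by simp
  next
    assume "I' k < I k"
    then show ?thesis using less[of "I' k" "I k"] eq assms(3) by simp
  qed
qed

text \<open>The index type is an abstract finite order. It is identified with {0, ..., n-1} through
  the rank \<open>r\<close>, the number of smaller elements, and the sorted list of \<open>S\<close>
  is read at that rank.\<close>

lemma ex_strict_mono_range:
  assumes "finite S" "card S = CARD('n::{finite,linorder})"
  shows "\<exists>I :: 'n \<Rightarrow> nat. strict_mono I \<and> range I = S"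
proof -
  define r where "r k = card {..<k}" for k :: 'n
  have r_mono: "strict_mono r"
    unfolding r_def strict_mono_def by (auto intro!: psubset_card_mono)
  have "r k < CARD('n)" for k
    unfolding r_def by (rule psubset_card_mono) auto
  then have r_sub: "range r \<subseteq> {..<CARD('n)}"
    by auto
  have r_eq: "range r = {..<CARD('n)}"
    using r_sub card_image[OF strict_mono_imp_inj_on[OF r_mono]]
    by (intro card_subset_eq) auto
  let ?xs = "sorted_list_of_set S"
  have len: "length ?xs = CARD('n)" "sorted_wrt (<) ?xs" "set ?xs = S"
    using assms by (auto simp: strict_sorted_list_of_set)
  have "strict_mono (\<lambda>k. ?xs ! r k)"
  proof (rule strict_monoI)
    fix k k' :: 'n assume "k < k'"
    then show "?xs ! r k < ?xs ! r k'"
      using len(1) r_sub strict_monoD[OF r_mono] by (intro sorted_wrt_nth_less[OF len(2)]) auto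
  qed
  moreover have "range (\<lambda>k. ?xs ! r k) = (!) ?xs ` range r"
    by auto
  then have "range (\<lambda>k. ?xs ! r k) = S"
    using len by (simp add: r_eq nth_image[of "CARD('n)" ?xs, simplified atLeast0LessThan] )
  ultimately show ?thesis by blast
qed

lemma increasing_enum:
  assumes "finite S" "card S = CARD('n::{finite,linorder})"
  shows "strict_mono (increasing_enum S :: 'n \<Rightarrow> nat)" "range (increasing_enum S :: 'n \<Rightarrow> nat) = S"
proof -
  have "\<exists>!I :: 'n \<Rightarrow> nat. strict_mono I \<and> range I = S"
    using ex_strict_mono_range[OF assms] strict_mono_range_unique by blast
  from theI'[OF this] show "strict_mono (increasing_enum S :: 'n \<Rightarrow> nat)"
    "range (increasing_enum S :: 'n \<Rightarrow> nat) = S"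
    by (auto simp: increasing_enum_def)
qed

lemma increasing_enum_eqI:
  assumes "strict_mono (I :: 'n::{finite,linorder} \<Rightarrow> nat)" "range I = S"
  shows "increasing_enum S = I"
  unfolding increasing_enum_def
  by (rule the_equality) (use assms strict_mono_range_unique in auto)

text \<open>For neighbours \<open>j < j'\<close> in \<open>J\<close>, deleting \<open>j'\<close>
  instead of \<open>j\<close> changes the enumeration at one position only, where \<open>j'\<close>
  becomes \<open>j\<close>. No reordering occurs, so a single use of antisymmetry suffices.\<close>

lemma wedge1_adjacent:
  fixes w :: "'n::{finite,linorder} \<Rightarrow> nat \<Rightarrow> real"
  assumes J: "finite J" "card J = CARD('n) + 1" and j: "j \<in> J" "j' \<in> J" "j < j'"
    and between: "\<And>i. i \<in> J \<Longrightarrow> j < i \<Longrightarrow> j' \<le> i"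
  shows "wedge1 j (increasing_enum (J - {j})) u w = - wedge1 j' (increasing_enum (J - {j'})) u w"
proof -
  define I :: "'n \<Rightarrow> nat" where "I = increasing_enum (J - {j})"
  have I: "strict_mono I" "range I = J - {j}"
    unfolding I_def using J j by (auto intro!: increasing_enum)
  obtain k where k: "I k = j'"
    using I(2) j by (metis Diff_iff imageE nat_neq_iff singletonD)
  have less: "I a < I b \<longleftrightarrow> a < b" for a b
    using strict_mono_less[OF I(1)] .
  have below: "I a < j" if "a < k" for a
  proof -
    have "I a < j'" "I a \<in> J - {j}" using less[of a k] that k I(2) by auto
    then show ?thesis using between[of "I a"] by force
  qed
  have above: "j < I a" if "k < a" for a
    using less[of k a] that k j by auto
  have "strict_mono (I(k := j))"
    using below above less by (auto simp: strict_mono_def)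
  moreover have "range (I(k := j)) = J - {j'}"
  proof -
    have "I ` (UNIV - {k}) = J - {j} - {j'}"
      using I(2) k strict_mono_eq[OF I(1)] by auto
    then show ?thesis using j by (auto simp: fun_upd_image)
  qed
  ultimately have "increasing_enum (J - {j'}) = I(k := j)"
    by (rule increasing_enum_eqI)
  moreover have "I(k := j') = I"
    using k by auto
  ultimately show ?thesis
    using wedge1_antisym[of j I k j' u w] unfolding I_def[symmetric] by simp
qed

text \<open>Walking down \<open>J\<close> from neighbour to neighbour costs one sign per step, and
  the number of steps from \<open>j\<close> to the minimum is the exponent of the sign in
  \<open>closed_form\<close>.\<close>

lemma wedge1_signed_constant:
  fixes w :: "'n::{finite,linorder} \<Rightarrow> nat \<Rightarrow> real"
  assumes J: "finite J" "card J = CARD('n) + 1" and "j \<in> J"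
  shows "wedge1 j (increasing_enum (J - {j})) u w
       = (-1) ^ card {i \<in> J. i < j} * wedge1 (Min J) (increasing_enum (J - {Min J})) u w"
  using \<open>j \<in> J\<close>
proof (induction j rule: less_induct)
  case (less j)
  show ?case
  proof (cases "{i \<in> J. i < j} = {}")
    case True
    then have "j = Min J" using less.prems J by (intro Min_eqI[symmetric]) auto
    then show ?thesis using True by (simp only: card.empty power_0 mult_1)
  next
    case False
    define p where "p = Max {i \<in> J. i < j}"
    have fin: "finite {i \<in> J. i < j}" using J by auto
    have p: "p \<in> J" "p < j" using Max_in[OF fin False] by (auto simp: p_def)
    have le_p: "i \<le> p" if "i \<in> J" "i < j" for i
      unfolding p_def using that fin by (intro Max_ge) auto
    have "{i \<in> J. i < j} = insert p {i \<in> J. i < p}"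
      using p le_p by (fastforce simp: less_le)
    then have "card {i \<in> J. i < j} = Suc (card {i \<in> J. i < p})"
      using J by simp
    moreover have "wedge1 p (increasing_enum (J - {p})) u w = - wedge1 j (increasing_enum (J - {j})) u w"
      using p less.prems le_p by (intro wedge1_adjacent[OF J]) (auto simp: not_le[symmetric])
    ultimately show ?thesis
      using less.IH[OF p(2,1)] by simp
  qed
qed

lemma finite_multi_indices [simp]: "finite (multi_indices m)"
proof -
  have "multi_indices m \<subseteq> PiE UNIV (\<lambda>_. {..<m})"
    by (auto simp: multi_indices_def)
  then show ?thesis
    by (rule finite_subset) (auto intro: finite_PiE)
qed

text \<open>The exterior derivative evaluated on \<open>u\<close> and the vectors of
  \<open>w\<close>. Pairs of a multi-index and a further index are grouped by their union; within a
  group all wedge values agree up to sign, and what remains is the coefficient that closedness sets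
  to zero.\<close>

lemma closed_form_sum_wedge1:
  fixes w :: "'n::{finite,linorder} \<Rightarrow> nat \<Rightarrow> real" and \<phi> :: "'n form"
  assumes "closed_form m \<phi>" "y \<in> Rm m"
  shows "(\<Sum>I\<in>multi_indices m. \<Sum>j<m. pderiv_target j (\<phi> I) y * wedge1 j I u w) = 0"
proof -
  let ?p = "\<lambda>I j. pderiv_target j (\<phi> I) y"
  let ?E = "increasing_enum :: nat set \<Rightarrow> 'n \<Rightarrow> nat"
  define \<J> where "\<J> = {J. J \<subseteq> {..<m} \<and> card J = CARD('n) + 1}"
  have fin: "finite \<J>" unfolding \<J>_def by auto
  have J: "finite J" "card J = CARD('n) + 1" if "J \<in> \<J>" for J
    using that finite_subset[of J "{..<m}"] by (auto simp: \<J>_def)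
  have E: "strict_mono (?E (J - {j}))" "range (?E (J - {j})) = J - {j}" if "J \<in> \<J>" "j \<in> J" for J j
    using J[OF that(1)] that(2) by (auto intro!: increasing_enum)
  have card_range: "card (range I) = CARD('n)" if "strict_mono I" for I :: "'n \<Rightarrow> nat"
    by (rule card_image[OF strict_mono_imp_inj_on[OF that]])
  have "(\<Sum>I\<in>multi_indices m. \<Sum>j<m. ?p I j * wedge1 j I u w)
      = (\<Sum>(I, j)\<in>multi_indices m \<times> {..<m}. ?p I j * wedge1 j I u w)"
    by (simp add: sum.cartesian_product)
  also have "\<dots> = (\<Sum>(I, j)\<in>{(I, j). I \<in> multi_indices m \<and> j < m \<and> j \<notin> range I}. ?p I j * wedge1 j I u w)"
    by (rule sum.mono_neutral_right) (auto intro!: wedge1_range finite_cartesian_product)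
  also have "\<dots> = (\<Sum>(J, j)\<in>Sigma \<J> (\<lambda>J. J). ?p (?E (J - {j})) j * wedge1 j (?E (J - {j})) u w)"
  proof (rule sum.reindex_bij_witness[of _ "\<lambda>(J, j). (?E (J - {j}), j)" "\<lambda>(I, j). (insert j (range I), j)"])
    fix a assume "a \<in> {(I, j). I \<in> (multi_indices m :: ('n \<Rightarrow> nat) set) \<and> j < m \<and> j \<notin> range I}"
    then obtain I j where a: "a = (I, j)" "I \<in> multi_indices m" "j < m" "j \<notin> range I" by auto
    have I: "strict_mono I" "range I \<subseteq> {..<m}" using a by (auto simp: multi_indices_def)
    have eq: "?E (insert j (range I) - {j}) = I"
      using I a by (intro increasing_enum_eqI) auto
    show "(case case a of (I, j) \<Rightarrow> (insert j (range I), j) of (J, j) \<Rightarrow> (?E (J - {j}), j)) = a"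
      using eq a by simp
    show "(case a of (I, j) \<Rightarrow> (insert j (range I), j)) \<in> Sigma \<J> (\<lambda>J. J)"
      using a I card_range[OF I(1)] by (auto simp: \<J>_def)
    show "(case case a of (I, j) \<Rightarrow> (insert j (range I), j) of
           (J, j) \<Rightarrow> ?p (?E (J - {j})) j * wedge1 j (?E (J - {j})) u w) =
          (case a of (I, j) \<Rightarrow> ?p I j * wedge1 j I u w)"
      using eq a by simp
  next
    fix b assume "b \<in> Sigma \<J> (\<lambda>J. J)"
    then obtain J' j where b: "b = (J', j)" "J' \<in> \<J>" "j \<in> J'" by auto
    show "(case case b of (J, j) \<Rightarrow> (?E (J - {j}), j) of (I, j) \<Rightarrow> (insert j (range I), j)) = b"
      using b E[OF b(2,3)] by auto
    show "(case b of (J, j) \<Rightarrow> (?E (J - {j}), j)) \<in> {(I, j). I \<in> multi_indices m \<and> j < m \<and> j \<notin> range I}"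
      using b E[OF b(2,3)] by (auto simp: multi_indices_def \<J>_def)
  qed
  also have "\<dots> = (\<Sum>J\<in>\<J>. \<Sum>j\<in>J. ?p (?E (J - {j})) j * wedge1 j (?E (J - {j})) u w)"
    using fin J by (subst sum.Sigma) auto
  also have "\<dots> = (\<Sum>J\<in>\<J>. 0)"
  proof (rule sum.cong[OF refl])
    fix J' assume J': "J' \<in> \<J>"
    have "(\<Sum>j\<in>J'. ?p (?E (J' - {j})) j * wedge1 j (?E (J' - {j})) u w)
       = (\<Sum>j\<in>J'. (-1) ^ card {i\<in>J'. i < j} * ?p (?E (J' - {j})) j)
           * wedge1 (Min J') (?E (J' - {Min J'})) u w"
      unfolding sum_distrib_right
      using wedge1_signed_constant[OF J[OF J'], of _ u w] by (intro sum.cong refl) simp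
    also have "\<dots> = 0"
      using assms J' by (simp add: closed_form_def \<J>_def)
    finally show "(\<Sum>j\<in>J'. ?p (?E (J' - {j})) j * wedge1 j (?E (J' - {j})) u w) = 0" .
  qed
  finally show ?thesis by simp
qed

subsection \<open>The primitive of a closed form\<close>

lemma Rm_iff: "y \<in> Rm m \<longleftrightarrow> (\<forall>i\<ge>m. y i = 0)"
  by (simp add: topspace_Euclidean_space)

lemma continuous_map_Euclidean_space_iff:
  "continuous_map (Euclidean_space m) euclideanreal h \<longleftrightarrow> continuous_on (Rm m) h"
  by (simp add: Euclidean_space_def topspace_Euclidean_space euclidean_product_topology)

lemma tendsto_coordinatewise:
  fixes f :: "'a \<Rightarrow> 'b \<Rightarrow> 'c::topological_space"
  assumes "\<And>i. ((\<lambda>x. f x i) \<longlongrightarrow> l i) F"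
  shows "(f \<longlongrightarrow> l) F"
proof -
  have "limitin (product_topology (\<lambda>_. euclidean) UNIV) f l F"
    using assms by (simp add: limitin_componentwise)
  then show ?thesis
    by (simp add: euclidean_product_topology)
qed

lemma smooth_target_continuous:
  assumes "smooth_target m h"
  shows "continuous_on (Rm m) h"
  using assms[unfolded smooth_target_def, rule_format, of 0] by (simp add: continuous_map_Euclidean_space_iff)

lemma smooth_target_pderiv:
  assumes "smooth_target m h" "j < m"
  shows "continuous_on (Rm m) (pderiv_target j h)"
    and "y \<in> Rm m \<Longrightarrow> ((\<lambda>t. h (y(j := t))) has_real_derivative pderiv_target j h y) (at (y j))"
proof -
  have "Ck_target m (Suc 0) h"
    using assms by (simp add: smooth_target_def del: Ck_target.simps)
  then obtain g where g: "\<And>y. y \<in> Rm m \<Longrightarrow> ((\<lambda>t. h (y(j := t))) has_real_derivative g y) (at (y j))"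
    and c: "continuous_on (Rm m) g"
    using assms(2) by (auto simp: continuous_map_Euclidean_space_iff Bex_def dest!: spec[of _ j])
  have eq: "g y = pderiv_target j h y" if "y \<in> Rm m" for y
    using DERIV_imp_deriv[OF g[OF that]] by (simp add: pderiv_target_def)
  show "continuous_on (Rm m) (pderiv_target j h)"
    using c eq by (simp cong: continuous_on_cong)
  show "((\<lambda>t. h (y(j := t))) has_real_derivative pderiv_target j h y) (at (y j))" if "y \<in> Rm m"
    using g[OF that] eq[OF that] by simp
qed

lemma smooth_target_line_mvt:
  assumes h: "smooth_target m h" "k < m" and y: "y \<in> Rm m"
  shows "\<exists>r. \<bar>r - y k\<bar> \<le> \<bar>s - y k\<bar> \<and>
     h (y(k := s)) - h y = pderiv_target k h (y(k := r)) * (s - y k)"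
proof -
  have d: "((\<lambda>t. h (y(k := t))) has_real_derivative pderiv_target k h (y(k := t))) (at t)" for t
  proof -
    have "y(k := t) \<in> Rm m" using y h(2) by (auto simp: Rm_iff)
    from smooth_target_pderiv(2)[OF h this] show ?thesis by simp
  qed
  consider "s = y k" | "s < y k" | "y k < s" by linarith
  then show ?thesis
  proof cases
    case 1 then show ?thesis by auto
  next
    case 2
    from MVT2[OF 2, of "\<lambda>t. h (y(k := t))" "\<lambda>t. pderiv_target k h (y(k := t))", OF d]
    obtain r where "s < r" "r < y k" "h (y(k := y k)) - h (y(k := s)) = (y k - s) * pderiv_target k h (y(k := r))"
      by blast
    then show ?thesis by (intro exI[of _ r]) (auto simp: algebra_simps)
  next
    case 3
    from MVT2[OF 3, of "\<lambda>t. h (y(k := t))" "\<lambda>t. pderiv_target k h (y(k := t))", OF d]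
    obtain r where "y k < r" "r < s" "h (y(k := s)) - h (y(k := y k)) = (s - y k) * pderiv_target k h (y(k := r))"
      by blast
    then show ?thesis by (intro exI[of _ r]) (auto simp: algebra_simps)
  qed
qed

text \<open>Differentiability is given through partial derivatives, so the coordinates of the curve
  are switched on one after another: \<open>z k\<close> follows the curve in the first
  \<open>k\<close> coordinates and is frozen at the base point in the others. Each switch is handled
  by the mean value theorem in one coordinate and continuity of that partial derivative.\<close>

lemma smooth_target_chain:
  assumes h: "smooth_target m h" and c: "\<And>\<tau>. c \<tau> \<in> Rm m"
    and c': "\<And>i. i < m \<Longrightarrow> ((\<lambda>\<tau>. c \<tau> i) has_real_derivative c' i) (at \<tau>0)"
  shows "((\<lambda>\<tau>. h (c \<tau>)) has_real_derivative (\<Sum>j<m. pderiv_target j h (c \<tau>0) * c' j)) (at \<tau>0)"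
proof -
  define z where "z k \<tau> = (\<lambda>i. if i < k then c \<tau> i else c \<tau>0 i)" for k \<tau>
  have cont: "((\<lambda>\<tau>. c \<tau> i) \<longlongrightarrow> c \<tau>0 i) (at \<tau>0)" for i
  proof (cases "i < m")
    case True
    then show ?thesis using DERIV_isCont[OF c'] by (simp add: isCont_def)
  next
    case False
    then show ?thesis using c by (simp add: Rm_iff)
  qed
  have z_Rm: "z k \<tau> \<in> Rm m" for k \<tau>
    using c by (auto simp: z_def Rm_iff)
  have "((\<lambda>\<tau>. h (z k \<tau>)) has_real_derivative (\<Sum>j<k. pderiv_target j h (c \<tau>0) * c' j)) (at \<tau>0)"
    if "k \<le> m" for k
    using that
  proof (induction k)
    case 0
    then show ?case by (simp add: z_def)
  next
    case (Suc k)
    have k: "k < m" using Suc by simp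
    define d where "d \<tau> = h (z (Suc k) \<tau>) - h (z k \<tau>)" for \<tau>
    have z_Suc: "z (Suc k) \<tau> = (z k \<tau>)(k := c \<tau> k)" and z_k: "z k \<tau> k = c \<tau>0 k" for \<tau>
      by (auto simp: z_def fun_eq_iff less_Suc_eq)
    have "\<exists>r. \<bar>r - c \<tau>0 k\<bar> \<le> \<bar>c \<tau> k - c \<tau>0 k\<bar> \<and>
       d \<tau> = pderiv_target k h ((z k \<tau>)(k := r)) * (c \<tau> k - c \<tau>0 k)" for \<tau>
      using smooth_target_line_mvt[OF h k z_Rm[of k \<tau>], of "c \<tau> k"] by (simp add: d_def z_Suc z_k)
    then obtain r where r: "\<And>\<tau>. \<bar>r \<tau> - c \<tau>0 k\<bar> \<le> \<bar>c \<tau> k - c \<tau>0 k\<bar>"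
      "\<And>\<tau>. d \<tau> = pderiv_target k h ((z k \<tau>)(k := r \<tau>)) * (c \<tau> k - c \<tau>0 k)"
      by metis
    have r_lim: "(r \<longlongrightarrow> c \<tau>0 k) (at \<tau>0)"
    proof (rule LIM_zero_cancel, rule Lim_null_comparison)
      show "\<forall>\<^sub>F \<tau> in at \<tau>0. norm (r \<tau> - c \<tau>0 k) \<le> \<bar>c \<tau> k - c \<tau>0 k\<bar>"
        using r(1) by simp
      show "((\<lambda>\<tau>. \<bar>c \<tau> k - c \<tau>0 k\<bar>) \<longlongrightarrow> 0) (at \<tau>0)"
        using LIM_zero[OF cont[of k]] by (rule tendsto_rabs_zero)
    qed
    have "((\<lambda>\<tau>. (z k \<tau>)(k := r \<tau>)) \<longlongrightarrow> c \<tau>0) (at \<tau>0)"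
    proof (rule tendsto_coordinatewise)
      fix i
      show "((\<lambda>\<tau>. ((z k \<tau>)(k := r \<tau>)) i) \<longlongrightarrow> c \<tau>0 i) (at \<tau>0)"
        using r_lim cont[of i] by (cases "i = k"; cases "i < k") (auto simp: z_def)
    qed
    moreover have "(z k \<tau>)(k := r \<tau>) \<in> Rm m" for \<tau>
      using z_Rm k by (auto simp: Rm_iff)
    ultimately have "((\<lambda>\<tau>. pderiv_target k h ((z k \<tau>)(k := r \<tau>))) \<longlongrightarrow> pderiv_target k h (c \<tau>0)) (at \<tau>0)"
      by (rule continuous_on_tendsto_compose[OF smooth_target_pderiv(1)[OF h k] _ c, OF _ always_eventually, OF _ allI])
    from tendsto_mult[OF this c'[OF k, unfolded has_field_derivative_iff]]
    have "((\<lambda>\<tau>. d \<tau> / (\<tau> - \<tau>0)) \<longlongrightarrow> pderiv_target k h (c \<tau>0) * c' k) (at \<tau>0)"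
      by (simp add: r(2))
    moreover have "d \<tau>0 = 0"
      using r(2)[of \<tau>0] by simp
    ultimately have "(d has_real_derivative pderiv_target k h (c \<tau>0) * c' k) (at \<tau>0)"
      by (simp add: has_field_derivative_iff)
    from DERIV_add[OF Suc.IH this] Suc.prems show ?case
      by (simp add: d_def)
  qed
  from this[of m] have "((\<lambda>\<tau>. h (z m \<tau>)) has_real_derivative (\<Sum>j<m. pderiv_target j h (c \<tau>0) * c' j)) (at \<tau>0)"
    by simp
  moreover have "z m \<tau> = c \<tau>" for \<tau>
    using c by (auto simp: z_def Rm_iff fun_eq_iff)
  ultimately show ?thesis by simp
qed

lemma dx_DERIV:
  fixes V :: "real \<Rightarrow> 'n::{finite,linorder} \<Rightarrow> nat \<Rightarrow> real"
  assumes I: "range I \<subseteq> {..<m}"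
    and V: "\<And>l i. i < m \<Longrightarrow> ((\<lambda>\<tau>. V \<tau> l i) has_real_derivative V' l i) (at \<tau>0)"
  shows "((\<lambda>\<tau>. dx I (V \<tau>)) has_real_derivative (\<Sum>l\<in>UNIV. dx I ((V \<tau>0)(l := V' l)))) (at \<tau>0)"
proof -
  have "((\<lambda>\<tau>. dx I (V \<tau>)) has_real_derivative
     (\<Sum>p | p permutes UNIV. of_int (sign p) * (\<Sum>l\<in>UNIV. V' l (I (p l)) * (\<Prod>k\<in>UNIV - {l}. V \<tau>0 k (I (p k)))))) (at \<tau>0)"
    unfolding dx_leibniz
    using I by (intro DERIV_sum DERIV_cmult has_field_derivative_prod V) auto
  then show ?thesis
    unfolding dx_update sum_distrib_left by (subst sum.swap)
qed

text \<open>
  Double sums over pairs of slots whose summands are antisymmetric vanish; this removes the second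
  derivatives when a pulled back form is differentiated.
\<close>

lemma sum_dx_symmetric:
  fixes w :: "'n::{finite,linorder} \<Rightarrow> nat \<Rightarrow> real"
  assumes "\<And>l k. S l k = S k l"
  shows "(\<Sum>l\<in>UNIV. \<Sum>k\<in>UNIV - {l}. dx I (w(l := u, k := S l k))) = 0"
proof -
  let ?D = "\<lambda>l k. if k \<noteq> l then dx I (w(l := u, k := S l k)) else 0"
  have "(\<Sum>l\<in>UNIV. \<Sum>k\<in>UNIV - {l}. dx I (w(l := u, k := S l k))) = (\<Sum>l\<in>UNIV. \<Sum>k\<in>UNIV. ?D l k)"
    by (intro sum.cong[OF refl] sum.mono_neutral_cong_left) auto
  moreover have "(\<Sum>l\<in>UNIV. \<Sum>k\<in>UNIV. ?D l k) = (\<Sum>l\<in>UNIV. \<Sum>k\<in>UNIV. - ?D l k)"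
  proof (subst sum.swap, intro sum.cong refl)
    fix l k
    have "dx I (w(k := u, l := S k l)) = - dx I (w(l := u, k := S l k))" if "k \<noteq> l"
      using dx_swap[OF that, of I w u "S k l"] unfolding assms[of l k] fun_upd_twist[OF that, of w "S k l" u] .
    then show "?D k l = - ?D l k" by auto
  qed
  moreover have "(\<Sum>l\<in>UNIV. \<Sum>k\<in>UNIV. - ?D l k) = - (\<Sum>l\<in>UNIV. \<Sum>k\<in>UNIV. ?D l k)"
    by (simp only: sum_negf)
  ultimately show ?thesis by linarith
qed

section \<open>Mixed partial derivatives and differentiation of parameter integrals\<close>

lemma Ck_domain_continuous: "Ck_domain k u \<Longrightarrow> continuous_on UNIV u"
  by (cases k) auto

lemma Ck_domain_SucD: "Ck_domain (Suc k) u \<Longrightarrow> Ck_domain k u"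
proof (induction k arbitrary: u)
  case (Suc k)
  then show ?case
    by (auto simp del: Ck_domain.simps(2) simp: Ck_domain.simps(2)[of "Suc k"] Ck_domain.simps(2)[of k])
       (metis Ck_domain.simps(2))
qed auto

lemma Ck_domain_pderiv:
  assumes "Ck_domain (Suc k) u"
  shows "Ck_domain k (pderiv_domain l u)"
    and "((\<lambda>t. u (x + t *\<^sub>R axis l 1)) has_real_derivative pderiv_domain l u (x + s *\<^sub>R axis l 1)) (at s)"
proof -
  obtain g where g: "\<And>x. ((\<lambda>t. u (x + t *\<^sub>R axis l 1)) has_real_derivative g x) (at 0)"
    and k: "Ck_domain k g"
    using assms by auto
  have eq: "g = pderiv_domain l u"
    unfolding pderiv_domain_def using DERIV_imp_deriv[OF g] by metis
  show "Ck_domain k (pderiv_domain l u)"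
    using k eq by simp
  have "((\<lambda>t. u (x + s *\<^sub>R axis l 1 + t *\<^sub>R axis l 1)) has_real_derivative g (x + s *\<^sub>R axis l 1)) (at 0)"
    by (rule g)
  then have "((\<lambda>t. (\<lambda>t. u (x + t *\<^sub>R axis l 1)) (s + t)) has_real_derivative g (x + s *\<^sub>R axis l 1)) (at 0)"
    by (simp add: algebra_simps)
  then show "((\<lambda>t. u (x + t *\<^sub>R axis l 1)) has_real_derivative pderiv_domain l u (x + s *\<^sub>R axis l 1)) (at s)"
    unfolding eq using DERIV_at_within_shift[of "\<lambda>t. u (x + t *\<^sub>R axis l 1)" _ s 0 UNIV] by (simp add: add.commute)
qed

lemma pderiv_domain_zero_outside:
  fixes u :: "real ^ 'n \<Rightarrow> real"
  assumes u: "Ck_domain (Suc 0) u" and S: "closed S" "\<And>x. x \<notin> S \<Longrightarrow> u x = 0" and x: "x \<notin> S"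
  shows "pderiv_domain l u x = 0"
proof -
  have "\<forall>\<^sub>F t in nhds 0. x + t *\<^sub>R axis l 1 \<in> - S"
  proof (rule topological_tendstoD)
    have "((\<lambda>t. x + t *\<^sub>R axis l 1) \<longlongrightarrow> x + 0 *\<^sub>R axis l 1) (nhds 0)"
      by (intro tendsto_intros filterlim_ident)
    then show "((\<lambda>t. x + t *\<^sub>R axis l 1) \<longlongrightarrow> x) (nhds 0)" by simp
  qed (use S(1) x in \<open>auto simp: open_Compl\<close>)
  then have "\<forall>\<^sub>F t in nhds 0. u (x + t *\<^sub>R axis l 1) = 0"
    by eventually_elim (use S(2) in auto)
  then have "((\<lambda>t. 0) has_real_derivative pderiv_domain l u x) (at 0)"
    using Ck_domain_pderiv(2)[OF u, of x l 0] by (subst (asm) DERIV_cong_ev[OF refl _ refl]) auto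
  then show ?thesis using DERIV_unique[OF _ DERIV_const] by blast
qed

text \<open>Schwarz's theorem from the second difference over a small square. The mean value
  theorem, applied in the two possible orders, writes the same number as either mixed derivative at
  a nearby point; continuity takes both to \<open>x\<close> as the side tends to zero.\<close>

lemma pderiv_domain_commute:
  assumes u: "Ck_domain 2 u"
  shows "pderiv_domain k (pderiv_domain l u) x = pderiv_domain l (pderiv_domain k u) x"
proof -
  let ?e = "\<lambda>l. axis l (1::real) :: real ^ 'a"
  have u2: "Ck_domain (Suc (Suc 0)) u"
    using u by (simp only: numeral_2_eq_2)
  have mvt: "\<exists>s t. 0 < s \<and> s < a \<and> 0 < t \<and> t < a \<and>
      u (x + a *\<^sub>R ?e k + a *\<^sub>R ?e l) - u (x + a *\<^sub>R ?e k) - u (x + a *\<^sub>R ?e l) + u x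
        = a * a * pderiv_domain l (pderiv_domain k u) (x + s *\<^sub>R ?e k + t *\<^sub>R ?e l)"
    if "0 < a" for a k l
  proof -
    define v where "v s = u (x + a *\<^sub>R ?e l + s *\<^sub>R ?e k) - u (x + s *\<^sub>R ?e k)" for s
    have "(v has_real_derivative
        pderiv_domain k u (x + a *\<^sub>R ?e l + s *\<^sub>R ?e k) - pderiv_domain k u (x + s *\<^sub>R ?e k)) (at s)" for s
      unfolding v_def by (intro DERIV_diff Ck_domain_pderiv(2)[OF u2])
    from MVT2[OF that this] obtain s where s: "0 < s" "s < a"
      "v a - v 0 = (a - 0) * (pderiv_domain k u (x + a *\<^sub>R ?e l + s *\<^sub>R ?e k) - pderiv_domain k u (x + s *\<^sub>R ?e k))"
      by blast
    from MVT2[OF that Ck_domain_pderiv(2)[OF Ck_domain_pderiv(1)[OF u2, of k], of "x + s *\<^sub>R ?e k" l]]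
    obtain t where t: "0 < t" "t < a"
      "pderiv_domain k u (x + s *\<^sub>R ?e k + a *\<^sub>R ?e l) - pderiv_domain k u (x + s *\<^sub>R ?e k + 0 *\<^sub>R ?e l)
         = (a - 0) * pderiv_domain l (pderiv_domain k u) (x + s *\<^sub>R ?e k + t *\<^sub>R ?e l)"
      by blast
    have "v a - v 0 = u (x + a *\<^sub>R ?e k + a *\<^sub>R ?e l) - u (x + a *\<^sub>R ?e k) - u (x + a *\<^sub>R ?e l) + u x"
      by (simp add: v_def algebra_simps)
    then show ?thesis
      using s t by (intro exI[of _ s] exI[of _ t]) (simp add: algebra_simps)
  qed
  have lim: "(\<lambda>N. pderiv_domain l (pderiv_domain k u) (x + s N *\<^sub>R ?e k + t N *\<^sub>R ?e l))
       \<longlonglongrightarrow> pderiv_domain l (pderiv_domain k u) x"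
    if "\<And>N. 0 < s N \<and> s N < 1 / real (Suc N)" "\<And>N. 0 < t N \<and> t N < 1 / real (Suc N)" for s t k l
  proof -
    have "s \<longlonglongrightarrow> 0" "t \<longlonglongrightarrow> 0"
      using that by (auto intro!: real_tendsto_sandwich[OF _ _ tendsto_const lim_1_over_n[THEN LIMSEQ_Suc]]
          simp: order.strict_implies_order)
    then have "(\<lambda>N. x + s N *\<^sub>R ?e k + t N *\<^sub>R ?e l) \<longlonglongrightarrow> x + 0 *\<^sub>R ?e k + 0 *\<^sub>R ?e l"
      by (intro tendsto_intros)
    moreover have "continuous_on UNIV (pderiv_domain l (pderiv_domain k u))"
      by (intro Ck_domain_continuous[of 0] Ck_domain_pderiv u2)
    ultimately show ?thesis
      using continuous_on_tendsto_compose[of UNIV "pderiv_domain l (pderiv_domain k u)"] by auto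
  qed
  have pos: "0 < 1 / real (Suc N)" for N by simp
  define \<Delta> where "\<Delta> a = u (x + a *\<^sub>R ?e k + a *\<^sub>R ?e l) - u (x + a *\<^sub>R ?e k) - u (x + a *\<^sub>R ?e l) + u x" for a
  have "\<exists>s t. (0 < s \<and> s < 1 / real (Suc N)) \<and> (0 < t \<and> t < 1 / real (Suc N)) \<and>
     \<Delta> (1 / real (Suc N)) = 1 / real (Suc N) * (1 / real (Suc N)) * pderiv_domain l (pderiv_domain k u) (x + s *\<^sub>R ?e k + t *\<^sub>R ?e l)" for N
    using mvt[OF pos[of N], of k l] unfolding \<Delta>_def by blast
  then obtain s t where 1: "\<And>N. 0 < s N \<and> s N < 1 / real (Suc N)" "\<And>N. 0 < t N \<and> t N < 1 / real (Suc N)"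
     "\<And>N. \<Delta> (1 / real (Suc N)) = 1 / real (Suc N) * (1 / real (Suc N)) * pderiv_domain l (pderiv_domain k u) (x + s N *\<^sub>R ?e k + t N *\<^sub>R ?e l)"
    by metis
  have "\<Delta> a = u (x + a *\<^sub>R ?e l + a *\<^sub>R ?e k) - u (x + a *\<^sub>R ?e l) - u (x + a *\<^sub>R ?e k) + u x" for a
    by (simp add: \<Delta>_def algebra_simps)
  then have "\<exists>s t. (0 < s \<and> s < 1 / real (Suc N)) \<and> (0 < t \<and> t < 1 / real (Suc N)) \<and>
     \<Delta> (1 / real (Suc N)) = 1 / real (Suc N) * (1 / real (Suc N)) * pderiv_domain k (pderiv_domain l u) (x + s *\<^sub>R ?e l + t *\<^sub>R ?e k)" for N
    using mvt[OF pos[of N], of l k] by metis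
  then obtain s' t' where 2: "\<And>N. 0 < s' N \<and> s' N < 1 / real (Suc N)" "\<And>N. 0 < t' N \<and> t' N < 1 / real (Suc N)"
     "\<And>N. \<Delta> (1 / real (Suc N)) = 1 / real (Suc N) * (1 / real (Suc N)) * pderiv_domain k (pderiv_domain l u) (x + s' N *\<^sub>R ?e l + t' N *\<^sub>R ?e k)"
    by metis
  have "pderiv_domain l (pderiv_domain k u) (x + s N *\<^sub>R ?e k + t N *\<^sub>R ?e l)
      = pderiv_domain k (pderiv_domain l u) (x + s' N *\<^sub>R ?e l + t' N *\<^sub>R ?e k)" for N
    using 1(3)[of N] 2(3)[of N] pos[of N] by (metis mult_cancel_left mult_eq_0_iff less_irrefl)
  then show ?thesis
    using LIMSEQ_unique[OF lim[OF 1(1,2), of l k]] lim[OF 2(1,2), of k l] by simp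
qed

text \<open>The weight \<open>f\<close> is merely integrable, so all regularity is put into
  \<open>F\<close>. The difference quotients of \<open>F\<close> are bounded by the maximum of
  \<open>F'\<close> on the compact product, and dominated convergence applies along
  sequences.\<close>

lemma integral_param_deriv:
  fixes F F' :: "real \<Rightarrow> 'b::euclidean_space \<Rightarrow> real"
  assumes f: "integrable lebesgue f" "\<And>y. y \<notin> S \<Longrightarrow> f y = 0" and S: "compact S" and d: "0 < d"
    and F: "\<And>t. \<bar>t - t0\<bar> \<le> d \<Longrightarrow> continuous_on S (F t)"
    and F': "continuous_on ({t0 - d..t0 + d} \<times> S) (\<lambda>(t, y). F' t y)"
    and deriv: "\<And>t y. \<bar>t - t0\<bar> \<le> d \<Longrightarrow> y \<in> S \<Longrightarrow> ((\<lambda>t. F t y) has_real_derivative F' t y) (at t)"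
  shows "((\<lambda>t. LINT y|lebesgue. f y * F t y) has_real_derivative (LINT y|lebesgue. f y * F' t0 y)) (at t0)"
proof -
  have Smeas: "S \<in> sets lebesgue" using S by (simp add: compact_imp_closed borel_closed)
  have compact_prod: "compact ({t0 - d..t0 + d} \<times> S)" by (intro compact_Times S compact_Icc)
  obtain C where C: "\<And>t y. \<bar>t - t0\<bar> \<le> d \<Longrightarrow> y \<in> S \<Longrightarrow> \<bar>F' t y\<bar> \<le> C"
  proof -
    obtain C where "\<forall>p\<in>(\<lambda>(t, y). F' t y) ` ({t0 - d..t0 + d} \<times> S). norm p \<le> C"
      using compact_imp_bounded[OF compact_continuous_image[OF F' compact_prod]] by (auto simp: bounded_iff)
    then have "\<And>t y. \<bar>t - t0\<bar> \<le> d \<Longrightarrow> y \<in> S \<Longrightarrow> \<bar>F' t y\<bar> \<le> C"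
      by (auto simp: abs_le_iff)
    then show ?thesis using that by blast
  qed
  have integrable_mult: "integrable lebesgue (\<lambda>y. f y * G y)" if G: "continuous_on S G" for G
  proof -
    obtain B where B: "\<forall>p\<in>G ` S. norm p \<le> B"
      using compact_imp_bounded[OF compact_continuous_image[OF G S]] by (auto simp: bounded_iff)
    have meas: "(\<lambda>y. indicator S y * G y) \<in> borel_measurable lebesgue"
      using borel_measurable_continuous_on_indicator[OF _ G] S
      by (simp add: compact_imp_closed borel_closed measurable_completion)
    have "integrable lebesgue (\<lambda>y. f y * (indicator S y * G y))"
    proof (rule Bochner_Integration.integrable_bound[OF integrable_mult_left[OF f(1), of B]])
      show "(\<lambda>y. f y * (indicator S y * G y)) \<in> borel_measurable lebesgue"
        by (rule borel_measurable_times[OF borel_measurable_integrable[OF f(1)] meas])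
      show "AE y in lebesgue. norm (f y * (indicator S y * G y)) \<le> norm (f y * B)"
      proof (rule AE_I2)
        fix y
        show "norm (f y * (indicator S y * G y)) \<le> norm (f y * B)"
        proof (cases "y \<in> S")
          case True
          then have "\<bar>G y\<bar> \<le> \<bar>B\<bar>" using B by fastforce
          then show ?thesis using True by (simp add: abs_mult mult_left_mono)
        qed (simp add: f(2))
      qed
    qed
    moreover have "(\<lambda>y. f y * (indicator S y * G y)) = (\<lambda>y. f y * G y)"
    proof
      fix y
      show "f y * (indicator S y * G y) = f y * G y"
        using f(2)[of y] by (cases "y \<in> S") auto
    qed
    ultimately show ?thesis by simp
  qed
  have mvt: "\<bar>F (t0 + s) y - F t0 y\<bar> \<le> C * \<bar>s\<bar>" if "\<bar>s\<bar> \<le> d" "y \<in> S" for s y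
  proof -
    have "norm (F (t0 + s) y - F t0 y) \<le> C * norm (t0 + s - t0)"
    proof (rule field_differentiable_bound[of "{t0 - d..t0 + d}" "\<lambda>t. F t y" "\<lambda>t. F' t y"])
      fix t assume "t \<in> {t0 - d..t0 + d}"
      then have t: "\<bar>t - t0\<bar> \<le> d" by auto
      show "((\<lambda>t. F t y) has_field_derivative F' t y) (at t within {t0 - d..t0 + d})"
        using deriv[OF t that(2)] by (rule has_field_derivative_at_within)
      show "norm (F' t y) \<le> C" using C[OF t that(2)] by simp
    qed (use that d in auto)
    then show ?thesis by simp
  qed
  have cont_F': "continuous_on S (F' t0)"
  proof -
    have "continuous_on S (\<lambda>y. (t0, y))" by (intro continuous_intros)
    from continuous_on_compose2[OF F' this] d show ?thesis by fastforce
  qed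
  show ?thesis
    unfolding DERIV_def tendsto_at_iff_sequentially
  proof (intro allI impI)
    fix X :: "nat \<Rightarrow> real" assume X: "\<forall>i. X i \<in> UNIV - {0}" "X \<longlonglongrightarrow> 0"
    have ev: "\<forall>\<^sub>F i in sequentially. \<bar>X i\<bar> < d"
      using X(2) d by (auto simp: tendsto_iff dist_real_def)
    \<comment> \<open>Dominated convergence asks for its bound at every index, so the finitely many
      increments that leave the window are replaced by \<open>d\<close>.\<close>
    define X' where "X' i = (if \<bar>X i\<bar> < d then X i else d)" for i
    have X': "X' i \<noteq> 0" "\<bar>X' i\<bar> \<le> d" for i using X(1) d by (auto simp: X'_def)
    have X'_ev: "\<forall>\<^sub>F i in sequentially. X' i = X i" using ev by eventually_elim (simp add: X'_def)
    have X'_lim: "X' \<longlonglongrightarrow> 0" using X(2) X'_ev by (simp add: tendsto_cong)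
    let ?q = "\<lambda>i y. f y * ((F (t0 + X' i) y - F t0 y) / X' i)"
    have lim: "(\<lambda>i. LINT y|lebesgue. ?q i y) \<longlonglongrightarrow> (LINT y|lebesgue. f y * F' t0 y)"
    proof (rule integral_dominated_convergence[where w = "\<lambda>y. C * \<bar>f y\<bar>"])
      show "(\<lambda>y. f y * F' t0 y) \<in> borel_measurable lebesgue"
        using integrable_mult[OF cont_F'] by auto
      show "?q i \<in> borel_measurable lebesgue" for i
        using X'[of i] d by (intro borel_measurable_integrable integrable_mult continuous_intros F) auto
      show "integrable lebesgue (\<lambda>y. C * \<bar>f y\<bar>)" using f(1) by auto
      show "AE y in lebesgue. (\<lambda>i. ?q i y) \<longlonglongrightarrow> f y * F' t0 y"
      proof (rule AE_I2)
        fix y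
        show "(\<lambda>i. ?q i y) \<longlonglongrightarrow> f y * F' t0 y"
        proof (cases "y \<in> S")
          case True
          have "((\<lambda>h. (F (t0 + h) y - F t0 y) / h) \<longlongrightarrow> F' t0 y) (at 0)"
            using deriv[OF _ True, of t0] d by (simp add: DERIV_def)
          then have "(\<lambda>i. (F (t0 + X' i) y - F t0 y) / X' i) \<longlonglongrightarrow> F' t0 y"
            using X' X'_lim unfolding tendsto_at_iff_sequentially by (auto simp: comp_def)
          then show ?thesis by (intro tendsto_mult tendsto_const)
        qed (simp add: f(2))
      qed
      show "AE y in lebesgue. norm (?q i y) \<le> C * \<bar>f y\<bar>" for i
      proof (rule AE_I2)
        fix y
        show "norm (?q i y) \<le> C * \<bar>f y\<bar>"
        proof (cases "y \<in> S")
          case True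
          have "\<bar>F (t0 + X' i) y - F t0 y\<bar> / \<bar>X' i\<bar> \<le> C"
            using mvt[OF X'(2) True, of i] X'(1)[of i] by (simp add: divide_simps)
          from mult_left_mono[OF this abs_ge_zero[of "f y"]] show ?thesis
            by (simp add: abs_mult mult.commute[of C])
        qed (simp add: f(2))
      qed
    qed
    have eq: "(LINT y|lebesgue. ?q i y) =
       ((LINT y|lebesgue. f y * F (t0 + X' i) y) - (LINT y|lebesgue. f y * F t0 y)) / X' i" for i
    proof -
      have "(LINT y|lebesgue. ?q i y) = (LINT y|lebesgue. (f y * F (t0 + X' i) y - f y * F t0 y) / X' i)"
        by (intro Bochner_Integration.integral_cong) (auto simp: algebra_simps diff_divide_distrib)
      also have "\<dots> = ((LINT y|lebesgue. f y * F (t0 + X' i) y) - (LINT y|lebesgue. f y * F t0 y)) / X' i"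
        using X'[of i] d by (simp add: Bochner_Integration.integral_diff integrable_mult F)
      finally show ?thesis .
    qed
    have ev_eq: "\<forall>\<^sub>F i in sequentially.
       ((LINT y|lebesgue. f y * F (t0 + X' i) y) - (LINT y|lebesgue. f y * F t0 y)) / X' i =
       ((LINT y|lebesgue. f y * F (t0 + X i) y) - (LINT y|lebesgue. f y * F t0 y)) / X i"
      using X'_ev by eventually_elim simp
    show "((\<lambda>h. ((LINT y|lebesgue. f y * F (t0 + h) y) - (LINT y|lebesgue. f y * F t0 y)) / h) \<circ> X)
       \<longlonglongrightarrow> (LINT y|lebesgue. f y * F' t0 y)"
      unfolding comp_def by (rule Lim_transform_eventually[OF lim[unfolded eq] ev_eq])
  qed
qed

section \<open>The homotopy primitive along a twice differentiable map\<close>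

definition C2_map :: "nat \<Rightarrow> (real ^ 'n \<Rightarrow> nat \<Rightarrow> real) \<Rightarrow> bool" where
  "C2_map m h \<longleftrightarrow> (\<forall>x. h x \<in> Rm m) \<and> (\<forall>i<m. Ck_domain 2 (\<lambda>x. h x i))"

definition jac :: "(real ^ 'n \<Rightarrow> nat \<Rightarrow> real) \<Rightarrow> real ^ 'n \<Rightarrow> 'n \<Rightarrow> nat \<Rightarrow> real" where
  "jac h x l i = pderiv_domain l (\<lambda>x. h x i) x"

text \<open>
  The primitive of \<open>\<omega>\<close> given by the Poincare homotopy: \<open>\<omega> = d\<eta>\<close> with
  \<open>\<eta>\<^sub>y(v\<^sub>2, \<dots>, v\<^sub>n) = \<integral>\<^sub>0\<^sup>1 s\<^sup>n\<^sup>-\<^sup>1 \<omega>\<^bsub>sy\<^esub>(y, v\<^sub>2, \<dots>, v\<^sub>n) ds\<close>.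
\<close>

definition homotopy_coeff :: "'n::{finite,linorder} form \<Rightarrow> 'n form" where
  "homotopy_coeff \<phi> I y = integral {0..1} (\<lambda>s. s ^ (CARD('n) - 1) * \<phi> I (\<lambda>i. s * y i))"

definition homotopy_form ::
  "nat \<Rightarrow> 'n::{finite,linorder} form \<Rightarrow> 'n \<Rightarrow> (nat \<Rightarrow> real) \<Rightarrow> ('n \<Rightarrow> nat \<Rightarrow> real) \<Rightarrow> real" where
  "homotopy_form m \<phi> l y A = (\<Sum>I\<in>multi_indices m. homotopy_coeff \<phi> I y * dx I (A(l := y)))"

lemma C2_mapD:
  assumes "C2_map m h"
  shows "h x \<in> Rm m" "continuous_on UNIV (\<lambda>x. h x i)" "jac h x l \<in> Rm m"
    "continuous_on UNIV (\<lambda>x. jac h x l i)"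
    "i < m \<Longrightarrow> ((\<lambda>t. h (x + t *\<^sub>R axis l 1) i) has_real_derivative jac h (x + s *\<^sub>R axis l 1) l i) (at s)"
    "i < m \<Longrightarrow> ((\<lambda>t. jac h (x + t *\<^sub>R axis l 1) k i) has_real_derivative
        pderiv_domain l (pderiv_domain k (\<lambda>x. h x i)) (x + s *\<^sub>R axis l 1)) (at s)"
    "i < m \<Longrightarrow> continuous_on UNIV (pderiv_domain l (pderiv_domain k (\<lambda>x. h x i)))"
    "i < m \<Longrightarrow> pderiv_domain l (pderiv_domain k (\<lambda>x. h x i)) x = pderiv_domain k (pderiv_domain l (\<lambda>x. h x i)) x"
proof -
  have h: "h x \<in> Rm m" "i < m \<Longrightarrow> Ck_domain (Suc (Suc 0)) (\<lambda>x. h x i)" for x i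
    using assms unfolding C2_map_def numeral_2_eq_2 by blast+
  show "h x \<in> Rm m" by (rule h)
  have zero: "h x i = 0" "jac h x l i = 0" if "\<not> i < m" for x l i
  proof -
    show "h x i = 0" for x using h(1) that by (auto simp: Rm_iff)
    then show "jac h x l i = 0" by (simp add: jac_def pderiv_domain_def)
  qed
  show "jac h x l \<in> Rm m"
    using zero(2) by (auto simp: Rm_iff)
  have jac: "jac h x l i = pderiv_domain l (\<lambda>x. h x i) x" for x l i
    by (simp add: jac_def)
  show "continuous_on UNIV (\<lambda>x. h x i)"
    using Ck_domain_continuous[OF h(2)] zero(1) by (cases "i < m") auto
  show "continuous_on UNIV (\<lambda>x. jac h x l i)"
    using Ck_domain_continuous[OF Ck_domain_pderiv(1)[OF h(2)]] zero(2)
    by (cases "i < m") (auto simp: jac)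
  assume i: "i < m"
  note u = h(2)[OF i] and u1 = Ck_domain_pderiv(1)[OF h(2)[OF i]]
  show "((\<lambda>t. h (x + t *\<^sub>R axis l 1) i) has_real_derivative jac h (x + s *\<^sub>R axis l 1) l i) (at s)"
    unfolding jac by (rule Ck_domain_pderiv(2)[OF u])
  show "((\<lambda>t. jac h (x + t *\<^sub>R axis l 1) k i) has_real_derivative
        pderiv_domain l (pderiv_domain k (\<lambda>x. h x i)) (x + s *\<^sub>R axis l 1)) (at s)"
    unfolding jac by (rule Ck_domain_pderiv(2)[OF u1])
  show "continuous_on UNIV (pderiv_domain l (pderiv_domain k (\<lambda>x. h x i)))"
    by (rule Ck_domain_continuous[OF Ck_domain_pderiv(1)[OF u1]])
  show "pderiv_domain l (pderiv_domain k (\<lambda>x. h x i)) x = pderiv_domain k (pderiv_domain l (\<lambda>x. h x i)) x"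
    by (rule pderiv_domain_commute) (use u in \<open>simp only: numeral_2_eq_2\<close>)
qed

lemma continuous_on_dx:
  assumes "range I \<subseteq> {..<m}" "\<And>l i. i < m \<Longrightarrow> continuous_on S (\<lambda>x. w x l i)"
  shows "continuous_on S (\<lambda>x. dx I (w x))"
  unfolding dx_leibniz using assms by (intro continuous_intros) auto

lemma continuous_on_scaled:
  assumes "continuous_on (Rm m) q" and h: "\<And>x. x \<in> S \<Longrightarrow> h x \<in> Rm m" "\<And>i. continuous_on S (\<lambda>x. h x i)"
  shows "continuous_on (S \<times> T) (\<lambda>(x, s). q (\<lambda>i. s * h x i))"
proof -
  have "continuous_on (S \<times> T) (\<lambda>p. h (fst p) i)" for i
    by (rule continuous_on_compose2[OF h(2)]) (auto intro!: continuous_intros)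
  then have "continuous_on (S \<times> T) (\<lambda>p i. snd p * h (fst p) i)"
    by (intro continuous_on_coordinatewise_then_product continuous_intros)
  then have "continuous_on (S \<times> T) (\<lambda>p. q (\<lambda>i. snd p * h (fst p) i))"
    by (rule continuous_on_compose2[OF assms(1)]) (use h(1) in \<open>auto simp: Rm_iff\<close>)
  then show ?thesis
    by (simp add: case_prod_unfold)
qed

lemma continuous_on_ray:
  assumes "continuous_on (Rm m) q" "y \<in> Rm m"
  shows "continuous_on T (\<lambda>s. q (\<lambda>i. s * y i))"
  by (rule continuous_on_compose2[OF assms(1)])
     (use assms(2) in \<open>auto intro!: continuous_on_coordinatewise_then_product continuous_intros simp: Rm_iff\<close>)

lemma continuous_on_homotopy_integral:
  fixes h :: "real ^ 'n \<Rightarrow> nat \<Rightarrow> real"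
  assumes "continuous_on (Rm m) q" "\<And>x. h x \<in> Rm m" "\<And>i. continuous_on UNIV (\<lambda>x. h x i)"
  shows "continuous_on UNIV (\<lambda>x. integral {0..1} (\<lambda>s. s ^ k * q (\<lambda>i. s * h x i)))"
proof -
  have "continuous_on (UNIV \<times> cbox 0 1) (\<lambda>(x, s). q (\<lambda>i. s * h x i))"
    by (rule continuous_on_scaled[OF assms(1)]) (use assms in auto)
  then have "continuous_on (UNIV \<times> cbox 0 1) (\<lambda>(x, s). s ^ k * q (\<lambda>i. s * h x i))"
    unfolding case_prod_unfold by (intro continuous_intros)
  from integral_continuous_on_param[OF this] show ?thesis by simp
qed

text \<open>Leibniz rule under the homotopy integral. The inner factor \<open>s\<close> of the chain
  rule raises the exponent of \<open>s\<close> from n-1 to n, the weight with which the closedness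
  relation is integrated below.\<close>

lemma homotopy_coeff_DERIV:
  fixes h :: "real ^ 'n::{finite,linorder} \<Rightarrow> nat \<Rightarrow> real" and \<phi> :: "'n form"
  assumes q: "smooth_target m (\<phi> I)" and h: "C2_map m h"
  shows "((\<lambda>t. homotopy_coeff \<phi> I (h (x + t *\<^sub>R axis l 1))) has_real_derivative
     (\<Sum>j<m. integral {0..1} (\<lambda>s. s ^ CARD('n) * pderiv_target j (\<phi> I) (\<lambda>i. s * h x i)) * jac h x l j)) (at 0)"
proof -
  let ?n = "CARD('n)"
  let ?e = "\<lambda>t. x + t *\<^sub>R axis l 1"
  have n: "?n = Suc (?n - 1)" by simp
  note hD = C2_mapD[OF h]
  have scale_Rm: "(\<lambda>i. s * h y i) \<in> Rm m" for s y
    using hD(1) by (auto simp: Rm_iff)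
  have cont_h: "continuous_on UNIV (\<lambda>t. h (?e t) i)" "continuous_on UNIV (\<lambda>t. jac h (?e t) l i)" for i
    by (rule continuous_on_compose2[OF hD(2)] continuous_on_compose2[OF hD(4)]; auto intro!: continuous_intros)+
  define f where "f t s = s ^ (?n - 1) * \<phi> I (\<lambda>i. s * h (?e t) i)" for t s
  define f' where "f' t s = (\<Sum>j<m. s ^ ?n * pderiv_target j (\<phi> I) (\<lambda>i. s * h (?e t) i) * jac h (?e t) l j)" for t s
  have cont_pd: "continuous_on (UNIV \<times> cbox 0 1) (\<lambda>(t, s). pderiv_target j (\<phi> I) (\<lambda>i. s * h (?e t) i))" if "j < m" for j
    by (rule continuous_on_scaled[OF smooth_target_pderiv(1)[OF q that]]) (use hD(1) cont_h in auto)
  have cont_jac: "continuous_on (UNIV \<times> cbox 0 (1::real)) (\<lambda>p. jac h (?e (fst p)) l j)" for j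
    by (rule continuous_on_compose2[OF cont_h(2)]) (auto intro!: continuous_intros)
  have "((\<lambda>t. integral (cbox 0 1) (f t)) has_field_derivative integral (cbox 0 1) (f' 0)) (at 0 within UNIV)"
  proof (rule leibniz_rule_field_derivative)
    fix t s :: real assume "s \<in> cbox 0 1"
    have "((\<lambda>t. \<phi> I (\<lambda>i. s * h (?e t) i)) has_real_derivative
       (\<Sum>j<m. pderiv_target j (\<phi> I) (\<lambda>i. s * h (?e t) i) * (s * jac h (?e t) l j))) (at t)"
      by (rule smooth_target_chain[OF q scale_Rm]) (intro DERIV_cmult hD(5))
    from DERIV_cmult[OF this, of "s ^ (?n - 1)"]
    show "((\<lambda>t. f t s) has_field_derivative f' t s) (at t within UNIV)"
      by (subst (asm) sum_distrib_left) (simp add: f_def f'_def n[symmetric] power_eq_if[of s ?n] mult_ac)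
  next
    fix t
    have "continuous_on (cbox 0 1) (\<lambda>s. \<phi> I (\<lambda>i. s * h (?e t) i))"
      by (rule continuous_on_ray[OF smooth_target_continuous[OF q] hD(1)])
    then show "f t integrable_on cbox 0 1"
      unfolding f_def by (intro integrable_continuous continuous_intros)
  next
    show "continuous_on (UNIV \<times> cbox 0 1) (\<lambda>(t, s). f' t s)"
      unfolding f'_def case_prod_unfold
      by (intro continuous_intros cont_jac cont_pd[unfolded case_prod_unfold]) auto
  qed auto
  moreover have "integral (cbox 0 1) (f' 0) =
     (\<Sum>j<m. integral {0..1} (\<lambda>s. s ^ ?n * pderiv_target j (\<phi> I) (\<lambda>i. s * h x i)) * jac h x l j)"
  proof -
    have "continuous_on {0..1} (\<lambda>s. pderiv_target j (\<phi> I) (\<lambda>i. s * h x i))" if "j < m" for j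
      by (rule continuous_on_ray[OF smooth_target_pderiv(1)[OF q that] hD(1)])
    then show ?thesis
      unfolding f'_def by (subst integral_sum) (auto intro!: integrable_continuous_interval continuous_intros)
  qed
  ultimately show ?thesis
    unfolding f_def homotopy_coeff_def by simp
qed

text \<open>Euler's relation along the ray: the derivative in s of s^n times the coefficient at s y
  is integrated over the unit interval. The lower endpoint contributes nothing because n is
  positive.\<close>

lemma homotopy_coeff_euler:
  fixes \<phi> :: "'n::{finite,linorder} form"
  assumes q: "smooth_target m (\<phi> I)" and y: "y \<in> Rm m"
  shows "(\<Sum>j<m. integral {0..1} (\<lambda>s. s ^ CARD('n) * pderiv_target j (\<phi> I) (\<lambda>i. s * y i)) * y j)
      = \<phi> I y - CARD('n) * homotopy_coeff \<phi> I y"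
proof -
  let ?n = "CARD('n)"
  have scale_Rm: "(\<lambda>i. s * y i) \<in> Rm m" for s
    using y by (auto simp: Rm_iff)
  have "((\<lambda>s. s ^ ?n * \<phi> I (\<lambda>i. s * y i)) has_real_derivative
      of_nat ?n * s ^ (?n - 1) * \<phi> I (\<lambda>i. s * y i)
        + (\<Sum>j<m. s ^ ?n * pderiv_target j (\<phi> I) (\<lambda>i. s * y i) * y j)) (at s)" for s
  proof -
    have "((\<lambda>s. \<phi> I (\<lambda>i. s * y i)) has_real_derivative
       (\<Sum>j<m. pderiv_target j (\<phi> I) (\<lambda>i. s * y i) * y j)) (at s)"
      by (rule smooth_target_chain[OF q scale_Rm]) (auto intro!: derivative_eq_intros)
    from DERIV_mult[OF DERIV_pow[of ?n] this] show ?thesis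
      by (simp add: sum_distrib_left mult_ac add.commute)
  qed
  then have "((\<lambda>s. of_nat ?n * s ^ (?n - 1) * \<phi> I (\<lambda>i. s * y i)
        + (\<Sum>j<m. s ^ ?n * pderiv_target j (\<phi> I) (\<lambda>i. s * y i) * y j)) has_integral
        (1 ^ ?n * \<phi> I (\<lambda>i. 1 * y i) - 0 ^ ?n * \<phi> I (\<lambda>i. 0 * y i))) {0..1}"
    by (intro fundamental_theorem_of_calculus)
       (auto simp: has_real_derivative_iff_has_vector_derivative[symmetric] intro: DERIV_subset)
  then have "integral {0..1} (\<lambda>s. of_nat ?n * s ^ (?n - 1) * \<phi> I (\<lambda>i. s * y i)
        + (\<Sum>j<m. s ^ ?n * pderiv_target j (\<phi> I) (\<lambda>i. s * y i) * y j)) = \<phi> I y"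
    by (simp add: integral_unique)
  moreover have "integral {0..1} (\<lambda>s. of_nat ?n * s ^ (?n - 1) * \<phi> I (\<lambda>i. s * y i)
        + (\<Sum>j<m. s ^ ?n * pderiv_target j (\<phi> I) (\<lambda>i. s * y i) * y j))
      = ?n * homotopy_coeff \<phi> I y
        + (\<Sum>j<m. integral {0..1} (\<lambda>s. s ^ ?n * pderiv_target j (\<phi> I) (\<lambda>i. s * y i)) * y j)"
  proof -
    have c: "continuous_on {0..1} (\<lambda>s. \<phi> I (\<lambda>i. s * y i))"
      by (rule continuous_on_ray[OF smooth_target_continuous[OF q] y])
    have c': "continuous_on {0..1} (\<lambda>s. pderiv_target j (\<phi> I) (\<lambda>i. s * y i))" if "j < m" for j
      by (rule continuous_on_ray[OF smooth_target_pderiv(1)[OF q that] y])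
    have "integral {0..1} (\<lambda>s. (\<Sum>j<m. s ^ ?n * pderiv_target j (\<phi> I) (\<lambda>i. s * y i) * y j))
        = (\<Sum>j<m. integral {0..1} (\<lambda>s. s ^ ?n * pderiv_target j (\<phi> I) (\<lambda>i. s * y i)) * y j)"
      by (subst integral_sum) (auto intro!: integrable_continuous_interval continuous_intros c')
    moreover have "integral {0..1} (\<lambda>s. of_nat ?n * s ^ (?n - 1) * \<phi> I (\<lambda>i. s * y i)) = ?n * homotopy_coeff \<phi> I y"
      by (simp add: homotopy_coeff_def mult.assoc)
    ultimately show ?thesis
      by (subst Henstock_Kurzweil_Integration.integral_add)
         (auto intro!: integrable_continuous_interval continuous_intros c c')
  qed
  ultimately show ?thesis by simp
qed

text \<open>Placing \<open>h x\<close> in slot \<open>l\<close> builds in the sign of the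
  contraction, so the exterior derivative of the pulled back primitive becomes the divergence of the
  vector field with components \<open>homotopy_form m \<phi> l\<close>. In the sum over
  \<open>l\<close>, closedness trades the derivatives of the coefficients for an Euler term, and the
  second derivatives of \<open>h\<close> drop out by symmetry.\<close>

lemma homotopy_form_divergence:
  fixes h :: "real ^ 'n::{finite,linorder} \<Rightarrow> nat \<Rightarrow> real"
  assumes \<phi>: "\<And>I. I \<in> multi_indices m \<Longrightarrow> smooth_target m (\<phi> I)" "closed_form m \<phi>" and h: "C2_map m h"
  obtains D where
    "\<And>l x. ((\<lambda>t. homotopy_form m \<phi> l (h (x + t *\<^sub>R axis l 1)) (jac h (x + t *\<^sub>R axis l 1))) has_real_derivative D l x) (at 0)"
    "\<And>l. continuous_on UNIV (D l)"
    "\<And>x. (\<Sum>l\<in>UNIV. D l x) = form_eval m \<phi> (h x) (jac h x)"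
proof -
  let ?n = "CARD('n)"
  let ?M = "multi_indices m :: ('n \<Rightarrow> nat) set"
  note hD = C2_mapD[OF h]
  define a where "a I j x = integral {0..1} (\<lambda>s. s ^ ?n * pderiv_target j (\<phi> I) (\<lambda>i. s * h x i))" for I j x
  define S where "S l k x i = pderiv_domain l (pderiv_domain k (\<lambda>x. h x i)) x" for l k x i
  \<comment> \<open>Second derivatives are controlled for the coordinates below \<open>m\<close>;
    the others are set to zero so that symmetry holds for whole vectors.\<close>
  define S' where "S' l k x i = (if i < m then S l k x i else 0)" for l k x i
  \<comment> \<open>\<open>W l k\<close> is the derivative in direction \<open>l\<close> of the
    vector in slot \<open>k\<close>: slot \<open>l\<close> holds the map itself, every other slot a
    first derivative.\<close>
  define W where "W l k x = (if k = l then jac h x l else S' l k x)" for l k x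
  define D where "D l x = (\<Sum>I\<in>?M. (\<Sum>j<m. a I j x * jac h x l j) * dx I ((jac h x)(l := h x))
      + homotopy_coeff \<phi> I (h x) * (\<Sum>k\<in>UNIV. dx I ((jac h x)(l := h x, k := W l k x))))" for l x
  have range: "range I \<subseteq> {..<m}" if "I \<in> ?M" for I
    using that by (auto simp: multi_indices_def)
  have deriv: "((\<lambda>t. homotopy_form m \<phi> l (h (x + t *\<^sub>R axis l 1)) (jac h (x + t *\<^sub>R axis l 1))) has_real_derivative D l x) (at 0)" for l x
  proof -
    have "((\<lambda>t. dx I ((jac h (x + t *\<^sub>R axis l 1))(l := h (x + t *\<^sub>R axis l 1)))) has_real_derivative
       (\<Sum>k\<in>UNIV. dx I ((jac h x)(l := h x, k := W l k x)))) (at 0)" if "I \<in> ?M" for I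
    proof -
      have "((\<lambda>t. dx I ((jac h (x + t *\<^sub>R axis l 1))(l := h (x + t *\<^sub>R axis l 1)))) has_real_derivative
         (\<Sum>k\<in>UNIV. dx I (((jac h (x + 0 *\<^sub>R axis l 1))(l := h (x + 0 *\<^sub>R axis l 1)))(k := W l k x)))) (at 0)"
      proof (rule dx_DERIV[OF range[OF that]])
        fix k i assume i: "i < m"
        show "((\<lambda>t. ((jac h (x + t *\<^sub>R axis l 1))(l := h (x + t *\<^sub>R axis l 1))) k i) has_real_derivative W l k x i) (at 0)"
          using hD(5)[OF i, of x l 0] hD(6)[OF i, of x l k 0] i
          by (cases "k = l") (auto simp: W_def S'_def S_def)
      qed
      then show ?thesis by simp
    qed
    from DERIV_mult[OF homotopy_coeff_DERIV[OF \<phi>(1) h] this]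
    show ?thesis
      unfolding homotopy_form_def D_def a_def
      by (intro DERIV_sum) (simp add: add.commute mult.commute)
  qed
  have cont: "continuous_on UNIV (D l)" for l
  proof -
    have W: "continuous_on UNIV (\<lambda>x. W l k x i)" for k i
      using hD(4)[of l i] hD(7)[of i l k] by (cases "k = l"; cases "i < m") (auto simp: W_def S'_def S_def)
    have "continuous_on UNIV (\<lambda>x. a I j x)" if "I \<in> ?M" "j < m" for I j
      unfolding a_def
      by (rule continuous_on_homotopy_integral[OF smooth_target_pderiv(1)[OF \<phi>(1)[OF that(1)] that(2)] hD(1,2)])
    moreover have "continuous_on UNIV (\<lambda>x. homotopy_coeff \<phi> I (h x))" if "I \<in> ?M" for I
      unfolding homotopy_coeff_def
      by (rule continuous_on_homotopy_integral[OF smooth_target_continuous[OF \<phi>(1)[OF that]] hD(1,2)])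
    moreover have "continuous_on UNIV (\<lambda>x. ((jac h x)(l := h x)) k i)" for k i
      using hD(2,4) by (cases "k = l") auto
    moreover have "continuous_on UNIV (\<lambda>x. ((jac h x)(l := h x, k := W l k x)) k' i)" for k k' i
      using hD(2,4) W by (cases "k' = k"; cases "k' = l") auto
    ultimately show ?thesis
      unfolding D_def using range hD(4)
      by (intro continuous_intros continuous_on_dx[of _ m]) auto
  qed
  have total: "(\<Sum>l\<in>UNIV. D l x) = form_eval m \<phi> (h x) (jac h x)" for x
  proof -
    \<comment> \<open>Closedness is used at all points \<open>s * h x\<close> of the ray, with
      \<open>u = h x\<close>, and integrated against s^n; the wedge factors do not depend on
      \<open>s\<close>.\<close>
    have "(\<Sum>I\<in>?M. \<Sum>j<m. a I j x * wedge1 j I (h x) (jac h x)) = 0"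
    proof -
      have int: "(\<lambda>s. s ^ ?n * pderiv_target j (\<phi> I) (\<lambda>i. s * h x i)) integrable_on {0..1}" if "I \<in> ?M" "j < m" for I j
        by (intro integrable_continuous_interval continuous_intros
            continuous_on_ray[OF smooth_target_pderiv(1)[OF \<phi>(1)[OF that(1)] that(2)] hD(1)])
      have "(\<Sum>I\<in>?M. \<Sum>j<m. a I j x * wedge1 j I (h x) (jac h x))
        = integral {0..1} (\<lambda>s. \<Sum>I\<in>?M. \<Sum>j<m. s ^ ?n * pderiv_target j (\<phi> I) (\<lambda>i. s * h x i) * wedge1 j I (h x) (jac h x))"
        unfolding a_def
        by (subst integral_sum; (intro integrable_sum integrable_on_mult_left int)?; simp?)
           (intro sum.cong refl, subst integral_sum; (intro integrable_on_mult_left int)?; simp)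
      also have "\<dots> = integral {0..1} (\<lambda>s. s ^ ?n * (\<Sum>I\<in>?M. \<Sum>j<m. pderiv_target j (\<phi> I) (\<lambda>i. s * h x i) * wedge1 j I (h x) (jac h x)))"
        by (simp add: sum_distrib_left mult.assoc)
      also have "\<dots> = 0"
      proof -
        have "(\<lambda>i. s * h x i) \<in> Rm m" for s
          using hD(1) by (auto simp: Rm_iff)
        from closed_form_sum_wedge1[OF \<phi>(2) this] show ?thesis by simp
      qed
      finally show ?thesis .
    qed
    then have "(\<Sum>I\<in>?M. \<Sum>j<m. \<Sum>l\<in>UNIV. a I j x * (jac h x l j * dx I ((jac h x)(l := h x))))
        = (\<Sum>I\<in>?M. (\<Sum>j<m. a I j x * h x j) * dx I (jac h x))"
      by (simp add: wedge1_def sum_subtractf right_diff_distrib sum_distrib_left sum_distrib_right mult.assoc)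
    also have "\<dots> = (\<Sum>I\<in>?M. (\<phi> I (h x) - ?n * homotopy_coeff \<phi> I (h x)) * dx I (jac h x))"
      by (intro sum.cong refl) (simp add: a_def homotopy_coeff_euler[where \<phi> = \<phi> and y = "h x", OF \<phi>(1) hD(1)])
    finally have 1: "(\<Sum>I\<in>?M. \<Sum>j<m. \<Sum>l\<in>UNIV. a I j x * (jac h x l j * dx I ((jac h x)(l := h x))))
        = (\<Sum>I\<in>?M. (\<phi> I (h x) - ?n * homotopy_coeff \<phi> I (h x)) * dx I (jac h x))" .
    \<comment> \<open>For each \<open>l\<close> the summand \<open>k = l\<close> restores the full
      minor. The n copies obtained in this way cancel the term with the factor n in Euler's
      relation.\<close>
    have 2: "(\<Sum>l\<in>UNIV. \<Sum>k\<in>UNIV. dx I ((jac h x)(l := h x, k := W l k x))) = ?n * dx I (jac h x)" for I :: "'n \<Rightarrow> nat"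
    proof -
      have "(\<Sum>k\<in>UNIV. dx I ((jac h x)(l := h x, k := W l k x)))
         = dx I (jac h x) + (\<Sum>k\<in>UNIV - {l}. dx I ((jac h x)(l := h x, k := S' l k x)))" for l
        by (subst sum.remove[of UNIV l]) (auto simp: W_def intro!: sum.cong)
      moreover have "(\<Sum>l\<in>UNIV. \<Sum>k\<in>UNIV - {l}. dx I ((jac h x)(l := h x, k := S' l k x))) = 0"
        by (rule sum_dx_symmetric[where S = "\<lambda>l k. S' l k x"]) (auto simp: S'_def S_def hD(8))
      ultimately show ?thesis by (simp add: sum.distrib)
    qed
    have "(\<Sum>l\<in>UNIV. D l x) =
       (\<Sum>I\<in>?M. \<Sum>l\<in>UNIV. (\<Sum>j<m. a I j x * jac h x l j) * dx I ((jac h x)(l := h x))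
      + homotopy_coeff \<phi> I (h x) * (\<Sum>k\<in>UNIV. dx I ((jac h x)(l := h x, k := W l k x))))"
      unfolding D_def by (rule sum.swap)
    also have "\<dots> = (\<Sum>I\<in>?M. \<Sum>l\<in>UNIV. \<Sum>j<m. a I j x * (jac h x l j * dx I ((jac h x)(l := h x))))
       + (\<Sum>I\<in>?M. homotopy_coeff \<phi> I (h x) * (?n * dx I (jac h x)))"
      by (simp add: sum.distrib sum_distrib_left[symmetric] 2 sum_distrib_right mult.assoc)
    also have "(\<Sum>I\<in>?M. \<Sum>l\<in>UNIV. \<Sum>j<m. a I j x * (jac h x l j * dx I ((jac h x)(l := h x))))
       = (\<Sum>I\<in>?M. \<Sum>j<m. \<Sum>l\<in>UNIV. a I j x * (jac h x l j * dx I ((jac h x)(l := h x))))"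
      by (intro sum.cong refl sum.swap)
    finally show ?thesis
      unfolding 1 form_eval_def by (simp add: algebra_simps sum.distrib[symmetric])
  qed
  show thesis using that deriv cont total by blast
qed

section \<open>Integration by parts against a cut-off function\<close>

lemma lebesgue_translation:
  fixes F :: "'b::euclidean_space \<Rightarrow> real"
  assumes "F \<in> borel_measurable borel"
  shows "(LINT y|lebesgue. F (y + c)) = (LINT y|lebesgue. F y)"
proof -
  have "(LINT y|lebesgue. F (y + c)) = (LINT y|lborel. F (c + y))"
    using assms by (subst integral_completion) (auto simp: add.commute)
  also have "\<dots> = (LINT y|distr lborel borel ((+) c). F y)"
    using assms by (subst integral_distr) auto
  also have "\<dots> = (LINT y|lebesgue. F y)"
    using assms by (simp add: lborel_distr_plus integral_completion)
  finally show ?thesis .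
qed

lemma integrable_continuous_compact_support:
  fixes F :: "'b::euclidean_space \<Rightarrow> real"
  assumes "continuous_on UNIV F" "compact S" "\<And>y. y \<notin> S \<Longrightarrow> F y = 0"
  shows "integrable lebesgue F"
proof -
  have "integrable lborel (\<lambda>y. indicator S y *\<^sub>R F y)"
    using assms by (intro borel_integrable_compact) (auto intro: continuous_on_subset)
  then have "integrable lebesgue (\<lambda>y. indicator S y *\<^sub>R F y)"
    by (subst integrable_completion) auto
  moreover have "(\<lambda>y. indicator S y *\<^sub>R F y) = F"
    using assms(3) by (auto simp: fun_eq_iff indicator_def)
  ultimately show ?thesis by simp
qed

text \<open>By translation invariance the integral of \<open>F (y + t *\<^sub>R e)\<close> does not
  depend on \<open>t\<close>. Differentiating it under the integral sign at \<open>t = 0\<close>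
  gives the claim without iterated integrals.\<close>

lemma integral_directional_derivative_zero:
  fixes F G :: "'b::euclidean_space \<Rightarrow> real"
  assumes F: "continuous_on UNIV F" and G: "continuous_on UNIV G" and S: "compact S"
    and zero: "\<And>y. y \<notin> S \<Longrightarrow> F y = 0"
    and deriv: "\<And>y. ((\<lambda>t. F (y + t *\<^sub>R e)) has_real_derivative G y) (at 0)"
  shows "(LINT y|lebesgue. G y) = 0"
proof -
  obtain r where r: "0 < r" "S \<subseteq> cball 0 r"
    using compact_imp_bounded[OF S] by (auto simp: bounded_subset_cball bounded_pos)
      (metis bounded_pos compact_imp_bounded mem_cball_0 subsetI S)
  \<comment> \<open>The ball is enlarged by the length of \<open>e\<close>, so that translates of
    the support by \<open>t *\<^sub>R e\<close> with |t| < 1 stay inside.\<close>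
  define K :: "'b set" where "K = cball 0 (r + norm e)"
  have deriv': "((\<lambda>t. F (y + t *\<^sub>R e)) has_real_derivative G (y + t *\<^sub>R e)) (at t)" for y t
    using deriv[of "y + t *\<^sub>R e"] DERIV_at_within_shift[of "\<lambda>t. F (y + t *\<^sub>R e)" "G (y + t *\<^sub>R e)" t 0 UNIV]
    by (simp add: algebra_simps)
  have K: "compact K" "K \<in> lmeasurable" by (auto simp: K_def)
  have "((\<lambda>t. LINT y|lebesgue. indicator K y * F (y + t *\<^sub>R e)) has_real_derivative
          (LINT y|lebesgue. indicator K y * G (y + 0 *\<^sub>R e))) (at 0)"
  proof (rule integral_param_deriv[where S = K and d = 1])
    show "integrable lebesgue (indicat_real K)"
      using K(2) by (simp add: lmeasurable_iff_integrable)
    show "continuous_on ({0 - 1..0 + 1} \<times> K) (\<lambda>(t, y). G (y + t *\<^sub>R e))"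
      unfolding case_prod_unfold
      by (rule continuous_on_compose2[OF G]) (auto intro!: continuous_intros)
    show "continuous_on K (\<lambda>y. F (y + t *\<^sub>R e))" for t
      by (rule continuous_on_compose2[OF F]) (auto intro!: continuous_intros)
  qed (use K deriv' in auto)
  moreover have "\<forall>\<^sub>F t in nhds 0. (LINT y|lebesgue. indicator K y * F (y + t *\<^sub>R e)) = (LINT y|lebesgue. F y)"
  proof -
    have "\<forall>\<^sub>F t in nhds 0. \<bar>t\<bar> < (1::real)"
      by (auto simp: eventually_nhds_metric dist_real_def intro!: exI[of _ 1])
    then show ?thesis
    proof eventually_elim
      case (elim t)
      have eq: "indicator K y * F (y + t *\<^sub>R e) = F (y + t *\<^sub>R e)" for y
      proof (cases "y \<in> K")
        case False
        have "norm y \<le> norm (y + t *\<^sub>R e) + norm e"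
          using norm_triangle_ineq4[of "y + t *\<^sub>R e" "t *\<^sub>R e"] elim
            mult_right_mono[of "\<bar>t\<bar>" 1 "norm e"] by simp
        then have "y + t *\<^sub>R e \<notin> S" using False r(2) by (auto simp: K_def)
        then show ?thesis using zero by simp
      qed simp
      then show ?case
        unfolding eq using F by (intro lebesgue_translation borel_measurable_continuous_onI)
    qed
  qed
  ultimately have "((\<lambda>t. LINT y|lebesgue. F y) has_real_derivative (LINT y|lebesgue. indicator K y * G (y + 0 *\<^sub>R e))) (at 0)"
    by (subst (asm) DERIV_cong_ev[OF refl _ refl]) auto
  then have "(LINT y|lebesgue. indicator K y * G y) = 0"
    using DERIV_unique[OF _ DERIV_const] by simp
  moreover have "indicator K y * G y = G y" for y
  proof (cases "y \<in> K")
    case False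
    have "open (- S)" using S by (simp add: compact_imp_closed open_Compl)
    have "y \<notin> S"
    proof
      assume "y \<in> S"
      then have "norm y \<le> r" using r(2) by auto
      then show False using False norm_ge_zero[of e] by (simp add: K_def)
    qed
    have "\<forall>\<^sub>F t in nhds 0. y + t *\<^sub>R e \<in> - S"
    proof (rule topological_tendstoD[OF _ \<open>open (- S)\<close>])
      have "((\<lambda>t. y + t *\<^sub>R e) \<longlongrightarrow> y + 0 *\<^sub>R e) (nhds 0)"
        by (intro tendsto_intros filterlim_ident)
      then show "((\<lambda>t. y + t *\<^sub>R e) \<longlongrightarrow> y) (nhds 0)" by simp
    qed (use \<open>y \<notin> S\<close> in auto)
    then have "\<forall>\<^sub>F t in nhds 0. F (y + t *\<^sub>R e) = 0"
      by eventually_elim (use zero in auto)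
    then have "((\<lambda>t. 0) has_real_derivative G y) (at 0)"
      using deriv[of y] by (subst (asm) DERIV_cong_ev[OF refl _ refl]) auto
    then have "G y = 0" using DERIV_unique[OF _ DERIV_const] by blast
    then show ?thesis by simp
  qed simp
  ultimately show ?thesis by simp
qed

lemma continuous_on_homotopy_form:
  assumes "\<And>I. I \<in> multi_indices m \<Longrightarrow> smooth_target m (\<phi> I)" and h: "C2_map m h"
  shows "continuous_on UNIV (\<lambda>x. homotopy_form m \<phi> l (h x) (jac h x))"
    and "continuous_on UNIV (\<lambda>x. form_eval m \<phi> (h x) (jac h x))"
proof -
  note hD = C2_mapD[OF h]
  have range: "range I \<subseteq> {..<m}" if "I \<in> multi_indices m" for I
    using that by (auto simp: multi_indices_def)
  have "continuous_on UNIV (\<lambda>x. homotopy_coeff \<phi> I (h x))" if "I \<in> multi_indices m" for I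
    unfolding homotopy_coeff_def
    by (rule continuous_on_homotopy_integral[OF smooth_target_continuous[OF assms(1)[OF that]] hD(1,2)])
  moreover have "continuous_on UNIV (\<lambda>x. ((jac h x)(l := h x)) k i)" for k i
    using hD(2,4) by (cases "k = l") auto
  ultimately show "continuous_on UNIV (\<lambda>x. homotopy_form m \<phi> l (h x) (jac h x))"
    unfolding homotopy_form_def 
    by (intro continuous_intros continuous_on_dx[OF range]) auto
  have "continuous_on UNIV h"
    using hD(2) by (intro continuous_on_coordinatewise_then_product)
  then have "continuous_on UNIV (\<lambda>x. \<phi> I (h x))" if "I \<in> multi_indices m" for I
    by (rule continuous_on_compose2[OF smooth_target_continuous[OF assms(1)[OF that]]]) (use hD(1) in auto)
  then show "continuous_on UNIV (\<lambda>x. form_eval m \<phi> (h x) (jac h x))"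
    unfolding form_eval_def using hD(4)
    by (intro continuous_intros continuous_on_dx[OF range]) auto
qed

text \<open>Each component of the field times \<open>\<psi>\<close> has compact support, so its
  directional derivative integrates to zero. Summed over the directions, the derivatives of the
  field give the pulled back form and those of \<open>\<psi>\<close> the boundary terms.\<close>

theorem stokes_pullback:
  fixes h :: "real ^ 'n::{finite,linorder} \<Rightarrow> nat \<Rightarrow> real"
  assumes \<phi>: "\<And>I. I \<in> multi_indices m \<Longrightarrow> smooth_target m (\<phi> I)" "closed_form m \<phi>" and h: "C2_map m h"
    and \<psi>: "Ck_domain (Suc 0) \<psi>" "compact S" "\<And>x. x \<notin> S \<Longrightarrow> \<psi> x = 0"
  shows "(LINT x|lebesgue. \<psi> x * form_eval m \<phi> (h x) (jac h x)
       + (\<Sum>l\<in>UNIV. pderiv_domain l \<psi> x * homotopy_form m \<phi> l (h x) (jac h x))) = 0"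
proof -
  let ?\<eta> = "\<lambda>l x. homotopy_form m \<phi> l (h x) (jac h x)"
  obtain D where D: "\<And>l x. ((\<lambda>t. ?\<eta> l (x + t *\<^sub>R axis l 1)) has_real_derivative D l x) (at 0)"
    "\<And>l. continuous_on UNIV (D l)" "\<And>x. (\<Sum>l\<in>UNIV. D l x) = form_eval m \<phi> (h x) (jac h x)"
    using homotopy_form_divergence[OF \<phi> h] by blast
  note \<psi>D = Ck_domain_continuous[OF \<psi>(1)] Ck_domain_continuous[OF Ck_domain_pderiv(1)[OF \<psi>(1)]]
  note cont = continuous_on_homotopy_form[OF \<phi>(1) h]
  let ?G = "\<lambda>l x. \<psi> x * D l x + pderiv_domain l \<psi> x * ?\<eta> l x"
  have zero': "pderiv_domain l \<psi> x = 0" if "x \<notin> S" for x l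
    using pderiv_domain_zero_outside[OF \<psi>(1) compact_imp_closed[OF \<psi>(2)] \<psi>(3) that] .
  have contG: "continuous_on UNIV (?G l)" for l
    by (intro continuous_intros \<psi>D D(2) cont)
  have "(LINT x|lebesgue. ?G l x) = 0" for l
  proof (rule integral_directional_derivative_zero[where F = "\<lambda>x. \<psi> x * ?\<eta> l x" and S = S and e = "axis l 1"])
    show "continuous_on UNIV (\<lambda>x. \<psi> x * ?\<eta> l x)"
      by (intro continuous_intros \<psi>D cont)
    show "((\<lambda>t. \<psi> (y + t *\<^sub>R axis l 1) * ?\<eta> l (y + t *\<^sub>R axis l 1)) has_real_derivative ?G l y) (at 0)" for y
      using DERIV_mult[OF Ck_domain_pderiv(2)[OF \<psi>(1), of y l 0] D(1)[of l y]] by (simp add: algebra_simps)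
  qed (use contG \<psi> in auto)
  moreover have "integrable lebesgue (?G l)" for l
    by (rule integrable_continuous_compact_support[OF contG \<psi>(2)]) (simp add: \<psi>(3) zero')
  ultimately have "(LINT x|lebesgue. (\<Sum>l\<in>UNIV. ?G l x)) = 0"
    by (subst Bochner_Integration.integral_sum) auto
  moreover have "(\<Sum>l\<in>UNIV. ?G l x) = \<psi> x * form_eval m \<phi> (h x) (jac h x)
       + (\<Sum>l\<in>UNIV. pderiv_domain l \<psi> x * ?\<eta> l x)" for x
    by (simp add: sum.distrib sum_distrib_left[symmetric] D(3))
  ultimately show ?thesis by simp
qed

subsection \<open>Mollifiers\<close>

text \<open>Smoothness in \<open>x\<close> with all derivatives jointly continuous in
  \<open>x\<close> and a parameter. The parameter is the variable of integration when convolutions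
  are differentiated; with a dummy parameter the same closure rules serve
  \<open>Ck_domain\<close>.\<close>

primrec Ck_param :: "nat \<Rightarrow> (real ^ 'n \<Rightarrow> 'p::topological_space \<Rightarrow> real) \<Rightarrow> bool" where
  "Ck_param 0 F \<longleftrightarrow> continuous_on UNIV (\<lambda>(x, p). F x p)"
| "Ck_param (Suc k) F \<longleftrightarrow> continuous_on UNIV (\<lambda>(x, p). F x p) \<and>
     (\<forall>l. \<exists>G. (\<forall>x p. ((\<lambda>t. F (x + t *\<^sub>R axis l 1) p) has_real_derivative G x p) (at 0)) \<and> Ck_param k G)"

lemma Ck_param_continuous: "Ck_param k F \<Longrightarrow> continuous_on UNIV (\<lambda>(x, p). F x p)"
  by (cases k) auto

lemma Ck_paramE:
  assumes "Ck_param (Suc k) F"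
  obtains G where "\<And>l x p. ((\<lambda>t. F (x + t *\<^sub>R axis l 1) p) has_real_derivative G l x p) (at 0)"
    "\<And>l. Ck_param k (G l)"
  using assms by (auto simp: choice_iff)

lemma Ck_paramI:
  assumes "continuous_on UNIV (\<lambda>(x, p). F x p)"
    "\<And>l x p. ((\<lambda>t. F (x + t *\<^sub>R axis l 1) p) has_real_derivative G l x p) (at 0)"
    "\<And>l. Ck_param k (G l)"
  shows "Ck_param (Suc k) F"
  unfolding Ck_param.simps(2) using assms by blast

lemma Ck_domainI:
  assumes "continuous_on UNIV h"
    "\<And>l x. ((\<lambda>t. h (x + t *\<^sub>R axis l 1)) has_real_derivative g l x) (at 0)"
    "\<And>l. Ck_domain k (g l)"
  shows "Ck_domain (Suc k) h"
  unfolding Ck_domain.simps(2) using assms by blast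

lemma continuous_on_snd_compose: "continuous_on UNIV c \<Longrightarrow> continuous_on UNIV (\<lambda>(x, p). c p)"
  unfolding case_prod_unfold by (rule continuous_on_compose2) (auto intro: continuous_intros)

lemma continuous_on_section:
  assumes "continuous_on UNIV (\<lambda>(x, y). F x y)"
  shows "continuous_on T (F x)" "continuous_on T' (\<lambda>x. F x y)"
proof -
  have "continuous_on T (\<lambda>y. (x, y))" "continuous_on T' (\<lambda>x. (x, y))"
    by (intro continuous_intros)+
  from this[THEN continuous_on_compose2[OF assms]]
  show "continuous_on T (F x)" "continuous_on T' (\<lambda>x. F x y)" by simp_all
qed

lemma continuous_on_fst_compose: "continuous_on UNIV c \<Longrightarrow> continuous_on UNIV (\<lambda>(x, p). c x)"
  unfolding case_prod_unfold by (rule continuous_on_compose2) (auto intro: continuous_intros)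

lemma Ck_param_SucD: "Ck_param (Suc k) F \<Longrightarrow> Ck_param k F"
proof (induction k arbitrary: F)
  case (Suc k)
  from Suc.prems obtain G where "\<And>l x p. ((\<lambda>t. F (x + t *\<^sub>R axis l 1) p) has_real_derivative G l x p) (at 0)"
    "\<And>l. Ck_param (Suc k) (G l)" by (rule Ck_paramE) blast
  then show ?case using Suc.IH Ck_param_continuous[OF Suc.prems] by (intro Ck_paramI) auto
qed auto

lemma Ck_param_const: "continuous_on UNIV c \<Longrightarrow> Ck_param k (\<lambda>x p. c p)"
proof (induction k arbitrary: c)
  case 0
  then show ?case by (simp add: continuous_on_snd_compose)
next
  case (Suc k)
  show ?case
    by (rule Ck_paramI[where G = "\<lambda>_ _ _. 0"])
       (use Suc.prems in \<open>auto intro!: continuous_on_snd_compose Suc.IH[of "\<lambda>_. 0"]\<close>)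
qed

lemma Ck_param_coord: "Ck_param k (\<lambda>x p. x $ i)"
proof (cases k)
  case 0
  then show ?thesis by (auto simp: case_prod_unfold intro!: continuous_intros)
next
  case (Suc k')
  show ?thesis unfolding Suc
  proof (rule Ck_paramI)
    show "Ck_param k' (\<lambda>x p. axis l 1 $ i)" for l :: 'a by (rule Ck_param_const) simp
    show "continuous_on UNIV (\<lambda>(x, p). x $ i)" by (auto simp: case_prod_unfold intro!: continuous_intros)
    show "((\<lambda>t. (x + t *\<^sub>R axis l 1) $ i) has_real_derivative axis l 1 $ i) (at 0)" for l x
      by (auto intro!: derivative_eq_intros)
  qed
qed

lemma Ck_param_add: "Ck_param k F \<Longrightarrow> Ck_param k G \<Longrightarrow> Ck_param k (\<lambda>x p. F x p + G x p)"
proof (induction k arbitrary: F G)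
  case 0
  then show ?case by (auto simp: case_prod_unfold intro: continuous_intros)
next
  case (Suc k)
  obtain F' where F': "\<And>l x p. ((\<lambda>t. F (x + t *\<^sub>R axis l 1) p) has_real_derivative F' l x p) (at 0)"
    "\<And>l. Ck_param k (F' l)" using Suc.prems(1) by (rule Ck_paramE) blast
  obtain G' where G': "\<And>l x p. ((\<lambda>t. G (x + t *\<^sub>R axis l 1) p) has_real_derivative G' l x p) (at 0)"
    "\<And>l. Ck_param k (G' l)" using Suc.prems(2) by (rule Ck_paramE) blast
  show ?case
  proof (rule Ck_paramI[OF _ DERIV_add[OF F'(1) G'(1)]])
    show "continuous_on UNIV (\<lambda>(x, p). F x p + G x p)"
      using Suc.prems[THEN Ck_param_continuous] by (auto simp: case_prod_unfold intro: continuous_intros)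
  qed (intro Suc.IH F' G')
qed

lemma Ck_param_mult: "Ck_param k F \<Longrightarrow> Ck_param k G \<Longrightarrow> Ck_param k (\<lambda>x p. F x p * G x p)"
proof (induction k arbitrary: F G)
  case 0
  then show ?case by (auto simp: case_prod_unfold intro: continuous_intros)
next
  case (Suc k)
  obtain F' where F': "\<And>l x p. ((\<lambda>t. F (x + t *\<^sub>R axis l 1) p) has_real_derivative F' l x p) (at 0)"
    "\<And>l. Ck_param k (F' l)" using Suc.prems(1) by (rule Ck_paramE) blast
  obtain G' where G': "\<And>l x p. ((\<lambda>t. G (x + t *\<^sub>R axis l 1) p) has_real_derivative G' l x p) (at 0)"
    "\<And>l. Ck_param k (G' l)" using Suc.prems(2) by (rule Ck_paramE) blast
  show ?case
  proof (rule Ck_paramI)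
    show "continuous_on UNIV (\<lambda>(x, p). F x p * G x p)"
      using Suc.prems[THEN Ck_param_continuous] by (auto simp: case_prod_unfold intro: continuous_intros)
    show "((\<lambda>t. F (x + t *\<^sub>R axis l 1) p * G (x + t *\<^sub>R axis l 1) p) has_real_derivative
       F' l x p * G x p + G' l x p * F x p) (at 0)" for l x p
      using DERIV_mult[OF F'(1) G'(1), of x l p x l p] by simp
    show "Ck_param k (\<lambda>x p. F' l x p * G x p + G' l x p * F x p)" for l
      by (intro Ck_param_add Suc.IH F' G' Suc.prems[THEN Ck_param_SucD])
  qed
qed

lemma Ck_param_diff: "Ck_param k F \<Longrightarrow> Ck_param k G \<Longrightarrow> Ck_param k (\<lambda>x p. F x p - G x p)"
  using Ck_param_add[OF _ Ck_param_mult[OF Ck_param_const[of "\<lambda>_. - 1"]], of k F G] by simp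

lemma Ck_param_sum: "finite S \<Longrightarrow> (\<And>i. i \<in> S \<Longrightarrow> Ck_param k (F i)) \<Longrightarrow> Ck_param k (\<lambda>x p. \<Sum>i\<in>S. F i x p)"
  by (induction S rule: finite_induct) (auto intro: Ck_param_const Ck_param_add)

lemma Ck_param_power: "Ck_param k F \<Longrightarrow> Ck_param k (\<lambda>x p. F x p ^ j)"
  by (induction j) (auto intro: Ck_param_const Ck_param_mult)

text \<open>The outer function comes with the whole sequence of its derivatives, so that the
  induction on \<open>k\<close> can pass from order \<open>j\<close> to the next one.\<close>

lemma Ck_param_compose:
  assumes "\<And>j u. (\<beta> j has_real_derivative \<beta> (Suc j) u) (at u)" and "Ck_param k F"
  shows "Ck_param k (\<lambda>x p. \<beta> j (F x p))"
  using assms(2)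
proof (induction k arbitrary: j F)
  have cont: "continuous_on UNIV (\<beta> j)" for j
    using assms(1) by (auto intro!: DERIV_continuous_on)
  {
    case 0
    then show ?case by (auto simp: case_prod_unfold intro: continuous_on_compose2[OF cont])
  next
    case (Suc k)
    obtain F' where F': "\<And>l x p. ((\<lambda>t. F (x + t *\<^sub>R axis l 1) p) has_real_derivative F' l x p) (at 0)"
      "\<And>l. Ck_param k (F' l)" using Suc.prems(1) by (rule Ck_paramE) blast
    show ?case
    proof (rule Ck_paramI)
      show "continuous_on UNIV (\<lambda>(x, p). \<beta> j (F x p))"
        using Suc.prems[THEN Ck_param_continuous] by (auto simp: case_prod_unfold intro: continuous_on_compose2[OF cont])
      show "((\<lambda>t. \<beta> j (F (x + t *\<^sub>R axis l 1) p)) has_real_derivative \<beta> (Suc j) (F x p) * F' l x p) (at 0)" for l x p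
        using DERIV_chain2[OF assms(1) F'(1)[of x l p], of j] by simp
      show "Ck_param k (\<lambda>x p. \<beta> (Suc j) (F x p) * F' l x p)" for l
        by (intro Ck_param_mult Suc.IH F' Suc.prems[THEN Ck_param_SucD])
    qed
  }
qed

lemma Ck_param_inverse:
  assumes "Ck_param k F" "\<And>x p. 0 < F x p"
  shows "Ck_param k (\<lambda>x p. inverse (F x p))"
  using assms
proof (induction k arbitrary: F)
  case 0
  have "F x p \<noteq> 0" for x p using "0.prems"(2)[of x p] by simp
  then show ?case using "0.prems"(1) by (auto simp: case_prod_unfold intro!: continuous_on_inverse)
next
  case (Suc k)
  obtain F' where F': "\<And>l x p. ((\<lambda>t. F (x + t *\<^sub>R axis l 1) p) has_real_derivative F' l x p) (at 0)"
    "\<And>l. Ck_param k (F' l)" using Suc.prems(1) by (rule Ck_paramE) blast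
  have nz: "F x p \<noteq> 0" for x p using Suc.prems(2)[of x p] by simp
  show ?case
  proof (rule Ck_paramI)
    show "continuous_on UNIV (\<lambda>(x, p). inverse (F x p))"
      using Suc.prems(1)[THEN Ck_param_continuous] nz
      by (auto simp: case_prod_unfold intro!: continuous_on_inverse)
    show "((\<lambda>t. inverse (F (x + t *\<^sub>R axis l 1) p)) has_real_derivative
        0 - F' l x p * (inverse (F x p) * inverse (F x p))) (at 0)" for l x p
      using DERIV_inverse'[OF F'(1)[of x l p]] nz[of x p] by (simp add: mult_ac)
    show "Ck_param k (\<lambda>x p. 0 - F' l x p * (inverse (F x p) * inverse (F x p)))" for l
      by (intro Ck_param_diff Ck_param_const Ck_param_mult Suc.IH F' Suc.prems(1)[THEN Ck_param_SucD] Suc.prems(2))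
         auto
  qed
qed

lemma Ck_param_Ck_domain: "Ck_domain k h \<Longrightarrow> Ck_param k (\<lambda>x p. h x)"
proof (induction k arbitrary: h)
  case 0
  then show ?case by (simp add: continuous_on_fst_compose)
next
  case (Suc k)
  show ?case
  proof (rule Ck_paramI)
    show "continuous_on UNIV (\<lambda>(x, p). h x)"
      by (rule continuous_on_fst_compose[OF Ck_domain_continuous[OF Suc.prems]])
    show "((\<lambda>t. h (x + t *\<^sub>R axis l 1)) has_real_derivative pderiv_domain l h x) (at 0)" for l x
      using Ck_domain_pderiv(2)[OF Suc.prems, of x l 0] by simp
  qed (intro Suc.IH Ck_domain_pderiv[OF Suc.prems])
qed

lemma Ck_domain_Ck_param: "Ck_param k F \<Longrightarrow> Ck_domain k (\<lambda>x. F x p)"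
proof (induction k arbitrary: F)
  case 0
  then show ?case by (simp add: continuous_on_section(2))
next
  case (Suc k)
  obtain F' where F': "\<And>l x p. ((\<lambda>t. F (x + t *\<^sub>R axis l 1) p) has_real_derivative F' l x p) (at 0)"
    "\<And>l. Ck_param k (F' l)" using Suc.prems(1) by (rule Ck_paramE) blast
  have "continuous_on UNIV (\<lambda>x. F x p)"
    by (rule continuous_on_section[OF Ck_param_continuous[OF Suc.prems]])
  then show ?case by (intro Ck_domainI[OF _ F'(1)] Suc.IH F'(2)) simp
qed

lemma continuous_on_param_integral:
  fixes F :: "'a::euclidean_space \<Rightarrow> 'b::euclidean_space \<Rightarrow> real"
  assumes f: "integrable lebesgue f" "\<And>y. y \<notin> S \<Longrightarrow> f y = 0" and S: "compact S"
    and F: "continuous_on UNIV (\<lambda>(x, y). F x y)"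
  shows "continuous_on UNIV (\<lambda>x. LINT y|lebesgue. f y * F x y)"
proof -
  have contF: "continuous_on T (\<lambda>q. F (fst q) (snd q))" for T
    using continuous_on_subset[OF F] by (simp add: case_prod_unfold)
  have cont1: "continuous_on UNIV (F x)" for x
    by (rule continuous_on_section[OF F])
  have cont2: "continuous_on UNIV (\<lambda>x. F x y)" for y
    by (rule continuous_on_section[OF F])
  show ?thesis
    unfolding continuous_on_sequentially
  proof (intro ballI allI impI, elim conjE)
    fix a and X :: "nat \<Rightarrow> 'a" assume X: "X \<longlonglongrightarrow> a"
    define K where "K = insert a (range X)"
    have "compact K"
      unfolding K_def using compact_sequence_with_limit[OF X] .
    then have "compact ((\<lambda>q. F (fst q) (snd q)) ` (K \<times> S))"
      by (intro compact_continuous_image contF compact_Times S)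
    then obtain C where C: "\<And>x y. x \<in> K \<Longrightarrow> y \<in> S \<Longrightarrow> \<bar>F x y\<bar> \<le> C"
      by (force dest!: compact_imp_bounded simp: bounded_iff)
    have meas: "(\<lambda>y. f y * F x y) \<in> borel_measurable lebesgue" for x
      by (intro borel_measurable_times borel_measurable_integrable[OF f(1)] measurable_completion)
         (simp add: borel_measurable_continuous_onI cont1)
    show "((\<lambda>x. LINT y|lebesgue. f y * F x y) \<circ> X) \<longlonglongrightarrow> (LINT y|lebesgue. f y * F a y)"
      unfolding comp_def
    proof (rule integral_dominated_convergence[where w = "\<lambda>y. C * \<bar>f y\<bar>"])
      show "AE y in lebesgue. (\<lambda>i. f y * F (X i) y) \<longlonglongrightarrow> f y * F a y"
      proof (rule AE_I2)
        fix y
        have "(\<lambda>i. F (X i) y) \<longlonglongrightarrow> F a y"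
          using continuous_on_tendsto_compose[OF cont2 X] by simp
        then show "(\<lambda>i. f y * F (X i) y) \<longlonglongrightarrow> f y * F a y" by (intro tendsto_intros)
      qed
      show "AE y in lebesgue. norm (f y * F (X i) y) \<le> C * \<bar>f y\<bar>" for i
      proof (rule AE_I2)
        fix y
        show "norm (f y * F (X i) y) \<le> C * \<bar>f y\<bar>"
        proof (cases "y \<in> S")
          case True
          from mult_left_mono[OF C[of "X i" y] abs_ge_zero[of "f y"]] True show ?thesis
            by (simp add: K_def abs_mult mult.commute)
        qed (simp add: f(2))
      qed
    qed (use f(1) meas in auto)
  qed
qed

text \<open>Each differentiation moves inside and leaves an integral of the same shape, so the
  kernel alone supplies the smoothness and the density \<open>f\<close> may be rough.\<close>

lemma Ck_domain_param_integral:
  assumes f: "integrable lebesgue f" "\<And>y. y \<notin> S \<Longrightarrow> f y = 0" and S: "compact S"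
    and F: "Ck_param k F"
  shows "Ck_domain k (\<lambda>x. LINT y|lebesgue. f y * F x y)"
  using F
proof (induction k arbitrary: F)
  case 0
  then show ?case using continuous_on_param_integral[OF f S] by simp
next
  case (Suc k)
  obtain F' where F': "\<And>l x p. ((\<lambda>t. F (x + t *\<^sub>R axis l 1) p) has_real_derivative F' l x p) (at 0)"
    "\<And>l. Ck_param k (F' l)" using Suc.prems(1) by (rule Ck_paramE) blast
  have cont: "continuous_on UNIV (\<lambda>(x, p). F x p)" "\<And>l. continuous_on UNIV (\<lambda>(x, p). F' l x p)"
    by (intro Ck_param_continuous[OF Suc.prems] Ck_param_continuous[OF F'(2)])+
  have "((\<lambda>t. LINT y|lebesgue. f y * F (x + t *\<^sub>R axis l 1) y) has_real_derivative
      (LINT y|lebesgue. f y * F' l (x + 0 *\<^sub>R axis l 1) y)) (at 0)" for x l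
  proof (rule integral_param_deriv[OF f S zero_less_one])
    show "continuous_on S (F (x + t *\<^sub>R axis l 1))" for t
      by (rule continuous_on_section[OF cont(1)])
    show "continuous_on ({0 - 1..0 + 1} \<times> S) (\<lambda>(t, y). F' l (x + t *\<^sub>R axis l 1) y)"
    proof -
      have "continuous_on ({0 - 1..0 + 1} \<times> S) (\<lambda>q. (x + fst q *\<^sub>R axis l 1, snd q))"
        by (intro continuous_intros)
      from continuous_on_compose2[OF cont(2)[of l] this] show ?thesis
        by (simp add: case_prod_unfold)
    qed
    show "((\<lambda>t. F (x + t *\<^sub>R axis l 1) y) has_real_derivative F' l (x + t *\<^sub>R axis l 1) y) (at t)" for t y
      using F'(1)[of "x + t *\<^sub>R axis l 1" l y]
        DERIV_at_within_shift[of "\<lambda>t. F (x + t *\<^sub>R axis l 1) y" "F' l (x + t *\<^sub>R axis l 1) y" t 0 UNIV]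
      by (simp add: algebra_simps)
  qed
  then have "((\<lambda>t. LINT y|lebesgue. f y * F (x + t *\<^sub>R axis l 1) y) has_real_derivative
      (LINT y|lebesgue. f y * F' l x y)) (at 0)" for x l by simp
  moreover have "Ck_domain k (\<lambda>x. LINT y|lebesgue. f y * F' l x y)" for l
    by (intro Suc.IH F')
  ultimately show ?case
    using continuous_on_param_integral[OF f S cont(1)] by (intro Ck_domainI)
qed

text \<open>With v = 1/u the derivative d/du is -v^2 d/dv, hence P(v) exp(-v) turns into v^2 (P -
  P')(v) exp(-v).\<close>

primrec bump_poly :: "nat \<Rightarrow> real poly" where
  "bump_poly 0 = 1"
| "bump_poly (Suc j) = [:0, 0, 1:] * (bump_poly j - pderiv (bump_poly j))"

text \<open>The \<open>j\<close>-th derivative of \<open>u \<mapsto> exp (-1/u)\<close> extended by \<open>0\<close> to \<open>u \<le> 0\<close>.\<close>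

definition bump :: "nat \<Rightarrow> real \<Rightarrow> real" where
  "bump j u = (if 0 < u then poly (bump_poly j) (1 / u) * exp (- 1 / u) else 0)"

lemma tendsto_poly_exp_at_top: "((\<lambda>v. poly p v * exp (- v)) \<longlongrightarrow> (0::real)) at_top"
proof (induction p)
  case (pCons a p)
  have pow: "((\<lambda>v. poly p v * v ^ k * exp (- v)) \<longlongrightarrow> (0::real)) at_top" for p k
  proof (induction p arbitrary: k)
    case (pCons a p)
    have "((\<lambda>v. a * (v ^ k / exp v) + poly p v * v ^ Suc k * exp (- v)) \<longlongrightarrow> a * 0 + 0) at_top"
      by (intro tendsto_intros tendsto_power_div_exp_0 pCons.IH)
    then show ?case by (simp add: algebra_simps exp_minus divide_inverse)
  qed simp
  show ?case using pow[of "pCons a p" 0] by simp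
qed simp

text \<open>Division by \<open>h\<close> multiplies the polynomial in 1/h by one more power, which
  the exponential still beats. This is differentiability at zero, for all orders at once.\<close>

lemma tendsto_bump_at_0: "((\<lambda>h. bump j h / h) \<longlongrightarrow> 0) (at 0)"
proof -
  have right: "((\<lambda>h. bump j h / h) \<longlongrightarrow> 0) (at_right 0)"
  proof -
    have "((\<lambda>h. poly (bump_poly j * [:0, 1:]) (inverse h) * exp (- inverse h)) \<longlongrightarrow> 0) (at_right (0::real))"
      by (rule filterlim_compose[OF tendsto_poly_exp_at_top filterlim_inverse_at_top_right])
    then show ?thesis
      by (rule Lim_transform_eventually)
         (auto simp: eventually_at_filter bump_def divide_inverse)
  qed
  have "((\<lambda>h. 0) \<longlongrightarrow> (0::real)) (at_left (0::real))" by simp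
  then have "((\<lambda>h. bump j h / h) \<longlongrightarrow> 0) (at_left 0)"
    by (rule Lim_transform_eventually) (auto simp: eventually_at_filter bump_def)
  then show ?thesis
    using right by (simp add: filterlim_split_at)
qed

lemma bump_DERIV: "(bump j has_real_derivative bump (Suc j) u) (at u)"
proof -
  consider "0 < u" | "u < 0" | "u = 0" by linarith
  then show ?thesis
  proof cases
    case 1
    have "((\<lambda>u. poly (bump_poly j) (1 / u) * exp (- 1 / u)) has_real_derivative bump (Suc j) u) (at u)"
      using 1 by (auto intro!: derivative_eq_intros DERIV_chain2[OF poly_DERIV]
        simp: bump_def field_simps power2_eq_square)
    moreover have "\<forall>\<^sub>F v in nhds u. bump j v = poly (bump_poly j) (1 / v) * exp (- 1 / v)"
      using eventually_nhds_in_open[of "{0<..}" u] 1 by (auto simp: bump_def elim: eventually_mono)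
    ultimately show ?thesis by (subst DERIV_cong_ev[OF refl _ refl])
  next
    case 2
    have "\<forall>\<^sub>F v in nhds u. bump j v = 0"
      using eventually_nhds_in_open[of "{..<0}" u] 2 by (auto simp: bump_def elim: eventually_mono)
    then show ?thesis
      using 2 by (subst DERIV_cong_ev[OF refl _ refl]) (auto simp: bump_def)
  next
    case 3
    then show ?thesis
      using tendsto_bump_at_0[of j] by (simp add: has_field_derivative_iff bump_def)
  qed
qed

lemma bump_0_bounds: "0 \<le> bump 0 u" "bump 0 u \<le> 1" "bump 0 u \<noteq> 0 \<longleftrightarrow> 0 < u"
  by (auto simp: bump_def)

definition unit_bump :: "nat \<Rightarrow> real ^ 'n::finite \<Rightarrow> real" where
  "unit_bump j z = bump j (1 - z \<bullet> z)"

lemma continuous_on_unit_bump: "continuous_on S (unit_bump j)"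
proof -
  have "continuous_on UNIV (bump j)"
    by (rule DERIV_continuous_on[OF has_field_derivative_at_within[OF bump_DERIV]])
  moreover have "continuous_on S (\<lambda>z :: real ^ 'a. 1 - z \<bullet> z)"
    by (intro continuous_intros)
  ultimately show ?thesis
    unfolding unit_bump_def by (rule continuous_on_compose2) auto
qed

lemma unit_bump_zero: "1 \<le> norm z \<Longrightarrow> unit_bump j z = 0"
  using one_le_power[of "norm z" 2] by (auto simp: unit_bump_def bump_def power2_norm_eq_inner)

lemma integrable_unit_bump: "integrable lebesgue (unit_bump j :: real ^ 'n \<Rightarrow> real)"
  by (rule integrable_continuous_compact_support[OF continuous_on_unit_bump compact_cball[of 0 1]])
     (auto intro: unit_bump_zero)

definition bump_mass :: "'n::finite itself \<Rightarrow> real" where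
  "bump_mass _ = (LINT z|lebesgue. unit_bump 0 (z :: real ^ 'n))"

lemma bump_mass_pos: "0 < bump_mass TYPE('n::finite)"
proof -
  have nonneg: "0 \<le> unit_bump 0 z" for z :: "real ^ 'n"
    by (simp add: unit_bump_def bump_0_bounds)
  have "bump_mass TYPE('n) \<noteq> 0"
  proof
    assume "bump_mass TYPE('n) = 0"
    then have "AE z in lebesgue. unit_bump 0 (z :: real ^ 'n) = 0"
      using integral_nonneg_eq_0_iff_AE[OF integrable_unit_bump, of 0] nonneg by (auto simp: bump_mass_def)
    moreover have "unit_bump 0 z \<noteq> 0" if "z \<in> ball (0 :: real ^ 'n) 1" for z
    proof -
      have "(norm z)\<^sup>2 < 1" using that by (auto simp: power_less_one_iff abs_square_less_1)
      then show ?thesis by (simp add: unit_bump_def bump_0_bounds power2_norm_eq_inner)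
    qed
    ultimately have "AE z in lebesgue. z \<notin> ball (0 :: real ^ 'n) 1"
      by (auto elim: eventually_mono)
    then have "negligible (ball (0 :: real ^ 'n) 1)"
      by (simp add: negligible_iff_null_sets AE_iff_null_sets)
    then show False
      using negligible_imp_measure0 content_ball_pos[of 1 "0 :: real ^ 'n"] by fastforce
  qed
  moreover have "0 \<le> bump_mass TYPE('n)"
    unfolding bump_mass_def by (rule integral_nonneg_AE) (simp add: nonneg)
  ultimately show ?thesis by simp
qed

text \<open>The index \<open>j\<close> differentiates the profile, not the kernel; the chain rule
  factors are written out in \<open>mollifier_DERIV\<close>. The squared norm keeps the kernel
  smooth at the origin, and \<open>inverse s\<close> matches the closure rules for smooth
  families.\<close>

definition mollifier :: "nat \<Rightarrow> real \<Rightarrow> real ^ 'n::finite \<Rightarrow> real" where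
  "mollifier j s z = inverse s ^ CARD('n) * bump j (1 - (z \<bullet> z) * (inverse s)\<^sup>2) / bump_mass TYPE('n)"

lemma mollifier_bounds:
  fixes z :: "real ^ 'n"
  assumes "0 < s"
  shows "0 \<le> mollifier 0 s z" "mollifier 0 s z \<le> inverse s ^ CARD('n) / bump_mass TYPE('n)"
    and "s \<le> norm z \<Longrightarrow> mollifier j s z = 0"
proof -
  show "0 \<le> mollifier 0 s z"
    using assms bump_mass_pos[where 'n = 'n] by (simp add: mollifier_def bump_0_bounds)
  show "mollifier 0 s z \<le> inverse s ^ CARD('n) / bump_mass TYPE('n)"
    using assms bump_mass_pos[where 'n = 'n] bump_0_bounds(2)[of "1 - (z \<bullet> z) * (inverse s)\<^sup>2"]
    by (simp add: mollifier_def divide_right_mono mult_left_le)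
  show "mollifier j s z = 0" if "s \<le> norm z"
  proof -
    have "s\<^sup>2 \<le> z \<bullet> z"
      using power_mono[OF that, of 2] assms by (simp add: power2_norm_eq_inner)
    then have "1 \<le> (z \<bullet> z) * (inverse s)\<^sup>2"
      using assms by (simp add: field_simps)
    then show ?thesis by (simp add: mollifier_def bump_def)
  qed
qed

lemma mollifier_eq: "0 < s \<Longrightarrow> mollifier j s z = inverse s ^ CARD('n) * unit_bump j (inverse s *\<^sub>R z) / bump_mass TYPE('n)"
  for z :: "real ^ 'n"
  by (simp add: mollifier_def unit_bump_def power2_eq_square mult_ac)

lemma Ck_param_mollifier:
  fixes Z :: "real ^ 'n \<Rightarrow> 'p::topological_space \<Rightarrow> real ^ 'n"
  assumes r: "Ck_param k r" "\<And>x p. 0 < r x p" and Z: "\<And>i. Ck_param k (\<lambda>x p. Z x p $ i)"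
  shows "Ck_param k (\<lambda>x p. mollifier 0 (r x p) (Z x p))"
proof -
  have "Ck_param k (\<lambda>x p. bump 0 (1 - (\<Sum>i\<in>UNIV. Z x p $ i * Z x p $ i) * inverse (r x p) ^ 2))"
    by (rule Ck_param_compose[of bump, OF bump_DERIV])
       (intro Ck_param_diff Ck_param_const Ck_param_mult Ck_param_sum Ck_param_power Ck_param_inverse r Z; simp)
  then have "Ck_param k (\<lambda>x p. inverse (r x p) ^ CARD('n) * bump 0 (1 - (\<Sum>i\<in>UNIV. Z x p $ i * Z x p $ i) * inverse (r x p) ^ 2)
      * (1 / bump_mass TYPE('n)))"
    by (intro Ck_param_mult Ck_param_power Ck_param_inverse r Ck_param_const) auto
  then show ?thesis
    by (simp add: mollifier_def inner_vec_def)
qed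

text \<open>Scale and point move together, since the smoothing scale will depend on the point. The
  terms with \<open>r'\<close> come from the scale, the one with \<open>z \<bullet> v\<close> from
  the point.\<close>

lemma mollifier_DERIV:
  fixes z v :: "real ^ 'n"
  assumes r: "(r has_real_derivative r') (at 0)" "0 < r 0"
  shows "((\<lambda>t. mollifier j (r t) (z + t *\<^sub>R v)) has_real_derivative
     - real CARD('n) * r' / r 0 * mollifier j (r 0) z
     + mollifier (Suc j) (r 0) z * (2 * (z \<bullet> z) * r' / r 0 ^ 3 - 2 * (z \<bullet> v) / (r 0)\<^sup>2)) (at 0)"
proof -
  let ?N = "CARD('n)"
  have 1: "((\<lambda>t. (inverse (r t)) ^ ?N) has_real_derivative - real ?N * r' / r 0 * inverse (r 0) ^ ?N) (at 0)"
  proof -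
    have "((\<lambda>t. (inverse (r t)) ^ ?N) has_real_derivative
        real ?N * (inverse (r 0) ^ (?N - 1) * (- (inverse (r 0) * r' * inverse (r 0))))) (at 0)"
      using DERIV_power[OF DERIV_inverse'[OF r(1)], of ?N] r(2) by (simp add: mult_ac)
    moreover have "inverse (r 0) ^ ?N = inverse (r 0) ^ (?N - 1) * inverse (r 0)"
      by (metis One_nat_def Suc_pred mult.commute power_Suc zero_less_card_finite)
    ultimately show ?thesis by (simp add: divide_inverse mult_ac)
  qed
  have "((\<lambda>t. 1 - ((z + t *\<^sub>R v) \<bullet> (z + t *\<^sub>R v)) * (inverse (r t))\<^sup>2) has_real_derivative
      2 * (z \<bullet> z) * r' / r 0 ^ 3 - 2 * (z \<bullet> v) / (r 0)\<^sup>2) (at 0)"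
  proof -
    have eq: "(z + t *\<^sub>R v) \<bullet> (z + t *\<^sub>R v) = z \<bullet> z + t * (2 * (z \<bullet> v)) + t\<^sup>2 * (v \<bullet> v)" for t
      by (simp add: inner_add_left inner_add_right inner_commute power2_eq_square algebra_simps)
    show ?thesis
      unfolding eq using r(2)
      by (auto intro!: derivative_eq_intros r(1) simp: field_simps power2_eq_square power3_eq_cube)
  qed
  from DERIV_chain2[OF bump_DERIV[of j] this]
  have 2: "((\<lambda>t. bump j (1 - ((z + t *\<^sub>R v) \<bullet> (z + t *\<^sub>R v)) * (inverse (r t))\<^sup>2)) has_real_derivative
     bump (Suc j) (1 - (z \<bullet> z) * (inverse (r 0))\<^sup>2) * (2 * (z \<bullet> z) * r' / r 0 ^ 3 - 2 * (z \<bullet> v) / (r 0)\<^sup>2)) (at 0)"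
    by simp
  from DERIV_cdivide[OF DERIV_mult[OF 1 2], of "bump_mass TYPE('n)"]
  show ?thesis
    unfolding mollifier_def
    by (rule DERIV_cong) (simp add: add_divide_distrib diff_divide_distrib mult_ac)
qed

lemma lebesgue_integral_affine:
  fixes F :: "'b::euclidean_space \<Rightarrow> real"
  assumes "F \<in> borel_measurable borel" "c \<noteq> 0"
  shows "(LINT y|lebesgue. F y) = \<bar>c\<bar> ^ DIM('b) * (LINT z|lebesgue. F (x + c *\<^sub>R z))"
proof -
  have "(LINT y|lebesgue. F y) = (LINT y|lborel. F y)"
    using assms by (simp add: integral_completion)
  also have "\<dots> = (LINT y|density (distr lborel borel (\<lambda>z. x + c *\<^sub>R z)) (\<lambda>_. \<bar>c\<bar> ^ DIM('b)). F y)"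
    using lborel_affine[OF assms(2), of x] by simp
  also have "\<dots> = \<bar>c\<bar> ^ DIM('b) * (LINT z|lborel. F (x + c *\<^sub>R z))"
    using assms by (simp add: integral_density integral_distr ennreal_power)
  also have "(LINT z|lborel. F (x + c *\<^sub>R z)) = (LINT z|lebesgue. F (x + c *\<^sub>R z))"
    using assms by (subst integral_completion) auto
  finally show ?thesis .
qed

lemma continuous_on_mollifier: "0 < s \<Longrightarrow> continuous_on S (\<lambda>y. mollifier j s (x - y :: real ^ 'n))"
proof -
  assume s: "0 < s"
  have "continuous_on S (\<lambda>y. inverse s *\<^sub>R (x - y))"
    by (intro continuous_intros)
  then have "continuous_on S (\<lambda>y. unit_bump j (inverse s *\<^sub>R (x - y)))"
    by (rule continuous_on_compose2[OF continuous_on_unit_bump]) auto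
  then show ?thesis
    using s bump_mass_pos[where 'n = 'n] by (auto simp: mollifier_eq intro!: continuous_intros)
qed

text \<open>An affine change of variables reduces the mass to \<open>bump_mass\<close>. The first
  moments vanish because the kernel is even; this is what makes the variation of the scale invisible
  in the limit.\<close>

lemma mollifier_integral:
  fixes x :: "real ^ 'n"
  assumes s: "0 < s"
  shows "integrable lebesgue (\<lambda>y. mollifier 0 s (x - y))"
    and "(LINT y|lebesgue. mollifier 0 s (x - y)) = 1"
    and "(LINT y|lebesgue. (x - y) $ i * mollifier 0 s (x - y)) = 0"
proof -
  have zero: "mollifier 0 s (x - y) = 0" if "y \<notin> cball x s" for y
    using that mollifier_bounds(3)[OF s, of "x - y"] by (simp add: dist_norm)
  show "integrable lebesgue (\<lambda>y. mollifier 0 s (x - y))"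
    by (rule integrable_continuous_compact_support[OF continuous_on_mollifier[OF s] compact_cball zero])
  have meas: "(\<lambda>y. mollifier 0 s (x - y)) \<in> borel_measurable borel"
    by (intro borel_measurable_continuous_onI continuous_on_mollifier s)
  have scale: "mollifier 0 s (x - (x + (- s) *\<^sub>R z)) = inverse s ^ CARD('n) * unit_bump 0 z / bump_mass TYPE('n)" for z
    using s by (simp add: mollifier_eq)
  have "(LINT y|lebesgue. mollifier 0 s (x - y))
      = \<bar>- s\<bar> ^ DIM(real ^ 'n) * (LINT z|lebesgue. mollifier 0 s (x - (x + (- s) *\<^sub>R z)))"
    using s by (intro lebesgue_integral_affine[OF meas]) auto
  also have "\<dots> = 1"
    unfolding scale using s bump_mass_pos[where 'n = 'n]
    by (simp add: bump_mass_def field_simps)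
  finally show "(LINT y|lebesgue. mollifier 0 s (x - y)) = 1" .
  let ?I = "LINT z|lebesgue. z $ i * mollifier 0 s z"
  have meas': "(\<lambda>z. z $ i * mollifier 0 s z) \<in> borel_measurable borel"
  proof (intro borel_measurable_continuous_onI continuous_intros)
    show "continuous_on UNIV (mollifier 0 s :: real ^ 'n \<Rightarrow> real)"
      using continuous_on_mollifier[OF s, of UNIV 0 0] by (simp add: mollifier_def)
  qed
  have "(LINT y|lebesgue. (x - y) $ i * mollifier 0 s (x - y)) = ?I"
    using lebesgue_integral_affine[OF meas', of "- 1" x] by simp
  moreover have "?I = - ?I"
  proof -
    have "?I = (LINT z|lebesgue. (- z) $ i * mollifier 0 s (- z))"
      using lebesgue_integral_affine[OF meas', of "- 1" 0] by simp
    then show ?thesis by (simp add: mollifier_def)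
  qed
  ultimately show "(LINT y|lebesgue. (x - y) $ i * mollifier 0 s (x - y)) = 0" by simp
qed

subsection \<open>Maximal functions and Lebesgue points\<close>

text \<open>The set where the uncentred maximal function of \<open>g\<close> exceeds \<open>t\<close>.\<close>

definition maximal_superlevel :: "('a::euclidean_space \<Rightarrow> real) \<Rightarrow> real \<Rightarrow> 'a set" where
  "maximal_superlevel g t =
     \<Union> {ball c r | c r. 0 < r \<and> t * measure lebesgue (ball c r) < (LINT y|lebesgue. indicator (ball c r) y * g y)}"

lemma open_maximal_superlevel: "open (maximal_superlevel g t)"
  unfolding maximal_superlevel_def by (rule open_Union) auto

lemma maximal_superlevel_mono:
  assumes "s \<le> t"
  shows "maximal_superlevel g t \<subseteq> maximal_superlevel g s"
proof -
  have "s * measure lebesgue (ball c r) \<le> t * measure lebesgue (ball c r)" for c :: 'a and r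
    using assms by (intro mult_right_mono) auto
  then show ?thesis
    unfolding maximal_superlevel_def by (smt (verit) Sup_subset_mono Collect_mono)
qed

lemma integrable_indicator_mult:
  fixes g :: "'a \<Rightarrow> real"
  shows "A \<in> sets M \<Longrightarrow> integrable M g \<Longrightarrow> integrable M (\<lambda>y. indicator A y * g y)"
  using integrable_mult_indicator[of A M g] by simp

lemma ball_average_le:
  assumes "x \<in> ball c r" "x \<notin> maximal_superlevel g t"
  shows "(LINT y|lebesgue. indicator (ball c r) y * g y) \<le> t * measure lebesgue (ball c r)"
proof (rule ccontr)
  assume "\<not> ?thesis"
  moreover have "0 < r" using assms(1) by (metis ball_eq_empty empty_iff not_less)
  ultimately show False
    using assms unfolding maximal_superlevel_def not_le by blast
qed

lemma emeasure_lebesgue_ball: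
  "emeasure lebesgue (ball (a :: 'a::euclidean_space) r) = ennreal (measure lebesgue (ball a r))"
  by (rule emeasure_eq_ennreal_measure[OF fmeasurableD2[OF lmeasurable_ball]])

lemma measure_ball_scale:
  assumes "0 < r" "0 \<le> k"
  shows "measure lebesgue (ball (a :: 'a::euclidean_space) (k * r)) = k ^ DIM('a) * measure lebesgue (ball a r)"
  using assms by (simp add: content_ball power_mult_distrib mult_ac)

text \<open>A ball on which the average of \<open>g\<close> exceeds \<open>t\<close> has volume less
  than the integral of \<open>g\<close> divided by \<open>t\<close>. In dimension n the radii
  therefore shrink like t^(-1/n), and so does the error made when a Lipschitz weight is moved across
  such a ball.\<close>

lemma maximal_ball_radius:
  fixes g :: "'a::euclidean_space \<Rightarrow> real"
  assumes g: "integrable lebesgue g" "\<And>y. 0 \<le> g y" and t: "0 < t" "0 < r"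
    and big: "t * measure lebesgue (ball c r) < (LINT y|lebesgue. indicator (ball c r) y * g y)"
  shows "r < ((LINT y|lebesgue. g y) / (unit_ball_vol DIM('a) * t)) powr (1 / DIM('a))"
proof -
  have "(LINT y|lebesgue. indicator (ball c r) y * g y) \<le> (LINT y|lebesgue. g y)"
    using g by (intro integral_mono integrable_indicator_mult) (auto simp: indicator_def)
  with big have "t * (unit_ball_vol DIM('a) * r ^ DIM('a)) < (LINT y|lebesgue. g y)"
    using t by (simp add: content_ball)
  moreover have pos: "0 < unit_ball_vol DIM('a)" by simp
  ultimately have "r ^ DIM('a) < (LINT y|lebesgue. g y) / (unit_ball_vol DIM('a) * t)"
    using t by (simp add: field_simps)
  then have "(r ^ DIM('a)) powr (1 / DIM('a)) < ((LINT y|lebesgue. g y) / (unit_ball_vol DIM('a) * t)) powr (1 / DIM('a))"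
    using t by (intro powr_less_mono2) auto
  moreover have "(r ^ DIM('a)) powr (1 / DIM('a)) = r"
    using t by (simp add: powr_realpow[symmetric] powr_powr)
  ultimately show ?thesis by simp
qed

text \<open>
  The weak type inequality of the maximal function with a Lipschitz weight: since the balls making up
  the superlevel set have small radius, the weight can be transported to the right hand side at the
  price of an error term.
\<close>

lemma weighted_weak_type:
  fixes g \<psi> :: "'a::euclidean_space \<Rightarrow> real"
  assumes g: "integrable lebesgue g" "\<And>y. 0 \<le> g y" and t: "0 < t"
    and \<psi>: "\<And>y. 0 \<le> \<psi> y" "\<And>x y. \<psi> x \<le> \<psi> y + \<Lambda> * dist x y" "0 \<le> \<Lambda>"
      "\<psi> \<in> borel_measurable lebesgue"
    and rad: "\<And>c r. 0 < r \<Longrightarrow> t * measure lebesgue (ball c r) < (LINT y|lebesgue. indicator (ball c r) y * g y) \<Longrightarrow> r \<le> \<rho>"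
  shows "(\<integral>\<^sup>+x. indicator (maximal_superlevel g t) x * ennreal (\<psi> x) \<partial>lebesgue)
     \<le> ennreal (2 * 5 ^ DIM('a) / t) *
       (\<integral>\<^sup>+x. indicator {x. t / 2 < g x} x * ennreal (g x * (\<psi> x + 6 * \<Lambda> * \<rho>)) \<partial>lebesgue)"
proof -
  define K where "K = {(c, r). 0 < r \<and> t * measure lebesgue (ball c r) < (LINT y|lebesgue. indicator (ball c r) y * g y)}"
  have U: "maximal_superlevel g t = (\<Union>i\<in>K. ball (fst i) (snd i))"
    unfolding maximal_superlevel_def K_def by (rule set_eqI) (simp del: mem_ball, blast)
  have K: "0 < snd i \<and> snd i \<le> \<rho>" if "i \<in> K" for i
    using that rad by (auto simp: K_def)
  obtain C where C: "countable C" "C \<subseteq> K"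
     "pairwise (\<lambda>i j. disjnt (ball (fst i) (snd i)) (ball (fst j) (snd j))) C"
     "maximal_superlevel g t \<subseteq> (\<Union>i\<in>C. ball (fst i) (5 * snd i))"
    by (rule Vitali_covering_lemma_balls[OF eq_refl[OF U], of \<rho>]) (use K in auto)
  let ?G = "\<lambda>x. indicator {x. t / 2 < g x} x * ennreal (g x * (\<psi> x + 6 * \<Lambda> * \<rho>))"
  have gm: "g \<in> borel_measurable lebesgue" using g(1) by auto
  have G_meas: "?G \<in> borel_measurable lebesgue"
    using gm \<psi>(4) by measurable
  have ball_meas: "(\<lambda>x. indicator (ball c r) x * G x) \<in> borel_measurable lebesgue"
    if "G \<in> borel_measurable lebesgue" for c r and G :: "'a \<Rightarrow> ennreal"
    using that by (intro borel_measurable_times_ennreal borel_measurable_indicator) auto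
  have one: "(\<integral>\<^sup>+x. indicator (ball (fst i) (5 * snd i)) x * ennreal (\<psi> x) \<partial>lebesgue)
     \<le> ennreal (2 * 5 ^ DIM('a) / t) * (\<integral>\<^sup>+x. indicator (ball (fst i) (snd i)) x * ?G x \<partial>lebesgue)"
    if "i \<in> C" for i
  proof -
    obtain a r where i: "i = (a, r)" by fastforce
    have r: "0 < r" "r \<le> \<rho>" and iK: "i \<in> K" using K C(2) that i by auto
    define M where "M = measure lebesgue (ball a r)"
    have M: "0 < M" using r by (simp add: M_def content_ball_pos)
    have big: "t * M < (LINT y|lebesgue. indicator (ball a r) y * g y)"
      using iK i by (simp add: K_def M_def)
    \<comment> \<open>Comparing the weight on the enlarged ball with its value at the centre costs
      \<open>5 * \<Lambda> * \<rho>\<close>, and comparing the centre with a point of the ball costs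
      another \<open>\<Lambda> * \<rho>\<close>; together they make the 6 of the statement.\<close>
    have lip: "\<psi> y \<le> \<psi> a + 5 * \<Lambda> * \<rho>" if "y \<in> ball a (5 * r)" for y
    proof -
      have "\<Lambda> * dist y a \<le> \<Lambda> * (5 * \<rho>)"
        using that r \<psi>(3) by (intro mult_left_mono) (auto simp: dist_commute)
      then show ?thesis using \<psi>(2)[of y a] by (simp add: mult_ac)
    qed
    have lip': "\<psi> a \<le> \<psi> y + \<Lambda> * \<rho>" if "y \<in> ball a r" for y
    proof -
      have "\<Lambda> * dist a y \<le> \<Lambda> * \<rho>"
        using that r \<psi>(3) by (intro mult_left_mono) auto
      then show ?thesis using \<psi>(2)[of a y] by simp
    qed
    define W where "W = \<psi> a + 5 * \<Lambda> * \<rho>"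
    have W: "0 \<le> W" using \<psi>(1)[of a] \<psi>(3) r by (simp add: W_def)
    have int1: "integrable lebesgue (\<lambda>y. indicator (ball a r) y * g y)"
      using g by (intro integrable_indicator_mult) auto
    define h where "h y = indicator (ball a r) y * (indicator {x. t / 2 < g x} y * g y)" for y
    have int2: "integrable lebesgue h"
    proof -
      have "{x \<in> space lebesgue. t / 2 < g x} \<in> sets lebesgue"
        using gm by measurable
      then have "{x. t / 2 < g x} \<in> sets lebesgue" by simp
      then show ?thesis
        unfolding h_def by (intro integrable_indicator_mult g(1)) auto
    qed
    have h_nonneg: "0 \<le> h y" for y using g(2) by (simp add: h_def)
    \<comment> \<open>Values of \<open>g\<close> up to \<open>t / 2\<close> account for at most half
      of the required mass, so the high part carries the other half. This is the origin of the
      factor 2.\<close>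
    have "(LINT y|lebesgue. indicator (ball a r) y * g y) \<le> (LINT y|lebesgue. h y + indicator (ball a r) y * (t / 2))"
    proof (rule integral_mono[OF int1])
      show "integrable lebesgue (\<lambda>y. h y + indicator (ball a r) y * (t / 2))"
        using int2 by (intro Bochner_Integration.integrable_add integrable_mult_left)
          (auto simp: emeasure_lebesgue_ball integrable_indicator_iff)
      show "indicator (ball a r) y * g y \<le> h y + indicator (ball a r) y * (t / 2)" for y
        using t by (auto simp: h_def indicator_def)
    qed
    also have "\<dots> = (LINT y|lebesgue. h y) + M * (t / 2)"
      using int2 by (subst Bochner_Integration.integral_add)
        (auto simp: M_def emeasure_lebesgue_ball integrable_indicator_iff)
    finally have h_big: "t / 2 * M < (LINT y|lebesgue. h y)"
      using big by (simp add: algebra_simps)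
    have "(\<integral>\<^sup>+x. indicator (ball (fst i) (5 * snd i)) x * ennreal (\<psi> x) \<partial>lebesgue)
       \<le> (\<integral>\<^sup>+x. ennreal W * indicator (ball a (5 * r)) x \<partial>lebesgue)"
      using lip i by (intro nn_integral_mono) (auto simp: indicator_def W_def intro!: ennreal_leI)
    also have "\<dots> = ennreal W * ennreal (measure lebesgue (ball a (5 * r)))"
      by (simp add: nn_integral_cmult_indicator emeasure_lebesgue_ball)
    also have "\<dots> = ennreal (W * (5 ^ DIM('a) * M))"
      using W M r measure_ball_scale[of r 5 a] by (simp add: ennreal_mult M_def)
    also have "\<dots> \<le> ennreal (2 * 5 ^ DIM('a) / t * (W * (LINT y|lebesgue. h y)))"
    proof (rule ennreal_leI)
      have "5 ^ DIM('a) * (W * M) \<le> 5 ^ DIM('a) * (W * (2 / t * (LINT y|lebesgue. h y)))"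
        using h_big t W by (intro mult_left_mono) (auto simp: field_simps)
      then show "W * (5 ^ DIM('a) * M) \<le> 2 * 5 ^ DIM('a) / t * (W * (LINT y|lebesgue. h y))"
        by (simp add: mult_ac)
    qed
    also have "\<dots> = ennreal (2 * 5 ^ DIM('a) / t) * ennreal (LINT y|lebesgue. W * h y)"
      using t W h_nonneg by (simp add: ennreal_mult[symmetric] integral_nonneg_AE)
    also have "ennreal (LINT y|lebesgue. W * h y) = (\<integral>\<^sup>+y. ennreal (W * h y) \<partial>lebesgue)"
      using W h_nonneg int2 by (subst nn_integral_eq_integral) auto
    also have "\<dots> \<le> (\<integral>\<^sup>+x. indicator (ball (fst i) (snd i)) x * ?G x \<partial>lebesgue)"
    proof (rule nn_integral_mono)
      fix y
      show "ennreal (W * h y) \<le> indicator (ball (fst i) (snd i)) y * ?G y"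
      proof (cases "y \<in> ball a r \<and> t / 2 < g y")
        case True
        have "W * g y \<le> (\<psi> y + 6 * \<Lambda> * \<rho>) * g y"
          using lip'[of y] True g(2)[of y] by (intro mult_right_mono) (auto simp: W_def)
        then show ?thesis using True i by (simp add: h_def mult.commute ennreal_leI)
      qed (auto simp: h_def)
    qed
    finally show ?thesis by (simp add: mult_left_mono)
  qed
  have "(\<integral>\<^sup>+x. indicator (maximal_superlevel g t) x * ennreal (\<psi> x) \<partial>lebesgue)
     \<le> (\<integral>\<^sup>+x. (\<integral>\<^sup>+i. indicator (ball (fst i) (5 * snd i)) x * ennreal (\<psi> x) \<partial>count_space C) \<partial>lebesgue)"
  proof (rule nn_integral_mono)
    fix x
    show "indicator (maximal_superlevel g t) x * ennreal (\<psi> x)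
       \<le> (\<integral>\<^sup>+i. indicator (ball (fst i) (5 * snd i)) x * ennreal (\<psi> x) \<partial>count_space C)"
    proof (cases "x \<in> maximal_superlevel g t")
      case True
      then obtain i where i: "i \<in> C" "x \<in> ball (fst i) (5 * snd i)" using C(4) by blast
      have "indicator (ball (fst i) (5 * snd i)) x * ennreal (\<psi> x)
        \<le> (\<integral>\<^sup>+i. indicator (ball (fst i) (5 * snd i)) x * ennreal (\<psi> x) \<partial>count_space C)"
        by (rule nn_integral_ge_point[OF i(1)])
      then show ?thesis using True i by simp
    qed simp
  qed
  also have "\<dots> = (\<integral>\<^sup>+i. (\<integral>\<^sup>+x. indicator (ball (fst i) (5 * snd i)) x * ennreal (\<psi> x) \<partial>lebesgue) \<partial>count_space C)"
    using \<psi>(4) C(1) by (intro nn_integral_count_space_nn_integral ball_meas) auto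
  also have "\<dots> \<le> (\<integral>\<^sup>+i. ennreal (2 * 5 ^ DIM('a) / t) * (\<integral>\<^sup>+x. indicator (ball (fst i) (snd i)) x * ?G x \<partial>lebesgue) \<partial>count_space C)"
    by (intro nn_integral_mono) (use one in auto)
  also have "\<dots> = ennreal (2 * 5 ^ DIM('a) / t) * (\<integral>\<^sup>+i. (\<integral>\<^sup>+x. indicator (ball (fst i) (snd i)) x * ?G x \<partial>lebesgue) \<partial>count_space C)"
    by (rule nn_integral_cmult) simp
  also have "(\<integral>\<^sup>+i. (\<integral>\<^sup>+x. indicator (ball (fst i) (snd i)) x * ?G x \<partial>lebesgue) \<partial>count_space C)
     = (\<integral>\<^sup>+x. (\<integral>\<^sup>+i. indicator (ball (fst i) (snd i)) x * ?G x \<partial>count_space C) \<partial>lebesgue)"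
    by (rule nn_integral_count_space_nn_integral[OF C(1) ball_meas[OF G_meas], symmetric])
  also have "\<dots> \<le> (\<integral>\<^sup>+x. ?G x \<partial>lebesgue)"
  proof (rule nn_integral_mono)
    fix x
    show "(\<integral>\<^sup>+i. indicator (ball (fst i) (snd i)) x * ?G x \<partial>count_space C) \<le> ?G x"
    proof (cases "\<exists>i\<in>C. x \<in> ball (fst i) (snd i)")
      case True
      then obtain j where j: "j \<in> C" "x \<in> ball (fst j) (snd j)" by blast
      have "indicator (ball (fst i) (snd i)) x = (indicator {j} i :: ennreal)" if "i \<in> C" for i
        using that j C(3) by (auto simp: pairwise_def disjnt_iff indicator_def)
      then have "(\<integral>\<^sup>+i. indicator (ball (fst i) (snd i)) x * ?G x \<partial>count_space C)
         = (\<integral>\<^sup>+i. ?G x * indicator {j} i \<partial>count_space C)"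
        by (intro nn_integral_cong) (auto simp: mult.commute)
      also have "\<dots> = ?G x"
        using j by (subst nn_integral_cmult_indicator) auto
      finally show ?thesis by simp
    next
      case False
      then have "(\<integral>\<^sup>+i. indicator (ball (fst i) (snd i)) x * ?G x \<partial>count_space C) = (\<integral>\<^sup>+i. 0 \<partial>count_space C)"
        by (intro nn_integral_cong) auto
      then show ?thesis by simp
    qed
  qed
  finally show ?thesis by (simp add: mult_left_mono)
qed

section \<open>The unweighted weak type inequality and Lebesgue's differentiation theorem\<close>

lemma lmeasurable_emeasure_less:
  "A \<in> lmeasurable \<Longrightarrow> emeasure lebesgue A < ennreal e \<Longrightarrow> measure lebesgue A < e"
  by (subst (asm) emeasure_eq_ennreal_measure[OF fmeasurableD2]) (simp_all only: ennreal_less_iff measure_nonneg)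

lemma integrable_indicator_ball: "integrable lebesgue (indicat_real (ball x r))"
  by (intro integrable_real_indicator) (auto simp: emeasure_lebesgue_ball)

lemma weak_type:
  fixes g :: "'a::euclidean_space \<Rightarrow> real"
  assumes g: "integrable lebesgue g" "\<And>y. 0 \<le> g y" and t: "0 < t"
  shows "emeasure lebesgue (maximal_superlevel g t) \<le> ennreal (2 * 5 ^ DIM('a) / t * (LINT y|lebesgue. g y))"
proof -
  have "emeasure lebesgue (maximal_superlevel g t)
      = (\<integral>\<^sup>+x. indicator (maximal_superlevel g t) x * ennreal 1 \<partial>lebesgue)"
    using open_maximal_superlevel[of g t] by (subst nn_integral_cong[of _ _ "indicator (maximal_superlevel g t)"]) auto
  also have "\<dots> \<le> ennreal (2 * 5 ^ DIM('a) / t) *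
       (\<integral>\<^sup>+x. indicator {x. t / 2 < g x} x * ennreal (g x * (1 + 6 * 0 * (((LINT y|lebesgue. g y) / (unit_ball_vol DIM('a) * t)) powr (1 / DIM('a))))) \<partial>lebesgue)"
    by (rule weighted_weak_type[OF g t]) (use maximal_ball_radius[OF g t] in \<open>auto intro: less_imp_le\<close>)
  also have "\<dots> \<le> ennreal (2 * 5 ^ DIM('a) / t) * (\<integral>\<^sup>+x. ennreal (g x) \<partial>lebesgue)"
    by (intro mult_left_mono nn_integral_mono) (auto simp: indicator_def)
  also have "\<dots> = ennreal (2 * 5 ^ DIM('a) / t * (LINT y|lebesgue. g y))"
    using g t by (subst nn_integral_eq_integral) (auto simp: ennreal_mult[symmetric] integral_nonneg_AE)
  finally show ?thesis .
qed

lemma lmeasurable_maximal_superlevel: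
  fixes g :: "'a::euclidean_space \<Rightarrow> real"
  assumes g: "integrable lebesgue g" "\<And>y. 0 \<le> g y" and t: "0 < t"
  shows "maximal_superlevel g t \<in> lmeasurable"
    and "measure lebesgue (maximal_superlevel g t) \<le> 2 * 5 ^ DIM('a) / t * (LINT y|lebesgue. g y)"
proof -
  have sets: "maximal_superlevel g t \<in> sets lebesgue"
    using open_maximal_superlevel[of g t] by auto
  show "maximal_superlevel g t \<in> lmeasurable"
    using sets weak_type[OF assms] by (intro fmeasurableI) (auto simp: le_less_trans)
  have "0 \<le> 2 * 5 ^ DIM('a) / t * (LINT y|lebesgue. g y)"
    using t g by (simp add: integral_nonneg_AE)
  then show "measure lebesgue (maximal_superlevel g t) \<le> 2 * 5 ^ DIM('a) / t * (LINT y|lebesgue. g y)"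
    using weak_type[OF assms]
    unfolding emeasure_eq_ennreal_measure[OF fmeasurableD2[OF \<open>maximal_superlevel g t \<in> lmeasurable\<close>]]
    by (simp only: ennreal_le_iff)
qed

definition lebesgue_point :: "('a::euclidean_space \<Rightarrow> real) \<Rightarrow> 'a \<Rightarrow> bool" where
  "lebesgue_point u x \<longleftrightarrow> (\<forall>e>0. \<exists>d>0. \<forall>r. 0 < r \<and> r < d \<longrightarrow>
     (LINT y|lebesgue. indicator (ball x r) y * \<bar>u y - u x\<bar>) \<le> e * measure lebesgue (ball x r))"

lemma integrable_osc:
  fixes u :: "'a::euclidean_space \<Rightarrow> real"
  assumes "integrable lebesgue u"
  shows "integrable lebesgue (\<lambda>y. indicator (ball x r) y * \<bar>u y - c\<bar>)"
proof -
  have "integrable lebesgue (\<lambda>y. \<bar>indicator (ball x r) y * u y - indicator (ball x r) y * c\<bar>)"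
    using assms
    by (intro integrable_abs Bochner_Integration.integrable_diff integrable_indicator_mult integrable_mult_left)
       (auto intro: integrable_indicator_ball)
  moreover have "\<bar>indicator (ball x r) y * u y - indicator (ball x r) y * c\<bar> = indicator (ball x r) y * \<bar>u y - c\<bar>" for y
    by (simp add: indicator_def)
  ultimately show ?thesis by simp
qed

text \<open>For a fixed tolerance the bad points lie in sets of arbitrarily small measure, hence
  form a negligible set by outer approximation, which also settles its measurability. The bad sets
  for the tolerances 1/(k+1) are then united.\<close>

lemma lebesgue_point_AE_approx:
  fixes u :: "'a::euclidean_space \<Rightarrow> real"
  assumes u: "\<And>e \<delta>. 0 < e \<Longrightarrow> 0 < \<delta> \<Longrightarrow> \<exists>T\<in>lmeasurable. measure lebesgue T < \<delta> \<and> (\<forall>x. x \<notin> T \<longrightarrow>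
     (\<exists>d>0. \<forall>r. 0 < r \<and> r < d \<longrightarrow>
       (LINT y|lebesgue. indicator (ball x r) y * \<bar>u y - u x\<bar>) \<le> e * measure lebesgue (ball x r)))"
  shows "AE x in lebesgue. lebesgue_point u x"
proof -
  define good where "good e x \<longleftrightarrow> (\<exists>d>0. \<forall>r. 0 < r \<and> r < d \<longrightarrow>
       (LINT y|lebesgue. indicator (ball x r) y * \<bar>u y - u x\<bar>) \<le> e * measure lebesgue (ball x r))" for e x
  have neg: "negligible {x. \<not> good e x}" if "0 < e" for e
    unfolding negligible_outer
  proof (intro allI impI)
    fix \<delta> :: real assume "0 < \<delta>"
    from u[OF that this] obtain T where "T \<in> lmeasurable" "measure lebesgue T < \<delta>" "\<And>x. x \<notin> T \<Longrightarrow> good e x"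
      unfolding good_def by blast
    then show "\<exists>T. {x. \<not> good e x} \<subseteq> T \<and> T \<in> lmeasurable \<and> measure lebesgue T < \<delta>" by blast
  qed
  have "negligible (\<Union>k. {x. \<not> good (1 / real (Suc k)) x})"
    by (rule negligible_countable_Union) (auto intro: neg)
  moreover have "lebesgue_point u x" if x: "x \<notin> (\<Union>k. {x. \<not> good (1 / real (Suc k)) x})" for x
    unfolding lebesgue_point_def
  proof (intro allI impI)
    fix e :: real assume "0 < e"
    then obtain k where k: "1 / real (Suc k) < e" using nat_approx_posE by blast
    have "good (1 / real (Suc k)) x" using x by blast
    then obtain d where d: "0 < d" "\<And>r. 0 < r \<and> r < d \<Longrightarrow>
       (LINT y|lebesgue. indicator (ball x r) y * \<bar>u y - u x\<bar>) \<le> 1 / real (Suc k) * measure lebesgue (ball x r)"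
      unfolding good_def by blast
    have "1 / real (Suc k) * measure lebesgue (ball x r) \<le> e * measure lebesgue (ball x r)" for r
      using k by (intro mult_right_mono) auto
    then show "\<exists>d>0. \<forall>r. 0 < r \<and> r < d \<longrightarrow>
       (LINT y|lebesgue. indicator (ball x r) y * \<bar>u y - u x\<bar>) \<le> e * measure lebesgue (ball x r)"
      using d by (meson order_trans)
  qed
  ultimately show ?thesis
    by (intro AE_I'[of "\<Union>k. {x. \<not> good (1 / real (Suc k)) x}"]) (auto simp: negligible_iff_null_sets)
qed

text \<open>Squeeze \<open>A\<close> between a closed and an open set whose difference
  \<open>D\<close> is small. Every point has a neighbourhood inside the open set or disjoint from
  the closed one, and there the indicator of \<open>A\<close> can differ from its value at the point
  only on \<open>D\<close>. Off a small superlevel set the averages of the indicator of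
  \<open>D\<close> are small.\<close>

lemma lebesgue_point_AE_indicator:
  fixes A :: "'a::euclidean_space set"
  assumes A: "A \<in> sets lebesgue"
  shows "AE x in lebesgue. lebesgue_point (\<lambda>y. indicator A y * c) x"
proof (rule lebesgue_point_AE_approx)
  fix e \<delta> :: real assume e: "0 < e" and \<delta>: "0 < \<delta>"
  define t where "t = e / (\<bar>c\<bar> + 1)"
  have t: "0 < t" "\<bar>c\<bar> * t \<le> e" using e by (auto simp: t_def field_simps)
  define \<delta>' where "\<delta>' = \<delta> * t / (4 * 5 ^ DIM('a))"
  have \<delta>': "0 < \<delta>'" using \<delta> t by (simp add: \<delta>'_def)
  obtain O' where O': "open O'" "A \<subseteq> O'" "O' - A \<in> lmeasurable" "emeasure lebesgue (O' - A) < ennreal (\<delta>' / 2)"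
    using sets_lebesgue_outer_open[OF A, of "\<delta>' / 2"] \<delta>' by auto
  obtain K where K: "closed K" "K \<subseteq> A" "A - K \<in> lmeasurable" "emeasure lebesgue (A - K) < ennreal (\<delta>' / 2)"
    using sets_lebesgue_inner_closed[OF A, of "\<delta>' / 2"] \<delta>' by auto
  define D where "D = (O' - A) \<union> (A - K)"
  have D: "D \<in> lmeasurable" unfolding D_def using O' K by (intro fmeasurable.Un)
  have "measure lebesgue D \<le> measure lebesgue (O' - A) + measure lebesgue (A - K)"
    unfolding D_def using O' K by (intro measure_Un_le) auto
  also have "\<dots> < \<delta>' / 2 + \<delta>' / 2"
    by (intro add_strict_mono lmeasurable_emeasure_less O' K)
  finally have mD: "measure lebesgue D < \<delta>'" by simp
  let ?g = "indicat_real D"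
  have g: "integrable lebesgue ?g" "\<And>y. 0 \<le> ?g y"
    using D by (auto simp: lmeasurable_iff_integrable)
  have intg: "(LINT y|lebesgue. ?g y) = measure lebesgue D" by simp
  let ?T = "maximal_superlevel ?g t"
  show "\<exists>T\<in>lmeasurable. measure lebesgue T < \<delta> \<and> (\<forall>x. x \<notin> T \<longrightarrow> (\<exists>d>0. \<forall>r. 0 < r \<and> r < d \<longrightarrow>
     (LINT y|lebesgue. indicator (ball x r) y * \<bar>indicator A y * c - indicator A x * c\<bar>) \<le> e * measure lebesgue (ball x r)))"
  proof (intro bexI conjI allI impI)
    show "?T \<in> lmeasurable" by (rule lmeasurable_maximal_superlevel[OF g t(1)])
    have "measure lebesgue ?T \<le> 2 * 5 ^ DIM('a) / t * measure lebesgue D"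
      using lmeasurable_maximal_superlevel(2)[OF g t(1)] intg by simp
    also have "\<dots> \<le> 2 * 5 ^ DIM('a) / t * \<delta>'"
      using mD t by (intro mult_left_mono) auto
    also have "\<dots> < \<delta>" using \<delta> t by (simp add: \<delta>'_def field_simps)
    finally show "measure lebesgue ?T < \<delta>" .
    fix x assume x: "x \<notin> ?T"
    have "\<exists>d>0. \<forall>y\<in>ball x d. \<bar>indicator A y - indicator A x\<bar> \<le> ?g y"
    proof (cases "x \<in> A")
      case True
      then obtain d where "0 < d" "ball x d \<subseteq> O'" using O'(1,2) by (meson openE subsetD)
      then show ?thesis using True by (intro exI[of _ d]) (auto simp: D_def indicator_def)
    next
      case False
      then have "x \<in> - K" using K(2) by blast
      then obtain d where "0 < d" "ball x d \<subseteq> - K" using K(1) by (meson openE open_Compl)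
      then show ?thesis using False by (intro exI[of _ d]) (auto simp: D_def indicator_def)
    qed
    then obtain d where d: "0 < d" "\<And>y. y \<in> ball x d \<Longrightarrow> \<bar>indicator A y - indicator A x\<bar> \<le> ?g y" by blast
    show "\<exists>d>0. \<forall>r. 0 < r \<and> r < d \<longrightarrow>
     (LINT y|lebesgue. indicator (ball x r) y * \<bar>indicator A y * c - indicator A x * c\<bar>) \<le> e * measure lebesgue (ball x r)"
    proof (intro exI[of _ d] conjI allI impI d(1))
      fix r assume r: "0 < r \<and> r < d"
      have "(LINT y|lebesgue. indicator (ball x r) y * \<bar>indicator A y * c - indicator A x * c\<bar>)
        \<le> (LINT y|lebesgue. \<bar>c\<bar> * (indicator (ball x r) y * ?g y))"
      proof (rule integral_mono_AE')
        show "integrable lebesgue (\<lambda>y. \<bar>c\<bar> * (indicator (ball x r) y * ?g y))"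
          using g by (intro integrable_mult_right integrable_indicator_mult) auto
        show "AE y in lebesgue. indicator (ball x r) y * \<bar>indicator A y * c - indicator A x * c\<bar>
           \<le> \<bar>c\<bar> * (indicator (ball x r) y * ?g y)"
        proof (rule AE_I2)
          fix y
          have "\<bar>indicator A y * c - indicator A x * c\<bar> \<le> ?g y * \<bar>c\<bar>" if "y \<in> ball x r"
          proof -
            have "\<bar>indicator A y * c - indicator A x * c\<bar> = \<bar>indicator A y - indicator A x\<bar> * \<bar>c\<bar>"
              by (simp add: left_diff_distrib[symmetric] abs_mult)
            also have "\<dots> \<le> ?g y * \<bar>c\<bar>"
              using that r by (intro mult_right_mono d) auto
            finally show ?thesis .
          qed
          then show "indicator (ball x r) y * \<bar>indicator A y * c - indicator A x * c\<bar>
           \<le> \<bar>c\<bar> * (indicator (ball x r) y * ?g y)"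
            by (cases "y \<in> ball x r") (simp_all add: mult.commute)
        qed
      qed (simp add: AE_I2)
      also have "\<dots> = \<bar>c\<bar> * (LINT y|lebesgue. indicator (ball x r) y * ?g y)" by simp
      also have "\<dots> \<le> \<bar>c\<bar> * (t * measure lebesgue (ball x r))"
        using r by (intro mult_left_mono ball_average_le[OF _ x]) auto
      also have "\<dots> \<le> e * measure lebesgue (ball x r)"
        using t(2) by (simp only: mult.assoc[symmetric]) (intro mult_right_mono, auto)
      finally show "(LINT y|lebesgue. indicator (ball x r) y * \<bar>indicator A y * c - indicator A x * c\<bar>) \<le> e * measure lebesgue (ball x r)" .
    qed
  qed
qed

text \<open>The oscillation of \<open>u\<close> is at most that of \<open>v\<close>, plus the
  average of |u - v|, plus the value of |u - v| at the point: three terms of size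
  \<open>e / 3\<close>. The last two are controlled off the superlevel set of the maximal function
  and off a Markov set, both of small measure.\<close>

lemma lebesgue_point_AE_limit:
  fixes u :: "'a::euclidean_space \<Rightarrow> real"
  assumes u: "integrable lebesgue u"
    and approx: "\<And>\<delta>. 0 < \<delta> \<Longrightarrow> \<exists>v. integrable lebesgue v \<and> (LINT y|lebesgue. \<bar>u y - v y\<bar>) < \<delta> \<and> (AE x in lebesgue. lebesgue_point v x)"
  shows "AE x in lebesgue. lebesgue_point u x"
proof (rule lebesgue_point_AE_approx)
  fix e \<delta> :: real assume e: "0 < e" and \<delta>: "0 < \<delta>"
  define t where "t = e / 3"
  have t: "0 < t" using e by (simp add: t_def)
  \<comment> \<open>The weak type constant and the constant 1 of Markov's inequality add up in the
    denominator.\<close>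
  define \<delta>' where "\<delta>' = \<delta> * t / (2 * 5 ^ DIM('a) + 1)"
  have pos: "(0::real) < 2 * 5 ^ DIM('a) + 1" by (simp add: add_pos_pos)
  have \<delta>': "0 < \<delta>'" using \<delta> t pos by (simp add: \<delta>'_def)
  obtain v where v: "integrable lebesgue v" "(LINT y|lebesgue. \<bar>u y - v y\<bar>) < \<delta>'" "AE x in lebesgue. lebesgue_point v x"
    using approx[OF \<delta>'] by blast
  define g where "g = (\<lambda>y. \<bar>u y - v y\<bar>)"
  have g: "integrable lebesgue g" "\<And>y. 0 \<le> g y" using u v by (auto simp: g_def)
  obtain N where N: "N \<in> null_sets lebesgue" "\<And>x. x \<notin> N \<Longrightarrow> lebesgue_point v x"
    using v(3) by (auto elim!: AE_E3 simp: null_sets_def)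
  let ?U = "maximal_superlevel g t" and ?B = "{x. t \<le> g x}"
  have B: "?B \<in> lmeasurable" "measure lebesgue ?B \<le> (LINT y|lebesgue. g y) / t"
  proof -
    have "{x \<in> space lebesgue. t \<le> g x} \<in> sets lebesgue" using g(1) by measurable
    then have sets: "?B \<in> sets lebesgue" by simp
    have "integrable lebesgue (indicat_real ?B)"
      by (rule Bochner_Integration.integrable_bound[of _ "\<lambda>y. g y / t"])
         (use g t sets in \<open>auto simp: indicator_def field_simps\<close>)
    then show "?B \<in> lmeasurable" by (simp add: lmeasurable_iff_integrable)
    show "measure lebesgue ?B \<le> (LINT y|lebesgue. g y) / t"
      using integral_Markov_inequality_measure[OF g(1), of UNIV t] g t by simp
  qed
  show "\<exists>T\<in>lmeasurable. measure lebesgue T < \<delta> \<and> (\<forall>x. x \<notin> T \<longrightarrow> (\<exists>d>0. \<forall>r. 0 < r \<and> r < d \<longrightarrow>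
     (LINT y|lebesgue. indicator (ball x r) y * \<bar>u y - u x\<bar>) \<le> e * measure lebesgue (ball x r)))"
  proof (intro bexI[of _ "?U \<union> ?B \<union> N"] conjI allI impI)
    have NL: "N \<in> lmeasurable" "measure lebesgue N = 0"
      using N(1) by (auto simp: null_sets_def intro: fmeasurableI measure_eq_0_null_sets)
    note U = lmeasurable_maximal_superlevel[OF g t]
    show "?U \<union> ?B \<union> N \<in> lmeasurable" using U B NL by (intro fmeasurable.Un)
    have "measure lebesgue (?U \<union> ?B \<union> N) \<le> measure lebesgue ?U + measure lebesgue ?B + measure lebesgue N"
      using U(1) B(1) NL(1) by (intro order_trans[OF measure_Un_le] add_right_mono measure_Un_le) auto
    also have "\<dots> \<le> (2 * 5 ^ DIM('a) + 1) / t * (LINT y|lebesgue. g y)"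
      using U(2) B(2) NL(2) by (simp add: add_divide_distrib distrib_right)
    also have "\<dots> < (2 * 5 ^ DIM('a) + 1) / t * \<delta>'"
      using v(2) t pos by (intro mult_strict_left_mono) (auto simp: g_def)
    also have "\<dots> = \<delta>" using t pos by (simp add: \<delta>'_def)
    finally show "measure lebesgue (?U \<union> ?B \<union> N) < \<delta>" .
    fix x assume x: "x \<notin> ?U \<union> ?B \<union> N"
    then obtain d where d: "0 < d" "\<And>r. 0 < r \<and> r < d \<Longrightarrow>
       (LINT y|lebesgue. indicator (ball x r) y * \<bar>v y - v x\<bar>) \<le> t * measure lebesgue (ball x r)"
      using N(2)[of x] t unfolding lebesgue_point_def by blast
    show "\<exists>d>0. \<forall>r. 0 < r \<and> r < d \<longrightarrow>
     (LINT y|lebesgue. indicator (ball x r) y * \<bar>u y - u x\<bar>) \<le> e * measure lebesgue (ball x r)"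
    proof (intro exI[of _ d] conjI allI impI d(1))
      fix r assume r: "0 < r \<and> r < d"
      have int1: "integrable lebesgue (\<lambda>y. indicator (ball x r) y * g y)"
        using g by (intro integrable_indicator_mult) auto
      have int2: "integrable lebesgue (\<lambda>y. indicator (ball x r) y * g x)"
        by (intro integrable_mult_left integrable_indicator_ball)
      have "(LINT y|lebesgue. indicator (ball x r) y * \<bar>u y - u x\<bar>) \<le>
         (LINT y|lebesgue. indicator (ball x r) y * \<bar>v y - v x\<bar> + indicator (ball x r) y * g y + indicator (ball x r) y * g x)"
        by (intro integral_mono integrable_osc u v Bochner_Integration.integrable_add int1 int2)
           (auto simp: indicator_def g_def)
      also have "\<dots> = (LINT y|lebesgue. indicator (ball x r) y * \<bar>v y - v x\<bar>)
           + (LINT y|lebesgue. indicator (ball x r) y * g y) + measure lebesgue (ball x r) * g x"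
        using int1 int2 integrable_osc[OF v(1), of x r "v x"] by simp
      also have "\<dots> \<le> t * measure lebesgue (ball x r) + t * measure lebesgue (ball x r) + measure lebesgue (ball x r) * t"
      proof (intro add_mono mult_left_mono)
        show "(LINT y|lebesgue. indicator (ball x r) y * g y) \<le> t * measure lebesgue (ball x r)"
          using x r by (intro ball_average_le[of x]) auto
      qed (use x r d in auto)
      also have "\<dots> = e * measure lebesgue (ball x r)" by (simp add: t_def)
      finally show "(LINT y|lebesgue. indicator (ball x r) y * \<bar>u y - u x\<bar>) \<le> e * measure lebesgue (ball x r)" .
    qed
  qed
qed

theorem lebesgue_point_AE:
  fixes u :: "'a::euclidean_space \<Rightarrow> real"
  assumes "integrable lebesgue u"
  shows "AE x in lebesgue. lebesgue_point u x"
  using assms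
proof (induct rule: integrable_induct)
  case (base A c)
  then show ?case using lebesgue_point_AE_indicator[of A c] by simp
next
  case (add f g)
  from add(2,4) show ?case
  proof eventually_elim
    case (elim x)
    show ?case unfolding lebesgue_point_def
    proof (intro allI impI)
      fix e :: real assume "0 < e"
      then have e: "0 < e / 2" by simp
      obtain d1 d2 where d: "0 < d1" "0 < d2"
        "\<And>r. 0 < r \<and> r < d1 \<Longrightarrow> (LINT y|lebesgue. indicator (ball x r) y * \<bar>f y - f x\<bar>) \<le> e / 2 * measure lebesgue (ball x r)"
        "\<And>r. 0 < r \<and> r < d2 \<Longrightarrow> (LINT y|lebesgue. indicator (ball x r) y * \<bar>g y - g x\<bar>) \<le> e / 2 * measure lebesgue (ball x r)"
        using elim[unfolded lebesgue_point_def, rule_format, OF e] by blast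
      show "\<exists>d>0. \<forall>r. 0 < r \<and> r < d \<longrightarrow>
        (LINT y|lebesgue. indicator (ball x r) y * \<bar>f y + g y - (f x + g x)\<bar>) \<le> e * measure lebesgue (ball x r)"
      proof (intro exI[of _ "min d1 d2"] conjI allI impI)
        fix r assume r: "0 < r \<and> r < min d1 d2"
        have "(LINT y|lebesgue. indicator (ball x r) y * \<bar>f y + g y - (f x + g x)\<bar>) \<le>
          (LINT y|lebesgue. indicator (ball x r) y * \<bar>f y - f x\<bar> + indicator (ball x r) y * \<bar>g y - g x\<bar>)"
          using add by (intro integral_mono integrable_osc Bochner_Integration.integrable_add)
            (auto simp: indicator_def)
        also have "\<dots> = (LINT y|lebesgue. indicator (ball x r) y * \<bar>f y - f x\<bar>) + (LINT y|lebesgue. indicator (ball x r) y * \<bar>g y - g x\<bar>)"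
          using add integrable_osc by (intro Bochner_Integration.integral_add)
        also have "\<dots> \<le> e / 2 * measure lebesgue (ball x r) + e / 2 * measure lebesgue (ball x r)"
          using r d by (intro add_mono) auto
        finally show "(LINT y|lebesgue. indicator (ball x r) y * \<bar>f y + g y - (f x + g x)\<bar>) \<le> e * measure lebesgue (ball x r)"
          by simp
      qed (use d in auto)
    qed
  qed
next
  case (lim f s)
  show ?case
  proof (rule lebesgue_point_AE_limit[OF lim(5)])
    fix \<delta> :: real assume \<delta>: "0 < \<delta>"
    have "(\<lambda>i. LINT y|lebesgue. \<bar>f y - s i y\<bar>) \<longlonglongrightarrow> (LINT y|(lebesgue :: 'a measure). (0::real))"
    proof (rule integral_dominated_convergence[where w = "\<lambda>y. 3 * \<bar>f y\<bar>"])
      show "AE y in lebesgue. (\<lambda>i. \<bar>f y - s i y\<bar>) \<longlonglongrightarrow> 0"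
      proof (rule AE_I2)
        fix y assume "y \<in> space (lebesgue :: 'a measure)"
        then have "(\<lambda>i. s i y) \<longlonglongrightarrow> f y" using lim(3) by blast
        then have "(\<lambda>i. \<bar>f y - s i y\<bar>) \<longlonglongrightarrow> \<bar>f y - f y\<bar>" by (intro tendsto_intros)
        then show "(\<lambda>i. \<bar>f y - s i y\<bar>) \<longlonglongrightarrow> 0" by simp
      qed
      show "AE y in lebesgue. norm \<bar>f y - s i y\<bar> \<le> 3 * \<bar>f y\<bar>" for i
      proof (rule AE_I2)
        fix y assume "y \<in> space (lebesgue :: 'a measure)"
        then have "\<bar>s i y\<bar> \<le> 2 * \<bar>f y\<bar>" using lim(4) by auto
        then show "norm \<bar>f y - s i y\<bar> \<le> 3 * \<bar>f y\<bar>" by simp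
      qed
    qed (use lim(1,5) in auto)
    then have "\<forall>\<^sub>F i in sequentially. (LINT y|lebesgue. \<bar>f y - s i y\<bar>) < \<delta>"
      using \<delta> by (auto intro: order_tendstoD)
    then obtain i where "(LINT y|lebesgue. \<bar>f y - s i y\<bar>) < \<delta>"
      by (auto dest: eventually_happens)
    then show "\<exists>v. integrable lebesgue v \<and> (LINT y|lebesgue. \<bar>f y - v y\<bar>) < \<delta> \<and> (AE x in lebesgue. lebesgue_point v x)"
      using lim(1,2) by blast
  qed
qed

text \<open>The averages of \<open>g\<close> over balls shrinking to a Lebesgue point tend to the
  value there. Consequently the set where \<open>g\<close> exceeds \<open>t\<close> lies in the
  superlevel set up to a null set, which is how levels of \<open>g\<close> are compared with levels
  of its maximal function.\<close>

lemma lebesgue_point_le_maximal: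
  fixes g :: "'a::euclidean_space \<Rightarrow> real"
  assumes g: "integrable lebesgue g" and x: "lebesgue_point g x" "x \<notin> maximal_superlevel g t"
  shows "g x \<le> t"
proof (rule field_le_epsilon)
  fix e :: real assume "0 < e"
  then obtain d where d: "0 < d" "\<And>r. 0 < r \<and> r < d \<Longrightarrow>
     (LINT y|lebesgue. indicator (ball x r) y * \<bar>g y - g x\<bar>) \<le> e * measure lebesgue (ball x r)"
    using x(1) unfolding lebesgue_point_def by blast
  define r where "r = d / 2"
  have r: "0 < r" "r < d" using d by (auto simp: r_def)
  have M: "0 < measure lebesgue (ball x r)" using content_ball_pos[OF r(1), of x] by simp
  have int: "integrable lebesgue (\<lambda>y. indicator (ball x r) y * g y)"
    using g by (intro integrable_indicator_mult) auto
  have "measure lebesgue (ball x r) * g x = (LINT y|lebesgue. indicator (ball x r) y * g x)"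
    by simp
  also have "\<dots> \<le> (LINT y|lebesgue. indicator (ball x r) y * g y + indicator (ball x r) y * \<bar>g y - g x\<bar>)"
    by (intro integral_mono Bochner_Integration.integrable_add int integrable_osc g)
       (rule integrable_mult_left[OF integrable_indicator_ball], simp add: indicator_def abs_if)
  also have "\<dots> = (LINT y|lebesgue. indicator (ball x r) y * g y) + (LINT y|lebesgue. indicator (ball x r) y * \<bar>g y - g x\<bar>)"
    by (intro Bochner_Integration.integral_add int integrable_osc g)
  also have "\<dots> \<le> t * measure lebesgue (ball x r) + e * measure lebesgue (ball x r)"
    using r d(2)[of r] by (intro add_mono ball_average_le[OF _ x(2)]) auto
  finally have "measure lebesgue (ball x r) * g x \<le> measure lebesgue (ball x r) * (t + e)"
    by (simp add: algebra_simps)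
  then show "g x \<le> t + e" using M by simp
qed

text \<open>The mean oscillation of \<open>u\<close> dominates the error because the kernels have
  size at most a multiple of the inverse volume of their balls. Leaving the limit mass
  \<open>W\<close> free covers the mollifier, with mass one, and its product with a coordinate, with
  mass zero.\<close>

lemma lebesgue_point_kernel_limit:
  fixes u :: "'a::euclidean_space \<Rightarrow> real"
  assumes u: "integrable lebesgue u" and x: "lebesgue_point u x"
    and s: "\<And>k. 0 < s k" "s \<longlonglongrightarrow> 0"
    and w: "\<And>k. w k \<in> borel_measurable lebesgue" "\<And>k y. \<bar>w k y\<bar> \<le> C * indicator (ball x (s k)) y / s k ^ DIM('a)"
    and W: "(\<lambda>k. LINT y|lebesgue. w k y) \<longlonglongrightarrow> W"
  shows "(\<lambda>k. LINT y|lebesgue. u y * w k y) \<longlonglongrightarrow> u x * W"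
proof -
  have int_osc: "integrable lebesgue (\<lambda>y. indicator (ball x (s k)) y * \<bar>u y - u x\<bar>)" for k
    by (rule integrable_osc[OF u])
  have int_w: "integrable lebesgue (w k)" for k
  proof (rule Bochner_Integration.integrable_bound[OF _ w(1)])
    show "integrable lebesgue (\<lambda>y. C * indicator (ball x (s k)) y / s k ^ DIM('a))"
      by (intro integrable_divide integrable_mult_right integrable_indicator_ball)
    show "AE y in lebesgue. norm (w k y) \<le> norm (C * indicator (ball x (s k)) y / s k ^ DIM('a))"
      unfolding real_norm_def by (intro AE_I2 order_trans[OF w(2) abs_ge_self])
  qed
  have bound: "\<bar>(u y - u x) * w k y\<bar> \<le> \<bar>C\<bar> / s k ^ DIM('a) * (indicator (ball x (s k)) y * \<bar>u y - u x\<bar>)" for k y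
  proof -
    have "\<bar>w k y\<bar> \<le> \<bar>C\<bar> * indicator (ball x (s k)) y / s k ^ DIM('a)"
      using s(1)[of k] by (intro order_trans[OF w(2)[of k y]] divide_right_mono mult_right_mono) auto
    from mult_left_mono[OF this abs_ge_zero[of "u y - u x"]] show ?thesis
      by (simp add: abs_mult mult_ac)
  qed
  have int_diff: "integrable lebesgue (\<lambda>y. (u y - u x) * w k y)" for k
  proof (rule Bochner_Integration.integrable_bound)
    show "integrable lebesgue (\<lambda>y. \<bar>C\<bar> / s k ^ DIM('a) * (indicator (ball x (s k)) y * \<bar>u y - u x\<bar>))"
      by (intro integrable_mult_right int_osc)
    show "(\<lambda>y. (u y - u x) * w k y) \<in> borel_measurable lebesgue"
      using u w(1) by (intro borel_measurable_times borel_measurable_diff) auto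
    show "AE y in lebesgue. norm ((u y - u x) * w k y) \<le> norm (\<bar>C\<bar> / s k ^ DIM('a) * (indicator (ball x (s k)) y * \<bar>u y - u x\<bar>))"
      unfolding real_norm_def by (intro AE_I2 order_trans[OF bound abs_ge_self])
  qed
  have "(\<lambda>k. LINT y|lebesgue. (u y - u x) * w k y) \<longlonglongrightarrow> 0"
  proof (rule LIMSEQ_I)
    fix e :: real assume e: "0 < e"
    define V where "V = unit_ball_vol (real DIM('a))"
    have V: "0 < V" by (simp add: V_def)
    define e' where "e' = e / (2 * (\<bar>C\<bar> + 1) * V)"
    have e': "0 < e'" using e V by (simp add: e'_def)
    obtain d where d: "0 < d" "\<And>r. 0 < r \<and> r < d \<Longrightarrow>
      (LINT y|lebesgue. indicator (ball x r) y * \<bar>u y - u x\<bar>) \<le> e' * measure lebesgue (ball x r)"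
      using x e' unfolding lebesgue_point_def by blast
    obtain k0 where k0: "\<And>k. k \<ge> k0 \<Longrightarrow> s k < d"
      using order_tendstoD(2)[OF s(2) d(1)] by (auto simp: eventually_sequentially)
    show "\<exists>k0. \<forall>k\<ge>k0. norm ((LINT y|lebesgue. (u y - u x) * w k y) - 0) < e"
    proof (intro exI[of _ k0] allI impI)
      fix k assume k: "k0 \<le> k"
      have "norm (LINT y|lebesgue. (u y - u x) * w k y) \<le> (LINT y|lebesgue. norm ((u y - u x) * w k y))"
        by (rule integral_norm_bound)
      also have "\<dots> \<le> (LINT y|lebesgue. \<bar>C\<bar> / s k ^ DIM('a) * (indicator (ball x (s k)) y * \<bar>u y - u x\<bar>))"
        using bound by (intro integral_mono integrable_norm int_diff integrable_mult_right int_osc) auto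
      also have "\<dots> = \<bar>C\<bar> / s k ^ DIM('a) * (LINT y|lebesgue. indicator (ball x (s k)) y * \<bar>u y - u x\<bar>)"
        by simp
      also have "\<dots> \<le> \<bar>C\<bar> / s k ^ DIM('a) * (e' * measure lebesgue (ball x (s k)))"
        using d(2)[of "s k"] k0[OF k] s(1)[of k] by (intro mult_left_mono) auto
      also have "\<dots> = \<bar>C\<bar> * e' * V"
        using s(1)[of k] by (simp add: content_ball V_def)
      also have "\<dots> = e * (\<bar>C\<bar> / (2 * (\<bar>C\<bar> + 1)))"
        using V by (simp add: e'_def)
      also have "\<dots> < e * 1"
        using e by (intro mult_strict_left_mono) (auto simp: divide_less_eq)
      finally show "norm ((LINT y|lebesgue. (u y - u x) * w k y) - 0) < e" by simp
    qed
  qed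
  from tendsto_add[OF this tendsto_mult[OF tendsto_const[of "u x"] W]]
  have "(\<lambda>k. (LINT y|lebesgue. (u y - u x) * w k y) + u x * (LINT y|lebesgue. w k y)) \<longlonglongrightarrow> u x * W" by simp
  moreover have "(LINT y|lebesgue. (u y - u x) * w k y) + u x * (LINT y|lebesgue. w k y) = (LINT y|lebesgue. u y * w k y)" for k
  proof -
    have "(LINT y|lebesgue. (u y - u x) * w k y) + (LINT y|lebesgue. u x * w k y)
      = (LINT y|lebesgue. (u y - u x) * w k y + u x * w k y)"
      by (intro Bochner_Integration.integral_add[symmetric] int_diff integrable_mult_right int_w)
    then show ?thesis by (simp add: algebra_simps)
  qed
  ultimately show ?thesis by simp
qed

subsection \<open>Smoothing at a variable scale\<close>

lemma enorm_add: "enorm m (\<lambda>i. x i + y i) \<le> enorm m x + enorm m y"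
  unfolding enorm_def by (rule L2_set_triangle_ineq)

lemma enorm_scale: "enorm m (\<lambda>i. c * x i) = \<bar>c\<bar> * enorm m x"
proof -
  have "L2_set (\<lambda>i. c * x i) {..<m} = sqrt (c\<^sup>2 * (\<Sum>i<m. (x i)\<^sup>2))"
    by (simp add: L2_set_def power_mult_distrib sum_distrib_left)
  then show ?thesis by (simp add: enorm_def L2_set_def real_sqrt_mult)
qed

lemma enorm_sum: "finite S \<Longrightarrow> enorm m (\<lambda>i. \<Sum>k\<in>S. c k * x k i) \<le> (\<Sum>k\<in>S. \<bar>c k\<bar> * enorm m (x k))"
proof (induction S rule: finite_induct)
  case empty
  then show ?case by (simp add: enorm_def L2_set_def)
next
  case (insert k S)
  have "enorm m (\<lambda>i. c k * x k i + (\<Sum>k\<in>S. c k * x k i)) \<le> enorm m (\<lambda>i. c k * x k i) + enorm m (\<lambda>i. \<Sum>k\<in>S. c k * x k i)"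
    by (rule enorm_add)
  then show ?case using insert by (simp add: enorm_scale)
qed

lemma enorm_le_sum: "enorm m x \<le> (\<Sum>i<m. \<bar>x i\<bar>)"
  unfolding enorm_def by (rule L2_set_le_sum_abs)

lemma enorm_measurable:
  "(\<And>i. i < m \<Longrightarrow> (\<lambda>x. u x i) \<in> borel_measurable M) \<Longrightarrow> (\<lambda>x. enorm m (u x)) \<in> borel_measurable M"
  unfolding enorm_def L2_set_def by (intro measurable_compose[OF _ borel_measurable_sqrt] borel_measurable_sum borel_measurable_power) auto

lemma integrable_enorm:
  assumes "\<And>i. i < m \<Longrightarrow> integrable M (\<lambda>x. u x i)"
  shows "integrable M (\<lambda>x. enorm m (u x))"
proof (rule Bochner_Integration.integrable_bound)
  show "integrable M (\<lambda>x. \<Sum>i<m. \<bar>u x i\<bar>)" using assms by auto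
  show "(\<lambda>x. enorm m (u x)) \<in> borel_measurable M" using assms by (intro enorm_measurable) auto
  show "AE x in M. norm (enorm m (u x)) \<le> norm (\<Sum>i<m. \<bar>u x i\<bar>)"
    using enorm_le_sum by (intro AE_I2) (simp add: sum_nonneg abs_of_nonneg)
qed

text \<open>Minkowski's inequality by duality: pair the vector of integrals with itself, pull the
  pairing inside the integral, and apply Cauchy-Schwarz pointwise.\<close>

lemma enorm_integral_le:
  assumes u: "\<And>i. i < m \<Longrightarrow> integrable M (\<lambda>x. u x i)"
  shows "enorm m (\<lambda>i. LINT x|M. u x i) \<le> (LINT x|M. enorm m (u x))"
proof -
  define a where "a i = (LINT x|M. u x i)" for i
  have "enorm m a * enorm m a = (\<Sum>i<m. a i * a i)"
    by (simp add: enorm_def L2_set_def sum_nonneg power2_eq_square)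
  also have "\<dots> = (LINT x|M. (\<Sum>i<m. a i * u x i))"
    using u by (simp add: a_def)
  also have "\<dots> \<le> (LINT x|M. enorm m a * enorm m (u x))"
  proof (rule integral_mono)
    show "(\<Sum>i<m. a i * u x i) \<le> enorm m a * enorm m (u x)" for x
    proof -
      have "(\<Sum>i<m. a i * u x i) \<le> (\<Sum>i<m. \<bar>a i\<bar> * \<bar>u x i\<bar>)"
        by (rule sum_mono) (metis abs_ge_self abs_mult)
      also have "\<dots> \<le> enorm m a * enorm m (u x)"
        unfolding enorm_def by (rule L2_set_mult_ineq)
      finally show ?thesis .
    qed
  qed (use u in \<open>auto intro: integrable_enorm\<close>)
  also have "\<dots> = enorm m a * (LINT x|M. enorm m (u x))" by simp
  finally have "enorm m a * enorm m a \<le> enorm m a * (LINT x|M. enorm m (u x))" .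
  moreover have "0 \<le> (LINT x|M. enorm m (u x))" by simp
  ultimately have "enorm m a \<le> (LINT x|M. enorm m (u x))"
    using enorm_nonneg[of m a] by (cases "enorm m a = 0") auto
  then show ?thesis by (simp add: a_def[abs_def])
qed

lemma integrable_mult_continuous:
  fixes f :: "'b::euclidean_space \<Rightarrow> real"
  assumes f: "integrable lebesgue f" "\<And>y. y \<notin> S \<Longrightarrow> f y = 0" and S: "compact S" and G: "continuous_on UNIV G"
  shows "integrable lebesgue (\<lambda>y. f y * G y)"
proof -
  obtain B where B: "\<And>y. y \<in> S \<Longrightarrow> \<bar>G y\<bar> \<le> B"
    using compact_imp_bounded[OF compact_continuous_image[OF continuous_on_subset[OF G subset_UNIV] S]]
    by (auto simp: bounded_iff)
  show ?thesis
  proof (rule Bochner_Integration.integrable_bound[OF integrable_mult_left[OF f(1), of B]])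
    show "(\<lambda>y. f y * G y) \<in> borel_measurable lebesgue"
      by (intro borel_measurable_times borel_measurable_integrable[OF f(1)] measurable_completion)
         (simp add: borel_measurable_continuous_onI G)
    show "AE y in lebesgue. norm (f y * G y) \<le> norm (f y * B)"
    proof (rule AE_I2)
      fix y
      show "norm (f y * G y) \<le> norm (f y * B)"
      proof (cases "y \<in> S")
        case True
        then have "\<bar>G y\<bar> \<le> \<bar>B\<bar>" using B by fastforce
        then show ?thesis by (simp add: abs_mult mult_left_mono)
      qed (simp add: f(2))
    qed
  qed
qed

lemma pderiv_param_integral:
  assumes f: "integrable lebesgue f" "\<And>y. y \<notin> S \<Longrightarrow> f y = 0" and S: "compact S"
    and F: "Ck_param (Suc 0) F"
    and G: "\<And>y. ((\<lambda>t. F (x + t *\<^sub>R axis l 1) y) has_real_derivative G y) (at 0)"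
  shows "pderiv_domain l (\<lambda>x. LINT y|lebesgue. f y * F x y) x = (LINT y|lebesgue. f y * G y)"
proof -
  obtain F' where F': "\<And>l x p. ((\<lambda>t. F (x + t *\<^sub>R axis l 1) p) has_real_derivative F' l x p) (at 0)"
    "\<And>l. Ck_param 0 (F' l)" using F by (rule Ck_paramE) blast
  have cont: "continuous_on UNIV (\<lambda>(x, p). F x p)" "\<And>l. continuous_on UNIV (\<lambda>(x, p). F' l x p)"
    by (intro Ck_param_continuous[OF F] Ck_param_continuous[OF F'(2)])+
  have "((\<lambda>t. LINT y|lebesgue. f y * F (x + t *\<^sub>R axis l 1) y) has_real_derivative
      (LINT y|lebesgue. f y * F' l (x + 0 *\<^sub>R axis l 1) y)) (at 0)"
  proof (rule integral_param_deriv[OF f S zero_less_one])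
    show "continuous_on S (F (x + t *\<^sub>R axis l 1))" for t
      by (rule continuous_on_section[OF cont(1)])
    show "continuous_on ({0 - 1..0 + 1} \<times> S) (\<lambda>(t, y). F' l (x + t *\<^sub>R axis l 1) y)"
    proof -
      have "continuous_on ({0 - 1..0 + 1} \<times> S) (\<lambda>q. (x + fst q *\<^sub>R axis l 1, snd q))"
        by (intro continuous_intros)
      from continuous_on_compose2[OF cont(2)[of l] this] show ?thesis
        by (simp add: case_prod_unfold)
    qed
    show "((\<lambda>t. F (x + t *\<^sub>R axis l 1) y) has_real_derivative F' l (x + t *\<^sub>R axis l 1) y) (at t)" for t y
      using F'(1)[of "x + t *\<^sub>R axis l 1" l y]
        DERIV_at_within_shift[of "\<lambda>t. F (x + t *\<^sub>R axis l 1) y" "F' l (x + t *\<^sub>R axis l 1) y" t 0 UNIV]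
      by (simp add: algebra_simps)
  qed
  moreover have "F' l x y = G y" for y
    using DERIV_unique[OF F'(1) G] .
  ultimately show ?thesis
    unfolding pderiv_domain_def by (intro DERIV_imp_deriv) simp
qed

lemma continuous_on_homotopy_coeff:
  assumes "smooth_target m (\<phi> I)"
  shows "continuous_on (Rm m) (homotopy_coeff \<phi> I)"
proof -
  have "continuous_on (Rm m) (\<lambda>y. y i)" for i
    by (rule continuous_on_product_then_coordinatewise[OF continuous_on_id])
  then have "continuous_on (Rm m \<times> cbox 0 1) (\<lambda>(y, s). \<phi> I (\<lambda>i. s * y i))"
    by (intro continuous_on_scaled[OF smooth_target_continuous[OF assms]])
  then have "continuous_on (Rm m \<times> cbox 0 1) (\<lambda>(y, s). s ^ (CARD('a) - 1) * \<phi> I (\<lambda>i. s * y i))"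
    unfolding case_prod_unfold by (intro continuous_intros)
  from integral_continuous_on_param[OF this] show ?thesis
    by (simp add: homotopy_coeff_def[abs_def])
qed

lemma abs_form_eval_le:
  fixes \<phi> :: "'n::{finite,linorder} form"
  assumes "(\<Sum>I\<in>multi_indices m. \<bar>\<phi> I y\<bar>) \<le> L"
  shows "\<bar>form_eval m \<phi> y v\<bar> \<le> L * (fact CARD('n) * (\<Prod>l\<in>UNIV. enorm m (v l)))"
proof -
  have P: "0 \<le> fact CARD('n) * (\<Prod>l\<in>(UNIV :: 'n set). enorm m (v l))"
    by (simp add: prod_nonneg)
  have "\<bar>form_eval m \<phi> y v\<bar> \<le> (\<Sum>I\<in>multi_indices m. \<bar>\<phi> I y\<bar> * (fact CARD('n) * (\<Prod>l\<in>UNIV. enorm m (v l))))"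
    unfolding form_eval_def
    by (intro order_trans[OF sum_abs] sum_mono)
       (auto simp: abs_mult multi_indices_def intro!: mult_left_mono abs_dx_le)
  also have "\<dots> \<le> L * (fact CARD('n) * (\<Prod>l\<in>UNIV. enorm m (v l)))"
    unfolding sum_distrib_right[symmetric] by (rule mult_right_mono[OF assms P])
  finally show ?thesis .
qed

text \<open>The weight s^(n-1) is at most one on the unit interval and rays stay in
  \<open>Rm m\<close>, so the coefficients of the primitive inherit the bound \<open>L\<close> of
  the form itself.\<close>

lemma sum_abs_homotopy_coeff_le:
  fixes \<phi> :: "'n::{finite,linorder} form"
  assumes \<phi>: "\<And>I. I \<in> multi_indices m \<Longrightarrow> smooth_target m (\<phi> I)"
    and L: "\<And>y. y \<in> Rm m \<Longrightarrow> (\<Sum>I\<in>multi_indices m. \<bar>\<phi> I y\<bar>) \<le> L" and y: "y \<in> Rm m"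
  shows "(\<Sum>I\<in>multi_indices m. \<bar>homotopy_coeff \<phi> I y\<bar>) \<le> L"
proof -
  let ?M = "multi_indices m :: ('n \<Rightarrow> nat) set"
  let ?f = "\<lambda>I s. s ^ (CARD('n) - 1) * \<phi> I (\<lambda>i. s * y i)"
  have cont: "continuous_on {0..1} (\<lambda>s. \<phi> I (\<lambda>i. s * y i))" if "I \<in> ?M" for I
    by (rule continuous_on_ray[OF smooth_target_continuous[OF \<phi>[OF that]] y])
  have "(\<Sum>I\<in>?M. \<bar>homotopy_coeff \<phi> I y\<bar>) \<le> (\<Sum>I\<in>?M. integral {0..1} (\<lambda>s. \<bar>?f I s\<bar>))"
  proof (rule sum_mono)
    fix I assume I: "I \<in> ?M"
    have "continuous_on {0..1} (?f I)"
      by (intro continuous_intros cont I)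
    then have "norm (integral {0..1} (?f I)) \<le> integral {0..1} (\<lambda>s. \<bar>?f I s\<bar>)"
      by (intro integral_norm_bound_integral integrable_continuous_interval continuous_on_rabs) auto
    then show "\<bar>homotopy_coeff \<phi> I y\<bar> \<le> integral {0..1} (\<lambda>s. \<bar>?f I s\<bar>)"
      by (simp add: homotopy_coeff_def)
  qed
  also have "\<dots> = integral {0..1} (\<lambda>s. \<Sum>I\<in>?M. \<bar>?f I s\<bar>)"
    by (rule integral_sum[symmetric]) (auto intro!: integrable_continuous_interval continuous_intros cont)
  also have "\<dots> \<le> integral {0..1} (\<lambda>s :: real. L)"
  proof (rule Henstock_Kurzweil_Integration.integral_le)
    show "(\<lambda>s. \<Sum>I\<in>?M. \<bar>?f I s\<bar>) integrable_on {0..1}"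
      by (auto intro!: integrable_continuous_interval continuous_intros cont)
    fix s :: real assume s: "s \<in> {0..1}"
    have s_Rm: "(\<lambda>i. s * y i) \<in> Rm m" using y by (auto simp: Rm_iff)
    have L0: "0 \<le> L" using L[OF s_Rm] by (meson order_trans sum_nonneg abs_ge_zero)
    have "(\<Sum>I\<in>?M. \<bar>?f I s\<bar>) = s ^ (CARD('n) - 1) * (\<Sum>I\<in>?M. \<bar>\<phi> I (\<lambda>i. s * y i)\<bar>)"
      using s by (simp add: abs_mult sum_distrib_left)
    also have "\<dots> \<le> 1 * L"
      using s L[OF s_Rm] L0 by (intro mult_mono power_le_one) (auto simp: sum_nonneg)
    finally show "(\<Sum>I\<in>?M. \<bar>?f I s\<bar>) \<le> L" by simp
  qed auto
  finally show ?thesis by simp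
qed

text \<open>The bound is proportional to the norm of \<open>y\<close>, because the homotopy
  contracts with \<open>y\<close> itself. Any gain in the size of the map is therefore a gain in the
  boundary term.\<close>

lemma abs_homotopy_form_le:
  fixes \<phi> :: "'n::{finite,linorder} form"
  assumes \<phi>: "\<And>I. I \<in> multi_indices m \<Longrightarrow> smooth_target m (\<phi> I)"
    and L: "\<And>y. y \<in> Rm m \<Longrightarrow> (\<Sum>I\<in>multi_indices m. \<bar>\<phi> I y\<bar>) \<le> L" and y: "y \<in> Rm m"
  shows "\<bar>homotopy_form m \<phi> l y A\<bar> \<le> L * (fact CARD('n) * (enorm m y * (\<Prod>k\<in>UNIV - {l}. enorm m (A k))))"
proof -
  have "homotopy_form m \<phi> l y A = form_eval m (homotopy_coeff \<phi>) y (A(l := y))"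
    by (simp add: homotopy_form_def form_eval_def)
  moreover have "(\<Prod>k\<in>UNIV. enorm m ((A(l := y)) k)) = enorm m y * (\<Prod>k\<in>UNIV - {l}. enorm m (A k))"
    by (subst prod.remove[of UNIV l]) (auto intro!: prod.cong)
  ultimately show ?thesis
    using abs_form_eval_le[where \<phi> = "homotopy_coeff \<phi>" and L = L and v = "A(l := y)",
        OF sum_abs_homotopy_coeff_le[where \<phi> = \<phi>, OF \<phi> L y]] by simp
qed

text \<open>\<open>q\<close> is continuous on \<open>Rm m\<close> only. That set is closed in the
  product topology, as an intersection of coordinate hyperplanes, so extension by zero makes
  \<open>q\<close> Borel.\<close>

lemma measurable_compose_Rm:
  assumes q: "continuous_on (Rm m) q" and f: "\<And>x. f x \<in> Rm m" "\<And>i. (\<lambda>x. f x i) \<in> borel_measurable M"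
  shows "(\<lambda>x. q (f x) :: real) \<in> borel_measurable M"
proof -
  have "Rm m = (\<Inter>i\<in>{m..}. {y. y i = 0})" by (auto simp: Rm_iff)
  moreover have "closed {y :: nat \<Rightarrow> real. y i = 0}" for i
    using continuous_on_product_then_coordinatewise[OF continuous_on_id, of UNIV i]
    by (intro closed_Collect_eq) auto
  ultimately have "closed (Rm m)" by auto
  then have "(\<lambda>y. indicator (Rm m) y *\<^sub>R q y) \<in> borel_measurable borel"
    using q by (intro borel_measurable_continuous_on_indicator) auto
  moreover have "f \<in> borel_measurable M"
    by (rule measurable_coordinatewise_then_product[OF f(2)])
  ultimately have "(\<lambda>x. indicator (Rm m) (f x) *\<^sub>R q (f x)) \<in> borel_measurable M"
    by (rule measurable_compose[rotated])
  then show ?thesis using f(1) by simp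
qed

lemma dx_measurable:
  assumes "\<And>l i. i < m \<Longrightarrow> (\<lambda>x. v x l i) \<in> borel_measurable M" "range I \<subseteq> {..<m}"
  shows "(\<lambda>x. dx I (v x)) \<in> borel_measurable M"
proof -
  have "I k < m" for k using assms(2) by auto
  then show ?thesis
    unfolding dx_leibniz
    by (intro borel_measurable_sum borel_measurable_times borel_measurable_prod borel_measurable_const assms(1))
qed

lemma form_measurable:
  fixes \<phi> :: "'n::{finite,linorder} form"
  assumes \<phi>: "\<And>I. I \<in> multi_indices m \<Longrightarrow> smooth_target m (\<phi> I)"
    and f: "\<And>x. f x \<in> Rm m" "\<And>i. (\<lambda>x. f x i) \<in> borel_measurable M"
    and Df: "\<And>l i. i < m \<Longrightarrow> (\<lambda>x. Df x l i) \<in> borel_measurable M"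
  shows "(\<lambda>x. form_eval m \<phi> (f x) (Df x)) \<in> borel_measurable M"
    and "(\<lambda>x. homotopy_form m \<phi> l (f x) (Df x)) \<in> borel_measurable M"
proof -
  have range: "range I \<subseteq> {..<m}" if "I \<in> multi_indices m" for I :: "'n \<Rightarrow> nat"
    using that by (auto simp: multi_indices_def)
  show "(\<lambda>x. form_eval m \<phi> (f x) (Df x)) \<in> borel_measurable M"
    unfolding form_eval_def
    by (intro borel_measurable_sum borel_measurable_times dx_measurable[OF Df range]
        measurable_compose_Rm[OF smooth_target_continuous[OF \<phi>] f])
  have upd: "(\<lambda>x. ((Df x)(l := f x)) k i) \<in> borel_measurable M" if "i < m" for k i
    using f(2) Df[OF that] by (cases "k = l") auto
  show "(\<lambda>x. homotopy_form m \<phi> l (f x) (Df x)) \<in> borel_measurable M"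
    unfolding homotopy_form_def
    by (intro borel_measurable_sum borel_measurable_times dx_measurable[OF upd range]
        measurable_compose_Rm[OF continuous_on_homotopy_coeff[OF \<phi>] f])
qed

lemma tendsto_dx:
  assumes "\<And>l i. i < m \<Longrightarrow> ((\<lambda>k. v k l i) \<longlongrightarrow> w l i) F" "range I \<subseteq> {..<m}"
  shows "((\<lambda>k. dx I (v k)) \<longlongrightarrow> dx I w) F"
proof -
  have "I k < m" for k using assms(2) by auto
  then show ?thesis
    unfolding dx_leibniz by (intro tendsto_sum tendsto_mult tendsto_prod tendsto_const assms(1))
qed

lemma tendsto_forms:
  fixes \<phi> :: "'n::{finite,linorder} form"
  assumes \<phi>: "\<And>I. I \<in> multi_indices m \<Longrightarrow> smooth_target m (\<phi> I)"
    and h: "\<And>k. h k \<in> Rm m" "y \<in> Rm m" "\<And>i. i < m \<Longrightarrow> ((\<lambda>k. h k i) \<longlongrightarrow> y i) F"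
    and v: "\<And>l i. i < m \<Longrightarrow> ((\<lambda>k. v k l i) \<longlongrightarrow> w l i) F"
  shows "((\<lambda>k. form_eval m \<phi> (h k) (v k)) \<longlongrightarrow> form_eval m \<phi> y w) F"
    and "((\<lambda>k. homotopy_form m \<phi> l (h k) (v k)) \<longlongrightarrow> homotopy_form m \<phi> l y w) F"
proof -
  have range: "range I \<subseteq> {..<m}" if "I \<in> multi_indices m" for I :: "'n \<Rightarrow> nat"
    using that by (auto simp: multi_indices_def)
  have "(h \<longlongrightarrow> y) F"
  proof (rule tendsto_coordinatewise)
    show "((\<lambda>k. h k i) \<longlongrightarrow> y i) F" for i
      using h by (cases "i < m") (auto simp: Rm_iff)
  qed
  then have comp: "((\<lambda>k. q (h k)) \<longlongrightarrow> q y) F" if "continuous_on (Rm m) q" for q :: "_ \<Rightarrow> real"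
    by (rule continuous_on_tendsto_compose[OF that]) (use h in auto)
  show "((\<lambda>k. form_eval m \<phi> (h k) (v k)) \<longlongrightarrow> form_eval m \<phi> y w) F"
    unfolding form_eval_def
    by (intro tendsto_sum tendsto_mult comp smooth_target_continuous[OF \<phi>] tendsto_dx[OF v range])
  have upd: "((\<lambda>k. ((v k)(l := h k)) l' i) \<longlongrightarrow> (w(l := y)) l' i) F" if "i < m" for l' i
    using v[OF that] h(3)[OF that] by (cases "l' = l") auto
  show "((\<lambda>k. homotopy_form m \<phi> l (h k) (v k)) \<longlongrightarrow> homotopy_form m \<phi> l y w) F"
    unfolding homotopy_form_def
    by (intro tendsto_sum tendsto_mult comp continuous_on_homotopy_coeff[OF \<phi>] tendsto_dx[OF upd range])
qed

text \<open>Mollifying a 1-Lipschitz function at scale \<open>\<epsilon>\<close> moves it by at most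
  \<open>\<epsilon>\<close>. The shift by \<open>2 * \<epsilon>\<close> then places the result
  between \<open>d + \<epsilon>\<close> and \<open>d + 3 * \<epsilon>\<close>, in particular above
  zero for nonnegative \<open>d\<close>.\<close>

definition regularize :: "real \<Rightarrow> (real ^ 'n \<Rightarrow> real) \<Rightarrow> real ^ 'n \<Rightarrow> real" where
  "regularize \<epsilon> d x = 2 * \<epsilon> + (LINT y|lebesgue. d y * mollifier 0 \<epsilon> (x - y))"

text \<open>Smoothness is taken from the kernel, the slope from \<open>d\<close>: after a
  translation of the convolution, differences of the mollified function fall on \<open>d\<close>,
  which is 1-Lipschitz.\<close>

lemma regularize_properties:
  fixes d :: "real ^ 'n \<Rightarrow> real"
  assumes \<epsilon>: "0 < \<epsilon>" and d: "\<And>y. 0 \<le> d y" "\<And>x y. \<bar>d x - d y\<bar> \<le> dist x y"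
    and S: "compact S" "\<And>y. y \<notin> S \<Longrightarrow> d y = 0"
  shows "Ck_domain k (regularize \<epsilon> d)"
    and "d x + \<epsilon> \<le> regularize \<epsilon> d x" "regularize \<epsilon> d x \<le> d x + 3 * \<epsilon>"
    and "\<bar>pderiv_domain l (regularize \<epsilon> d) x\<bar> \<le> 1"
proof -
  have "1-lipschitz_on UNIV d"
    using d(2) by (auto intro!: lipschitz_onI simp: dist_real_def)
  then have contd: "continuous_on UNIV d" by (rule lipschitz_on_continuous_on)
  have intd: "integrable lebesgue d"
    by (rule integrable_continuous_compact_support[OF contd S])
  have smooth: "Ck_domain k (regularize \<epsilon> d)" for k
  proof -
    have "Ck_param k (\<lambda>x y :: real ^ 'n. mollifier 0 \<epsilon> (x - y))"
    proof (rule Ck_param_mollifier)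
      show "Ck_param k (\<lambda>x y. (x - y) $ i)" for i :: 'n
        by (simp, intro Ck_param_diff Ck_param_coord Ck_param_const continuous_intros)
    qed (use \<epsilon> in \<open>auto intro: Ck_param_const\<close>)
    from Ck_domain_param_integral[OF intd S(2,1) this]
    have 1: "Ck_domain k (\<lambda>x. LINT y|lebesgue. d y * mollifier 0 \<epsilon> (x - y))" .
    have "Ck_param k (\<lambda>x (p :: real). 2 * \<epsilon> + (LINT y|lebesgue. d y * mollifier 0 \<epsilon> (x - y)))"
      by (intro Ck_param_add Ck_param_const Ck_param_Ck_domain[OF 1] continuous_on_const)
    from Ck_domain_Ck_param[OF this] show ?thesis
      by (simp add: regularize_def[abs_def])
  qed
  show "Ck_domain k (regularize \<epsilon> d)" by (rule smooth)
  note mol = mollifier_integral[OF \<epsilon>] mollifier_bounds[OF \<epsilon>]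
  have int: "integrable lebesgue (\<lambda>y. d y * mollifier 0 \<epsilon> (x - y))" for x
    by (rule integrable_mult_continuous[OF intd S(2,1) continuous_on_mollifier[OF \<epsilon>]])
  have "\<bar>(LINT y|lebesgue. d y * mollifier 0 \<epsilon> (x - y)) - d x\<bar> \<le> \<epsilon>"
  proof -
    have "(LINT y|lebesgue. d y * mollifier 0 \<epsilon> (x - y)) - d x
        = (LINT y|lebesgue. d y * mollifier 0 \<epsilon> (x - y)) - (LINT y|lebesgue. d x * mollifier 0 \<epsilon> (x - y))"
      using mol(2)[of x] by simp
    also have "\<dots> = (LINT y|lebesgue. d y * mollifier 0 \<epsilon> (x - y) - d x * mollifier 0 \<epsilon> (x - y))"
      by (intro Bochner_Integration.integral_diff[symmetric] int integrable_mult_right mol(1))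
    also have "\<bar>\<dots>\<bar> \<le> (LINT y|lebesgue. \<epsilon> * mollifier 0 \<epsilon> (x - y))"
    proof (rule order_trans[OF integral_abs_bound integral_mono])
      show "integrable lebesgue (\<lambda>y. \<bar>d y * mollifier 0 \<epsilon> (x - y) - d x * mollifier 0 \<epsilon> (x - y)\<bar>)"
        by (intro integrable_abs Bochner_Integration.integrable_diff int integrable_mult_right mol(1))
      show "integrable lebesgue (\<lambda>y. \<epsilon> * mollifier 0 \<epsilon> (x - y))"
        by (intro integrable_mult_right mol(1))
      fix y
      show "\<bar>d y * mollifier 0 \<epsilon> (x - y) - d x * mollifier 0 \<epsilon> (x - y)\<bar> \<le> \<epsilon> * mollifier 0 \<epsilon> (x - y)"
      proof (cases "\<epsilon> \<le> norm (x - y)")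
        case False
        then have "\<bar>d y - d x\<bar> \<le> \<epsilon>" using d(2)[of y x] by (simp add: dist_norm norm_minus_commute)
        then have "\<bar>d y - d x\<bar> * mollifier 0 \<epsilon> (x - y) \<le> \<epsilon> * mollifier 0 \<epsilon> (x - y)"
          by (intro mult_right_mono mol)
        then show ?thesis using mol(4)[of "x - y"] by (simp add: left_diff_distrib[symmetric] abs_mult)
      qed (simp add: mol(6))
    qed
    also have "\<dots> = \<epsilon>" using mol(2)[of x] by simp
    finally show ?thesis .
  qed
  then show "d x + \<epsilon> \<le> regularize \<epsilon> d x" "regularize \<epsilon> d x \<le> d x + 3 * \<epsilon>"
    by (auto simp: regularize_def abs_le_iff)
  have lip: "\<bar>regularize \<epsilon> d (x + v) - regularize \<epsilon> d x\<bar> \<le> norm v" for v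
  proof -
    let ?F = "\<lambda>y. d y * mollifier 0 \<epsilon> (x + v - y)"
    have "continuous_on UNIV ?F"
      by (intro continuous_intros contd continuous_on_mollifier \<epsilon>)
    then have "(LINT y|lebesgue. ?F y) = (LINT y|lebesgue. ?F (y + v))"
      by (intro lebesgue_translation[symmetric] borel_measurable_continuous_onI)
    then have eq: "(LINT y|lebesgue. d y * mollifier 0 \<epsilon> (x + v - y)) = (LINT y|lebesgue. d (y + v) * mollifier 0 \<epsilon> (x - y))"
      by simp
    have contdv: "continuous_on UNIV (\<lambda>y. d (y + v))"
      by (rule continuous_on_compose2[OF contd]) (auto intro!: continuous_intros)
    have int': "integrable lebesgue (\<lambda>y. d (y + v) * mollifier 0 \<epsilon> (x - y))"
    proof (rule integrable_continuous_compact_support[of _ "cball x \<epsilon>"])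
      show "continuous_on UNIV (\<lambda>y. d (y + v) * mollifier 0 \<epsilon> (x - y))"
        by (intro continuous_intros contdv continuous_on_mollifier \<epsilon>)
      show "d (y + v) * mollifier 0 \<epsilon> (x - y) = 0" if "y \<notin> cball x \<epsilon>" for y
        using that by (simp add: mol(6) dist_norm)
    qed simp
    have "regularize \<epsilon> d (x + v) - regularize \<epsilon> d x
       = (LINT y|lebesgue. d (y + v) * mollifier 0 \<epsilon> (x - y) - d y * mollifier 0 \<epsilon> (x - y))"
      unfolding regularize_def eq using int' int by simp
    also have "\<bar>\<dots>\<bar> \<le> (LINT y|lebesgue. norm v * mollifier 0 \<epsilon> (x - y))"
    proof (rule order_trans[OF integral_abs_bound integral_mono])
      show "integrable lebesgue (\<lambda>y. \<bar>d (y + v) * mollifier 0 \<epsilon> (x - y) - d y * mollifier 0 \<epsilon> (x - y)\<bar>)"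
        by (intro integrable_abs Bochner_Integration.integrable_diff int int')
      show "integrable lebesgue (\<lambda>y. norm v * mollifier 0 \<epsilon> (x - y))"
        by (intro integrable_mult_right mol(1))
      fix y
      have "\<bar>d (y + v) - d y\<bar> * mollifier 0 \<epsilon> (x - y) \<le> norm v * mollifier 0 \<epsilon> (x - y)"
        using d(2)[of "y + v" y] by (intro mult_right_mono mol) (simp add: dist_norm)
      then show "\<bar>d (y + v) * mollifier 0 \<epsilon> (x - y) - d y * mollifier 0 \<epsilon> (x - y)\<bar> \<le> norm v * mollifier 0 \<epsilon> (x - y)"
        using mol(4)[of "x - y"] by (simp add: left_diff_distrib[symmetric] abs_mult)
    qed
    also have "\<dots> = norm v" using mol(2)[of x] by simp
    finally show ?thesis .
  qed
  have "((\<lambda>t. regularize \<epsilon> d (x + t *\<^sub>R axis l 1)) has_real_derivative pderiv_domain l (regularize \<epsilon> d) x) (at 0)"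
    using Ck_domain_pderiv(2)[OF smooth[of "Suc 0"], of x l 0] by simp
  then have "((\<lambda>t. \<bar>(regularize \<epsilon> d (x + t *\<^sub>R axis l 1) - regularize \<epsilon> d x) / t\<bar>) \<longlongrightarrow> \<bar>pderiv_domain l (regularize \<epsilon> d) x\<bar>) (at 0)"
    by (intro tendsto_rabs) (simp add: DERIV_def)
  moreover have "\<forall>\<^sub>F t in at 0. \<bar>(regularize \<epsilon> d (x + t *\<^sub>R axis l 1) - regularize \<epsilon> d x) / t\<bar> \<le> 1"
  proof -
    have "\<bar>regularize \<epsilon> d (x + t *\<^sub>R axis l 1) - regularize \<epsilon> d x\<bar> \<le> \<bar>t\<bar>" for t
      using lip[of "t *\<^sub>R axis l 1"] by simp
    then show ?thesis
      by (auto simp: eventually_at_filter divide_le_eq)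
  qed
  ultimately show "\<bar>pderiv_domain l (regularize \<epsilon> d) x\<bar> \<le> 1"
    by (rule tendsto_upperbound) simp
qed

text \<open>\<open>f\<close> and \<open>Df\<close> are extended by zero beyond the closed ball, to
  have integrable functions on the whole space. \<open>Df\<close> then ignores the jump of
  \<open>f\<close> across the sphere, so the weak identity is asked for test functions supported in
  the open ball, and the kernels tested against it must stay inside.\<close>

locale cutoff_curve =
  fixes m :: nat and \<phi> :: "'n::{finite,linorder} form" and L :: real
    and f :: "(real, 'n) vec \<Rightarrow> nat \<Rightarrow> real" and Df :: "(real, 'n) vec \<Rightarrow> 'n \<Rightarrow> nat \<Rightarrow> real"
    and c0 :: "(real, 'n) vec" and R :: real
  assumes smooth: "\<And>I. I \<in> multi_indices m \<Longrightarrow> smooth_target m (\<phi> I)"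
    and closed: "closed_form m \<phi>"
    and L: "\<And>y. y \<in> Rm m \<Longrightarrow> (\<Sum>I\<in>multi_indices m. \<bar>\<phi> I y\<bar>) \<le> L"
    and R: "0 < R"
    and f_Rm: "\<And>x. f x \<in> Rm m" and Df_Rm: "\<And>x l. Df x l \<in> Rm m"
    and f_int: "\<And>i. i < m \<Longrightarrow> integrable lebesgue (\<lambda>x. f x i)"
    and Df_int: "\<And>l i. i < m \<Longrightarrow> integrable lebesgue (\<lambda>x. Df x l i)"
    and f_zero: "\<And>x i. x \<notin> cball c0 R \<Longrightarrow> f x i = 0"
    and Df_zero: "\<And>x l i. x \<notin> cball c0 R \<Longrightarrow> Df x l i = 0"
    and weak: "\<And>i l \<psi>. i < m \<Longrightarrow> test_function (ball c0 R) \<psi> \<Longrightarrow>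
       (LINT x|lebesgue. f x i * pderiv_domain l \<psi> x) = - (LINT x|lebesgue. Df x l i * \<psi> x)"
begin

definition g :: "(real, 'n) vec \<Rightarrow> real" where
  "g x = (\<Sum>l\<in>UNIV. enorm m (Df x l))"

text \<open>The mollifier is at most \<open>kap\<close> times the normalised indicator of its ball;
  this is the price for passing from ball averages of \<open>g\<close> to mollified ones.\<close>

definition kap :: real where
  "kap = unit_ball_vol (real CARD('n)) / bump_mass TYPE('n)"

lemma kap_pos: "0 < kap"
  using bump_mass_pos[where 'n = 'n] by (simp add: kap_def)

lemma g_nonneg: "0 \<le> g x"
  by (simp add: g_def sum_nonneg)

lemma enorm_Df_le_g: "enorm m (Df x l) \<le> g x"
  unfolding g_def by (rule member_le_sum) auto

lemma g_int: "integrable lebesgue g"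
  unfolding g_def[abs_def] by (intro Bochner_Integration.integrable_sum integrable_enorm Df_int)

lemma g_zero: "x \<notin> cball c0 R \<Longrightarrow> g x = 0"
  by (simp add: g_def enorm_def L2_set_def Df_zero)

lemma f_mult_int: "i < m \<Longrightarrow> continuous_on UNIV G \<Longrightarrow> integrable lebesgue (\<lambda>y. f y i * G y)"
  by (rule integrable_mult_continuous[OF f_int f_zero compact_cball]) auto

lemma Df_mult_int: "i < m \<Longrightarrow> continuous_on UNIV G \<Longrightarrow> integrable lebesgue (\<lambda>y. Df y l i * G y)"
  by (rule integrable_mult_continuous[OF Df_int Df_zero compact_cball]) auto

lemma g_mult_int: "continuous_on UNIV G \<Longrightarrow> integrable lebesgue (\<lambda>y. g y * G y)"
  by (rule integrable_mult_continuous[OF g_int g_zero compact_cball]) auto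

lemma Ck_domain_mollifier:
  assumes "0 < s"
  shows "Ck_domain k (\<lambda>y. mollifier 0 s (x - y :: (real, 'n) vec))"
    and "Ck_domain k (\<lambda>y. (x - y) $ i / s * mollifier 0 s (x - y :: (real, 'n) vec))"
proof -
  have Z: "Ck_param k (\<lambda>y (p :: real). (x - y) $ i)" for i :: 'n
    by (simp, intro Ck_param_diff Ck_param_coord Ck_param_const continuous_intros)
  have M: "Ck_param k (\<lambda>y (p :: real). mollifier 0 s (x - y))"
    using assms by (intro Ck_param_mollifier Z Ck_param_const) auto
  from Ck_domain_Ck_param[OF this] show "Ck_domain k (\<lambda>y. mollifier 0 s (x - y))" .
  have "Ck_param k (\<lambda>y (p :: real). (x - y) $ i * (1 / s) * mollifier 0 s (x - y))"
    by (intro Ck_param_mult Z M Ck_param_const) auto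
  from Ck_domain_Ck_param[OF this] show "Ck_domain k (\<lambda>y. (x - y) $ i / s * mollifier 0 s (x - y))"
    by simp
qed

lemma mollifier_DERIV_minus:
  fixes x y :: "(real, 'n) vec"
  assumes "0 < s"
  shows "((\<lambda>t. mollifier 0 s (x - (y + t *\<^sub>R axis l 1))) has_real_derivative
     mollifier (Suc 0) s (x - y) * (2 * (x - y) $ l / s\<^sup>2)) (at 0)"
proof -
  have "((\<lambda>t. mollifier 0 s (x - y + t *\<^sub>R - axis l 1)) has_real_derivative
     mollifier (Suc 0) s (x - y) * (2 * (x - y) $ l / s\<^sup>2)) (at 0)"
  proof -
    show ?thesis
      by (rule DERIV_cong[OF mollifier_DERIV[of "\<lambda>_. s" 0]])
         (use assms in \<open>auto simp: inner_axis field_simps\<close>)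
  qed
  moreover have "x - y + t *\<^sub>R - axis l 1 = x - (y + t *\<^sub>R axis l 1)" for t
    by simp
  ultimately show ?thesis by (simp only:)
qed

lemma test_function_mollifier:
  assumes s: "0 < s" "cball x s \<subseteq> ball c0 R"
  shows "test_function (ball c0 R) (\<lambda>y. mollifier 0 s (x - y))"
    and "test_function (ball c0 R) (\<lambda>y. (x - y) $ i / s * mollifier 0 s (x - y))"
proof -
  have zero: "mollifier 0 s (x - y) = 0" if "y \<notin> cball x s" for y
    using that by (intro mollifier_bounds(3) s(1)) (simp add: dist_norm)
  show "test_function (ball c0 R) (\<lambda>y. mollifier 0 s (x - y))"
    unfolding test_function_def using s(2) Ck_domain_mollifier(1)[OF s(1)] zero
    by (intro conjI allI exI[of _ "cball x s"]) auto
  show "test_function (ball c0 R) (\<lambda>y. (x - y) $ i / s * mollifier 0 s (x - y))"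
    unfolding test_function_def using s(2) Ck_domain_mollifier(2)[OF s(1)] zero
    by (intro conjI allI exI[of _ "cball x s"]) auto
qed

lemma weak_mollifier:
  assumes s: "0 < s" "cball x s \<subseteq> ball c0 R" and i: "i < m"
  shows "(LINT y|lebesgue. f y i * (mollifier (Suc 0) s (x - y) * (2 * (x - y) $ l / s\<^sup>2)))
      = - (LINT y|lebesgue. Df y l i * mollifier 0 s (x - y))"
proof -
  have "pderiv_domain l (\<lambda>y. mollifier 0 s (x - y)) y = mollifier (Suc 0) s (x - y) * (2 * (x - y) $ l / s\<^sup>2)" for y
    unfolding pderiv_domain_def by (rule DERIV_imp_deriv[OF mollifier_DERIV_minus[OF s(1)]])
  with weak[OF i test_function_mollifier(1)[OF s], of l] show ?thesis by simp
qed

text \<open>The derivative of the kernel in the scale is the divergence in \<open>y\<close> of the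
  field \<open>(x - y) / s\<close> times the kernel. Hence a change of scale, too, sees
  \<open>f\<close> through \<open>Df\<close> alone.\<close>

lemma weak_mollifier_scale:
  assumes s: "0 < s" "cball x s \<subseteq> ball c0 R" and i: "i < m"
  shows "(LINT y|lebesgue. f y i * (- real CARD('n) / s * mollifier 0 s (x - y)
        + mollifier (Suc 0) s (x - y) * (2 * ((x - y) \<bullet> (x - y)) / s ^ 3)))
      = - (\<Sum>k\<in>UNIV. LINT y|lebesgue. Df y k i * ((x - y) $ k / s * mollifier 0 s (x - y)))"
proof -
  let ?T = "\<lambda>k y. - mollifier 0 s (x - y) / s + (x - y) $ k / s * (mollifier (Suc 0) s (x - y) * (2 * (x - y) $ k / s\<^sup>2))"
  have pd: "pderiv_domain k (\<lambda>y. (x - y) $ k / s * mollifier 0 s (x - y)) y = ?T k y" for k y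
  proof -
    have "((\<lambda>t. (x - (y + t *\<^sub>R axis k 1)) $ k / s) has_real_derivative - 1 / s) (at 0)"
      using s(1) by (auto intro!: derivative_eq_intros)
    from DERIV_mult[OF this mollifier_DERIV_minus[OF s(1), of x y k]]
    have "((\<lambda>t. (x - (y + t *\<^sub>R axis k 1)) $ k / s * mollifier 0 s (x - (y + t *\<^sub>R axis k 1))) has_real_derivative ?T k y) (at 0)"
      by (simp add: algebra_simps)
    from DERIV_imp_deriv[OF this] show ?thesis unfolding pderiv_domain_def .
  qed
  have cont: "continuous_on UNIV (?T k)" for k
    using s(1) by (intro continuous_intros continuous_on_mollifier) auto
  have "(LINT y|lebesgue. f y i * ?T k y) = - (LINT y|lebesgue. Df y k i * ((x - y) $ k / s * mollifier 0 s (x - y)))" for k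
    using weak[OF i test_function_mollifier(2)[OF s], of k k] by (simp only: pd)
  then have "- (\<Sum>k\<in>UNIV. LINT y|lebesgue. Df y k i * ((x - y) $ k / s * mollifier 0 s (x - y)))
     = (\<Sum>k\<in>UNIV. LINT y|lebesgue. f y i * ?T k y)"
    by (simp add: sum_negf)
  also have "\<dots> = (LINT y|lebesgue. (\<Sum>k\<in>UNIV. f y i * ?T k y))"
    by (rule Bochner_Integration.integral_sum[symmetric]) (intro f_mult_int[OF i] cont)
  also have "\<dots> = (LINT y|lebesgue. f y i * (- real CARD('n) / s * mollifier 0 s (x - y)
        + mollifier (Suc 0) s (x - y) * (2 * ((x - y) \<bullet> (x - y)) / s ^ 3)))"
  proof (rule Bochner_Integration.integral_cong[OF refl])
    fix y
    have "(\<Sum>k\<in>UNIV. (x - y) $ k / s * (mollifier (Suc 0) s (x - y) * (2 * (x - y) $ k / s\<^sup>2)))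
       = mollifier (Suc 0) s (x - y) * (2 / s ^ 3 * (\<Sum>k\<in>UNIV. (x - y) $ k * (x - y) $ k))"
      unfolding sum_distrib_left by (intro sum.cong refl) (simp add: power2_eq_square power3_eq_cube field_simps)
    also have "\<dots> = mollifier (Suc 0) s (x - y) * (2 * ((x - y) \<bullet> (x - y)) / s ^ 3)"
      by (simp add: inner_vec_def)
    finally have "(\<Sum>k\<in>UNIV. ?T k y) = - real CARD('n) / s * mollifier 0 s (x - y)
        + mollifier (Suc 0) s (x - y) * (2 * ((x - y) \<bullet> (x - y)) / s ^ 3)"
      by (simp only: sum.distrib) simp
    then show "(\<Sum>k\<in>UNIV. f y i * ?T k y) = f y i * (- real CARD('n) / s * mollifier 0 s (x - y)
        + mollifier (Suc 0) s (x - y) * (2 * ((x - y) \<bullet> (x - y)) / s ^ 3))"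
      by (simp only: sum_distrib_left[symmetric])
  qed
  finally show ?thesis by simp
qed

lemma coord_div_le: "0 < s \<Longrightarrow> mollifier 0 s z \<noteq> 0 \<Longrightarrow> \<bar>z $ k / s\<bar> \<le> 1"
  using component_le_norm_cart[of z k] mollifier_bounds(3)[of s z 0] by (force simp: abs_divide)

text \<open>Since the maximal function is uncentred, the second bound asks only that the ball
  contain some point off \<open>U t\<close>, not that its centre be one.\<close>

lemma g_average:
  assumes s: "0 < s"
  shows "(LINT y|lebesgue. g y * mollifier 0 s (x - y)) \<le> inverse s ^ CARD('n) / bump_mass TYPE('n) * (LINT y|lebesgue. g y)"
    and "x' \<in> ball x s \<Longrightarrow> x' \<notin> maximal_superlevel g t \<Longrightarrow> (LINT y|lebesgue. g y * mollifier 0 s (x - y)) \<le> kap * t"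
proof -
  let ?c = "inverse s ^ CARD('n) / bump_mass TYPE('n)"
  have c: "0 \<le> ?c" using s bump_mass_pos[where 'n = 'n] by simp
  have int: "integrable lebesgue (\<lambda>y. g y * mollifier 0 s (x - y))"
    by (intro g_mult_int continuous_on_mollifier s)
  have "(LINT y|lebesgue. g y * mollifier 0 s (x - y)) \<le> (LINT y|lebesgue. ?c * (indicator (ball x s) y * g y))"
  proof (rule integral_mono[OF int])
    show "integrable lebesgue (\<lambda>y. ?c * (indicator (ball x s) y * g y))"
      using g_int by (intro integrable_mult_right integrable_indicator_mult) auto
    fix y
    show "g y * mollifier 0 s (x - y) \<le> ?c * (indicator (ball x s) y * g y)"
    proof (cases "y \<in> ball x s")
      case True
      then show ?thesis
        using mult_left_mono[OF mollifier_bounds(2)[OF s, of "x - y"] g_nonneg[of y]] by (simp add: mult.commute)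
    next
      case False
      then show ?thesis using mollifier_bounds(3)[OF s, of "x - y" 0] by (simp add: dist_norm)
    qed
  qed
  then have le: "(LINT y|lebesgue. g y * mollifier 0 s (x - y)) \<le> ?c * (LINT y|lebesgue. indicator (ball x s) y * g y)"
    by simp
  also have "\<dots> \<le> ?c * (LINT y|lebesgue. g y)"
    using g_int g_nonneg c
    by (intro mult_left_mono integral_mono integrable_indicator_mult) (auto simp: indicator_def)
  finally show "(LINT y|lebesgue. g y * mollifier 0 s (x - y)) \<le> ?c * (LINT y|lebesgue. g y)" .
  show "(LINT y|lebesgue. g y * mollifier 0 s (x - y)) \<le> kap * t" if "x' \<in> ball x s" "x' \<notin> maximal_superlevel g t"
  proof -
    note le
    also have "?c * (LINT y|lebesgue. indicator (ball x s) y * g y) \<le> ?c * (t * measure lebesgue (ball x s))"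
      by (intro mult_left_mono ball_average_le[OF that] c)
    also have "\<dots> = kap * t"
      using s by (simp add: kap_def content_ball power_inverse field_simps)
    finally show ?thesis .
  qed
qed

definition smoothed :: "((real, 'n) vec \<Rightarrow> real) \<Rightarrow> (real, 'n) vec \<Rightarrow> nat \<Rightarrow> real" where
  "smoothed \<rho> x i = (LINT y|lebesgue. f y i * mollifier 0 (\<rho> x) (x - y))"

lemma smoothed_C2:
  assumes \<rho>: "Ck_domain 2 \<rho>" "\<And>x. 0 < \<rho> x"
  shows "C2_map m (smoothed \<rho>)"
proof -
  have "smoothed \<rho> x \<in> Rm m" for x
    using f_Rm by (auto simp: Rm_iff smoothed_def)
  moreover have "Ck_domain 2 (\<lambda>x. smoothed \<rho> x i)" if "i < m" for i
    unfolding smoothed_def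
  proof (rule Ck_domain_param_integral[OF f_int[OF that] f_zero compact_cball])
    show "Ck_param 2 (\<lambda>x y :: (real, 'n) vec. mollifier 0 (\<rho> x) (x - y))"
    proof (rule Ck_param_mollifier[OF Ck_param_Ck_domain[OF \<rho>(1)] \<rho>(2)])
      show "Ck_param 2 (\<lambda>x y :: (real, 'n) vec. (x - y) $ i)" for i
        by (simp only: vector_minus_component, intro Ck_param_diff Ck_param_coord Ck_param_const continuous_intros)
    qed
  qed
  ultimately show ?thesis by (simp add: C2_map_def)
qed

text \<open>Moving the point yields the average of \<open>Df\<close>; the accompanying change of
  scale yields averages of \<open>Df\<close> against the first moment kernels, with the factor
  \<open>pderiv_domain l \<rho> x\<close>. Both derivatives of the kernel have been integrated by
  parts, so no value of \<open>f\<close> survives.\<close>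

lemma jac_smoothed:
  assumes \<rho>: "Ck_domain 2 \<rho>" "\<And>x. 0 < \<rho> x" and x: "cball x (\<rho> x) \<subseteq> ball c0 R" and i: "i < m"
  shows "jac (smoothed \<rho>) x l i = (LINT y|lebesgue. Df y l i * mollifier 0 (\<rho> x) (x - y))
      - pderiv_domain l \<rho> x * (\<Sum>k\<in>UNIV. LINT y|lebesgue. Df y k i * ((x - y) $ k / \<rho> x * mollifier 0 (\<rho> x) (x - y)))"
proof -
  let ?p = "pderiv_domain l \<rho> x" and ?s = "\<rho> x" and ?N = "real CARD('n)"
  have \<rho>1: "Ck_domain (Suc 0) \<rho>" using \<rho>(1) unfolding numeral_2_eq_2 by (rule Ck_domain_SucD)
  have d\<rho>: "((\<lambda>t. \<rho> (x + t *\<^sub>R axis l 1)) has_real_derivative ?p) (at 0)"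
    using Ck_domain_pderiv(2)[OF \<rho>1, of x l 0] by simp
  let ?G = "\<lambda>y. ?p * (- ?N / ?s * mollifier 0 ?s (x - y) + mollifier (Suc 0) ?s (x - y) * (2 * ((x - y) \<bullet> (x - y)) / ?s ^ 3))
      - mollifier (Suc 0) ?s (x - y) * (2 * (x - y) $ l / ?s\<^sup>2)"
  have "jac (smoothed \<rho>) x l i = pderiv_domain l (\<lambda>x. LINT y|lebesgue. f y i * mollifier 0 (\<rho> x) (x - y)) x"
    by (simp add: jac_def smoothed_def)
  also have "\<dots> = (LINT y|lebesgue. f y i * ?G y)"
  proof (rule pderiv_param_integral[OF f_int[OF i] f_zero compact_cball])
    show "Ck_param (Suc 0) (\<lambda>x y :: (real, 'n) vec. mollifier 0 (\<rho> x) (x - y))"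
    proof (rule Ck_param_mollifier[OF Ck_param_Ck_domain[OF \<rho>1] \<rho>(2)])
      show "Ck_param (Suc 0) (\<lambda>x y :: (real, 'n) vec. (x - y) $ i)" for i
        by (simp only: vector_minus_component, intro Ck_param_diff Ck_param_coord Ck_param_const continuous_intros)
    qed
    fix y
    have "((\<lambda>t. mollifier 0 (\<rho> (x + t *\<^sub>R axis l 1)) (x - y + t *\<^sub>R axis l 1)) has_real_derivative ?G y) (at 0)"
      using mollifier_DERIV[OF d\<rho>, of 0 "x - y" "axis l 1"] \<rho>(2)[of x]
      by (simp add: inner_axis algebra_simps)
    then show "((\<lambda>t. mollifier 0 (\<rho> (x + t *\<^sub>R axis l 1)) (x + t *\<^sub>R axis l 1 - y)) has_real_derivative ?G y) (at 0)"
      by (simp add: algebra_simps)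
  qed
  also have "\<dots> = (LINT y|lebesgue. ?p * (f y i * (- ?N / ?s * mollifier 0 ?s (x - y) + mollifier (Suc 0) ?s (x - y) * (2 * ((x - y) \<bullet> (x - y)) / ?s ^ 3)))
      - f y i * (mollifier (Suc 0) ?s (x - y) * (2 * (x - y) $ l / ?s\<^sup>2)))"
    by (intro Bochner_Integration.integral_cong refl) (simp only: right_diff_distrib mult.left_commute[of _ ?p])
  also have "\<dots> = (LINT y|lebesgue. ?p * (f y i * (- ?N / ?s * mollifier 0 ?s (x - y) + mollifier (Suc 0) ?s (x - y) * (2 * ((x - y) \<bullet> (x - y)) / ?s ^ 3))))
      - (LINT y|lebesgue. f y i * (mollifier (Suc 0) ?s (x - y) * (2 * (x - y) $ l / ?s\<^sup>2)))"
    using \<rho>(2)[of x]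
    by (intro Bochner_Integration.integral_diff integrable_mult_right f_mult_int[OF i] continuous_intros continuous_on_mollifier) auto
  also have "\<dots> = ?p * (- (\<Sum>k\<in>UNIV. LINT y|lebesgue. Df y k i * ((x - y) $ k / ?s * mollifier 0 ?s (x - y))))
      - (- (LINT y|lebesgue. Df y l i * mollifier 0 ?s (x - y)))"
    by (simp only: integral_mult_right_zero weak_mollifier_scale[OF \<rho>(2) x i] weak_mollifier[OF \<rho>(2) x i])
  finally show ?thesis by simp
qed

text \<open>The factor 2 collects the average of the derivative itself and the change of scale. The
  latter is no larger, because the slope of \<open>\<rho>\<close> and the quotients
  \<open>(x - y) $ k / \<rho> x\<close> on the support of the kernel are at most one in absolute
  value.\<close>

lemma enorm_jac_smoothed_le:
  assumes \<rho>: "Ck_domain 2 \<rho>" "\<And>x. 0 < \<rho> x" and x: "cball x (\<rho> x) \<subseteq> ball c0 R"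
    and p: "\<bar>pderiv_domain l \<rho> x\<bar> \<le> 1" and x': "x' \<in> ball x (\<rho> x)" "x' \<notin> maximal_superlevel g t"
  shows "enorm m (jac (smoothed \<rho>) x l) \<le> 2 * kap * t"
proof -
  let ?p = "pderiv_domain l \<rho> x" and ?s = "\<rho> x"
  let ?mol = "\<lambda>y. mollifier 0 ?s (x - y)"
  define c where "c k y = ?p * ((x - y) $ k / ?s) * ?mol y" for k y
  define W where "W y i = Df y l i * ?mol y - (\<Sum>k\<in>UNIV. Df y k i * c k y)" for y i
  have cont_c: "continuous_on UNIV (c k)" for k
    unfolding c_def using \<rho>(2)[of x] by (intro continuous_intros continuous_on_mollifier) auto
  have W_int: "integrable lebesgue (\<lambda>y. W y i)" if "i < m" for i
    unfolding W_def
    by (intro Bochner_Integration.integrable_diff Bochner_Integration.integrable_sum Df_mult_int[OF that] cont_c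
        continuous_on_mollifier \<rho>)
  have jac_eq: "jac (smoothed \<rho>) x l i = (LINT y|lebesgue. W y i)" if "i < m" for i
  proof -
    have "(LINT y|lebesgue. W y i) = (LINT y|lebesgue. Df y l i * ?mol y) - (\<Sum>k\<in>UNIV. LINT y|lebesgue. Df y k i * c k y)"
      unfolding W_def using cont_c \<rho>(2)[of x] that
      by (subst Bochner_Integration.integral_diff)
         (auto intro!: Bochner_Integration.integrable_sum Df_mult_int continuous_on_mollifier
           Bochner_Integration.integral_sum)
    moreover have "(LINT y|lebesgue. Df y k i * c k y) = ?p * (LINT y|lebesgue. Df y k i * ((x - y) $ k / ?s * ?mol y))" for k
      unfolding integral_mult_right_zero[symmetric] c_def by (intro Bochner_Integration.integral_cong) (auto simp: mult_ac)
    ultimately show ?thesis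
      using jac_smoothed[OF \<rho> x that, of l] by (simp add: sum_distrib_left)
  qed
  have "enorm m (jac (smoothed \<rho>) x l) = enorm m (\<lambda>i. LINT y|lebesgue. W y i)"
    unfolding enorm_def by (intro L2_set_cong refl) (simp add: jac_eq)
  also have "\<dots> \<le> (LINT y|lebesgue. enorm m (W y))"
    by (intro enorm_integral_le W_int)
  also have "\<dots> \<le> (LINT y|lebesgue. 2 * (g y * ?mol y))"
  proof (rule integral_mono)
    show "integrable lebesgue (\<lambda>y. enorm m (W y))" by (intro integrable_enorm W_int)
    show "integrable lebesgue (\<lambda>y. 2 * (g y * ?mol y))"
      by (intro integrable_mult_right g_mult_int continuous_on_mollifier \<rho>)
    fix y
    note mol = mollifier_bounds(1)[OF \<rho>(2)[of x], of "x - y"]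
    have c_le: "\<bar>- c k y\<bar> \<le> ?mol y" for k
    proof (cases "?mol y = 0")
      case False
      have "\<bar>?p\<bar> * \<bar>(x - y) $ k / ?s\<bar> \<le> 1 * 1"
        using p coord_div_le[OF \<rho>(2) False] by (intro mult_mono) auto
      then have "\<bar>?p\<bar> * \<bar>(x - y) $ k / ?s\<bar> * ?mol y \<le> 1 * ?mol y"
        using mol by (intro mult_right_mono) auto
      then show ?thesis using mol by (simp add: c_def abs_mult)
    qed (simp add: c_def)
    have "enorm m (W y) = enorm m (\<lambda>i. ?mol y * Df y l i + (\<Sum>k\<in>UNIV. (- c k y) * Df y k i))"
      by (simp add: W_def[abs_def] mult.commute sum_negf)
    also have "\<dots> \<le> enorm m (\<lambda>i. ?mol y * Df y l i) + enorm m (\<lambda>i. \<Sum>k\<in>UNIV. (- c k y) * Df y k i)"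
      by (rule enorm_add)
    also have "\<dots> \<le> ?mol y * enorm m (Df y l) + (\<Sum>k\<in>UNIV. \<bar>- c k y\<bar> * enorm m (Df y k))"
      using mol enorm_sum[of UNIV m "\<lambda>k. - c k y" "Df y"] by (simp add: enorm_scale)
    also have "\<dots> \<le> ?mol y * g y + (\<Sum>k\<in>UNIV. ?mol y * enorm m (Df y k))"
      using c_le mol by (intro add_mono sum_mono mult_left_mono mult_right_mono enorm_Df_le_g) auto
    also have "\<dots> = 2 * (g y * ?mol y)"
      by (simp add: g_def sum_distrib_left mult.commute)
    finally show "enorm m (W y) \<le> 2 * (g y * ?mol y)" .
  qed
  also have "\<dots> = 2 * (LINT y|lebesgue. g y * ?mol y)" by simp
  also have "\<dots> \<le> 2 * (kap * t)"
    by (intro mult_left_mono g_average(2)[OF \<rho>(2) x']) simp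
  finally show ?thesis by simp
qed

lemma continuous_on_mollifier_scale:
  "continuous_on ({s. 0 < s} \<times> UNIV) (\<lambda>(s, y :: (real, 'n) vec). mollifier j s (x - y))"
proof -
  have b: "continuous_on UNIV (bump j)"
    by (rule DERIV_continuous_on[OF has_field_derivative_at_within[OF bump_DERIV]])
  have "continuous_on ({s. 0 < s} \<times> UNIV) (\<lambda>p. bump j (1 - ((x - snd p) \<bullet> (x - snd p)) * (inverse (fst p))\<^sup>2))"
    by (rule continuous_on_compose2[OF b]) (auto intro!: continuous_intros)
  then show ?thesis
    unfolding mollifier_def case_prod_unfold using bump_mass_pos[where 'n = 'n]
    by (intro continuous_intros) auto
qed

lemma mollified_scale_DERIV:
  assumes s: "0 < s" "cball x s \<subseteq> ball c0 R" and i: "i < m"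
  shows "((\<lambda>s. LINT y|lebesgue. f y i * mollifier 0 s (x - y)) has_real_derivative
     - (\<Sum>k\<in>UNIV. LINT y|lebesgue. Df y k i * ((x - y) $ k / s * mollifier 0 s (x - y)))) (at s)"
proof -
  let ?F' = "\<lambda>s y. - real CARD('n) / s * mollifier 0 s (x - y) + mollifier (Suc 0) s (x - y) * (2 * ((x - y) \<bullet> (x - y)) / s ^ 3)"
  have "((\<lambda>s. LINT y|lebesgue. f y i * mollifier 0 s (x - y)) has_real_derivative (LINT y|lebesgue. f y i * ?F' s y)) (at s)"
  proof (rule integral_param_deriv[OF f_int[OF i] f_zero compact_cball, where d = "s / 2"])
    have pos: "0 < t" if "\<bar>t - s\<bar> \<le> s / 2" for t using that s by linarith
    show "continuous_on (cball c0 R) (\<lambda>y. mollifier 0 t (x - y))" if "\<bar>t - s\<bar> \<le> s / 2" for t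
      by (rule continuous_on_mollifier[OF pos[OF that]])
    have sub: "{s - s / 2..s + s / 2} \<times> cball c0 R \<subseteq> {s. 0 < s} \<times> UNIV" using s by auto
    have "continuous_on ({s - s / 2..s + s / 2} \<times> cball c0 R) (\<lambda>p. mollifier j (fst p) (x - snd p))" for j
      using continuous_on_subset[OF continuous_on_mollifier_scale[of j x] sub] by (simp add: case_prod_unfold)
    then show "continuous_on ({s - s / 2..s + s / 2} \<times> cball c0 R) (\<lambda>(t, y). ?F' t y)"
      unfolding case_prod_unfold using s by (intro continuous_intros) auto
    show "((\<lambda>t. mollifier 0 t (x - y)) has_real_derivative ?F' t y) (at t)" if "\<bar>t - s\<bar> \<le> s / 2" for t y
    proof -
      have "((\<lambda>u. mollifier 0 (t + u) (x - y + u *\<^sub>R 0)) has_real_derivative ?F' t y) (at 0)"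
      proof -
        have "((\<lambda>u. t + u) has_real_derivative 1) (at 0)"
          by (auto intro!: derivative_eq_intros)
        from mollifier_DERIV[OF this, of 0 "x - y" 0] pos[OF that] show ?thesis by simp
      qed
      then show ?thesis
        using DERIV_at_within_shift[of "\<lambda>t. mollifier 0 t (x - y)" "?F' t y" t 0 UNIV] by simp
    qed
  qed (use s in auto)
  then show ?thesis
    unfolding weak_mollifier_scale[OF s i] .
qed

section \<open>Truncation at a level and the smoothing scale attached to it\<close>

abbreviation U :: "real \<Rightarrow> (real, 'n) vec set" where
  "U t \<equiv> maximal_superlevel g t"

text \<open>Interpolation will raise s^(-n) to the power \<open>gam\<close>. With n times
  \<open>gam\<close> equal to 1/2 this is s^(-1/2), which is integrable at scale zero.\<close>

definition gam :: real where
  "gam = 1 / (2 * real CARD('n))"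

lemma gam_bounds: "0 < gam" "gam < 1" "real CARD('n) * gam = 1 / 2"
proof -
  have n: "1 \<le> real CARD('n)" by simp
  show "0 < gam" "real CARD('n) * gam = 1 / 2" by (simp_all add: gam_def)
  have "gam \<le> 1 / 2" unfolding gam_def using n by (simp add: divide_simps)
  then show "gam < 1" by simp
qed

definition scale :: "real \<Rightarrow> real \<Rightarrow> (real, 'n) vec \<Rightarrow> real" where
  "scale t \<epsilon> = regularize \<epsilon> (\<lambda>y. infdist y (- U t))"

text \<open>From this level on the weak type inequality makes \<open>U t\<close> too small to
  contain a ball of radius \<open>s0 / 2\<close>, so every point is within \<open>s0 / 2\<close> of
  the complement.\<close>

definition threshold :: "real \<Rightarrow> real" where
  "threshold s0 = 1 + 2 * 5 ^ CARD('n) * (LINT y|lebesgue. g y) / measure lebesgue (ball (0 :: (real, 'n) vec) (s0 / 2))"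

lemma g_integral_nonneg: "0 \<le> (LINT y|lebesgue. g y)"
  by (rule integral_nonneg_AE) (simp add: g_nonneg)

lemma threshold_ge_1: "1 \<le> threshold s0"
  unfolding threshold_def using g_integral_nonneg by simp

lemma weak_type_U: "0 < t \<Longrightarrow> U t \<in> lmeasurable"
  "0 < t \<Longrightarrow> measure lebesgue (U t) \<le> 2 * 5 ^ CARD('n) / t * (LINT y|lebesgue. g y)"
  using lmeasurable_maximal_superlevel[OF g_int g_nonneg, of t] by simp_all

lemma infdist_complement_le:
  assumes s0: "0 < s0" and t: "threshold s0 \<le> t"
  shows "- U t \<noteq> {}" "infdist x (- U t) \<le> s0 / 2"
proof -
  have t0: "0 < t" using t threshold_ge_1[of s0] by linarith
  have no_ball: "\<not> ball x (s0 / 2) \<subseteq> U t" for x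
  proof
    assume sub: "ball x (s0 / 2) \<subseteq> U t"
    let ?M = "measure lebesgue (ball (0 :: (real, 'n) vec) (s0 / 2))"
    have M: "0 < ?M" using s0 content_ball_pos[of "s0 / 2" "0 :: (real, 'n) vec"] by simp
    have "?M = measure lebesgue (ball x (s0 / 2))"
      using s0 by (simp add: content_ball)
    also have "\<dots> \<le> measure lebesgue (U t)"
      using sub weak_type_U(1)[OF t0] by (intro measure_mono_fmeasurable) auto
    also have "\<dots> \<le> 2 * 5 ^ CARD('n) / t * (LINT y|lebesgue. g y)"
      by (rule weak_type_U(2)[OF t0])
    finally have "?M * t \<le> 2 * 5 ^ CARD('n) * (LINT y|lebesgue. g y)"
      using t0 by (simp add: field_simps)
    moreover have "threshold s0 * ?M \<le> ?M * t"
      using mult_right_mono[OF t less_imp_le[OF M]] by (simp add: mult.commute)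
    moreover have "threshold s0 * ?M = ?M + 2 * 5 ^ CARD('n) * (LINT y|lebesgue. g y)"
      using M unfolding threshold_def distrib_right by simp
    ultimately show False using M by linarith
  qed
  show ne: "- U t \<noteq> {}" using no_ball[of 0] by blast
  obtain y where y: "y \<in> ball x (s0 / 2)" "y \<in> - U t" using no_ball[of x] by blast
  have "infdist x (- U t) \<le> dist x y" by (rule infdist_le[OF y(2)])
  then show "infdist x (- U t) \<le> s0 / 2" using y(1) by simp
qed

text \<open>Each of the balls making up \<open>U t\<close> meets the ball carrying \<open>g\<close>
  and has radius below a fixed bound. Boundedness gives the distance to the complement a compact
  support, as its regularisation requires.\<close>

lemma U_bounded: "0 < t \<Longrightarrow> bounded (U t)"
proof -
  assume t: "0 < t"
  define r0 where "r0 = ((LINT y|lebesgue. g y) / (unit_ball_vol DIM((real, 'n) vec) * t)) powr (1 / DIM((real, 'n) vec))"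
  have "x \<in> cball c0 (R + 2 * r0)" if "x \<in> U t" for x
  proof -
    from that obtain c r where cr: "x \<in> ball c r" "0 < r"
      "t * measure lebesgue (ball c r) < (LINT y|lebesgue. indicator (ball c r) y * g y)"
      unfolding maximal_superlevel_def by blast
    have r: "r < r0"
      unfolding r0_def by (rule maximal_ball_radius[OF g_int g_nonneg t cr(2,3)])
    have "\<exists>y\<in>ball c r. y \<in> cball c0 R"
    proof (rule ccontr)
      assume "\<not> ?thesis"
      then have "(\<lambda>y. indicator (ball c r) y * g y) = (\<lambda>_. 0)"
        using g_zero by (auto simp: indicator_def)
      then have "t * measure lebesgue (ball c r) < 0" using cr(3) by (simp only: integral_zero)
      moreover have "0 \<le> t * measure lebesgue (ball c r)" using t by simp
      ultimately show False by linarith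
    qed
    then obtain y where "dist c y < r" "dist c0 y \<le> R" by auto
    then show ?thesis
      using cr(1) r dist_triangle[of c0 x y] dist_triangle[of y x c] by (simp add: dist_commute)
  qed
  then show ?thesis by (rule bounded_subset[OF bounded_cball subsetI])
qed

text \<open>The scale strictly exceeds the distance to the complement of \<open>U t\<close>, so the
  ball of that radius reaches a point off \<open>U t\<close>. This makes the average estimates
  available at every point, including those deep inside \<open>U t\<close>.\<close>

lemma scale_properties:
  assumes s0: "0 < s0" and t: "threshold s0 \<le> t" and \<epsilon>: "0 < \<epsilon>"
  shows "Ck_domain k (scale t \<epsilon>)" "infdist x (- U t) + \<epsilon> \<le> scale t \<epsilon> x"
    "scale t \<epsilon> x \<le> infdist x (- U t) + 3 * \<epsilon>" "\<bar>pderiv_domain l (scale t \<epsilon>) x\<bar> \<le> 1"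
    "0 < scale t \<epsilon> x" "\<exists>x'\<in>ball x (scale t \<epsilon> x). x' \<notin> U t"
proof -
  have t0: "0 < t" using t threshold_ge_1[of s0] by linarith
  have cl: "closed (- U t)" by (simp add: closed_def open_maximal_superlevel)
  have lip: "\<bar>infdist x (- U t) - infdist y (- U t)\<bar> \<le> dist x y" for x y
    using infdist_triangle[of x "- U t" y] infdist_triangle[of y "- U t" x] by (simp add: dist_commute)
  have supp: "infdist y (- U t) = 0" if "y \<notin> closure (U t)" for y
    using that closure_subset[of "U t"] by (intro infdist_zero) blast
  have comp: "compact (closure (U t))" using U_bounded[OF t0] by (simp add: compact_closure)
  note reg = regularize_properties[OF \<epsilon> infdist_nonneg lip comp supp, folded scale_def]
  show "Ck_domain k (scale t \<epsilon>)" by (rule reg(1))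
  show "\<bar>pderiv_domain l (scale t \<epsilon>) x\<bar> \<le> 1" by (rule reg(4))
  show 1: "infdist x (- U t) + \<epsilon> \<le> scale t \<epsilon> x" by (rule reg(2))
  show "scale t \<epsilon> x \<le> infdist x (- U t) + 3 * \<epsilon>" by (rule reg(3))
  show "0 < scale t \<epsilon> x" using 1 \<epsilon> infdist_nonneg[of x "- U t"] by linarith
  obtain x' where "x' \<in> - U t" "infdist x (- U t) = dist x x'"
    using infdist_attains_inf[OF cl infdist_complement_le(1)[OF s0 t]] by blast
  then show "\<exists>x'\<in>ball x (scale t \<epsilon> x). x' \<notin> U t"
    using 1 \<epsilon> by (intro bexI[of _ x']) auto
qed

lemma scale_le:
  assumes "0 < s0" "threshold s0 \<le> t" "0 < \<epsilon>" "\<epsilon> \<le> s0 / 6"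
  shows "scale t \<epsilon> x \<le> s0"
  using scale_properties(3)[OF assms(1-3), of x] infdist_complement_le(2)[OF assms(1,2), of x] assms(4) by linarith

lemma cball_inside:
  assumes "x \<in> cball c0 (R - 2 * s0)" "s \<le> s0" "0 < s0"
  shows "cball x s \<subseteq> ball c0 R"
proof
  fix y assume "y \<in> cball x s"
  then show "y \<in> ball c0 R"
    using assms dist_triangle[of c0 y x] by simp
qed

text \<open>The mollified value is followed from scale \<open>s0\<close> down to
  \<open>scale t \<epsilon> x\<close>. Its derivative in the scale is at most \<open>kap * t\<close>
  and also at most a multiple of s^(-n); the geometric mean of the two with weight
  \<open>gam\<close> is integrable in \<open>s\<close> and grows only like t^(1-gam). This sublinear
  growth in \<open>t\<close> is what makes boundary terms lower order.\<close>

lemma smoothed_bound_component: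
  assumes s0: "0 < s0" and t: "threshold s0 \<le> t" and \<epsilon>: "0 < \<epsilon>" "\<epsilon> \<le> s0 / 6"
    and x: "x \<in> cball c0 (R - 2 * s0)" and i: "i < m"
  shows "\<bar>smoothed (scale t \<epsilon>) x i\<bar> \<le> inverse s0 ^ CARD('n) / bump_mass TYPE('n) * (LINT y|lebesgue. \<bar>f y i\<bar>)
     + 2 * sqrt s0 * ((kap * t) powr (1 - gam) * ((LINT y|lebesgue. g y) / bump_mass TYPE('n)) powr gam)"
proof -
  let ?\<rho> = "scale t \<epsilon> x" and ?A = "(LINT y|lebesgue. g y) / bump_mass TYPE('n)"
  define C where "C = (kap * t) powr (1 - gam) * ?A powr gam"
  define u where "u s = (LINT y|lebesgue. f y i * mollifier 0 s (x - y))" for s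
  define u' where "u' s = - (\<Sum>k\<in>UNIV. LINT y|lebesgue. Df y k i * ((x - y) $ k / s * mollifier 0 s (x - y)))" for s
  note sc = scale_properties[OF s0 t \<epsilon>(1)]
  have \<rho>: "0 < ?\<rho>" "?\<rho> \<le> s0" by (rule sc(5), rule scale_le[OF s0 t \<epsilon>])
  have t0: "0 < t" using t threshold_ge_1[of s0] by linarith
  have mass: "0 < bump_mass TYPE('n)" by (rule bump_mass_pos)
  obtain x' where x': "x' \<in> ball x ?\<rho>" "x' \<notin> U t" using sc(6) by blast
  have bound: "\<bar>u' s\<bar> \<le> C / sqrt s" if s: "?\<rho> \<le> s" for s
  proof -
    have s_pos: "0 < s" using \<rho> s by linarith
    let ?v = "LINT y|lebesgue. g y * mollifier 0 s (x - y)"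
    have cont: "continuous_on UNIV (\<lambda>y. (x - y) $ k / s * mollifier 0 s (x - y))" for k
      using s_pos by (intro continuous_intros continuous_on_mollifier) auto
    have contm: "continuous_on UNIV (\<lambda>y. mollifier 0 s (x - y))"
      by (rule continuous_on_mollifier[OF s_pos])
    have int_e: "integrable lebesgue (\<lambda>y. enorm m (Df y k) * mollifier 0 s (x - y))" for k
    proof (rule integrable_mult_continuous[OF _ _ compact_cball contm])
      show "integrable lebesgue (\<lambda>y. enorm m (Df y k))" by (intro integrable_enorm Df_int)
      show "enorm m (Df y k) = 0" if "y \<notin> cball c0 R" for y
        using that Df_zero by (simp add: enorm_def L2_set_def)
    qed
    have "\<bar>u' s\<bar> \<le> (\<Sum>k\<in>UNIV. \<bar>LINT y|lebesgue. Df y k i * ((x - y) $ k / s * mollifier 0 s (x - y))\<bar>)"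
      unfolding u'_def abs_minus_cancel by (rule sum_abs)
    also have "\<dots> \<le> (\<Sum>k\<in>UNIV. LINT y|lebesgue. enorm m (Df y k) * mollifier 0 s (x - y))"
    proof (rule sum_mono, rule order_trans[OF integral_abs_bound], rule integral_mono)
      fix k
      show "integrable lebesgue (\<lambda>y. \<bar>Df y k i * ((x - y) $ k / s * mollifier 0 s (x - y))\<bar>)"
        by (intro integrable_abs Df_mult_int[OF i] cont)
      show "integrable lebesgue (\<lambda>y. enorm m (Df y k) * mollifier 0 s (x - y))" by (rule int_e)
      fix y
      have mol: "0 \<le> mollifier 0 s (x - y)" by (rule mollifier_bounds(1)[OF s_pos])
      have "\<bar>(x - y) $ k / s * mollifier 0 s (x - y)\<bar> \<le> mollifier 0 s (x - y)"
      proof (cases "mollifier 0 s (x - y) = 0")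
        case False
        from mult_right_mono[OF coord_div_le[OF s_pos False, of k] mol] mol show ?thesis
          by (simp add: abs_mult)
      qed simp
      then show "\<bar>Df y k i * ((x - y) $ k / s * mollifier 0 s (x - y))\<bar> \<le> enorm m (Df y k) * mollifier 0 s (x - y)"
        unfolding abs_mult[of "Df y k i"] by (intro mult_mono abs_le_enorm[OF i]) auto
    qed
    also have "\<dots> = ?v"
      unfolding g_def sum_distrib_right by (rule Bochner_Integration.integral_sum[symmetric]) (rule int_e)
    finally have le_v: "\<bar>u' s\<bar> \<le> ?v" .
    have v0: "0 \<le> ?v" using le_v by linarith
    have v1: "?v \<le> kap * t"
      by (rule g_average(2)[OF s_pos _ x'(2)]) (use x'(1) s in auto)
    have v2: "?v \<le> inverse s ^ CARD('n) * ?A"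
      using g_average(1)[OF s_pos, of x] by simp
    have A: "0 \<le> ?A" using g_integral_nonneg mass by simp
    have "?v \<le> (kap * t) powr (1 - gam) * (inverse s ^ CARD('n) * ?A) powr gam"
    proof (cases "?v = 0")
      case False
      then have "?v = ?v powr (1 - gam) * ?v powr gam"
        using v0 by (simp add: powr_add[symmetric])
      also have "\<dots> \<le> (kap * t) powr (1 - gam) * (inverse s ^ CARD('n) * ?A) powr gam"
        using v0 v1 v2 gam_bounds by (intro mult_mono powr_mono2) auto
      finally show ?thesis .
    qed simp
    also have "(inverse s ^ CARD('n) * ?A) powr gam = inverse s powr (1 / 2) * ?A powr gam"
    proof -
      have "(inverse s ^ CARD('n)) powr gam = inverse s powr (real CARD('n) * gam)"
        using s_pos by (simp add: powr_realpow[symmetric] powr_powr)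
      moreover have "(inverse s ^ CARD('n) * ?A) powr gam = (inverse s ^ CARD('n)) powr gam * ?A powr gam"
        by (rule powr_mult)
      ultimately show ?thesis by (simp only: gam_bounds)
    qed
    also have "inverse s powr (1 / 2) = 1 / sqrt s"
      using s_pos by (simp add: powr_half_sqrt real_sqrt_divide inverse_eq_divide)
    finally show ?thesis using le_v by (simp add: C_def mult_ac)
  qed
  have du: "(u has_real_derivative u' s) (at s)" if "?\<rho> \<le> s" "s \<le> s0" for s
    unfolding u_def u'_def
    by (rule mollified_scale_DERIV[OF _ cball_inside[OF x that(2) s0] i]) (use \<rho> that in linarith)
  have dP: "((\<lambda>s. 2 * C * sqrt s) has_real_derivative C / sqrt s) (at s)" if "?\<rho> \<le> s" for s
    using that \<rho> by (auto intro!: derivative_eq_intros simp: field_simps)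
  have C0: "0 \<le> C" by (simp add: C_def)
  \<comment> \<open>\<open>2 * C * sqrt s\<close> is a primitive of the bound
    \<open>C / sqrt s\<close>. Monotonicity of its difference and of its sum with \<open>u\<close>
    gives the two-sided estimate.\<close>
  have "2 * C * sqrt ?\<rho> - u ?\<rho> \<le> 2 * C * sqrt s0 - u s0"
  proof (rule DERIV_nonneg_imp_nondecreasing[OF \<rho>(2)])
    fix s assume s: "?\<rho> \<le> s" "s \<le> s0"
    show "\<exists>y. ((\<lambda>s. 2 * C * sqrt s - u s) has_real_derivative y) (at s) \<and> 0 \<le> y"
      using DERIV_diff[OF dP[OF s(1)] du[OF s]] bound[OF s(1)] by (intro exI conjI) auto
  qed
  moreover have "2 * C * sqrt ?\<rho> + u ?\<rho> \<le> 2 * C * sqrt s0 + u s0"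
  proof (rule DERIV_nonneg_imp_nondecreasing[OF \<rho>(2)])
    fix s assume s: "?\<rho> \<le> s" "s \<le> s0"
    show "\<exists>y. ((\<lambda>s. 2 * C * sqrt s + u s) has_real_derivative y) (at s) \<and> 0 \<le> y"
      using DERIV_add[OF dP[OF s(1)] du[OF s]] bound[OF s(1)] by (intro exI conjI) auto
  qed
  moreover have "0 \<le> 2 * C * sqrt ?\<rho>" using C0 \<rho> by simp
  moreover have "\<bar>u s0\<bar> \<le> inverse s0 ^ CARD('n) / bump_mass TYPE('n) * (LINT y|lebesgue. \<bar>f y i\<bar>)"
  proof -
    have "\<bar>u s0\<bar> \<le> (LINT y|lebesgue. inverse s0 ^ CARD('n) / bump_mass TYPE('n) * \<bar>f y i\<bar>)"
      unfolding u_def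
    proof (rule order_trans[OF integral_abs_bound integral_mono])
      show "integrable lebesgue (\<lambda>y. \<bar>f y i * mollifier 0 s0 (x - y)\<bar>)"
        by (intro integrable_abs f_mult_int[OF i] continuous_on_mollifier s0)
      show "integrable lebesgue (\<lambda>y. inverse s0 ^ CARD('n) / bump_mass TYPE('n) * \<bar>f y i\<bar>)"
        by (intro integrable_mult_right integrable_abs f_int i)
      fix y
      show "\<bar>f y i * mollifier 0 s0 (x - y)\<bar> \<le> inverse s0 ^ CARD('n) / bump_mass TYPE('n) * \<bar>f y i\<bar>"
        using mult_left_mono[OF mollifier_bounds(2)[OF s0, of "x - y"] abs_ge_zero[of "f y i"]]
          mollifier_bounds(1)[OF s0, of "x - y"]
        by (simp add: abs_mult mult.commute)
    qed
    then show ?thesis by simp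
  qed
  ultimately have "\<bar>u ?\<rho>\<bar> \<le> inverse s0 ^ CARD('n) / bump_mass TYPE('n) * (LINT y|lebesgue. \<bar>f y i\<bar>) + 2 * C * sqrt s0"
    by linarith
  then show ?thesis by (simp add: u_def smoothed_def C_def mult_ac)
qed

lemma smoothed_bound:
  assumes s0: "0 < s0"
  obtains Cf where "0 \<le> Cf" "\<And>t \<epsilon> x. threshold s0 \<le> t \<Longrightarrow> 0 < \<epsilon> \<Longrightarrow> \<epsilon> \<le> s0 / 6 \<Longrightarrow> x \<in> cball c0 (R - 2 * s0) \<Longrightarrow>
      enorm m (smoothed (scale t \<epsilon>) x) \<le> Cf * t powr (1 - gam)"
proof -
  define a where "a i = inverse s0 ^ CARD('n) / bump_mass TYPE('n) * (LINT y|lebesgue. \<bar>f y i\<bar>)" for i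
  define c where "c = 2 * sqrt s0 * (kap powr (1 - gam) * ((LINT y|lebesgue. g y) / bump_mass TYPE('n)) powr gam)"
  have a0: "0 \<le> a i" for i using s0 bump_mass_pos[where 'n = 'n] by (simp add: a_def)
  have c0: "0 \<le> c" using s0 by (simp add: c_def)
  show thesis
  proof (rule that[of "\<Sum>i<m. a i + c"])
    show "0 \<le> (\<Sum>i<m. a i + c)" by (intro sum_nonneg add_nonneg_nonneg a0 c0)
    fix t \<epsilon> :: real and x
    assume t: "threshold s0 \<le> t" and \<epsilon>: "0 < \<epsilon>" "\<epsilon> \<le> s0 / 6" and x: "x \<in> cball c0 (R - 2 * s0)"
    have t1: "1 \<le> t" using t threshold_ge_1[of s0] by linarith
    have "enorm m (smoothed (scale t \<epsilon>) x) \<le> (\<Sum>i<m. \<bar>smoothed (scale t \<epsilon>) x i\<bar>)"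
      by (rule enorm_le_sum)
    also have "\<dots> \<le> (\<Sum>i<m. (a i + c) * t powr (1 - gam))"
    proof (rule sum_mono)
      fix i assume "i \<in> {..<m}"
      then have "\<bar>smoothed (scale t \<epsilon>) x i\<bar> \<le> a i + c * t powr (1 - gam)"
        using smoothed_bound_component[OF s0 t \<epsilon> x, of i] kap_pos t1
        by (simp add: a_def c_def powr_mult mult_ac)
      also have "a i * 1 \<le> a i * t powr (1 - gam)"
        using t1 gam_bounds by (intro mult_left_mono a0 ge_one_powr_ge_zero) auto
      then have "a i + c * t powr (1 - gam) \<le> (a i + c) * t powr (1 - gam)"
        by (simp add: algebra_simps)
      finally show "\<bar>smoothed (scale t \<epsilon>) x i\<bar> \<le> (a i + c) * t powr (1 - gam)" .
    qed
    finally show "enorm m (smoothed (scale t \<epsilon>) x) \<le> (\<Sum>i<m. a i + c) * t powr (1 - gam)"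
      by (simp only: sum_distrib_right)
  qed
qed

lemma enorm_jac_smoothed_scale_le:
  assumes s0: "0 < s0" and t: "threshold s0 \<le> t" and \<epsilon>: "0 < \<epsilon>" "\<epsilon> \<le> s0 / 6"
    and x: "x \<in> cball c0 (R - 2 * s0)"
  shows "enorm m (jac (smoothed (scale t \<epsilon>)) x l) \<le> 2 * kap * t"
proof -
  note sc = scale_properties[OF s0 t \<epsilon>(1)]
  obtain x' where "x' \<in> ball x (scale t \<epsilon> x)" "x' \<notin> U t" using sc(6) by blast
  then show ?thesis
    by (rule enorm_jac_smoothed_le[OF sc(1,5) cball_inside[OF x scale_le[OF s0 t \<epsilon>] s0] sc(4)])
qed

text \<open>Off \<open>U t\<close> the distance vanishes and the scale is at most three times
  \<open>\<epsilon>\<close>, so averages converge at Lebesgue points. The terms from the slope of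
  the scale tend to zero: their kernels have mass zero and the slope stays bounded by one.\<close>

lemma smoothed_limits:
  assumes s0: "0 < s0" and t: "threshold s0 \<le> t" and \<epsilon>: "\<And>k. 0 < \<epsilon> k" "\<And>k. \<epsilon> k \<le> s0 / 6" "\<epsilon> \<longlonglongrightarrow> 0"
    and x: "x \<in> cball c0 (R - 2 * s0)" "x \<notin> U t"
    and lp: "\<And>i. i < m \<Longrightarrow> lebesgue_point (\<lambda>x. f x i) x" "\<And>i l. i < m \<Longrightarrow> lebesgue_point (\<lambda>x. Df x l i) x"
    and i: "i < m"
  shows "(\<lambda>k. smoothed (scale t (\<epsilon> k)) x i) \<longlonglongrightarrow> f x i"
    and "(\<lambda>k. jac (smoothed (scale t (\<epsilon> k))) x l i) \<longlonglongrightarrow> Df x l i"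
proof -
  note sc = scale_properties[OF s0 t \<epsilon>(1)]
  define s where "s k = scale t (\<epsilon> k) x" for k
  define C where "C = 1 / bump_mass TYPE('n)"
  have s_pos: "0 < s k" for k by (simp add: s_def sc(5))
  have s_lim: "s \<longlonglongrightarrow> 0"
  proof (rule real_tendsto_sandwich)
    show "\<forall>\<^sub>F k in sequentially. 0 \<le> s k" by (intro always_eventually allI less_imp_le s_pos)
    have "s k \<le> 3 * \<epsilon> k" for k
      using sc(3)[of k x] infdist_zero[of x "- U t"] x(2) by (simp add: s_def)
    then show "\<forall>\<^sub>F k in sequentially. s k \<le> 3 * \<epsilon> k" by simp
    show "(\<lambda>k. 3 * \<epsilon> k) \<longlonglongrightarrow> 0" using tendsto_mult[OF tendsto_const[of 3] \<epsilon>(3)] by simp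
  qed simp
  have meas: "(\<lambda>y. mollifier 0 (s k) (x - y)) \<in> borel_measurable lebesgue" for k
    using mollifier_integral(1)[OF s_pos] by auto
  have bound: "\<bar>mollifier 0 (s k) (x - y)\<bar> \<le> C * indicator (ball x (s k)) y / s k ^ DIM((real, 'n) vec)" for k y
  proof (cases "y \<in> ball x (s k)")
    case True
    then show ?thesis
      using mollifier_bounds(1,2)[OF s_pos[of k], of "x - y"] by (simp add: C_def power_inverse divide_inverse mult.commute)
  next
    case False
    then show ?thesis using mollifier_bounds(3)[OF s_pos[of k], of "x - y" 0] by (simp add: dist_norm)
  qed
  have one: "(\<lambda>k. LINT y|lebesgue. u y * mollifier 0 (s k) (x - y)) \<longlonglongrightarrow> u x"
    if u: "integrable lebesgue u" "lebesgue_point u x" for u :: "(real, 'n) vec \<Rightarrow> real"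
  proof -
    have "(\<lambda>k. LINT y|lebesgue. mollifier 0 (s k) (x - y)) \<longlonglongrightarrow> 1"
      by (simp add: mollifier_integral(2)[OF s_pos])
    from lebesgue_point_kernel_limit[OF u s_pos s_lim meas bound this] show ?thesis by simp
  qed
  show "(\<lambda>k. smoothed (scale t (\<epsilon> k)) x i) \<longlonglongrightarrow> f x i"
    using one[OF f_int[OF i] lp(1)[OF i]] by (simp add: smoothed_def s_def)
  define p where "p k = pderiv_domain l (scale t (\<epsilon> k)) x" for k
  have p: "\<bar>p k\<bar> \<le> 1" for k by (simp add: p_def sc(4))
  have zero: "(\<lambda>k. p k * (LINT y|lebesgue. u y * ((x - y) $ j / s k * mollifier 0 (s k) (x - y)))) \<longlonglongrightarrow> 0"
    if u: "integrable lebesgue u" "lebesgue_point u x" for u :: "(real, 'n) vec \<Rightarrow> real" and j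
  proof (rule Lim_null_comparison)
    have "(\<lambda>k. LINT y|lebesgue. u y * ((x - y) $ j / s k * mollifier 0 (s k) (x - y))) \<longlonglongrightarrow> u x * 0"
    proof (rule lebesgue_point_kernel_limit[OF u s_pos s_lim])
      show "(\<lambda>y. (x - y) $ j / s k * mollifier 0 (s k) (x - y)) \<in> borel_measurable lebesgue" for k
      proof -
        have "continuous_on UNIV (\<lambda>y. (x - y) $ j / s k * mollifier 0 (s k) (x - y))"
          using s_pos[of k] by (intro continuous_intros continuous_on_mollifier) auto
        then show ?thesis
          by (intro measurable_completion) (simp add: borel_measurable_continuous_onI)
      qed
      fix k y
      have "\<bar>(x - y) $ j / s k * mollifier 0 (s k) (x - y)\<bar> \<le> \<bar>mollifier 0 (s k) (x - y)\<bar>"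
      proof (cases "mollifier 0 (s k) (x - y) = 0")
        case False
        from mult_right_mono[OF coord_div_le[OF s_pos False, of j] abs_ge_zero[of "mollifier 0 (s k) (x - y)"]] show ?thesis
          by (simp add: abs_mult)
      qed simp
      with bound[of k y] show "\<bar>(x - y) $ j / s k * mollifier 0 (s k) (x - y)\<bar> \<le> C * indicator (ball x (s k)) y / s k ^ DIM((real, 'n) vec)"
        by linarith
    next
      have zero: "(LINT y|lebesgue. (x - y) $ j / s k * mollifier 0 (s k) (x - y)) = 0" for k
      proof -
        have "(LINT y|lebesgue. (x - y) $ j / s k * mollifier 0 (s k) (x - y))
          = (LINT y|lebesgue. (x - y) $ j * mollifier 0 (s k) (x - y)) / s k"
          by simp
        then show ?thesis unfolding mollifier_integral(3)[OF s_pos] by simp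
      qed
      show "(\<lambda>k. LINT y|lebesgue. (x - y) $ j / s k * mollifier 0 (s k) (x - y)) \<longlonglongrightarrow> 0"
        unfolding zero by (rule tendsto_const)
    qed
    then show "(\<lambda>k. \<bar>LINT y|lebesgue. u y * ((x - y) $ j / s k * mollifier 0 (s k) (x - y))\<bar>) \<longlonglongrightarrow> 0"
      by (simp only: mult_zero_right tendsto_rabs_zero)
    show "\<forall>\<^sub>F k in sequentially. norm (p k * (LINT y|lebesgue. u y * ((x - y) $ j / s k * mollifier 0 (s k) (x - y))))
       \<le> \<bar>LINT y|lebesgue. u y * ((x - y) $ j / s k * mollifier 0 (s k) (x - y))\<bar>"
      unfolding real_norm_def abs_mult by (intro always_eventually allI mult_left_le_one_le p) auto
  qed
  have "jac (smoothed (scale t (\<epsilon> k))) x l i = (LINT y|lebesgue. Df y l i * mollifier 0 (s k) (x - y))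
      - (\<Sum>j\<in>UNIV. p k * (LINT y|lebesgue. Df y j i * ((x - y) $ j / s k * mollifier 0 (s k) (x - y))))" for k
    unfolding s_def p_def sum_distrib_left[symmetric]
    by (rule jac_smoothed[OF sc(1,5) cball_inside[OF x(1) scale_le[OF s0 t \<epsilon>(1,2)] s0] i])
  moreover have "(\<lambda>k. (LINT y|lebesgue. Df y l i * mollifier 0 (s k) (x - y))
      - (\<Sum>j\<in>UNIV. p k * (LINT y|lebesgue. Df y j i * ((x - y) $ j / s k * mollifier 0 (s k) (x - y))))) \<longlonglongrightarrow> Df x l i - (\<Sum>j\<in>(UNIV :: 'n set). 0)"
    by (intro tendsto_diff tendsto_sum one zero Df_int[OF i] lp(2)[OF i])
  ultimately show "(\<lambda>k. jac (smoothed (scale t (\<epsilon> k))) x l i) \<longlonglongrightarrow> Df x l i" by simp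
qed

end

subsection \<open>The truncation estimate\<close>

context cutoff_curve
begin

definition boundary_term :: "((real, 'n) vec \<Rightarrow> real) \<Rightarrow> (real, 'n) vec \<Rightarrow> real" where
  "boundary_term \<psi> x = (\<Sum>l\<in>UNIV. pderiv_domain l \<psi> x * homotopy_form m \<phi> l (f x) (Df x))"

definition jacobian :: "(real, 'n) vec \<Rightarrow> real" where
  "jacobian x = form_eval m \<phi> (f x) (Df x)"

lemma L_nonneg: "0 \<le> L"
proof -
  have "(\<lambda>_. 0) \<in> Rm m" by (simp add: Rm_iff)
  from L[OF this] show ?thesis by (meson order_trans sum_nonneg abs_ge_zero)
qed

lemma f_Df_measurable:
  "(\<lambda>x. f x i) \<in> borel_measurable lebesgue" "i < m \<Longrightarrow> (\<lambda>x. Df x l i) \<in> borel_measurable lebesgue"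
proof -
  show "(\<lambda>x. f x i) \<in> borel_measurable lebesgue"
    using f_Rm f_int[THEN borel_measurable_integrable] by (cases "i < m") (auto simp: Rm_iff)
  show "i < m \<Longrightarrow> (\<lambda>x. Df x l i) \<in> borel_measurable lebesgue"
    by (rule borel_measurable_integrable[OF Df_int])
qed

lemma jacobian_measurable: "jacobian \<in> borel_measurable lebesgue"
  unfolding jacobian_def[abs_def] by (rule form_measurable(1)[OF smooth f_Rm f_Df_measurable])

lemma boundary_term_measurable:
  assumes "Ck_domain (Suc 0) \<psi>"
  shows "boundary_term \<psi> \<in> borel_measurable lebesgue"
proof -
  have "pderiv_domain l \<psi> \<in> borel_measurable lebesgue" for l
    using Ck_domain_continuous[OF Ck_domain_pderiv(1)[OF assms]]
    by (intro measurable_completion) (simp add: borel_measurable_continuous_onI)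
  then show ?thesis
    unfolding boundary_term_def[abs_def]
    by (intro borel_measurable_sum borel_measurable_times form_measurable(2)[OF smooth f_Rm f_Df_measurable])
qed

lemma lebesgue_points_AE:
  "AE x in lebesgue. \<forall>i\<in>{..<m}. lebesgue_point (\<lambda>x. f x i) x \<and> (\<forall>l\<in>UNIV. lebesgue_point (\<lambda>x. Df x l i) x)"
  by (intro eventually_ball_finite ballI eventually_conj lebesgue_point_AE f_int Df_int) auto

text \<open>
  Stokes' theorem for the smooth maps \<open>smoothed (scale t \<epsilon>)\<close>, which are of Lipschitz constant
  comparable to \<open>t\<close> and converge to \<open>f\<close> off \<open>U t\<close> as \<open>\<epsilon> \<rightarrow> 0\<close>.
\<close>

lemma truncation_estimate:
  assumes s0: "0 < s0" and \<psi>: "Ck_domain (Suc 0) \<psi>" "\<And>x. 0 \<le> \<psi> x" "\<And>x. x \<notin> cball c0 (R - 2 * s0) \<Longrightarrow> \<psi> x = 0"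
  obtains C where "0 \<le> C"
    "\<And>t. threshold s0 \<le> t \<Longrightarrow>
       \<bar>LINT x|lebesgue. indicator (- U t) x * (\<psi> x * jacobian x + boundary_term \<psi> x)\<bar>
         \<le> L * (fact CARD('n) * (2 * kap * t) ^ CARD('n)) * (LINT x|lebesgue. indicator (U t) x * \<psi> x)
            + C * t powr (real CARD('n) - gam) * measure lebesgue (U t)"
    "\<And>t. threshold s0 \<le> t \<Longrightarrow> AE x in lebesgue. x \<notin> U t \<longrightarrow> \<bar>boundary_term \<psi> x\<bar> \<le> C * t powr (real CARD('n) - gam)"
proof -
  let ?N = "CARD('n)"
  define S where "S = cball c0 (R - 2 * s0)"
  have S: "compact S" "closed S" by (auto simp: S_def)
  have S_meas: "S \<in> sets lebesgue" using S(2) by auto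
  have \<psi>_zero: "\<psi> x = 0" if "x \<notin> S" for x using \<psi>(3) that by (simp add: S_def)
  have pd_zero: "pderiv_domain l \<psi> x = 0" if "x \<notin> S" for l x
    by (rule pderiv_domain_zero_outside[OF \<psi>(1) S(2) \<psi>_zero that])
  have cont_pd: "continuous_on UNIV (pderiv_domain l \<psi>)" for l
    by (rule Ck_domain_continuous[OF Ck_domain_pderiv(1)[OF \<psi>(1)]])
  have "\<exists>P. \<forall>x. \<bar>pderiv_domain l \<psi> x\<bar> \<le> P" for l
  proof -
    obtain P where "\<forall>y\<in>pderiv_domain l \<psi> ` S. norm y \<le> P"
      using compact_imp_bounded[OF compact_continuous_image[OF continuous_on_subset[OF cont_pd subset_UNIV] S(1)]]
      unfolding bounded_iff by blast
    then have P: "\<And>x. x \<in> S \<Longrightarrow> \<bar>pderiv_domain l \<psi> x\<bar> \<le> P" by auto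
    have "\<bar>pderiv_domain l \<psi> x\<bar> \<le> \<bar>P\<bar>" for x
      using P[of x] pd_zero[of x l] by (cases "x \<in> S") auto
    then show ?thesis by blast
  qed
  then obtain P' where P': "\<And>l x. \<bar>pderiv_domain l \<psi> x\<bar> \<le> P' l" by metis
  define P where "P = (\<Sum>l\<in>UNIV. P' l)"
  have P'_nonneg: "0 \<le> P' l" for l using P'[of l undefined] by linarith
  have P: "\<bar>pderiv_domain l \<psi> x\<bar> \<le> P" for l x
    using P'[of l x] member_le_sum[of l UNIV P'] P'_nonneg by (simp add: P_def)
  have P0: "0 \<le> P" by (simp add: P_def sum_nonneg P'_nonneg)
  obtain Cf where Cf: "0 \<le> Cf" "\<And>t \<epsilon> x. threshold s0 \<le> t \<Longrightarrow> 0 < \<epsilon> \<Longrightarrow> \<epsilon> \<le> s0 / 6 \<Longrightarrow> x \<in> S \<Longrightarrow>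
      enorm m (smoothed (scale t \<epsilon>) x) \<le> Cf * t powr (1 - gam)"
    unfolding S_def using smoothed_bound[OF s0] by blast
  \<comment> \<open>There are n directions: \<open>P\<close> bounds the gradient of
    \<open>\<psi>\<close>, the map contributes \<open>Cf\<close> times t^(1-gam), and the remaining
    n-1 slots contribute \<open>2 * kap * t\<close> each. The powers of \<open>t\<close> combine to
    t^(n-gam).\<close>
  define C where "C = real ?N * (P * (L * (fact ?N * (Cf * (2 * kap) ^ (?N - 1)))))"
  have C0: "0 \<le> C" using P0 L_nonneg Cf(1) kap_pos by (simp add: C_def)
  define \<epsilon> where "\<epsilon> k = s0 / 6 / real (Suc k)" for k
  have \<epsilon>: "0 < \<epsilon> k" "\<epsilon> k \<le> s0 / 6" for k
    using s0 divide_left_mono[of 1 "real (Suc k)" "s0 / 6"] by (auto simp: \<epsilon>_def)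
  have \<epsilon>_lim: "\<epsilon> \<longlonglongrightarrow> 0"
    unfolding \<epsilon>_def by (rule LIMSEQ_Suc[OF lim_const_over_n])
  have main: "\<bar>LINT x|lebesgue. indicator (- U t) x * (\<psi> x * jacobian x + boundary_term \<psi> x)\<bar>
         \<le> L * (fact ?N * (2 * kap * t) ^ ?N) * (LINT x|lebesgue. indicator (U t) x * \<psi> x)
            + C * t powr (real ?N - gam) * measure lebesgue (U t)
      \<and> (AE x in lebesgue. x \<notin> U t \<longrightarrow> \<bar>boundary_term \<psi> x\<bar> \<le> C * t powr (real ?N - gam))"
    if t: "threshold s0 \<le> t" for t
  proof -
    have t1: "1 \<le> t" using t threshold_ge_1[of s0] by linarith
    then have t0: "0 < t" by linarith
    define h where "h k = smoothed (scale t (\<epsilon> k))" for k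
    have hC2: "C2_map m (h k)" for k
      unfolding h_def by (rule smoothed_C2) (rule scale_properties[OF s0 t \<epsilon>(1)])+
    define A where "A = L * (fact ?N * (2 * kap * t) ^ ?N)"
    define B where "B = C * t powr (real ?N - gam)"
    have A0: "0 \<le> A" using L_nonneg kap_pos t0 by (simp add: A_def)
    have B0: "0 \<le> B" using C0 by (simp add: B_def)
    define F where "F k x = form_eval m \<phi> (h k x) (jac (h k) x)" for k x
    define E where "E k x = (\<Sum>l\<in>UNIV. pderiv_domain l \<psi> x * homotopy_form m \<phi> l (h k x) (jac (h k) x))" for k x
    have jac_le: "enorm m (jac (h k) x l) \<le> 2 * kap * t" if "x \<in> S" for k x l
      unfolding h_def using enorm_jac_smoothed_scale_le[OF s0 t \<epsilon>] that by (simp add: S_def)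
    have F_le: "\<bar>F k x\<bar> \<le> A" if "x \<in> S" for k x
    proof -
      have "\<bar>F k x\<bar> \<le> L * (fact ?N * (\<Prod>l\<in>UNIV. enorm m (jac (h k) x l)))"
        unfolding F_def by (rule abs_form_eval_le[where \<phi> = \<phi> and L = L, OF L[OF C2_mapD(1)[OF hC2]]])
      also have "\<dots> \<le> L * (fact ?N * (\<Prod>l\<in>(UNIV :: 'n set). 2 * kap * t))"
        using jac_le[OF that] by (intro mult_left_mono prod_mono L_nonneg) auto
      finally show ?thesis by (simp add: A_def)
    qed
    have E_le: "\<bar>E k x\<bar> \<le> indicator S x * B" for k x
    proof (cases "x \<in> S")
      case True
      have "\<bar>E k x\<bar> \<le> (\<Sum>l\<in>UNIV. \<bar>pderiv_domain l \<psi> x\<bar> * \<bar>homotopy_form m \<phi> l (h k x) (jac (h k) x)\<bar>)"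
        unfolding E_def abs_mult[symmetric] by (rule sum_abs)
      also have "\<dots> \<le> (\<Sum>l\<in>(UNIV :: 'n set). P * (L * (fact ?N * (Cf * t powr (1 - gam) * (2 * kap * t) ^ (?N - 1)))))"
      proof (intro sum_mono mult_mono P P0)
        fix l
        have "\<bar>homotopy_form m \<phi> l (h k x) (jac (h k) x)\<bar>
          \<le> L * (fact ?N * (enorm m (h k x) * (\<Prod>j\<in>UNIV - {l}. enorm m (jac (h k) x j))))"
          by (rule abs_homotopy_form_le[where \<phi> = \<phi> and L = L, OF smooth L C2_mapD(1)[OF hC2]])
        also have "\<dots> \<le> L * (fact ?N * (Cf * t powr (1 - gam) * (\<Prod>j\<in>UNIV - {l}. 2 * kap * t)))"
          using jac_le[OF True] Cf(2)[OF t \<epsilon> True] Cf(1)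
          by (intro mult_left_mono mult_mono prod_mono L_nonneg) (auto simp: h_def prod_nonneg)
        finally show "\<bar>homotopy_form m \<phi> l (h k x) (jac (h k) x)\<bar>
          \<le> L * (fact ?N * (Cf * t powr (1 - gam) * (2 * kap * t) ^ (?N - 1)))" by simp
      qed simp
      also have "\<dots> = C * (t powr (1 - gam) * t ^ (?N - 1))"
        by (simp add: C_def power_mult_distrib mult_ac)
      also have "t powr (1 - gam) * t ^ (?N - 1) = t powr (real ?N - gam)"
      proof -
        have "t ^ (?N - 1) = t powr (real ?N - 1)"
          using t0 powr_realpow[OF t0, of "?N - 1"] by (simp add: of_nat_diff)
        then show ?thesis by (simp add: powr_add[symmetric])
      qed
      finally show ?thesis using True by (simp add: B_def)
    qed (simp add: E_def pd_zero)
    have q_le: "\<bar>\<psi> x * F k x + E k x\<bar> \<le> \<psi> x * A + indicator S x * B" for k x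
    proof -
      have "\<bar>\<psi> x * F k x\<bar> \<le> \<psi> x * A"
        using F_le[of x k] \<psi>_zero[of x] \<psi>(2)[of x]
        by (cases "x \<in> S") (auto simp: abs_mult intro!: mult_left_mono)
      then show ?thesis using E_le[of k x] by linarith
    qed
    have q_cont: "continuous_on UNIV (\<lambda>x. \<psi> x * F k x + E k x)" for k
      unfolding F_def E_def
      by (intro continuous_intros Ck_domain_continuous[OF \<psi>(1)] cont_pd continuous_on_homotopy_form[OF smooth hC2])
    have q_int: "integrable lebesgue (\<lambda>x. \<psi> x * F k x + E k x)" for k
      by (rule integrable_continuous_compact_support[OF q_cont S(1)]) (simp add: \<psi>_zero E_def pd_zero)
    have q_zero: "(LINT x|lebesgue. \<psi> x * F k x + E k x) = 0" for k
      unfolding F_def E_def by (rule stokes_pullback[OF smooth closed hC2 \<psi>(1) S(1) \<psi>_zero])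
    have \<psi>_int: "integrable lebesgue \<psi>"
      by (rule integrable_continuous_compact_support[OF Ck_domain_continuous[OF \<psi>(1)] S(1) \<psi>_zero])
    have U_meas: "U t \<in> sets lebesgue" "- U t \<in> sets lebesgue"
      using weak_type_U(1)[OF t0] by (auto simp: fmeasurableD Compl_in_sets_lebesgue)
    have S_int: "integrable lebesgue (\<lambda>x. indicator S x * B)"
      using lmeasurable_compact[OF S(1)] unfolding lmeasurable_iff_integrable by (rule integrable_mult_left)
    have w_int: "integrable lebesgue (\<lambda>x. \<psi> x * A + indicator S x * B)"
      by (intro Bochner_Integration.integrable_add integrable_mult_left \<psi>_int S_int)
    have limits: "AE x in lebesgue. x \<notin> U t \<longrightarrow> (\<lambda>k. \<psi> x * F k x) \<longlonglongrightarrow> \<psi> x * jacobian x \<and> (\<lambda>k. E k x) \<longlonglongrightarrow> boundary_term \<psi> x"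
      using lebesgue_points_AE
    proof eventually_elim
      case (elim x)
      show ?case
      proof
        assume xU: "x \<notin> U t"
        show "(\<lambda>k. \<psi> x * F k x) \<longlonglongrightarrow> \<psi> x * jacobian x \<and> (\<lambda>k. E k x) \<longlonglongrightarrow> boundary_term \<psi> x"
        proof (cases "x \<in> S")
          case True
          have xS: "x \<in> cball c0 (R - 2 * s0)" using True by (simp add: S_def)
          have lims: "(\<lambda>k. h k x i) \<longlonglongrightarrow> f x i" "(\<lambda>k. jac (h k) x l i) \<longlonglongrightarrow> Df x l i" if "i < m" for i l
            unfolding h_def using elim that
            by (auto intro!: smoothed_limits[OF s0 t \<epsilon> \<epsilon>_lim xS xU])
          show ?thesis
            unfolding F_def E_def jacobian_def boundary_term_def
            by (intro conjI tendsto_mult tendsto_sum tendsto_const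
              tendsto_forms[OF smooth C2_mapD(1)[OF hC2] f_Rm lims])
        next
          case False
          then show ?thesis by (simp add: \<psi>_zero E_def pd_zero boundary_term_def)
        qed
      qed
    qed
    have lim: "(\<lambda>k. LINT x|lebesgue. indicator (- U t) x * (\<psi> x * F k x + E k x))
        \<longlonglongrightarrow> (LINT x|lebesgue. indicator (- U t) x * (\<psi> x * jacobian x + boundary_term \<psi> x))"
    proof (rule integral_dominated_convergence[OF _ _ w_int])
      have "\<psi> \<in> borel_measurable lebesgue" by (rule borel_measurable_integrable[OF \<psi>_int])
      then show "(\<lambda>x. indicator (- U t) x * (\<psi> x * jacobian x + boundary_term \<psi> x)) \<in> borel_measurable lebesgue"
        by (intro borel_measurable_times borel_measurable_add borel_measurable_indicator U_meas
            jacobian_measurable boundary_term_measurable[OF \<psi>(1)])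
      show "(\<lambda>x. indicator (- U t) x * (\<psi> x * F k x + E k x)) \<in> borel_measurable lebesgue" for k
        by (intro borel_measurable_integrable integrable_indicator_mult U_meas q_int)
      show "AE x in lebesgue. (\<lambda>k. indicator (- U t) x * (\<psi> x * F k x + E k x))
           \<longlonglongrightarrow> indicator (- U t) x * (\<psi> x * jacobian x + boundary_term \<psi> x)"
        using limits
      proof eventually_elim
        case (elim x)
        then show ?case
          by (cases "x \<in> U t") (auto intro!: tendsto_add)
      qed
      show "AE x in lebesgue. norm (indicator (- U t) x * (\<psi> x * F k x + E k x)) \<le> \<psi> x * A + indicator S x * B" for k
      proof (rule AE_I2)
        fix x
        show "norm (indicator (- U t) x * (\<psi> x * F k x + E k x)) \<le> \<psi> x * A + indicator S x * B"
          using q_le[of x k] abs_ge_zero[of "\<psi> x * F k x + E k x"] by (cases "x \<in> U t") auto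
      qed
    qed
    \<comment> \<open>The integral over the whole space vanishes by Stokes, so off
      \<open>U t\<close> it is minus the integral over \<open>U t\<close>; there the Lipschitz
      bounds on the smoothed map stand in for any knowledge of \<open>f\<close>.\<close>
    have bound: "\<bar>LINT x|lebesgue. indicator (- U t) x * (\<psi> x * F k x + E k x)\<bar>
       \<le> A * (LINT x|lebesgue. indicator (U t) x * \<psi> x) + B * measure lebesgue (U t)" for k
    proof -
      let ?q = "\<lambda>x. \<psi> x * F k x + E k x"
      have "(LINT x|lebesgue. ?q x) = (LINT x|lebesgue. indicator (- U t) x * ?q x + indicator (U t) x * ?q x)"
        by (intro Bochner_Integration.integral_cong) (auto simp: indicator_def)
      also have "\<dots> = (LINT x|lebesgue. indicator (- U t) x * ?q x) + (LINT x|lebesgue. indicator (U t) x * ?q x)"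
        by (intro Bochner_Integration.integral_add integrable_indicator_mult U_meas q_int)
      finally have "\<bar>LINT x|lebesgue. indicator (- U t) x * ?q x\<bar> = \<bar>LINT x|lebesgue. indicator (U t) x * ?q x\<bar>"
        using q_zero[of k] by linarith
      also have "\<dots> \<le> (LINT x|lebesgue. A * (indicator (U t) x * \<psi> x) + B * indicator (U t) x)"
      proof (rule order_trans[OF integral_abs_bound integral_mono])
        show "integrable lebesgue (\<lambda>x. \<bar>indicator (U t) x * ?q x\<bar>)"
          by (intro integrable_abs integrable_indicator_mult U_meas q_int)
        show "integrable lebesgue (\<lambda>x. A * (indicator (U t) x * \<psi> x) + B * indicator (U t) x)"
          using weak_type_U(1)[OF t0] unfolding lmeasurable_iff_integrable
          by (intro Bochner_Integration.integrable_add integrable_mult_right integrable_indicator_mult U_meas \<psi>_int)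
        fix x
        have "indicator S x * B \<le> B" using B0 by (simp add: indicator_def)
        then show "\<bar>indicator (U t) x * ?q x\<bar> \<le> A * (indicator (U t) x * \<psi> x) + B * indicator (U t) x"
          using q_le[of x k] by (cases "x \<in> U t") (auto simp: mult.commute)
      qed
      also have "\<dots> = A * (LINT x|lebesgue. indicator (U t) x * \<psi> x) + B * measure lebesgue (U t)"
        using weak_type_U(1)[OF t0] unfolding lmeasurable_iff_integrable
        by (subst Bochner_Integration.integral_add)
           (auto intro!: integrable_mult_right integrable_indicator_mult U_meas \<psi>_int)
      finally show ?thesis .
    qed
    have "\<bar>LINT x|lebesgue. indicator (- U t) x * (\<psi> x * jacobian x + boundary_term \<psi> x)\<bar>
       \<le> A * (LINT x|lebesgue. indicator (U t) x * \<psi> x) + B * measure lebesgue (U t)"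
      by (rule LIMSEQ_le_const2[OF tendsto_rabs[OF lim]]) (use bound in blast)
    \<comment> \<open>The bound on the approximations is uniform in \<open>k\<close> and passes to
      the limit, so it holds for the boundary term of \<open>f\<close> itself.\<close>
    moreover have "AE x in lebesgue. x \<notin> U t \<longrightarrow> \<bar>boundary_term \<psi> x\<bar> \<le> B"
      using limits
    proof eventually_elim
      case (elim x)
      show ?case
      proof
        assume "x \<notin> U t"
        then have "(\<lambda>k. E k x) \<longlonglongrightarrow> boundary_term \<psi> x" using elim by blast
        moreover have "\<bar>E k x\<bar> \<le> B" for k
          using E_le[of k x] B0 by (cases "x \<in> S") auto
        ultimately show "\<bar>boundary_term \<psi> x\<bar> \<le> B"
          by (intro LIMSEQ_le_const2[OF tendsto_rabs]) auto
      qed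
    qed
    ultimately show ?thesis by (simp add: A_def B_def)
  qed
  show thesis using that[of C] C0 main by blast
qed

definition high :: "real \<Rightarrow> (real, 'n) vec set" where
  "high t = {x. t / 2 < g x}"

lemma high_meas: "high t \<in> sets lebesgue"
proof -
  have "g \<in> borel_measurable lebesgue" using g_int by auto
  then have "{x \<in> space lebesgue. t / 2 < g x} \<in> sets lebesgue" by measurable
  then show ?thesis by (simp add: high_def)
qed

lemma weighted_weak_type_real:
  assumes \<psi>: "\<And>y. 0 \<le> \<psi> y" "\<And>y. \<psi> y \<le> 1" "\<And>x y. \<psi> x \<le> \<psi> y + \<Lambda> * dist x y" "0 \<le> \<Lambda>"
      "\<psi> \<in> borel_measurable lebesgue" and t: "0 < t"
  shows "(LINT x|lebesgue. indicator (U t) x * \<psi> x) \<le> 2 * 5 ^ CARD('n) / t *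
    ((LINT x|lebesgue. indicator (high t) x * (g x * \<psi> x))
      + 6 * \<Lambda> * ((LINT y|lebesgue. g y) / (unit_ball_vol CARD('n) * t)) powr (1 / CARD('n))
        * (LINT x|lebesgue. indicator (high t) x * g x))"
proof -
  define \<rho> where "\<rho> = ((LINT y|lebesgue. g y) / (unit_ball_vol CARD('n) * t)) powr (1 / CARD('n))"
  let ?c = "2 * 5 ^ CARD('n) / t"
  have g_psi: "integrable lebesgue (\<lambda>x. g x * \<psi> x)"
  proof (rule Bochner_Integration.integrable_bound[OF g_int])
    show "(\<lambda>x. g x * \<psi> x) \<in> borel_measurable lebesgue"
      by (intro borel_measurable_times \<psi>(5) borel_measurable_integrable[OF g_int])
    show "AE x in lebesgue. norm (g x * \<psi> x) \<le> norm (g x)"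
      using \<psi>(1,2) g_nonneg by (intro AE_I2) (simp add: abs_mult mult_left_le)
  qed
  have int1: "integrable lebesgue (\<lambda>x. indicator (high t) x * (g x * \<psi> x))"
    and int2: "integrable lebesgue (\<lambda>x. indicator (high t) x * g x)"
    by (intro integrable_indicator_mult high_meas g_psi g_int)+
  have U_meas: "U t \<in> lmeasurable" by (rule weak_type_U(1)[OF t])
  have int3: "integrable lebesgue (\<lambda>x. indicator (U t) x * \<psi> x)"
  proof (rule Bochner_Integration.integrable_bound)
    show "integrable lebesgue (indicat_real (U t))" using U_meas by (simp add: lmeasurable_iff_integrable)
    show "(\<lambda>x. indicator (U t) x * \<psi> x) \<in> borel_measurable lebesgue"
      by (intro borel_measurable_times \<psi>(5) borel_measurable_indicator fmeasurableD U_meas)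
    show "AE x in lebesgue. norm (indicator (U t) x * \<psi> x) \<le> norm (indicat_real (U t) x)"
      using \<psi>(1,2) by (intro AE_I2) (simp add: indicator_def)
  qed
  have rhs: "indicator (high t) x * (g x * \<psi> x) + 6 * \<Lambda> * \<rho> * (indicator (high t) x * g x)
     = indicator (high t) x * (g x * (\<psi> x + 6 * \<Lambda> * \<rho>))" for x
    by (simp add: algebra_simps)
  have \<rho>0: "0 \<le> \<rho>" by (simp add: \<rho>_def)
  have "ennreal (LINT x|lebesgue. indicator (U t) x * \<psi> x) = (\<integral>\<^sup>+x. indicator (U t) x * ennreal (\<psi> x) \<partial>lebesgue)"
    by (subst nn_integral_eq_integral[OF int3, symmetric])
       (auto simp: \<psi>(1) ennreal_mult ennreal_indicator[symmetric] intro!: nn_integral_cong)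
  also have "\<dots> \<le> ennreal ?c * (\<integral>\<^sup>+x. indicator {x. t / 2 < g x} x * ennreal (g x * (\<psi> x + 6 * \<Lambda> * \<rho>)) \<partial>lebesgue)"
    using weighted_weak_type[OF g_int g_nonneg t \<psi>(1,3,4,5), of \<rho>] maximal_ball_radius[OF g_int g_nonneg t]
    by (auto simp: \<rho>_def intro: less_imp_le)
  also have "(\<integral>\<^sup>+x. indicator {x. t / 2 < g x} x * ennreal (g x * (\<psi> x + 6 * \<Lambda> * \<rho>)) \<partial>lebesgue)
     = (\<integral>\<^sup>+x. ennreal (indicator (high t) x * (g x * \<psi> x) + 6 * \<Lambda> * \<rho> * (indicator (high t) x * g x)) \<partial>lebesgue)"
    unfolding rhs by (intro nn_integral_cong) (simp add: high_def indicator_def)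
  also have "\<dots> = ennreal (LINT x|lebesgue. indicator (high t) x * (g x * \<psi> x) + 6 * \<Lambda> * \<rho> * (indicator (high t) x * g x))"
    using \<psi>(1,4) \<rho>0 g_nonneg
    by (intro nn_integral_eq_integral Bochner_Integration.integrable_add integrable_mult_right int1 int2)
       (auto intro!: add_nonneg_nonneg mult_nonneg_nonneg)
  also have "(LINT x|lebesgue. indicator (high t) x * (g x * \<psi> x) + 6 * \<Lambda> * \<rho> * (indicator (high t) x * g x))
     = (LINT x|lebesgue. indicator (high t) x * (g x * \<psi> x)) + 6 * \<Lambda> * \<rho> * (LINT x|lebesgue. indicator (high t) x * g x)"
    (is "_ = ?r") using int1 int2 by simp
  also have "ennreal ?c * ennreal ?r = ennreal (?c * ?r)"
    using t by (intro ennreal_mult'[symmetric]) simp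
  finally have "ennreal (LINT x|lebesgue. indicator (U t) x * \<psi> x) \<le> ennreal (?c * ?r)" .
  moreover have "0 \<le> ?c * ?r"
    using t \<psi>(1,4) \<rho>0 g_nonneg
    by (intro mult_nonneg_nonneg add_nonneg_nonneg integral_nonneg_AE AE_I2) auto
  ultimately show ?thesis
    unfolding \<rho>_def by (simp only: ennreal_le_iff)
qed

text \<open>Origin of the factors: n! from the expansion of minors, \<open>2 * kap\<close> for each
  slot from the Lipschitz constant of the smoothed map, and \<open>2 * 5 ^ CARD('n)\<close> from the
  weak type inequality.\<close>

definition main_const :: real where
  "main_const = fact CARD('n) * (2 * kap) ^ CARD('n) * (2 * 5 ^ CARD('n))"

text \<open>The weighted weak type inequality moves the right-hand side of the truncation estimate
  from \<open>U t\<close> to the set where \<open>g\<close> exceeds \<open>t / 2\<close>. As it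
  divides by \<open>t\<close>, the power t^n becomes t^(n-1) times an integral of \<open>g\<close>.
  Only dyadic \<open>t\<close> are kept.\<close>

lemma level_estimate:
  assumes s0: "0 < s0" and \<psi>: "Ck_domain (Suc 0) \<psi>" "\<And>x. 0 \<le> \<psi> x" "\<And>x. x \<notin> cball c0 (R - 2 * s0) \<Longrightarrow> \<psi> x = 0"
    and \<psi>_Lip: "\<And>y. \<psi> y \<le> 1" "\<And>x y. \<psi> x \<le> \<psi> y + \<Lambda> * dist x y" "0 \<le> \<Lambda>"
  obtains C k0 where "0 \<le> C"
    "\<And>k. k0 \<le> k \<Longrightarrow>
       \<bar>LINT x|lebesgue. indicator (- U (2 ^ k)) x * (\<psi> x * jacobian x + boundary_term \<psi> x)\<bar>
         \<le> L * main_const * 2 ^ (k * (CARD('n) - 1)) * (LINT x|lebesgue. indicator (high (2 ^ k)) x * (g x * \<psi> x))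
            + C * (2 ^ k) powr (real CARD('n) - 1 - gam) * (LINT x|lebesgue. indicator (high (2 ^ k)) x * g x)"
    "\<And>k. k0 \<le> k \<Longrightarrow> AE x in lebesgue. x \<notin> U (2 ^ k) \<longrightarrow> \<bar>boundary_term \<psi> x\<bar> \<le> C * (2 ^ k) powr (real CARD('n) - gam)"
    "\<And>k. k0 \<le> k \<Longrightarrow> measure lebesgue (U (2 ^ k)) \<le> C / 2 ^ k * (LINT x|lebesgue. indicator (high (2 ^ k)) x * g x)"
proof -
  let ?N = "CARD('n)"
  let ?a1 = "\<lambda>t. LINT x|lebesgue. indicator (high t) x * (g x * \<psi> x)"
  let ?a2 = "\<lambda>t. LINT x|lebesgue. indicator (high t) x * g x"
  obtain C where C: "0 \<le> C"
    "\<And>t. threshold s0 \<le> t \<Longrightarrow>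
       \<bar>LINT x|lebesgue. indicator (- U t) x * (\<psi> x * jacobian x + boundary_term \<psi> x)\<bar>
         \<le> L * (fact ?N * (2 * kap * t) ^ ?N) * (LINT x|lebesgue. indicator (U t) x * \<psi> x)
            + C * t powr (real ?N - gam) * measure lebesgue (U t)"
    "\<And>t. threshold s0 \<le> t \<Longrightarrow> AE x in lebesgue. x \<notin> U t \<longrightarrow> \<bar>boundary_term \<psi> x\<bar> \<le> C * t powr (real ?N - gam)"
    using truncation_estimate[OF s0 \<psi>] by blast
  have \<psi>_meas: "\<psi> \<in> borel_measurable lebesgue"
    using Ck_domain_continuous[OF \<psi>(1)] by (intro measurable_completion) (simp add: borel_measurable_continuous_onI)
  define B where "B = (LINT y|lebesgue. g y) / unit_ball_vol ?N"
  have B0: "0 \<le> B" using g_integral_nonneg by (simp add: B_def)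
  define w where "w = 2 * 5 ^ ?N * (1::real)"
  define D where "D = fact ?N * (2 * kap) ^ ?N * L * w * (6 * \<Lambda> * B powr (1 / ?N)) + C * w"
  have D0: "0 \<le> D" unfolding D_def w_def
    using L_nonneg kap_pos \<psi>_Lip(3) C(1) by (intro add_nonneg_nonneg mult_nonneg_nonneg) auto
  have a2: "0 \<le> ?a2 t" for t using g_nonneg by (intro integral_nonneg_AE AE_I2) auto
  have weak: "measure lebesgue (U t) \<le> w / t * ?a2 t" if "0 < t" for t
  proof -
    have "(LINT x|lebesgue. indicator (U t) x * 1) \<le> 2 * 5 ^ ?N / t * ((LINT x|lebesgue. indicator (high t) x * (g x * 1))
      + 6 * 0 * ((LINT y|lebesgue. g y) / (unit_ball_vol ?N * t)) powr (1 / ?N) * ?a2 t)"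
      by (rule weighted_weak_type_real) (use that in auto)
    then show ?thesis by (simp add: w_def)
  qed
  have main: "\<bar>LINT x|lebesgue. indicator (- U t) x * (\<psi> x * jacobian x + boundary_term \<psi> x)\<bar>
         \<le> L * main_const * t ^ (?N - 1) * ?a1 t + D * t powr (real ?N - 1 - gam) * ?a2 t" if t: "threshold s0 \<le> t" for t
  proof -
    have t1: "1 \<le> t" using t threshold_ge_1[of s0] by linarith
    then have t0: "0 < t" by linarith
    \<comment> \<open>The radii decay like t^(-1/n), at least as fast as t^(-gam), because
      \<open>gam\<close> is at most 1/n and \<open>t\<close> at least one. The error from moving the
      weight thus joins the lower order terms.\<close>
    have rho: "((LINT y|lebesgue. g y) / (unit_ball_vol ?N * t)) powr (1 / ?N) \<le> B powr (1 / ?N) * t powr (- gam)"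
    proof -
      have "((LINT y|lebesgue. g y) / (unit_ball_vol ?N * t)) powr (1 / ?N) = (B * inverse t) powr (1 / ?N)"
        by (simp add: B_def divide_inverse mult.assoc)
      also have "\<dots> = B powr (1 / ?N) * t powr (- (1 / ?N))"
        using t0 by (simp add: powr_mult powr_minus inverse_powr)
      also have "\<dots> \<le> B powr (1 / ?N) * t powr (- gam)"
        using t1 by (intro mult_left_mono powr_mono) (auto simp: gam_def divide_simps)
      finally show ?thesis .
    qed
    have tN: "t ^ ?N = t ^ (?N - 1) * t" by (metis One_nat_def Suc_pred mult.commute power_Suc zero_less_card_finite)
    have tp: "t powr (real ?N - gam) = t powr (real ?N - 1 - gam) * t"
      using t0 powr_mult_base[of t "real ?N - 1 - gam"] by (simp add: mult.commute)
    have tq: "t ^ (?N - 1) * t powr (- gam) = t powr (real ?N - 1 - gam)"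
    proof -
      have "t ^ (?N - 1) = t powr (real ?N - 1)"
        using powr_realpow[OF t0, of "?N - 1"] by (simp add: of_nat_diff)
      then show ?thesis by (simp only: powr_add[symmetric]) simp
    qed
    have "L * (fact ?N * (2 * kap * t) ^ ?N) * (LINT x|lebesgue. indicator (U t) x * \<psi> x)
       \<le> L * (fact ?N * (2 * kap * t) ^ ?N) * (w / t * (?a1 t + 6 * \<Lambda> * (B powr (1 / ?N) * t powr (- gam)) * ?a2 t))"
    proof (intro mult_left_mono)
      have "(LINT x|lebesgue. indicator (U t) x * \<psi> x) \<le> w / t * (?a1 t + 6 * \<Lambda> * ((LINT y|lebesgue. g y) / (unit_ball_vol ?N * t)) powr (1 / ?N) * ?a2 t)"
        unfolding w_def mult_1_right by (rule weighted_weak_type_real[OF \<psi>(2) \<psi>_Lip \<psi>_meas t0])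
      also have "\<dots> \<le> w / t * (?a1 t + 6 * \<Lambda> * (B powr (1 / ?N) * t powr (- gam)) * ?a2 t)"
        using rho t0 \<psi>_Lip(3) a2 by (intro mult_left_mono add_left_mono mult_right_mono) (auto simp: w_def)
      finally show "(LINT x|lebesgue. indicator (U t) x * \<psi> x) \<le> w / t * (?a1 t + 6 * \<Lambda> * (B powr (1 / ?N) * t powr (- gam)) * ?a2 t)" .
    qed (use L_nonneg kap_pos t0 in auto)
    also have "\<dots> = L * main_const * t ^ (?N - 1) * ?a1 t
        + (fact ?N * (2 * kap) ^ ?N * L * w * (6 * \<Lambda> * B powr (1 / ?N))) * (t ^ (?N - 1) * t powr (- gam)) * ?a2 t"
      unfolding power_mult_distrib[of "2 * kap" t] tN main_const_def w_def using t0 by (simp add: field_simps)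
    finally have 1: "L * (fact ?N * (2 * kap * t) ^ ?N) * (LINT x|lebesgue. indicator (U t) x * \<psi> x)
      \<le> L * main_const * t ^ (?N - 1) * ?a1 t
        + (fact ?N * (2 * kap) ^ ?N * L * w * (6 * \<Lambda> * B powr (1 / ?N))) * t powr (real ?N - 1 - gam) * ?a2 t"
      unfolding tq .
    have "C * t powr (real ?N - gam) * measure lebesgue (U t) \<le> C * t powr (real ?N - gam) * (w / t * ?a2 t)"
      using C(1) by (intro mult_left_mono weak[OF t0]) auto
    also have "\<dots> = C * w * t powr (real ?N - 1 - gam) * ?a2 t"
      unfolding tp using t0 by simp
    finally have "C * t powr (real ?N - gam) * measure lebesgue (U t) \<le> C * w * t powr (real ?N - 1 - gam) * ?a2 t" .
    with 1 C(2)[OF t] show ?thesis by (simp add: D_def distrib_right)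
  qed
  obtain k0 where k0: "threshold s0 \<le> 2 ^ k0"
    using real_arch_pow[of 2 "threshold s0"] by (auto intro: less_imp_le)
  have ge: "threshold s0 \<le> 2 ^ k" if "k0 \<le> k" for k
    using k0 power_increasing[OF that, of "2::real"] by linarith
  have "0 \<le> C + D + w" using C(1) D0 by (simp add: w_def)
  show thesis
  proof (rule that[of "C + D + w" k0])
    fix k assume k: "k0 \<le> k"
    have p: "(2 ^ k) ^ (?N - 1) = (2::real) ^ (k * (?N - 1))" by (simp add: power_mult)
    have "\<bar>LINT x|lebesgue. indicator (- U (2 ^ k)) x * (\<psi> x * jacobian x + boundary_term \<psi> x)\<bar>
         \<le> L * main_const * 2 ^ (k * (?N - 1)) * ?a1 (2 ^ k) + D * (2 ^ k) powr (real ?N - 1 - gam) * ?a2 (2 ^ k)"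
      using main[OF ge[OF k]] unfolding p .
    also have "D * (2 ^ k) powr (real ?N - 1 - gam) * ?a2 (2 ^ k) \<le> (C + D + w) * (2 ^ k) powr (real ?N - 1 - gam) * ?a2 (2 ^ k)"
      using C(1) by (intro mult_right_mono a2) (auto simp: w_def)
    finally show "\<bar>LINT x|lebesgue. indicator (- U (2 ^ k)) x * (\<psi> x * jacobian x + boundary_term \<psi> x)\<bar>
         \<le> L * main_const * 2 ^ (k * (?N - 1)) * ?a1 (2 ^ k) + (C + D + w) * (2 ^ k) powr (real ?N - 1 - gam) * ?a2 (2 ^ k)" by simp
    have le: "C * (2 ^ k) powr (real ?N - gam) \<le> (C + D + w) * (2 ^ k) powr (real ?N - gam)"
      using D0 by (intro mult_right_mono) (auto simp: w_def)
    show "AE x in lebesgue. x \<notin> U (2 ^ k) \<longrightarrow> \<bar>boundary_term \<psi> x\<bar> \<le> (C + D + w) * (2 ^ k) powr (real ?N - gam)"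
      using C(3)[OF ge[OF k]] by eventually_elim (use le in linarith)
    have "measure lebesgue (U (2 ^ k)) \<le> w / 2 ^ k * ?a2 (2 ^ k)" by (rule weak) simp
    also have "\<dots> \<le> (C + D + w) / 2 ^ k * ?a2 (2 ^ k)"
      using C(1) D0 by (intro mult_right_mono divide_right_mono a2) auto
    finally show "measure lebesgue (U (2 ^ k)) \<le> (C + D + w) / 2 ^ k * ?a2 (2 ^ k)" .
  qed fact
qed

end

subsection \<open>Sums over dyadic levels\<close>

text \<open>The summands grow at least by the factor 4/3 at each step, so the sum is comparable to
  its last term; in the induction the constant splits as 4 = 3 + 1. The bound
  \<open>2 \<le> E\<close> keeps the denominators from spoiling the growth.\<close>

lemma geometric_weight_sum:
  fixes v :: "nat \<Rightarrow> real"
  assumes v: "mono v" "0 \<le> v 0" and E: "2 \<le> E" and d: "1 \<le> (d::nat)"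
  shows "(\<Sum>k\<le>X. v k / (E + real k) * 2 ^ (k * d)) \<le> 4 * v X * 2 ^ (X * d) / (E + real X)"
proof (induction X)
  case 0
  then show ?case using v E by (simp add: field_simps)
next
  case (Suc X)
  have vX: "0 \<le> v X" "v X \<le> v (Suc X)"
    using v monoD[OF v(1), of 0 X] monoD[OF v(1), of X "Suc X"] by auto
  have le: "4 * (2 ^ (X * d) / (E + real X)) \<le> 3 * (2 ^ (Suc X * d) / (E + real (Suc X)))"
  proof -
    have "(2::real) \<le> 2 ^ d" using d power_increasing[of 1 d "2::real"] by simp
    have "4 * (E + real (Suc X)) \<le> 3 * 2 * (E + real X)" using E by simp
    also have "\<dots> \<le> 3 * 2 ^ d * (E + real X)"
      using \<open>2 \<le> 2 ^ d\<close> E by (intro mult_right_mono mult_left_mono) auto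
    finally have "4 * (E + real (Suc X)) * 2 ^ (X * d) \<le> 3 * 2 ^ d * (E + real X) * 2 ^ (X * d)"
      by (rule mult_right_mono) simp
    then show ?thesis using E by (simp add: field_simps power_add)
  qed
  have "v X * (4 * (2 ^ (X * d) / (E + real X))) \<le> v (Suc X) * (3 * (2 ^ (Suc X * d) / (E + real (Suc X))))"
    by (rule mult_mono[OF vX(2) le]) (use vX E in auto)
  note le2 = this
  have "(\<Sum>k\<le>Suc X. v k / (E + real k) * 2 ^ (k * d))
      = (\<Sum>k\<le>X. v k / (E + real k) * 2 ^ (k * d)) + v (Suc X) / (E + real (Suc X)) * 2 ^ (Suc X * d)"
    by (rule sum.atMost_Suc)
  also have "\<dots> \<le> 4 * v X * 2 ^ (X * d) / (E + real X) + v (Suc X) / (E + real (Suc X)) * 2 ^ (Suc X * d)"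
    by (rule add_right_mono[OF Suc.IH])
  also have "\<dots> = v X * (4 * (2 ^ (X * d) / (E + real X))) + v (Suc X) * (2 ^ (Suc X * d) / (E + real (Suc X)))"
    by simp
  also have "\<dots> \<le> v (Suc X) * (3 * (2 ^ (Suc X * d) / (E + real (Suc X)))) + v (Suc X) * (2 ^ (Suc X * d) / (E + real (Suc X)))"
    by (rule add_right_mono[OF le2])
  also have "\<dots> = 4 * v (Suc X) * 2 ^ (Suc X * d) / (E + real (Suc X))"
    by (simp only: times_divide_eq_right[symmetric] mult.assoc distrib_left[symmetric]) simp
  finally show ?case .
qed

text \<open>The dyadic level of \<open>y\<close>: the binary logarithm rounded up, and zero for
  \<open>y \<le> 1\<close>.\<close>

definition lev :: "real \<Rightarrow> nat" where
  "lev y = (LEAST K. y \<le> 2 ^ K)"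

lemma lev_le: "y \<le> 2 ^ lev y"
proof -
  obtain K where "y < 2 ^ K" using real_arch_pow[of 2 y] by auto
  then have "y \<le> 2 ^ K" by simp
  then show ?thesis unfolding lev_def by (rule LeastI)
qed

lemma less_lev_iff: "k < lev y \<longleftrightarrow> 2 ^ k < y"
proof
  assume "k < lev y"
  then show "2 ^ k < y" unfolding lev_def by (meson not_less not_less_Least)
next
  assume *: "2 ^ k < y"
  show "k < lev y"
  proof (rule ccontr)
    assume "\<not> k < lev y"
    then have "(2::real) ^ lev y \<le> 2 ^ k" by (intro power_increasing) auto
    with lev_le[of y] * show False by linarith
  qed
qed

lemma half_le_lev: "2 ^ k / 2 < y \<Longrightarrow> k \<le> lev y"
proof -
  assume "2 ^ k / 2 < y"
  then have "(2::real) ^ k < 2 ^ Suc (lev y)" using lev_le[of y] by simp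
  then show "k \<le> lev y" by (simp only: power_strict_increasing_iff)
qed

lemma lev_upper: "1 / 2 < y \<Longrightarrow> 2 ^ lev y \<le> 2 * y"
proof (cases "lev y")
  case (Suc k)
  then have "2 ^ k < y" using less_lev_iff[of k y] by simp
  then show ?thesis using Suc by simp
qed simp

text \<open>The terms grow geometrically, so the sum is governed by the highest level reached, about
  log y, where it is of order y^d / log y. The weight \<open>v\<close> is evaluated at a level cut
  at \<open>T - 1\<close>: the truncated weight, not the full one, must reappear when the estimate
  is absorbed.\<close>

lemma weighted_level_sum:
  fixes v :: "nat \<Rightarrow> real"
  assumes v: "mono v" "0 \<le> v 0" and E: "2 \<le> E" and d: "1 \<le> (d::nat)" and y: "0 \<le> y"
  shows "y * (\<Sum>k\<in>{k0..<T}. if 2 ^ k / 2 < y then v k / (E + real k) * 2 ^ (k * d) else 0)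
       \<le> 4 * 2 ^ d * v (min (lev y) (T - 1)) * (y ^ Suc d / (E + real (lev y)))"
proof -
  let ?t = "\<lambda>k. v k / (E + real k) * 2 ^ (k * d)"
  let ?X = "min (lev y) (T - 1)"
  have v0: "0 \<le> v k" for k using v monoD[OF v(1), of 0 k] by auto
  have t0: "0 \<le> ?t k" for k using v0 E by simp
  show ?thesis
  proof (cases "\<exists>k\<in>{k0..<T}. 2 ^ k / 2 < y")
    case False
    then have "(\<Sum>k\<in>{k0..<T}. if 2 ^ k / 2 < y then ?t k else 0) = 0" by (intro sum.neutral) auto
    then show ?thesis using v0 E y by simp
  next
    case True
    then obtain k where k: "k < T" "2 ^ k / 2 < y" by auto
    have "(1::real) \<le> 2 ^ k" by simp
    then have "1 / 2 < y" using k(2) by linarith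
    then have up: "2 ^ lev y \<le> 2 * y" by (rule lev_upper)
    have "(\<Sum>k\<in>{k0..<T}. if 2 ^ k / 2 < y then ?t k else 0) \<le> (\<Sum>k\<le>?X. ?t k)"
    proof -
      have "(\<Sum>k\<in>{k0..<T}. if 2 ^ k / 2 < y then ?t k else 0) = (\<Sum>k\<in>{k\<in>{k0..<T}. 2 ^ k / 2 < y}. ?t k)"
        by (rule sum.inter_filter[symmetric]) simp
      also have "\<dots> \<le> (\<Sum>k\<le>?X. ?t k)"
        by (rule sum_mono2) (use t0 half_le_lev[of _ y] in auto)
      finally show ?thesis .
    qed
    also have "\<dots> \<le> 4 * v ?X * 2 ^ (?X * d) / (E + real ?X)"
      by (rule geometric_weight_sum[OF v E d])
    also have "\<dots> \<le> 4 * v ?X * (2 ^ (lev y * d) / (E + real (lev y)))"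
    proof -
      have mono: "2 ^ (k * d) / (E + real k) \<le> 2 ^ (Suc k * d) / (E + real (Suc k))" for k
      proof -
        have "E + real (Suc k) \<le> 2 * (E + real k)" using E by simp
        also have "\<dots> \<le> 2 ^ d * (E + real k)"
          using d E power_increasing[of 1 d "2::real"] by (intro mult_right_mono) auto
        finally have "(E + real (Suc k)) * 2 ^ (k * d) \<le> 2 ^ d * (E + real k) * 2 ^ (k * d)"
          by (rule mult_right_mono) simp
        then show ?thesis using E by (simp add: field_simps power_add)
      qed
      have "2 ^ (?X * d) / (E + real ?X) \<le> 2 ^ (lev y * d) / (E + real (lev y))"
        by (rule lift_Suc_mono_le[of "\<lambda>k. 2 ^ (k * d) / (E + real k)"]) (use mono in auto)
      then have "4 * v ?X * (2 ^ (?X * d) / (E + real ?X)) \<le> 4 * v ?X * (2 ^ (lev y * d) / (E + real (lev y)))"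
        using v0 by (intro mult_left_mono) auto
      then show ?thesis by simp
    qed
    also have "\<dots> \<le> 4 * v ?X * ((2 * y) ^ d / (E + real (lev y)))"
    proof -
      have "2 ^ (lev y * d) \<le> (2 * y) ^ d"
        unfolding power_mult by (rule power_mono[OF up]) simp
      then show ?thesis using v0 E by (intro mult_left_mono divide_right_mono) auto
    qed
    finally have "y * (\<Sum>k\<in>{k0..<T}. if 2 ^ k / 2 < y then ?t k else 0) \<le> y * (4 * v ?X * ((2 * y) ^ d / (E + real (lev y))))"
      by (rule mult_left_mono[OF _ y])
    also have "\<dots> = 4 * 2 ^ d * v ?X * (y ^ Suc d / (E + real (lev y)))"
      by (simp add: power_mult_distrib)
    finally show ?thesis .
  qed
qed

lemma powr_level_sum:
  fixes \<beta> y :: real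
  assumes \<beta>: "0 < \<beta>" and y: "0 \<le> y"
  shows "y * (\<Sum>k\<in>{k0..<T}. if 2 ^ k / 2 < y then (2 ^ k) powr \<beta> else 0)
       \<le> 2 powr \<beta> * 2 powr \<beta> / (2 powr \<beta> - 1) * y powr (\<beta> + 1)"
proof -
  define r where "r = (2::real) powr \<beta>"
  have r: "1 < r" using \<beta> by (simp add: r_def)
  have rk: "(2 ^ k) powr \<beta> = r ^ k" for k
    by (simp add: r_def powr_realpow[symmetric] powr_powr mult.commute)
  show ?thesis
  proof (cases "\<exists>k\<in>{k0..<T}. 2 ^ k / 2 < y")
    case False
    then have "(\<Sum>k\<in>{k0..<T}. if 2 ^ k / 2 < y then (2 ^ k) powr \<beta> else 0) = 0" by (intro sum.neutral) auto
    then show ?thesis using r by (simp add: r_def)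
  next
    case True
    then obtain k where k: "k < T" "2 ^ k / 2 < y" by auto
    have "(1::real) \<le> 2 ^ k" by simp
    then have "1 / 2 < y" using k(2) by linarith
    then have up: "2 ^ lev y \<le> 2 * y" and y0: "0 < y" by (auto intro: lev_upper)
    have "(\<Sum>k\<in>{k0..<T}. if 2 ^ k / 2 < y then (2 ^ k) powr \<beta> else 0) = (\<Sum>k\<in>{k\<in>{k0..<T}. 2 ^ k / 2 < y}. r ^ k)"
      unfolding rk by (rule sum.inter_filter[symmetric]) simp
    also have "\<dots> \<le> (\<Sum>k\<le>lev y. r ^ k)"
      by (rule sum_mono2) (use r half_le_lev[of _ y] in auto)
    also have "\<dots> = (r ^ Suc (lev y) - 1) / (r - 1)"
      using r geometric_sum[of r "Suc (lev y)"] by (simp only: lessThan_Suc_atMost)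
    also have "\<dots> \<le> r ^ Suc (lev y) / (r - 1)"
      using r by (intro divide_right_mono) auto
    also have "\<dots> = r / (r - 1) * (2 ^ lev y) powr \<beta>"
      unfolding rk by simp
    also have "\<dots> \<le> r / (r - 1) * (2 * y) powr \<beta>"
      using r up \<beta> by (intro mult_left_mono powr_mono2) auto
    finally have "y * (\<Sum>k\<in>{k0..<T}. if 2 ^ k / 2 < y then (2 ^ k) powr \<beta> else 0) \<le> y * (r / (r - 1) * (2 * y) powr \<beta>)"
      by (rule mult_left_mono[OF _ y])
    also have "\<dots> = r * r / (r - 1) * (y powr \<beta> * y)"
      by (simp add: powr_mult r_def[symmetric])
    also have "y powr \<beta> * y = y powr (\<beta> + 1)"
      using y0 by (simp add: powr_add)
    finally show ?thesis by (simp add: r_def)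
  qed
qed

section \<open>Elementary inequalities for powers and exponentials\<close>

lemma power_div_fact_le_exp:
  fixes y :: real
  assumes "0 \<le> y"
  shows "y ^ n / fact n \<le> exp y"
  using sum_le_suminf[OF summable_exp_generic[of y], of "{n}"] assms
  by (simp add: exp_def divide_inverse mult.commute)

lemma powr_le_exp:
  fixes a c :: real
  assumes "0 < c" "0 \<le> a"
  obtains C where "0 < C" "\<And>x. 1 \<le> x \<Longrightarrow> x powr a \<le> C * exp (c * x)"
proof -
  define n where "n = nat \<lceil>a\<rceil>"
  show thesis
  proof (rule that[of "fact n / c ^ n"])
    show "0 < fact n / c ^ n" using assms by simp
    fix x :: real assume x: "1 \<le> x"
    have "x powr a \<le> x powr real n"
      using x real_nat_ceiling_ge[of a] by (intro powr_mono) (auto simp: n_def)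
    also have "\<dots> = x ^ n" using x by (simp add: powr_realpow)
    also have "\<dots> \<le> fact n / c ^ n * exp (c * x)"
    proof -
      have "(c * x) ^ n / fact n \<le> exp (c * x)"
        using assms x by (intro power_div_fact_le_exp) simp
      then show ?thesis using assms by (simp add: field_simps power_mult_distrib)
    qed
    finally show "x powr a \<le> fact n / c ^ n * exp (c * x)" .
  qed
qed

text \<open>The derivative \<open>a * z powr (a - 1)\<close> is written as
  \<open>a * z powr a / z\<close>, so that one bound serves exponents on both sides of one. The
  factor \<open>a\<close> is what later makes the sum absorbable for small \<open>a\<close>.\<close>

lemma powr_increment_le:
  fixes a s :: real
  assumes "0 < a" "1 \<le> s"
  shows "(s + 1) powr a - s powr a \<le> a * (s + 1) powr a / s"
proof -
  have "((\<lambda>s. s powr a) has_real_derivative a * z powr (a - 1)) (at z)" if "s \<le> z" for z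
    using that assms by (auto intro!: derivative_eq_intros)
  then obtain z where z: "s < z" "z < s + 1" "(s + 1) powr a - s powr a = (s + 1 - s) * (a * z powr (a - 1))"
    using MVT2[of s "s + 1" "\<lambda>s. s powr a" "\<lambda>z. a * z powr (a - 1)"] by auto
  have "z powr (a - 1) = z powr a / z"
    using z assms by (simp add: powr_diff)
  also have "\<dots> \<le> (s + 1) powr a / s"
    using z assms by (intro frac_le powr_mono2) auto
  finally have "a * z powr (a - 1) \<le> a * ((s + 1) powr a / s)"
    using assms by (intro mult_left_mono) auto
  then show ?thesis using z by simp
qed

text \<open>The quotient is at most exp(a/s), hence at most exp(1/2), by the lower bound on
  \<open>E\<close>. It allows the weight at the next level to be replaced by the current one at the
  cost of a factor 2.\<close>

lemma powr_Suc_le_double: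
  fixes a E :: real
  assumes "0 < a" "2 * a \<le> E" "2 \<le> E"
  shows "(E + real k + 1) powr a \<le> 2 * (E + real k) powr a"
proof -
  define s where "s = E + real k"
  have s: "2 \<le> s" "2 * a \<le> s" using assms by (auto simp: s_def)
  have "(1 + 1 / s) powr a \<le> exp (1 / s) powr a"
    using s assms by (intro powr_mono2) (auto intro: exp_ge_add_one_self)
  also have "\<dots> = exp (a / s)" by (simp add: powr_def)
  also have "\<dots> \<le> exp (1 / 2)" using s assms by (simp add: field_simps)
  also have "\<dots> \<le> 2"
  proof -
    have "(exp (1 / 2 :: real))\<^sup>2 = exp 1"
      by (simp add: power2_eq_square flip: exp_add)
    then have "(exp (1 / 2 :: real))\<^sup>2 \<le> 2\<^sup>2"
      using exp_le by simp
    then show ?thesis by (rule power2_le_imp_le) simp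
  qed
  finally have "s powr a * (1 + 1 / s) powr a \<le> s powr a * 2"
    by (rule mult_left_mono) simp
  moreover have "(s + 1) powr a = s powr a * (1 + 1 / s) powr a"
  proof -
    have "s + 1 = s * (1 + 1 / s)" using s by (simp add: field_simps)
    then show ?thesis by (metis powr_mult)
  qed
  ultimately show ?thesis by (simp add: s_def mult.commute[of _ 2])
qed

subsection \<open>Distortion and absorption\<close>

text \<open>\<open>c\<close> stands for a positive lower bound of the comass. The factor n^n in the
  distortion inequality appears because \<open>g\<close> is a sum of n column norms, hence at most n
  times the operator norm.\<close>

locale distortion_curve = cutoff_curve m \<phi> L f Df c0 R
  for m and \<phi> :: "'n::{finite,linorder} form" and L
    and f :: "(real, 'n) vec \<Rightarrow> nat \<Rightarrow> real" and Df :: "(real, 'n) vec \<Rightarrow> 'n \<Rightarrow> nat \<Rightarrow> real"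
    and c0 and R +
  fixes Kf :: "(real, 'n) vec \<Rightarrow> real" and lam c :: real
  assumes N2: "2 \<le> CARD('n)" and c_pos: "0 < c" and lam_pos: "0 < lam"
    and dist: "AE x in lebesgue. x \<in> cball c0 R \<longrightarrow>
       0 \<le> jacobian x \<and> 1 \<le> Kf x \<and> c * g x ^ CARD('n) \<le> real CARD('n) ^ CARD('n) * Kf x * jacobian x"
    and J_int: "integrable lebesgue jacobian"
    and exp_int: "integrable lebesgue (\<lambda>x. indicator (cball c0 R) x * exp (lam * Kf x))"
begin

definition ex :: "(real, 'n) vec \<Rightarrow> real" where
  "ex x = indicator (cball c0 R) x * exp (lam * Kf x)"

lemma ex_nonneg: "0 \<le> ex x" by (simp add: ex_def)

lemma ex_int: "integrable lebesgue ex" using exp_int by (simp add: ex_def[abs_def])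

text \<open>Halfway between n - gam, the order of the boundary terms, and the critical exponent n.
  The distance \<open>gam / 2\<close> to the former leaves room for logarithmic weights, the
  distance to the latter makes the power of \<open>g\<close> integrable.\<close>

definition qexp :: real where "qexp = real CARD('n) - gam / 2"

lemma qexp_bounds: "0 < qexp" "0 < qexp - 1"
  using N2 gam_bounds by (auto simp: qexp_def)

lemma jacobian_zero: "x \<notin> cball c0 R \<Longrightarrow> jacobian x = 0"
proof -
  assume x: "x \<notin> cball c0 R"
  then have "enorm m (Df x l) = 0" for l by (simp add: enorm_def L2_set_def Df_zero)
  then show ?thesis
    using abs_form_eval_le[where \<phi> = \<phi> and L = L, OF L[OF f_Rm[of x]], of "Df x"] by (simp add: jacobian_def power_0_left)
qed

lemma jacobian_nonneg: "AE x in lebesgue. 0 \<le> jacobian x"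
  using dist by eventually_elim (use jacobian_zero in force)

text \<open>Where \<open>Kf x\<close> is at most \<open>g x powr \<delta>\<close>, the distortion
  inequality can be divided by that factor, and the remaining power of \<open>g\<close> is bounded
  by the Jacobian. Elsewhere \<open>exp (lam * Kf x)\<close> dominates any power of
  \<open>g x\<close>.\<close>

lemma g_powr_int: "integrable lebesgue (\<lambda>x. g x powr qexp)"
proof -
  define \<delta> where "\<delta> = gam / 2"
  have \<delta>: "0 < \<delta>" using gam_bounds by (simp add: \<delta>_def)
  obtain C where C: "0 < C" "\<And>x. 1 \<le> x \<Longrightarrow> x powr (qexp / \<delta>) \<le> C * exp (lam * x)"
    using powr_le_exp[OF lam_pos, of "qexp / \<delta>"] qexp_bounds \<delta> by auto
  define C' where "C' = real CARD('n) ^ CARD('n) / c"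
  have C': "0 \<le> C'" using c_pos by (simp add: C'_def)
  show ?thesis
  proof (rule Bochner_Integration.integrable_bound)
    show "integrable lebesgue (\<lambda>x. indicator (cball c0 R) x + C' * jacobian x + C * ex x)"
      using lmeasurable_cball[of c0 R] unfolding lmeasurable_iff_integrable
      by (intro Bochner_Integration.integrable_add integrable_mult_right J_int ex_int)
    show "(\<lambda>x. g x powr qexp) \<in> borel_measurable lebesgue"
      using borel_measurable_integrable[OF g_int] by measurable
    show "AE x in lebesgue. norm (g x powr qexp) \<le> norm (indicator (cball c0 R) x + C' * jacobian x + C * ex x)"
      using dist
    proof eventually_elim
      case (elim x)
      show ?case
      proof (cases "x \<in> cball c0 R")
        case False
        then show ?thesis by (simp add: g_zero)
      next
        case True
        then have J: "0 \<le> jacobian x" "1 \<le> Kf x" "c * g x ^ CARD('n) \<le> real CARD('n) ^ CARD('n) * Kf x * jacobian x" using elim by auto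
        have nonneg: "0 \<le> C' * jacobian x" "0 \<le> C * ex x"
          using J C' C(1) ex_nonneg by auto
        have "g x powr qexp \<le> 1 + C' * jacobian x + C * ex x"
        proof (cases "g x \<le> 1")
          case le: True
          have "g x powr qexp \<le> 1 powr qexp"
            using le g_nonneg qexp_bounds by (intro powr_mono2) auto
          then show ?thesis using nonneg by simp
        next
          case False
          then have y: "1 < g x" by simp
          show ?thesis
          proof (cases "Kf x \<le> g x powr \<delta>")
            case True
            have "g x powr qexp * g x powr \<delta> = g x ^ CARD('n)"
              using y powr_realpow[of "g x" "CARD('n)"] by (simp add: powr_add[symmetric] qexp_def \<delta>_def)
            moreover have "real CARD('n) ^ CARD('n) * Kf x * jacobian x \<le> real CARD('n) ^ CARD('n) * g x powr \<delta> * jacobian x"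
              using True J(1) by (intro mult_right_mono mult_left_mono) auto
            ultimately have "c * g x powr qexp * g x powr \<delta> \<le> (real CARD('n) ^ CARD('n) * jacobian x) * g x powr \<delta>"
              using J(3) by (simp only: mult_ac)
            then have "c * g x powr qexp \<le> real CARD('n) ^ CARD('n) * jacobian x"
              using y by (subst (asm) mult_le_cancel_right_pos) auto
            then have "g x powr qexp \<le> C' * jacobian x"
              using c_pos by (simp add: C'_def field_simps)
            then show ?thesis using nonneg by linarith
          next
            case False
            have "1 \<le> g x powr \<delta>" using y \<delta> by (intro ge_one_powr_ge_zero) auto
            then have "(g x powr \<delta>) powr (qexp / \<delta>) \<le> C * exp (lam * g x powr \<delta>)" by (rule C(2))
            also have "\<dots> \<le> C * exp (lam * Kf x)"
              using False C(1) lam_pos by simp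
            also have "\<dots> = C * ex x" using \<open>x \<in> cball c0 R\<close> by (simp add: ex_def)
            finally have "g x powr qexp \<le> C * ex x" using \<delta> by (simp add: powr_powr)
            then show ?thesis using nonneg by linarith
          qed
        qed
        then show ?thesis using True nonneg by simp
      qed
    qed
  qed
qed

text \<open>Origin of the factors: \<open>4 * 2 ^ (CARD('n) - 1)\<close> from the sum over levels,
  n^n and 1/c from the distortion inequality, and 2n/lam from the bound on \<open>Kf\<close> in the
  main case of the split below.\<close>

definition absorb_const :: real where
  "absorb_const = 4 * 2 ^ (CARD('n) - 1) * real CARD('n) ^ CARD('n) * (2 * real CARD('n)) / (c * lam)"

lemma absorb_const_nonneg: "0 \<le> absorb_const"
  using c_pos lam_pos by (simp add: absorb_const_def)

text \<open>
  The exponential integrability of the distortion enters here: either \<open>Kf x\<close> is at most of the order of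
  the logarithm of \<open>g x\<close>, or \<open>ex x\<close> dominates every power of \<open>g x\<close> that occurs.
\<close>

lemma distortion_split:
  assumes E: "2 \<le> E"
  shows "AE x in lebesgue. \<forall>v Cv. 0 \<le> v \<longrightarrow> v \<le> Cv * 2 ^ lev (g x) \<longrightarrow>
    4 * 2 ^ (CARD('n) - 1) * v * (g x ^ CARD('n) / (E + real (lev (g x)))) \<le> absorb_const * v * jacobian x + 4 * 2 ^ (CARD('n) - 1) * Cv * ex x"
  using dist
proof eventually_elim
  case (elim x)
  show ?case
  proof (intro allI impI)
    fix v Cv :: real assume v: "0 \<le> v" "v \<le> Cv * 2 ^ lev (g x)"
    let ?K = "lev (g x)"
    have "0 \<le> Cv * 2 ^ ?K" using v by linarith
    then have Cv: "0 \<le> Cv" by (metis mult_neg_pos not_less zero_less_numeral zero_less_power)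
    show "4 * 2 ^ (CARD('n) - 1) * v * (g x ^ CARD('n) / (E + real ?K)) \<le> absorb_const * v * jacobian x + 4 * 2 ^ (CARD('n) - 1) * Cv * ex x"
    proof (cases "x \<in> cball c0 R")
      case False
      then show ?thesis using Cv by (simp add: g_zero jacobian_zero ex_def power_0_left)
    next
      case True
      then have J: "0 \<le> jacobian x" "1 \<le> Kf x" "c * g x ^ CARD('n) \<le> real CARD('n) ^ CARD('n) * Kf x * jacobian x" using elim by auto
      have nonneg: "0 \<le> absorb_const * v * jacobian x" "0 \<le> 4 * 2 ^ (CARD('n) - 1) * Cv * ex x"
        using J v Cv ex_nonneg absorb_const_nonneg by auto
      show ?thesis
      \<comment> \<open>In the second case the exponential has to dominate \<open>v\<close> times
        the n-th power of \<open>g\<close>, that is, 2 raised to n + 1 times the level. Since n + 1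
        is at most 2n, the factor 2n in the split suffices.\<close>
      proof (cases "lam * Kf x \<le> 2 * real CARD('n) * (E + real ?K)")
        case True
        then have "Kf x \<le> 2 * real CARD('n) * (E + real ?K) / lam" using lam_pos by (simp add: field_simps)
        then have "real CARD('n) ^ CARD('n) * Kf x * jacobian x \<le> real CARD('n) ^ CARD('n) * (2 * real CARD('n) * (E + real ?K) / lam) * jacobian x"
          using J by (intro mult_right_mono mult_left_mono) auto
        with J(3) have "c * g x ^ CARD('n) \<le> real CARD('n) ^ CARD('n) * (2 * real CARD('n) * (E + real ?K) / lam) * jacobian x" by linarith
        then have "g x ^ CARD('n) / (E + real ?K) \<le> real CARD('n) ^ CARD('n) * (2 * real CARD('n)) / (c * lam) * jacobian x"
          using c_pos lam_pos E by (simp add: field_simps)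
        then have "4 * 2 ^ (CARD('n) - 1) * v * (g x ^ CARD('n) / (E + real ?K)) \<le> 4 * 2 ^ (CARD('n) - 1) * v * (real CARD('n) ^ CARD('n) * (2 * real CARD('n)) / (c * lam) * jacobian x)"
          using v by (intro mult_left_mono) auto
        also have "\<dots> = absorb_const * v * jacobian x"
          by (simp add: absorb_const_def)
        finally show ?thesis using nonneg by linarith
      next
        case False
        have "g x ^ CARD('n) \<le> (2 ^ ?K) ^ CARD('n)"
          using lev_le[of "g x"] g_nonneg[of x] by (intro power_mono) auto
        moreover have "1 \<le> E + real ?K" using E by simp
        ultimately have "g x ^ CARD('n) / (E + real ?K) \<le> (2 ^ ?K) ^ CARD('n) / 1"
          using g_nonneg[of x] by (intro frac_le) auto
        then have "v * (g x ^ CARD('n) / (E + real ?K)) \<le> (Cv * 2 ^ ?K) * (2 ^ ?K) ^ CARD('n)"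
          using v Cv g_nonneg[of x] E by (intro mult_mono) auto
        also have "\<dots> = Cv * 2 ^ (?K * Suc CARD('n))"
          by (simp add: power_mult[symmetric] power_add)
        also have "(2::real) ^ (?K * Suc CARD('n)) \<le> exp 1 ^ (?K * Suc CARD('n))"
          using exp_ge_add_one_self[of "1::real"] by (intro power_mono) auto
        then have "Cv * 2 ^ (?K * Suc CARD('n)) \<le> Cv * exp (real (?K * Suc CARD('n)))"
          using Cv by (intro mult_left_mono) (simp add: exp_of_nat_mult[symmetric])
        also have "\<dots> \<le> Cv * exp (lam * Kf x)"
        proof -
          have "real (?K * Suc CARD('n)) \<le> real (2 * CARD('n) * ?K)"
            using N2 by (intro of_nat_mono) (simp add: mult.commute)
          also have "\<dots> \<le> 2 * real CARD('n) * (E + real ?K)" using E by (simp add: distrib_left)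
          finally have "real (?K * Suc CARD('n)) \<le> lam * Kf x" using False by linarith
          then show ?thesis using Cv by (simp add: mult_left_mono)
        qed
        also have "\<dots> = Cv * ex x" using \<open>x \<in> cball c0 R\<close> by (simp add: ex_def)
        finally have "4 * 2 ^ (CARD('n) - 1) * (v * (g x ^ CARD('n) / (E + real ?K))) \<le> 4 * 2 ^ (CARD('n) - 1) * (Cv * ex x)"
          by (intro mult_left_mono) auto
        then show ?thesis using nonneg by (simp add: mult.assoc)
      qed
    qed
  qed
qed

definition level_const :: real where
  "level_const = 2 powr (qexp - 1) * 2 powr (qexp - 1) / (2 powr (qexp - 1) - 1)"

lemma level_const_bound:
  "g x * (\<Sum>k\<in>{k0..<T}. if 2 ^ k / 2 < g x then (2 ^ k) powr (qexp - 1) else 0) \<le> level_const * g x powr qexp"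
  using powr_level_sum[OF qexp_bounds(2) g_nonneg[of x]] by (simp add: level_const_def)

lemma lev_measurable: "(\<lambda>x. lev (g x)) \<in> measurable lebesgue (count_space UNIV)"
  unfolding lev_def using borel_measurable_integrable[OF g_int] by measurable

lemma g_psi_int:
  assumes "\<And>x. 0 \<le> \<psi> x" "\<And>x. \<psi> x \<le> 1" "\<psi> \<in> borel_measurable lebesgue" "integrable lebesgue h"
  shows "integrable lebesgue (\<lambda>x. \<psi> x * h x :: real)"
proof (rule Bochner_Integration.integrable_bound[OF assms(4)])
  show "(\<lambda>x. \<psi> x * h x) \<in> borel_measurable lebesgue"
    by (intro borel_measurable_times assms(3) borel_measurable_integrable[OF assms(4)])
  show "AE x in lebesgue. norm (\<psi> x * h x) \<le> norm (h x)"
    using assms(1,2) by (intro AE_I2) (simp add: abs_mult mult_left_le_one_le)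
qed

text \<open>Sum and integral are exchanged and the levels are summed pointwise. The main part is of
  order g^n / log g, with weight \<open>v\<close>, and is passed to the Jacobian by the distortion
  split; the lower order part is a multiple of \<open>g powr qexp\<close>. The two uses have weights
  1/(k+2) and the increments of a power of the level.\<close>

lemma level_sum_bound:
  fixes u v :: "nat \<Rightarrow> real"
  assumes \<psi>: "\<And>x. 0 \<le> \<psi> x" "\<And>x. \<psi> x \<le> 1" "\<psi> \<in> borel_measurable lebesgue"
    and u: "\<And>k. 0 \<le> u k" "\<And>k. u k \<le> v k / (E + real k)" and v: "mono v" "0 \<le> v 0" "\<And>k. v k \<le> Cv * (2 ^ k) powr (gam / 2)"
    and E: "2 \<le> E" and C: "0 \<le> A" "0 \<le> C"
  shows "integrable lebesgue (\<lambda>x. \<psi> x * (v (min (lev (g x)) (T - 1)) * jacobian x))"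
    and "(\<Sum>k\<in>{k0..<T}. u k * (A * 2 ^ (k * (CARD('n) - 1)) * (LINT x|lebesgue. indicator (high (2 ^ k)) x * (g x * \<psi> x))
            + C * (2 ^ k) powr (real CARD('n) - 1 - gam) * (LINT x|lebesgue. indicator (high (2 ^ k)) x * g x)))
      \<le> A * (absorb_const * (LINT x|lebesgue. \<psi> x * (v (min (lev (g x)) (T - 1)) * jacobian x))
            + 4 * 2 ^ (CARD('n) - 1) * Cv * (LINT x|lebesgue. ex x))
         + C * Cv * level_const * (LINT x|lebesgue. g x powr qexp)"
proof -
  let ?X = "\<lambda>x. min (lev (g x)) (T - 1)"
  have v0: "0 \<le> v k" for k using v monoD[OF v(1), of 0 k] by auto
  have Cv: "0 \<le> Cv" using v0[of 0] v(3)[of 0] by simp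
  have X_meas: "(\<lambda>x. v (?X x)) \<in> borel_measurable lebesgue"
    by (rule measurable_compose[OF lev_measurable, of "\<lambda>k. v (min k (T - 1))"]) simp
  have vJ: "integrable lebesgue (\<lambda>x. v (?X x) * jacobian x)"
  proof (rule Bochner_Integration.integrable_bound[OF integrable_mult_right[OF J_int, of "v (T - 1)"]])
    show "(\<lambda>x. v (?X x) * jacobian x) \<in> borel_measurable lebesgue"
      by (intro borel_measurable_times X_meas jacobian_measurable)
    show "AE x in lebesgue. norm (v (?X x) * jacobian x) \<le> norm (v (T - 1) * jacobian x)"
      using v0 monoD[OF v(1)] by (intro AE_I2) (auto simp: abs_mult intro!: mult_right_mono)
  qed
  show int1: "integrable lebesgue (\<lambda>x. \<psi> x * (v (?X x) * jacobian x))"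
    by (rule g_psi_int[OF \<psi> vJ])
  have gpsi: "integrable lebesgue (\<lambda>x. g x * \<psi> x)"
    using g_psi_int[OF \<psi> g_int] by (simp add: mult.commute)
  have hi1: "integrable lebesgue (\<lambda>x. indicator (high (2 ^ k)) x * (g x * \<psi> x))"
    and hi2: "integrable lebesgue (\<lambda>x. indicator (high (2 ^ k)) x * g x)" for k
    by (intro integrable_indicator_mult high_meas gpsi g_int)+
  let ?l = "\<lambda>x. \<Sum>k\<in>{k0..<T}. u k * (A * 2 ^ (k * (CARD('n) - 1)) * (indicator (high (2 ^ k)) x * (g x * \<psi> x))
            + C * (2 ^ k) powr (real CARD('n) - 1 - gam) * (indicator (high (2 ^ k)) x * g x))"
  let ?r = "\<lambda>x. A * (absorb_const * (\<psi> x * (v (?X x) * jacobian x)) + 4 * 2 ^ (CARD('n) - 1) * Cv * ex x)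
         + C * Cv * level_const * g x powr qexp"
  have "(\<Sum>k\<in>{k0..<T}. u k * (A * 2 ^ (k * (CARD('n) - 1)) * (LINT x|lebesgue. indicator (high (2 ^ k)) x * (g x * \<psi> x))
            + C * (2 ^ k) powr (real CARD('n) - 1 - gam) * (LINT x|lebesgue. indicator (high (2 ^ k)) x * g x)))
      = (LINT x|lebesgue. ?l x)"
    using hi1 hi2 by simp
  also have "\<dots> \<le> (LINT x|lebesgue. ?r x)"
  proof (rule integral_mono_AE)
    show "integrable lebesgue ?l"
      using hi1 hi2 by (intro Bochner_Integration.integrable_sum integrable_mult_right Bochner_Integration.integrable_add)
    show "integrable lebesgue ?r"
      by (intro Bochner_Integration.integrable_add integrable_mult_right int1 ex_int g_powr_int)
    show "AE x in lebesgue. ?l x \<le> ?r x"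
      using distortion_split[OF E]
    proof eventually_elim
      case (elim x)
      have ind: "indicator (high (2 ^ k)) x = (if 2 ^ k / 2 < g x then 1 else 0 :: real)" for k
        by (simp add: high_def)
      have l_eq: "?l x = A * \<psi> x * (g x * (\<Sum>k\<in>{k0..<T}. if 2 ^ k / 2 < g x then u k * 2 ^ (k * (CARD('n) - 1)) else 0))
         + C * (g x * (\<Sum>k\<in>{k0..<T}. if 2 ^ k / 2 < g x then u k * (2 ^ k) powr (real CARD('n) - 1 - gam) else 0))"
        unfolding ind sum_distrib_left sum.distrib[symmetric] by (intro sum.cong refl) (simp add: algebra_simps)
      have u': "u k * 2 ^ (k * (CARD('n) - Suc 0)) \<le> v k * 2 ^ (k * (CARD('n) - Suc 0)) / (E + real k)" for k
        using mult_right_mono[OF u(2)[of k], of "2 ^ (k * (CARD('n) - Suc 0))"] by simp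
      have "g x * (\<Sum>k\<in>{k0..<T}. if 2 ^ k / 2 < g x then u k * 2 ^ (k * (CARD('n) - 1)) else 0)
         \<le> g x * (\<Sum>k\<in>{k0..<T}. if 2 ^ k / 2 < g x then v k / (E + real k) * 2 ^ (k * (CARD('n) - 1)) else 0)"
        using u' g_nonneg by (intro mult_left_mono sum_mono) auto
      also have "\<dots> \<le> 4 * 2 ^ (CARD('n) - 1) * v (?X x) * (g x ^ Suc (CARD('n) - 1) / (E + real (lev (g x))))"
        using N2 by (intro weighted_level_sum[OF v(1,2) E] g_nonneg) auto
      also have "Suc (CARD('n) - 1) = CARD('n)" using N2 by simp
      also have "4 * 2 ^ (CARD('n) - 1) * v (?X x) * (g x ^ CARD('n) / (E + real (lev (g x))))
         \<le> absorb_const * v (?X x) * jacobian x + 4 * 2 ^ (CARD('n) - 1) * Cv * ex x"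
      proof -
        have "v (?X x) \<le> v (lev (g x))" using monoD[OF v(1)] by simp
        also have "\<dots> \<le> Cv * (2 ^ lev (g x)) powr (gam / 2)" by (rule v(3))
        also have "\<dots> \<le> Cv * (2 ^ lev (g x)) powr 1"
          using Cv gam_bounds by (intro mult_left_mono powr_mono) auto
        finally have "v (?X x) \<le> Cv * 2 ^ lev (g x)" by simp
        then show ?thesis using elim v0 by blast
      qed
      finally have 1: "A * \<psi> x * (g x * (\<Sum>k\<in>{k0..<T}. if 2 ^ k / 2 < g x then u k * 2 ^ (k * (CARD('n) - 1)) else 0))
        \<le> A * \<psi> x * (absorb_const * v (?X x) * jacobian x + 4 * 2 ^ (CARD('n) - 1) * Cv * ex x)"
        using C(1) \<psi>(1) by (intro mult_left_mono) auto
      also have "\<dots> \<le> A * (absorb_const * (\<psi> x * (v (?X x) * jacobian x)) + 4 * 2 ^ (CARD('n) - 1) * Cv * ex x)"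
      proof -
        have "\<psi> x * (4 * 2 ^ (CARD('n) - 1) * Cv * ex x) \<le> 4 * 2 ^ (CARD('n) - 1) * Cv * ex x"
          using \<psi> Cv ex_nonneg[of x] by (intro mult_left_le_one_le) auto
        then have "A * (\<psi> x * (absorb_const * v (?X x) * jacobian x) + \<psi> x * (4 * 2 ^ (CARD('n) - 1) * Cv * ex x))
          \<le> A * (\<psi> x * (absorb_const * v (?X x) * jacobian x) + 4 * 2 ^ (CARD('n) - 1) * Cv * ex x)"
          using C(1) by (intro mult_left_mono) auto
        then show ?thesis by (simp add: algebra_simps)
      qed
      finally have 1: "A * \<psi> x * (g x * (\<Sum>k\<in>{k0..<T}. if 2 ^ k / 2 < g x then u k * 2 ^ (k * (CARD('n) - 1)) else 0))
        \<le> A * (absorb_const * (\<psi> x * (v (?X x) * jacobian x)) + 4 * 2 ^ (CARD('n) - 1) * Cv * ex x)" .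
      have uk: "u k * (2 ^ k) powr (real CARD('n) - 1 - gam) \<le> Cv * (2 ^ k) powr (qexp - 1)" for k
      proof -
        have "u k \<le> v k / (E + real k)" by (rule u(2))
        also have "\<dots> \<le> v k / 1" using v0 E by (intro divide_left_mono) auto
        also have "\<dots> \<le> Cv * (2 ^ k) powr (gam / 2)" using v(3) by simp
        finally have "u k * (2 ^ k) powr (real CARD('n) - 1 - gam) \<le> Cv * (2 ^ k) powr (gam / 2) * (2 ^ k) powr (real CARD('n) - 1 - gam)"
          by (rule mult_right_mono) simp
        also have "\<dots> = Cv * (2 ^ k) powr (qexp - 1)"
          by (simp add: mult.assoc powr_add[symmetric] qexp_def algebra_simps)
        finally show ?thesis .
      qed
      have "g x * (\<Sum>k\<in>{k0..<T}. if 2 ^ k / 2 < g x then u k * (2 ^ k) powr (real CARD('n) - 1 - gam) else 0)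
        \<le> g x * (\<Sum>k\<in>{k0..<T}. Cv * (if 2 ^ k / 2 < g x then (2 ^ k) powr (qexp - 1) else 0))"
        using uk g_nonneg by (intro mult_left_mono sum_mono) auto
      also have "\<dots> = Cv * (g x * (\<Sum>k\<in>{k0..<T}. if 2 ^ k / 2 < g x then (2 ^ k) powr (qexp - 1) else 0))"
        by (simp only: sum_distrib_left[symmetric] mult.left_commute)
      also have "\<dots> \<le> Cv * (level_const * g x powr qexp)"
        by (rule mult_left_mono[OF level_const_bound Cv])
      finally have "C * (g x * (\<Sum>k\<in>{k0..<T}. if 2 ^ k / 2 < g x then u k * (2 ^ k) powr (real CARD('n) - 1 - gam) else 0))
        \<le> C * (Cv * (level_const * g x powr qexp))"
        using C(2) by (rule mult_left_mono)
      with 1 show ?case unfolding l_eq by (simp add: mult.assoc)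
    qed
  qed
  also have "(LINT x|lebesgue. ?r x) = A * (absorb_const * (LINT x|lebesgue. \<psi> x * (v (?X x) * jacobian x))
            + 4 * 2 ^ (CARD('n) - 1) * Cv * (LINT x|lebesgue. ex x))
         + C * Cv * level_const * (LINT x|lebesgue. g x powr qexp)"
    using int1 ex_int g_powr_int by simp
  finally show "(\<Sum>k\<in>{k0..<T}. u k * (A * 2 ^ (k * (CARD('n) - 1)) * (LINT x|lebesgue. indicator (high (2 ^ k)) x * (g x * \<psi> x))
            + C * (2 ^ k) powr (real CARD('n) - 1 - gam) * (LINT x|lebesgue. indicator (high (2 ^ k)) x * g x)))
      \<le> A * (absorb_const * (LINT x|lebesgue. \<psi> x * (v (?X x) * jacobian x))
            + 4 * 2 ^ (CARD('n) - 1) * Cv * (LINT x|lebesgue. ex x))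
         + C * Cv * level_const * (LINT x|lebesgue. g x powr qexp)" .
qed

end

text \<open>Collects the estimates at the dyadic levels for one fixed cut-off function, so that the
  summation over levels proceeds without reference to the smoothing.\<close>

locale level_curve = distortion_curve m \<phi> L f Df c0 R Kf lam c
  for m and \<phi> :: "'n::{finite,linorder} form" and L
    and f :: "(real, 'n) vec \<Rightarrow> nat \<Rightarrow> real" and Df :: "(real, 'n) vec \<Rightarrow> 'n \<Rightarrow> nat \<Rightarrow> real"
    and c0 and R and Kf and lam and c +
  fixes \<psi> :: "(real, 'n) vec \<Rightarrow> real" and C :: real and k0 :: nat
  assumes \<psi>: "\<And>x. 0 \<le> \<psi> x" "\<And>x. \<psi> x \<le> 1" "\<psi> \<in> borel_measurable lebesgue"
    and b_meas: "boundary_term \<psi> \<in> borel_measurable lebesgue"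
    and b_zero: "\<And>x. x \<notin> cball c0 R \<Longrightarrow> boundary_term \<psi> x = 0"
    and C: "0 \<le> C"
    and level: "\<And>k. k0 \<le> k \<Longrightarrow>
       \<bar>LINT x|lebesgue. indicator (- U (2 ^ k)) x * (\<psi> x * jacobian x + boundary_term \<psi> x)\<bar>
         \<le> L * main_const * 2 ^ (k * (CARD('n) - 1)) * (LINT x|lebesgue. indicator (high (2 ^ k)) x * (g x * \<psi> x))
            + C * (2 ^ k) powr (real CARD('n) - 1 - gam) * (LINT x|lebesgue. indicator (high (2 ^ k)) x * g x)"
    and b_bound: "\<And>k. k0 \<le> k \<Longrightarrow> AE x in lebesgue. x \<notin> U (2 ^ k) \<longrightarrow>
       \<bar>boundary_term \<psi> x\<bar> \<le> C * (2 ^ k) powr (real CARD('n) - gam)"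
    and U_measure: "\<And>k. k0 \<le> k \<Longrightarrow>
       measure lebesgue (U (2 ^ k)) \<le> C / 2 ^ k * (LINT x|lebesgue. indicator (high (2 ^ k)) x * g x)"
begin

abbreviation b where "b \<equiv> boundary_term \<psi>"

lemma U_lmeas: "U (2 ^ k) \<in> lmeasurable"
  by (rule weak_type_U(1)) simp

lemma U_sets: "U (2 ^ k) \<in> sets lebesgue"
  using U_lmeas by (rule fmeasurableD)

lemma U_mono: "j \<le> k \<Longrightarrow> U (2 ^ k) \<subseteq> U (2 ^ j)"
  by (intro maximal_superlevel_mono power_increasing) auto

lemma U_integral: "integrable lebesgue (indicat_real (U (2 ^ k)))"
  using U_lmeas[of k] by (simp add: lmeasurable_iff_integrable)

text \<open>A dyadic form of the bound for the maximal function in the Lebesgue space of exponent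
  \<open>qexp\<close>: the measure bounds are multiplied by 2^(k qexp), and the resulting geometric
  sums are evaluated under the integral.\<close>

lemma U_series_integral: "(\<Sum>k\<in>{k0..<T}. (2 ^ k) powr qexp * measure lebesgue (U (2 ^ k)))
    \<le> C * level_const * (LINT x|lebesgue. g x powr qexp)"
proof -
  have hi: "integrable lebesgue (\<lambda>x. indicator (high (2 ^ k)) x * g x)" for k
    by (intro integrable_indicator_mult high_meas g_int)
  have "(\<Sum>k\<in>{k0..<T}. (2 ^ k) powr qexp * measure lebesgue (U (2 ^ k)))
     \<le> (\<Sum>k\<in>{k0..<T}. C * (2 ^ k) powr (qexp - 1) * (LINT x|lebesgue. indicator (high (2 ^ k)) x * g x))"
  proof (rule sum_mono)
    fix k assume "k \<in> {k0..<T}"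
    then have "(2 ^ k) powr qexp * measure lebesgue (U (2 ^ k))
       \<le> (2 ^ k) powr qexp * (C / 2 ^ k * (LINT x|lebesgue. indicator (high (2 ^ k)) x * g x))"
      by (intro mult_left_mono U_measure) auto
    also have "\<dots> = C * (2 ^ k) powr (qexp - 1) * (LINT x|lebesgue. indicator (high (2 ^ k)) x * g x)"
      by (simp add: powr_diff)
    finally show "(2 ^ k) powr qexp * measure lebesgue (U (2 ^ k))
       \<le> C * (2 ^ k) powr (qexp - 1) * (LINT x|lebesgue. indicator (high (2 ^ k)) x * g x)" .
  qed
  also have "\<dots> = (LINT x|lebesgue. (\<Sum>k\<in>{k0..<T}. C * (2 ^ k) powr (qexp - 1) * (indicator (high (2 ^ k)) x * g x)))"
    using hi by simp
  also have "\<dots> \<le> (LINT x|lebesgue. C * level_const * g x powr qexp)"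
  proof (rule integral_mono)
    show "integrable lebesgue (\<lambda>x. \<Sum>k\<in>{k0..<T}. C * (2 ^ k) powr (qexp - 1) * (indicator (high (2 ^ k)) x * g x))"
      using hi by (intro Bochner_Integration.integrable_sum integrable_mult_right)
    show "integrable lebesgue (\<lambda>x. C * level_const * g x powr qexp)"
      by (intro integrable_mult_right g_powr_int)
    fix x
    have "(\<Sum>k\<in>{k0..<T}. C * (2 ^ k) powr (qexp - 1) * (indicator (high (2 ^ k)) x * g x))
      = C * (g x * (\<Sum>k\<in>{k0..<T}. if 2 ^ k / 2 < g x then (2 ^ k) powr (qexp - 1) else 0))"
      unfolding sum_distrib_left by (intro sum.cong refl) (simp add: high_def)
    also have "\<dots> \<le> C * (level_const * g x powr qexp)"
      by (rule mult_left_mono[OF level_const_bound C])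
    finally show "(\<Sum>k\<in>{k0..<T}. C * (2 ^ k) powr (qexp - 1) * (indicator (high (2 ^ k)) x * g x))
        \<le> C * level_const * g x powr qexp" by (simp add: mult.assoc)
  qed
  finally show ?thesis by simp
qed

text \<open>By the weak type inequality the measures of \<open>U (2 ^ k)\<close> decay like 2^(-k),
  so their intersection is a null set.\<close>

lemma not_in_all_U: "AE x in lebesgue. \<exists>k\<ge>k0. x \<notin> U (2 ^ k)"
proof -
  let ?N = "\<Inter>k\<in>{k0..}. U (2 ^ k)"
  have N: "?N \<in> sets lebesgue" using U_sets by (intro sets.countable_INT') auto
  have "emeasure lebesgue ?N = 0"
  proof (rule ccontr)
    assume ne: "emeasure lebesgue ?N \<noteq> 0"
    have lt: "emeasure lebesgue ?N < \<infinity>"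
      using U_lmeas[of k0] emeasure_mono[of ?N "U (2 ^ k0)" lebesgue] U_sets
      by (auto simp: fmeasurable_def intro: le_less_trans)
    then have Nl: "?N \<in> lmeasurable" using N by (intro fmeasurableI) auto
    have pos: "0 < measure lebesgue ?N"
      using ne lt by (simp add: measure_def enn2real_positive_iff zero_less_iff_neq_zero less_top)
    let ?B = "2 * 5 ^ CARD('n) * (LINT y|lebesgue. g y)"
    obtain k where k: "?B / measure lebesgue ?N < 2 ^ k" using real_arch_pow[of 2] by auto
    define k' where "k' = max k k0"
    have "(2::real) ^ k \<le> 2 ^ k'" by (simp add: k'_def)
    with k have "?B / measure lebesgue ?N < 2 ^ k'" by linarith
    then have "?B / 2 ^ k' < measure lebesgue ?N" using pos by (simp add: field_simps)
    moreover have "measure lebesgue ?N \<le> measure lebesgue (U (2 ^ k'))"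
      using N U_lmeas by (intro measure_mono_fmeasurable) (auto simp: k'_def)
    moreover have "measure lebesgue (U (2 ^ k')) \<le> ?B / 2 ^ k'"
      using weak_type_U(2)[of "2 ^ k'"] by simp
    ultimately show False by linarith
  qed
  then have "?N \<in> null_sets lebesgue" using N by auto
  then show ?thesis by (rule AE_I') auto
qed

lemma increment_sum_le:
  fixes p :: "nat \<Rightarrow> real"
  assumes p: "mono p" "0 \<le> p k0"
  shows "(\<Sum>k\<in>{k0..<T}. if k < M then p (Suc k) - p k else 0) = p (max k0 (min M T)) - p k0"
proof -
  have "(\<Sum>k\<in>{k0..<T}. if k < M then p (Suc k) - p k else 0) = (\<Sum>k\<in>{k0..<min M T}. p (Suc k) - p k)"
    by (subst sum.inter_filter[symmetric]) (auto intro!: sum.cong)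
  also have "\<dots> = p (max k0 (min M T)) - p k0"
    by (cases "k0 \<le> min M T") (auto simp: sum_Suc_diff' max_def)
  finally show ?thesis .
qed

text \<open>Let \<open>M\<close> be the first level from \<open>k0\<close> on at which
  \<open>x\<close> is outside \<open>U\<close>. The boundary term is at most of order 2^(M (n -
  gam)), the telescoped weight at most of order 2^(M gam/2), and the product is of order 2^(M qexp).
  The quantifiers over \<open>p\<close>, \<open>Cp\<close> and \<open>T\<close> stand inside the
  almost everywhere statement, so that one majorant serves all weights and all truncations.\<close>

lemma boundary_dominated:
  obtains Z where "integrable lebesgue Z" "\<And>x. 0 \<le> Z x"
    "AE x in lebesgue. \<forall>p Cp T. mono p \<longrightarrow> 0 \<le> p k0 \<longrightarrow> (\<forall>k. p k \<le> Cp * (2 ^ k) powr (gam / 2)) \<longrightarrow>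
       \<bar>b x\<bar> * (1 + (\<Sum>k\<in>{k0..<T}. (p (Suc k) - p k) * indicator (U (2 ^ k)) x)) \<le> (1 + Cp) * Z x"
proof -
  define h where "h k x = (if k0 \<le> k then (2 ^ k) powr qexp * indicator (U (2 ^ k)) x else 0)" for k :: nat and x
  have h_nonneg: "0 \<le> h k x" for k x by (simp add: h_def)
  have h_int: "integrable lebesgue (h k)" for k
    using U_integral[of k] by (cases "k0 \<le> k") (simp_all add: h_def[abs_def])
  have fin: "AE x in lebesgue. finite {k. h k x \<noteq> 0}"
    using not_in_all_U
  proof eventually_elim
    case (elim x)
    then obtain M where M: "x \<notin> U (2 ^ M)" by auto
    have "{k. h k x \<noteq> 0} \<subseteq> {..<M}"
      using M U_mono by (force simp: h_def indicator_def not_less[symmetric] split: if_splits)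
    then show ?case by (rule finite_subset) simp
  qed
  have Z0: "integrable lebesgue (\<lambda>x. \<Sum>k. h k x)"
  proof (rule integrable_suminf[OF h_int])
    show "AE x in lebesgue. summable (\<lambda>k. norm (h k x))"
      using fin
    proof eventually_elim
      case (elim x)
      show ?case by (rule summable_finite[OF elim]) simp
    qed
    show "summable (\<lambda>k. LINT x|lebesgue. norm (h k x))"
    proof (rule summableI_nonneg_bounded)
      show "0 \<le> (LINT x|lebesgue. norm (h k x))" for k by (rule integral_nonneg_AE) simp
      fix T
      have "(\<Sum>k<T. LINT x|lebesgue. norm (h k x)) = (\<Sum>k\<in>{k0..<T}. (2 ^ k) powr qexp * measure lebesgue (U (2 ^ k)))"
      proof -
        have "(LINT x|lebesgue. norm (h k x)) = (if k0 \<le> k then (2 ^ k) powr qexp * measure lebesgue (U (2 ^ k)) else 0)" for k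
          using h_nonneg by (simp add: h_def)
        then have "(\<Sum>k<T. LINT x|lebesgue. norm (h k x)) = (\<Sum>k\<in>{k\<in>{..<T}. k0 \<le> k}. (2 ^ k) powr qexp * measure lebesgue (U (2 ^ k)))"
          by (simp only: sum.inter_filter[symmetric] finite_lessThan)
        also have "{k\<in>{..<T}. k0 \<le> k} = {k0..<T}" by auto
        finally show ?thesis .
      qed
      also note U_series_integral
      finally show "(\<Sum>k<T. LINT x|lebesgue. norm (h k x)) \<le> C * level_const * (LINT x|lebesgue. g x powr qexp)" .
    qed
  qed
  define Z where "Z x = C * ((2 ^ k0) powr qexp * indicator (cball c0 R) x + 2 powr qexp * \<bar>\<Sum>k. h k x\<bar>)" for x
  show thesis
  proof (rule that[of Z])
    show "integrable lebesgue Z"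
      unfolding Z_def[abs_def] using lmeasurable_cball[of c0 R] unfolding lmeasurable_iff_integrable
      by (intro integrable_mult_right Bochner_Integration.integrable_add integrable_abs Z0)
    show "0 \<le> Z x" for x
      unfolding Z_def using C by simp
    have "AE x in lebesgue. \<forall>k. k0 \<le> k \<longrightarrow> x \<notin> U (2 ^ k) \<longrightarrow> \<bar>b x\<bar> \<le> C * (2 ^ k) powr (real CARD('n) - gam)"
      using b_bound by (subst AE_all_countable) auto
    then show "AE x in lebesgue. \<forall>p Cp T. mono p \<longrightarrow> 0 \<le> p k0 \<longrightarrow> (\<forall>k. p k \<le> Cp * (2 ^ k) powr (gam / 2)) \<longrightarrow>
       \<bar>b x\<bar> * (1 + (\<Sum>k\<in>{k0..<T}. (p (Suc k) - p k) * indicator (U (2 ^ k)) x)) \<le> (1 + Cp) * Z x"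
      using fin not_in_all_U
    proof eventually_elim
      case (elim x)
      have sm: "summable (\<lambda>k. h k x)" by (rule summable_finite[OF elim(2)]) simp
      show ?case
      proof (intro allI impI)
        fix p :: "nat \<Rightarrow> real" and Cp T assume p: "mono p" "0 \<le> p k0" "\<forall>k. p k \<le> Cp * (2 ^ k) powr (gam / 2)"
        define M where "M = (LEAST k. k0 \<le> k \<and> x \<notin> U (2 ^ k))"
        have M: "k0 \<le> M" "x \<notin> U (2 ^ M)"
          using LeastI_ex[of "\<lambda>k. k0 \<le> k \<and> x \<notin> U (2 ^ k)"] elim(3) by (auto simp: M_def)
        have less_M: "k0 \<le> k \<Longrightarrow> x \<in> U (2 ^ k) \<longleftrightarrow> k < M" for k
          using M U_mono[of M k] not_less_Least[of k "\<lambda>k. k0 \<le> k \<and> x \<notin> U (2 ^ k)"]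
          by (fastforce simp: M_def[symmetric] not_less)
        have "0 \<le> Cp * (2 ^ k0) powr (gam / 2)" using p(2,3) by (meson order_trans)
        then have Cp: "0 \<le> Cp" by (simp add: zero_le_mult_iff)
        have "1 + (\<Sum>k\<in>{k0..<T}. (p (Suc k) - p k) * indicator (U (2 ^ k)) x)
            = 1 + (\<Sum>k\<in>{k0..<T}. if k < M then p (Suc k) - p k else 0)"
          using less_M by (intro arg_cong2[of _ _ _ _ "(+)"] refl sum.cong) auto
        also have "\<dots> = 1 + (p (max k0 (min M T)) - p k0)"
          by (simp only: increment_sum_le[OF p(1,2)])
        also have "\<dots> \<le> 1 + p M"
          using M p(2) monoD[OF p(1), of "max k0 (min M T)" M] by simp
        also have "\<dots> \<le> 1 + Cp * (2 ^ M) powr (gam / 2)" using p(3) by simp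
        also have "\<dots> \<le> (1 + Cp) * (2 ^ M) powr (gam / 2)"
          using gam_bounds ge_one_powr_ge_zero[of "2 ^ M" "gam / 2"] by (simp add: distrib_right)
        finally have W: "1 + (\<Sum>k\<in>{k0..<T}. (p (Suc k) - p k) * indicator (U (2 ^ k)) x) \<le> (1 + Cp) * (2 ^ M) powr (gam / 2)" .
        have W0: "0 \<le> (\<Sum>k\<in>{k0..<T}. (p (Suc k) - p k) * indicator (U (2 ^ k)) x)"
          using monoD[OF p(1)] by (intro sum_nonneg) simp
        have sum0: "0 \<le> (\<Sum>k. h k x)" by (intro suminf_nonneg sm h_nonneg)
        show "\<bar>b x\<bar> * (1 + (\<Sum>k\<in>{k0..<T}. (p (Suc k) - p k) * indicator (U (2 ^ k)) x)) \<le> (1 + Cp) * Z x"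
        proof (cases "x \<in> cball c0 R \<or> k0 < M")
          case False
          then have "b x = 0" by (intro b_zero) auto
          then show ?thesis using Cp C sum0 by (simp add: Z_def)
        next
          case True
          have "\<bar>b x\<bar> * (1 + (\<Sum>k\<in>{k0..<T}. (p (Suc k) - p k) * indicator (U (2 ^ k)) x))
             \<le> (C * (2 ^ M) powr (real CARD('n) - gam)) * ((1 + Cp) * (2 ^ M) powr (gam / 2))"
            using elim(1) M W W0 C by (intro mult_mono) auto
          also have "\<dots> = (1 + Cp) * (C * (2 ^ M) powr qexp)"
            by (simp add: qexp_def powr_add[symmetric] mult.assoc mult.left_commute)
          also have "\<dots> \<le> (1 + Cp) * Z x"
            unfolding Z_def abs_of_nonneg[OF sum0]
          proof (intro mult_left_mono)
            show "(2 ^ M) powr qexp \<le> (2 ^ k0) powr qexp * indicator (cball c0 R) x + 2 powr qexp * (\<Sum>k. h k x)"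
            proof (cases "M = k0")
              case M_eq: True
              then have "x \<in> cball c0 R" using True by simp
              then show ?thesis using sum0 M_eq by simp
            next
              case False
              \<comment> \<open>One level below \<open>M\<close> the point still lies in
                \<open>U\<close>, so that level contributes a term of the series; stepping back
                costs the factor \<open>2 powr qexp\<close>.\<close>
              then obtain M' where M': "M = Suc M'" "k0 \<le> M'" using M(1) by (cases M) auto
              then have "(2 ^ M') powr qexp = h M' x" using less_M[of M'] by (simp add: h_def)
              also have "\<dots> \<le> (\<Sum>k. h k x)"
                using sum_le_suminf[OF sm, of "{M'}"] h_nonneg by simp
              finally have "2 powr qexp * (2 ^ M') powr qexp \<le> 2 powr qexp * (\<Sum>k. h k x)"
                by (rule mult_left_mono) simp
              then show ?thesis by (simp add: M' powr_mult add_increasing)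
            qed
          qed (use Cp C in auto)
          finally show ?thesis .
        qed
      qed
    qed
  qed
qed

abbreviation V :: "nat \<Rightarrow> real" where
  "V k \<equiv> L * main_const * 2 ^ (k * (CARD('n) - 1)) * (LINT x|lebesgue. indicator (high (2 ^ k)) x * (g x * \<psi> x))
            + C * (2 ^ k) powr (real CARD('n) - 1 - gam) * (LINT x|lebesgue. indicator (high (2 ^ k)) x * g x)"

lemma main_const_nonneg: "0 \<le> L * main_const"
  using L_nonneg kap_pos by (simp add: main_const_def)

lemma b_int: "integrable lebesgue b"
proof -
  obtain Z where Z: "integrable lebesgue Z" "\<And>x. 0 \<le> Z x"
    "AE x in lebesgue. \<forall>p Cp T. mono p \<longrightarrow> 0 \<le> p k0 \<longrightarrow> (\<forall>k. p k \<le> Cp * (2 ^ k) powr (gam / 2)) \<longrightarrow>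
       \<bar>b x\<bar> * (1 + (\<Sum>k\<in>{k0..<T}. (p (Suc k) - p k) * indicator (U (2 ^ k)) x)) \<le> (1 + Cp) * Z x"
    by (rule boundary_dominated) (rule that; assumption)
  show ?thesis
  proof (rule Bochner_Integration.integrable_bound[OF Z(1) b_meas])
    show "AE x in lebesgue. norm (b x) \<le> norm (Z x)"
      using Z(3)
    proof eventually_elim
      case (elim x)
      from elim[rule_format, of "\<lambda>_. 0" 0 0] show ?case using Z(2)[of x] by (simp add: monoI)
    qed
  qed
qed

lemma psi_J_int: "integrable lebesgue (\<lambda>x. \<psi> x * jacobian x)"
  by (rule g_psi_int[OF \<psi> J_int])

lemma psi_J_nonneg: "AE x in lebesgue. 0 \<le> \<psi> x * jacobian x"
  using jacobian_nonneg by eventually_elim (simp add: \<psi>)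

text \<open>If the integral were a nonzero \<open>D\<close>, the integrals off
  \<open>U (2 ^ k)\<close> would eventually exceed |D|/2 in absolute value, and so would the bounds
  \<open>V k\<close>. But \<open>level_sum_bound\<close> with the constant weight 1 bounds all
  partial sums of V k / (k + 2), which contradicts the divergence of the harmonic series.\<close>

lemma total_zero: "(LINT x|lebesgue. \<psi> x * jacobian x + b x) = 0"
proof (rule ccontr)
  let ?h = "\<lambda>x. \<psi> x * jacobian x + b x"
  define D where "D = (LINT x|lebesgue. ?h x)"
  assume "(LINT x|lebesgue. ?h x) \<noteq> 0"
  then have D: "0 < \<bar>D\<bar>" by (simp add: D_def)
  have h: "integrable lebesgue ?h" by (intro Bochner_Integration.integrable_add psi_J_int b_int)
  have "(\<lambda>k. LINT x|lebesgue. indicator (- U (2 ^ k)) x * ?h x) \<longlonglongrightarrow> (LINT x|lebesgue. ?h x)"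
  proof (rule integral_dominated_convergence[where w = "\<lambda>x. \<bar>?h x\<bar>"])
    show "?h \<in> borel_measurable lebesgue" using h by (rule borel_measurable_integrable)
    show "(\<lambda>x. indicator (- U (2 ^ k)) x * ?h x) \<in> borel_measurable lebesgue" for k
      using U_sets[of k] borel_measurable_integrable[OF h]
      by (intro borel_measurable_times borel_measurable_indicator) (auto simp: Compl_in_sets_lebesgue)
    show "integrable lebesgue (\<lambda>x. \<bar>?h x\<bar>)" using h by (rule integrable_abs)
    show "AE x in lebesgue. (\<lambda>k. indicator (- U (2 ^ k)) x * ?h x) \<longlonglongrightarrow> ?h x"
      using not_in_all_U
    proof eventually_elim
      case (elim x)
      then obtain M where M: "x \<notin> U (2 ^ M)" by auto
      then have "\<forall>k\<ge>M. indicator (- U (2 ^ k)) x * ?h x = ?h x"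
        using U_mono by (auto simp: indicator_def)
      then have "\<forall>\<^sub>F k in sequentially. indicator (- U (2 ^ k)) x * ?h x = ?h x"
        by (auto simp: eventually_sequentially)
      then show ?case by (rule tendsto_eventually)
    qed
    show "AE x in lebesgue. norm (indicator (- U (2 ^ k)) x * ?h x) \<le> \<bar>?h x\<bar>" for k
      by (intro AE_I2) (simp add: indicator_def)
  qed
  then have "(\<lambda>k. \<bar>LINT x|lebesgue. indicator (- U (2 ^ k)) x * ?h x\<bar>) \<longlonglongrightarrow> \<bar>D\<bar>"
    unfolding D_def by (rule tendsto_rabs)
  then have "\<forall>\<^sub>F k in sequentially. \<bar>D\<bar> / 2 < \<bar>LINT x|lebesgue. indicator (- U (2 ^ k)) x * ?h x\<bar>"
    by (rule order_tendstoD) (use D in simp)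
  then obtain k1 where k1: "\<And>k. k1 \<le> k \<Longrightarrow> \<bar>D\<bar> / 2 < \<bar>LINT x|lebesgue. indicator (- U (2 ^ k)) x * ?h x\<bar>"
    by (auto simp: eventually_sequentially)
  define k2 where "k2 = max k0 k1"
  have V: "\<bar>D\<bar> / 2 \<le> V k" if "k2 \<le> k" for k
    using k1[of k] level[of k] that by (simp add: k2_def)
  define B where "B = L * main_const * (absorb_const * (LINT x|lebesgue. \<psi> x * jacobian x)
            + 4 * 2 ^ (CARD('n) - 1) * (LINT x|lebesgue. ex x))
         + C * level_const * (LINT x|lebesgue. g x powr qexp)"
  have bound: "(\<Sum>k\<in>{k2..<T}. 1 / (2 + real k) * (\<bar>D\<bar> / 2)) \<le> B" for T
  proof -
    have "(\<Sum>k\<in>{k2..<T}. 1 / (2 + real k) * (\<bar>D\<bar> / 2)) \<le> (\<Sum>k\<in>{k2..<T}. 1 / (2 + real k) * V k)"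
      using V by (intro sum_mono mult_left_mono) auto
    also have "\<dots> \<le> B"
    proof -
      have "1 \<le> (1::real) * (2 ^ k) powr (gam / 2)" for k
        using gam_bounds ge_one_powr_ge_zero[of "2 ^ k" "gam / 2"] by simp
      then show ?thesis
        using level_sum_bound(2)[OF \<psi>, where u = "\<lambda>k. 1 / (2 + real k)" and v = "\<lambda>_. 1" and Cv = 1 and E = 2
            and A = "L * main_const" and C = C and ?k0.0 = k2 and T = T] main_const_nonneg C
        by (simp add: B_def monoI)
    qed
    finally show ?thesis .
  qed
  have "summable (\<lambda>j. 1 / (2 + real (j + k2)) * (\<bar>D\<bar> / 2))"
  proof (rule summableI_nonneg_bounded)
    fix T
    have "(\<Sum>j<T. 1 / (2 + real (j + k2)) * (\<bar>D\<bar> / 2)) = (\<Sum>k\<in>{0 + k2..<T + k2}. 1 / (2 + real k) * (\<bar>D\<bar> / 2))"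
      by (simp only: sum.shift_bounds_nat_ivl atLeast0LessThan)
    also have "\<dots> \<le> B" using bound[of "T + k2"] by simp
    finally show "(\<Sum>j<T. 1 / (2 + real (j + k2)) * (\<bar>D\<bar> / 2)) \<le> B" .
  qed simp
  then have "summable (\<lambda>j. (1 / (2 + real (j + k2)) * (\<bar>D\<bar> / 2)) * (2 / \<bar>D\<bar>))" by (rule summable_mult2)
  also have "(\<lambda>j. (1 / (2 + real (j + k2)) * (\<bar>D\<bar> / 2)) * (2 / \<bar>D\<bar>)) = (\<lambda>j. inverse (real (j + (k2 + 2))))"
  proof
    fix j
    have "1 / (2 + real (j + k2)) = inverse (real (j + (k2 + 2)))" by (simp add: inverse_eq_divide add_ac)
    then show "(1 / (2 + real (j + k2)) * (\<bar>D\<bar> / 2)) * (2 / \<bar>D\<bar>) = inverse (real (j + (k2 + 2)))"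
      using D by simp
  qed
  finally have "summable (\<lambda>j. inverse (real (j + (k2 + 2))))" .
  then have "summable (\<lambda>j. inverse (real j))" by (subst (asm) summable_iff_shift)
  then show False using not_summable_harmonic[where 'a = real] by simp
qed

text \<open>As the total vanishes, the Jacobian integral over \<open>U (2 ^ k)\<close> is traded for
  the integral over the complement, where the level estimate applies, at the price of the boundary
  term. Almost every point with \<open>g\<close> above \<open>2 ^ k\<close> lies in
  \<open>U (2 ^ k)\<close>, and the Jacobian is nonnegative.\<close>

lemma level_inequality:
  assumes "k0 \<le> k"
  shows "(LINT x|lebesgue. indicator {x. 2 ^ k < g x} x * (\<psi> x * jacobian x))
     \<le> V k + (LINT x|lebesgue. indicator (U (2 ^ k)) x * \<bar>b x\<bar>)"
proof -
  let ?h = "\<lambda>x. \<psi> x * jacobian x + b x" and ?U = "U (2 ^ k)"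
  have h: "integrable lebesgue ?h" by (intro Bochner_Integration.integrable_add psi_J_int b_int)
  have "{x \<in> space lebesgue. 2 ^ k < g x} \<in> sets lebesgue"
    using borel_measurable_integrable[OF g_int] by measurable
  then have S: "{x. 2 ^ k < g x} \<in> sets lebesgue" by simp
  have Uc: "- ?U \<in> sets lebesgue" using U_sets[of k] by (simp add: Compl_in_sets_lebesgue)
  have i1: "integrable lebesgue (\<lambda>x. indicator ?U x * (\<psi> x * jacobian x))"
    and i2: "integrable lebesgue (\<lambda>x. indicator ?U x * b x)"
    and i3: "integrable lebesgue (\<lambda>x. indicator (- ?U) x * ?h x)"
    and i4: "integrable lebesgue (\<lambda>x. indicator ?U x * \<bar>b x\<bar>)"
    by (intro integrable_indicator_mult U_sets Uc psi_J_int b_int h integrable_abs)+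
  have "(LINT x|lebesgue. indicator {x. 2 ^ k < g x} x * (\<psi> x * jacobian x)) \<le> (LINT x|lebesgue. indicator ?U x * (\<psi> x * jacobian x))"
  proof (rule integral_mono_AE[OF integrable_indicator_mult[OF S psi_J_int] i1])
    show "AE x in lebesgue. indicator {x. 2 ^ k < g x} x * (\<psi> x * jacobian x) \<le> indicator ?U x * (\<psi> x * jacobian x)"
      using lebesgue_point_AE[OF g_int] psi_J_nonneg
    proof eventually_elim
      case (elim x)
      have "x \<in> ?U" if "2 ^ k < g x"
        using lebesgue_point_le_maximal[OF g_int elim(1), of "2 ^ k"] that by fastforce
      then show ?case using elim(2) by (simp add: indicator_def)
    qed
  qed
  also have "\<dots> = - (LINT x|lebesgue. indicator ?U x * b x) - (LINT x|lebesgue. indicator (- ?U) x * ?h x)"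
  proof -
    have "0 = (LINT x|lebesgue. (indicator ?U x * (\<psi> x * jacobian x) + indicator ?U x * b x) + indicator (- ?U) x * ?h x)"
      unfolding total_zero[symmetric] by (intro Bochner_Integration.integral_cong refl) (simp add: indicator_def)
    also have "\<dots> = (LINT x|lebesgue. indicator ?U x * (\<psi> x * jacobian x)) + (LINT x|lebesgue. indicator ?U x * b x)
        + (LINT x|lebesgue. indicator (- ?U) x * ?h x)"
      by (simp only: Bochner_Integration.integral_add Bochner_Integration.integrable_add i1 i2 i3)
    finally show ?thesis by linarith
  qed
  also have "\<dots> \<le> (LINT x|lebesgue. indicator ?U x * \<bar>b x\<bar>) + V k"
  proof -
    have "- (LINT x|lebesgue. indicator ?U x * b x) = (LINT x|lebesgue. - (indicator ?U x * b x))" by simp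
    also have "\<dots> \<le> (LINT x|lebesgue. indicator ?U x * \<bar>b x\<bar>)"
      using i2 i4 by (intro integral_mono) (auto simp: indicator_def)
    finally show ?thesis using level[OF assms] by linarith
  qed
  finally show ?thesis by simp
qed

text \<open>Abel summation: the level inequalities are multiplied by the increments
  \<open>w k\<close> of \<open>p\<close> and summed up to \<open>T\<close>. The main part of the
  right-hand side is again the left-hand side, up to a multiple of \<open>S\<close>, with a factor
  at most 1/2 by the smallness of \<open>a\<close>. Being truncated, it is finite and can be
  subtracted; monotone convergence in \<open>T\<close> concludes.\<close>

lemma log_integrable:
  assumes a: "0 < a" and small: "L * main_const * absorb_const * (2 * a) \<le> 1 / 2" and E: "2 * a \<le> E" "2 \<le> E"
  shows "integrable lebesgue (\<lambda>x. \<psi> x * jacobian x * (E + real (lev (g x))) powr a)"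
proof -
  define p where "p k = (E + real k) powr a" for k :: nat
  define v where "v k = a * p (Suc k)" for k
  define w where "w k = p (Suc k) - p k" for k
  have p0: "0 \<le> p k" for k by (simp add: p_def)
  have p_mono: "mono p"
    using a E by (auto simp: p_def intro!: monoI powr_mono2)
  have p_Suc: "p (Suc k) \<le> 2 * p k" for k
    using powr_Suc_le_double[OF a E, of k] by (simp add: p_def add_ac)
  have v0: "0 \<le> v k" for k using a p0 by (simp add: v_def)
  have v_mono: "mono v"
    using a monoD[OF p_mono] by (auto simp: v_def intro!: monoI mult_left_mono)
  have w0: "0 \<le> w k" for k using monoD[OF p_mono, of k "Suc k"] by (simp add: w_def)
  have wv: "w k \<le> v k / (E + real k)" for k
    using powr_increment_le[OF a, of "E + real k"] E by (simp add: w_def v_def p_def add_ac)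
  \<comment> \<open>A power of the level lies below any exponential of it; the exponent
    \<open>gam / 2\<close> is the room left by \<open>qexp\<close>.\<close>
  obtain Cp where Cp: "0 \<le> Cp" "\<And>k. p (Suc k) \<le> Cp * (2 ^ k) powr (gam / 2)"
  proof -
    define e where "e = ln 2 * (gam / 2)"
    have e: "0 < e" using gam_bounds by (simp add: e_def)
    obtain B where B: "0 < B" "\<And>x. 1 \<le> x \<Longrightarrow> x powr a \<le> B * exp (e * x)"
      using powr_le_exp[OF e, of a] a by auto
    have "p (Suc k) \<le> B * exp (e * (E + 1)) * (2 ^ k) powr (gam / 2)" for k
    proof -
      have "p (Suc k) \<le> B * exp (e * (E + real (Suc k)))"
        unfolding p_def using E by (intro B(2)) simp
      also have "\<dots> = B * exp (e * (E + 1)) * exp (e * real k)"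
        by (simp add: exp_add[symmetric] algebra_simps)
      also have "exp (e * real k) = (2 ^ k) powr (gam / 2)"
        by (simp add: powr_def ln_realpow e_def mult_ac)
      finally show ?thesis .
    qed
    then show thesis using that[of "B * exp (e * (E + 1))"] B(1) by simp
  qed
  have p_le: "p k \<le> Cp * (2 ^ k) powr (gam / 2)" for k
    using Cp(2)[of k] monoD[OF p_mono, of k "Suc k"] by simp
  have v_le: "v k \<le> a * Cp * (2 ^ k) powr (gam / 2)" for k
    using mult_left_mono[OF Cp(2)[of k], of a] a by (simp add: v_def mult.assoc)
  define X where "X T x = min (lev (g x)) T" for T x
  \<comment> \<open>The increments over the levels below \<open>g\<close> telescope:
    \<open>G T\<close> is \<open>p\<close> at the level of \<open>g\<close>, cut at \<open>T\<close>
    and raised to at least \<open>k0\<close>, minus \<open>p k0\<close>.\<close>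
  define G where "G T x = (\<Sum>k\<in>{k0..<T}. w k * indicator {x. 2 ^ k < g x} x)" for T x
  have G_eq: "G T x = p (max k0 (X T x)) - p k0" for T x
  proof -
    have "G T x = (\<Sum>k\<in>{k0..<T}. if k < lev (g x) then p (Suc k) - p k else 0)"
      unfolding G_def w_def by (intro sum.cong refl) (simp add: less_lev_iff)
    then show ?thesis by (simp only: increment_sum_le[OF p_mono p0] X_def)
  qed
  have p_X: "p (X T x) \<le> G T x + p k0" for T x
    using G_eq[of T x] monoD[OF p_mono, of "X T x" "max k0 (X T x)"] by simp
  have lev_meas: "(\<lambda>x. q (lev (g x))) \<in> borel_measurable lebesgue" for q :: "nat \<Rightarrow> real"
    by (rule measurable_compose[OF lev_measurable]) simp
  have int_pX: "integrable lebesgue (\<lambda>x. \<psi> x * jacobian x * p (X T x))" for T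
  proof (rule Bochner_Integration.integrable_bound[OF integrable_mult_left[OF psi_J_int, of "p T"]])
    show "(\<lambda>x. \<psi> x * jacobian x * p (X T x)) \<in> borel_measurable lebesgue"
      using lev_meas[of "\<lambda>k. p (min k T)"] borel_measurable_integrable[OF psi_J_int]
      by (simp add: X_def borel_measurable_times)
    show "AE x in lebesgue. norm (\<psi> x * jacobian x * p (X T x)) \<le> norm (\<psi> x * jacobian x * p T)"
      using p0 monoD[OF p_mono] by (intro AE_I2) (auto simp: abs_mult X_def intro!: mult_left_mono)
  qed
  have g_sets: "{x. 2 ^ k < g x} \<in> sets lebesgue" for k
  proof -
    have "{x \<in> space lebesgue. 2 ^ k < g x} \<in> sets lebesgue"
      using borel_measurable_integrable[OF g_int] by measurable
    then show ?thesis by simp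
  qed
  have ind_int: "integrable lebesgue (\<lambda>x. indicator {x. 2 ^ k < g x} x * (\<psi> x * jacobian x))" for k
    by (intro integrable_indicator_mult g_sets psi_J_int)
  have G_sum: "\<psi> x * jacobian x * G T x = (\<Sum>k\<in>{k0..<T}. w k * (indicator {x. 2 ^ k < g x} x * (\<psi> x * jacobian x)))" for T x
    unfolding G_def sum_distrib_left by (intro sum.cong refl) (simp add: mult_ac)
  have int_G: "integrable lebesgue (\<lambda>x. \<psi> x * jacobian x * G T x)" for T
    unfolding G_sum by (intro Bochner_Integration.integrable_sum integrable_mult_right ind_int)
  obtain Z where Z: "integrable lebesgue Z" "\<And>x. 0 \<le> Z x"
    "AE x in lebesgue. \<forall>p Cp T. mono p \<longrightarrow> 0 \<le> p k0 \<longrightarrow> (\<forall>k. p k \<le> Cp * (2 ^ k) powr (gam / 2)) \<longrightarrow>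
       \<bar>b x\<bar> * (1 + (\<Sum>k\<in>{k0..<T}. (p (Suc k) - p k) * indicator (U (2 ^ k)) x)) \<le> (1 + Cp) * Z x"
    by (rule boundary_dominated) (rule that; assumption)
  define S where "S = (LINT x|lebesgue. \<psi> x * jacobian x)"
  define B where "B = L * main_const * (4 * 2 ^ (CARD('n) - 1) * (a * Cp) * (LINT x|lebesgue. ex x))
      + C * (a * Cp) * level_const * (LINT x|lebesgue. g x powr qexp) + (1 + Cp) * (LINT x|lebesgue. Z x)"
  have bound: "(LINT x|lebesgue. \<psi> x * jacobian x * G T x) \<le> p k0 * S + 2 * B" for T
  proof -
    define Q where "Q = (LINT x|lebesgue. \<psi> x * jacobian x * G T x)"
    have b_ind: "integrable lebesgue (\<lambda>x. indicator (U (2 ^ k)) x * \<bar>b x\<bar>)" for k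
      by (intro integrable_indicator_mult U_sets b_int integrable_abs)
    have "Q = (\<Sum>k\<in>{k0..<T}. w k * (LINT x|lebesgue. indicator {x. 2 ^ k < g x} x * (\<psi> x * jacobian x)))"
      unfolding Q_def G_sum using ind_int by simp
    also have "\<dots> \<le> (\<Sum>k\<in>{k0..<T}. w k * (V k + (LINT x|lebesgue. indicator (U (2 ^ k)) x * \<bar>b x\<bar>)))"
      by (intro sum_mono mult_left_mono level_inequality w0) auto
    also have "\<dots> = (\<Sum>k\<in>{k0..<T}. w k * V k) + (\<Sum>k\<in>{k0..<T}. w k * (LINT x|lebesgue. indicator (U (2 ^ k)) x * \<bar>b x\<bar>))"
      by (simp only: distrib_left sum.distrib)
    also have "(\<Sum>k\<in>{k0..<T}. w k * (LINT x|lebesgue. indicator (U (2 ^ k)) x * \<bar>b x\<bar>)) \<le> (1 + Cp) * (LINT x|lebesgue. Z x)"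
    proof -
      have "(\<Sum>k\<in>{k0..<T}. w k * (LINT x|lebesgue. indicator (U (2 ^ k)) x * \<bar>b x\<bar>))
          = (LINT x|lebesgue. (\<Sum>k\<in>{k0..<T}. w k * (indicator (U (2 ^ k)) x * \<bar>b x\<bar>)))"
        using b_ind by simp
      also have "\<dots> \<le> (LINT x|lebesgue. (1 + Cp) * Z x)"
      proof (rule integral_mono_AE)
        show "integrable lebesgue (\<lambda>x. \<Sum>k\<in>{k0..<T}. w k * (indicator (U (2 ^ k)) x * \<bar>b x\<bar>))"
          by (intro Bochner_Integration.integrable_sum integrable_mult_right b_ind)
        show "integrable lebesgue (\<lambda>x. (1 + Cp) * Z x)" by (intro integrable_mult_right Z(1))
        show "AE x in lebesgue. (\<Sum>k\<in>{k0..<T}. w k * (indicator (U (2 ^ k)) x * \<bar>b x\<bar>)) \<le> (1 + Cp) * Z x"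
          using Z(3)
        proof eventually_elim
          case (elim x)
          have "(\<Sum>k\<in>{k0..<T}. w k * (indicator (U (2 ^ k)) x * \<bar>b x\<bar>)) = \<bar>b x\<bar> * (\<Sum>k\<in>{k0..<T}. (p (Suc k) - p k) * indicator (U (2 ^ k)) x)"
            unfolding w_def sum_distrib_left by (intro sum.cong refl) (simp only: mult_ac)
          also have "\<dots> \<le> \<bar>b x\<bar> * (1 + (\<Sum>k\<in>{k0..<T}. (p (Suc k) - p k) * indicator (U (2 ^ k)) x))"
            by (intro mult_left_mono) auto
          also have "\<dots> \<le> (1 + Cp) * Z x"
            using elim p_mono p0 p_le by blast
          finally show ?case .
        qed
      qed
      finally show ?thesis by simp
    qed
    also have "(\<Sum>k\<in>{k0..<T}. w k * V k)
      \<le> L * main_const * (absorb_const * (LINT x|lebesgue. \<psi> x * (v (min (lev (g x)) (T - 1)) * jacobian x))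
            + 4 * 2 ^ (CARD('n) - 1) * (a * Cp) * (LINT x|lebesgue. ex x))
         + C * (a * Cp) * level_const * (LINT x|lebesgue. g x powr qexp)"
      by (rule level_sum_bound(2)[OF \<psi> w0 wv v_mono v0 v_le E(2) main_const_nonneg C])
    \<comment> \<open>The weight at the next level, contained in \<open>v\<close>, is at most twice
      the current one, whence the 2 in \<open>2 * a\<close>. The term \<open>p k0 * S\<close>
      restores the constant subtracted in \<open>G\<close>.\<close>
    also have "(LINT x|lebesgue. \<psi> x * (v (min (lev (g x)) (T - 1)) * jacobian x)) \<le> 2 * a * (Q + p k0 * S)"
    proof -
      have "(LINT x|lebesgue. \<psi> x * (v (min (lev (g x)) (T - 1)) * jacobian x))
        \<le> (LINT x|lebesgue. 2 * a * (\<psi> x * jacobian x * G T x + p k0 * (\<psi> x * jacobian x)))"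
      proof (rule integral_mono_AE)
        show "integrable lebesgue (\<lambda>x. \<psi> x * (v (min (lev (g x)) (T - 1)) * jacobian x))"
          by (rule level_sum_bound(1)[OF \<psi> w0 wv v_mono v0 v_le E(2) main_const_nonneg C])
        show "integrable lebesgue (\<lambda>x. 2 * a * (\<psi> x * jacobian x * G T x + p k0 * (\<psi> x * jacobian x)))"
          by (intro integrable_mult_right Bochner_Integration.integrable_add int_G psi_J_int)
        show "AE x in lebesgue. \<psi> x * (v (min (lev (g x)) (T - 1)) * jacobian x)
            \<le> 2 * a * (\<psi> x * jacobian x * G T x + p k0 * (\<psi> x * jacobian x))"
          using psi_J_nonneg
        proof eventually_elim
          case (elim x)
          have "v (min (lev (g x)) (T - 1)) \<le> a * (2 * p (min (lev (g x)) (T - 1)))"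
            unfolding v_def using p_Suc a by (intro mult_left_mono) auto
          also have "\<dots> \<le> a * (2 * p (X T x))"
            unfolding X_def using monoD[OF p_mono] a by (intro mult_left_mono) auto
          also have "\<dots> \<le> a * (2 * (G T x + p k0))"
            using p_X a by (intro mult_left_mono) auto
          finally have "(\<psi> x * jacobian x) * v (min (lev (g x)) (T - 1)) \<le> (\<psi> x * jacobian x) * (a * (2 * (G T x + p k0)))"
            by (rule mult_left_mono[OF _ elim])
          then show ?case by (simp add: algebra_simps)
        qed
      qed
      also have "\<dots> = 2 * a * (Q + p k0 * S)"
        unfolding Q_def S_def using int_G[of T] psi_J_int by simp
      finally show ?thesis .
    qed
    finally have "Q \<le> L * main_const * (absorb_const * (2 * a * (Q + p k0 * S))
            + 4 * 2 ^ (CARD('n) - 1) * (a * Cp) * (LINT x|lebesgue. ex x))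
         + C * (a * Cp) * level_const * (LINT x|lebesgue. g x powr qexp) + (1 + Cp) * (LINT x|lebesgue. Z x)"
      using main_const_nonneg absorb_const_nonneg by (simp add: mult_left_mono)
    then have "Q \<le> L * main_const * absorb_const * (2 * a) * (Q + p k0 * S) + B"
      by (simp add: B_def algebra_simps)
    also have "\<dots> \<le> 1 / 2 * (Q + p k0 * S) + B"
    proof -
      have "0 \<le> G T x" for x
        using w0 by (auto simp: G_def intro!: sum_nonneg)
      then have "0 \<le> Q" unfolding Q_def
        using psi_J_nonneg by (intro integral_nonneg_AE) auto
      moreover have "0 \<le> S" unfolding S_def using psi_J_nonneg by (rule integral_nonneg_AE)
      ultimately have "0 \<le> Q + p k0 * S" using p0[of k0] by simp
      then show ?thesis using small by (intro add_right_mono mult_right_mono) auto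
    qed
    finally show ?thesis by (simp add: Q_def field_simps)
  qed
  let ?I = "\<lambda>T. LINT x|lebesgue. \<psi> x * jacobian x * p (X T x)"
  have X_mono: "AE x in lebesgue. mono (\<lambda>T. \<psi> x * jacobian x * p (X T x))"
    using psi_J_nonneg
  proof eventually_elim
    case (elim x)
    then show ?case
      by (intro monoI mult_left_mono monoD[OF p_mono]) (auto simp: X_def)
  qed
  have I_le: "?I T \<le> (p k0 * S + 2 * B) + p k0 * S" for T
  proof -
    have "?I T \<le> (LINT x|lebesgue. \<psi> x * jacobian x * G T x + p k0 * (\<psi> x * jacobian x))"
    proof (rule integral_mono_AE[OF int_pX])
      show "integrable lebesgue (\<lambda>x. \<psi> x * jacobian x * G T x + p k0 * (\<psi> x * jacobian x))"
        by (intro integrable_mult_right Bochner_Integration.integrable_add int_G psi_J_int)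
      show "AE x in lebesgue. \<psi> x * jacobian x * p (X T x) \<le> \<psi> x * jacobian x * G T x + p k0 * (\<psi> x * jacobian x)"
        using psi_J_nonneg
      proof eventually_elim
        case (elim x)
        from mult_left_mono[OF p_X[of T x] elim] show ?case by (simp add: algebra_simps)
      qed
    qed
    also have "\<dots> = (LINT x|lebesgue. \<psi> x * jacobian x * G T x) + p k0 * S"
      unfolding S_def using int_G[of T] psi_J_int by simp
    finally show ?thesis using bound[of T] by linarith
  qed
  have "incseq ?I"
  proof (rule monoI)
    fix S T :: nat assume "S \<le> T"
    show "?I S \<le> ?I T"
    proof (rule integral_mono_AE[OF int_pX int_pX])
      show "AE x in lebesgue. \<psi> x * jacobian x * p (X S x) \<le> \<psi> x * jacobian x * p (X T x)"
        using X_mono by eventually_elim (use \<open>S \<le> T\<close> in \<open>auto dest: monoD\<close>)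
    qed
  qed
  then obtain l where l: "?I \<longlonglongrightarrow> l"
    using incseq_convergent[of ?I] I_le by metis
  show ?thesis
    unfolding p_def[symmetric]
  proof (rule integrable_monotone_convergence[OF int_pX X_mono _ l])
    show "(\<lambda>x. \<psi> x * jacobian x * p (lev (g x))) \<in> borel_measurable lebesgue"
      by (intro borel_measurable_times lev_meas borel_measurable_integrable[OF psi_J_int])
    show "AE x in lebesgue. (\<lambda>T. \<psi> x * jacobian x * p (X T x)) \<longlonglongrightarrow> \<psi> x * jacobian x * p (lev (g x))"
    proof (rule AE_I2)
      fix x
      have "\<forall>\<^sub>F T in sequentially. \<psi> x * jacobian x * p (X T x) = \<psi> x * jacobian x * p (lev (g x))"
        using eventually_ge_at_top[of "lev (g x)"] by eventually_elim (simp add: X_def)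
      then show "(\<lambda>T. \<psi> x * jacobian x * p (X T x)) \<longlonglongrightarrow> \<psi> x * jacobian x * p (lev (g x))"
        by (rule tendsto_eventually)
    qed
  qed
qed

end

text \<open>Smoothness is read off from the polynomial expression in the coordinates, the Lipschitz
  bound from the radial profile \<open>h\<close>, whose derivative is bounded on the half line. Half
  the radius corresponds to the argument 1 - 1/4 of the bump, which gives the lower bound
  \<open>\<beta>\<close>.\<close>

lemma bump_cutoff:
  fixes c0 :: "real ^ 'n::finite"
  assumes r: "0 < r"
  obtains \<psi> \<Lambda> \<beta> where "Ck_domain (Suc 0) \<psi>" "\<And>x. 0 \<le> \<psi> x" "\<And>x. \<psi> x \<le> 1" "\<And>x. x \<notin> cball c0 r \<Longrightarrow> \<psi> x = 0"
    "\<And>x y. \<psi> x \<le> \<psi> y + \<Lambda> * dist x y" "0 \<le> \<Lambda>" "0 < \<beta>" "\<And>x. x \<in> ball c0 (r / 2) \<Longrightarrow> \<beta> \<le> \<psi> x"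
proof -
  define q where "q x = dist x c0 / r" for x
  define h where "h s = bump 0 (1 - s\<^sup>2)" for s
  define \<psi> where "\<psi> x = h (q x)" for x
  have q0: "0 \<le> q x" for x using r by (simp add: q_def)
  have "continuous_on {0..1} (bump (Suc 0))"
    by (rule DERIV_continuous_on[OF has_field_derivative_at_within[OF bump_DERIV]])
  then have "compact (bump (Suc 0) ` {0..1})" by (rule compact_continuous_image) simp
  then obtain M where M: "\<And>u. u \<in> {0..1} \<Longrightarrow> \<bar>bump (Suc 0) u\<bar> \<le> M"
    using compact_imp_bounded[of "bump (Suc 0) ` {0..1}"] unfolding bounded_iff by (metis imageI real_norm_def)
  have M0: "0 \<le> M" using M[of 0] by simp
  have h_deriv: "(h has_real_derivative bump (Suc 0) (1 - s\<^sup>2) * (- (2 * s))) (at s)" for s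
    unfolding h_def[abs_def]
    by (rule DERIV_chain2[OF bump_DERIV]) (auto intro!: derivative_eq_intros)
  have h_bound: "\<bar>bump (Suc 0) (1 - s\<^sup>2) * (- (2 * s))\<bar> \<le> M * 2" if "0 \<le> s" for s :: real
  proof (cases "s \<le> 1")
    case True
    then have "\<bar>bump (Suc 0) (1 - s\<^sup>2)\<bar> \<le> M" using that by (intro M) (auto simp: power_le_one)
    then show ?thesis using True that M0 by (simp add: abs_mult mult_mono)
  next
    case False
    then have "1 \<le> s\<^sup>2" using one_le_power[of s 2] by simp
    then show ?thesis using M0 by (simp add: bump_def)
  qed
  have h_Lip: "\<bar>h s - h t\<bar> \<le> M * 2 * \<bar>s - t\<bar>" if "0 \<le> s" "0 \<le> t" for s t
    using field_differentiable_bound[of "{0..}" h "\<lambda>s. bump (Suc 0) (1 - s\<^sup>2) * (- (2 * s))" "M * 2" s t]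
      has_field_derivative_at_within[OF h_deriv] h_bound that by auto
  have poly: "\<psi> x = bump 0 (1 - (\<Sum>i\<in>UNIV. (x $ i - c0 $ i) ^ 2) * (inverse r)\<^sup>2)" for x
    unfolding \<psi>_def h_def q_def dist_norm norm_vec_def L2_set_def
    by (simp add: power_divide divide_inverse power_mult_distrib sum_nonneg power_inverse)
  have Ck: "Ck_param k (\<lambda>x (p :: real). bump 0 (1 - (\<Sum>i\<in>UNIV. (x $ i - c0 $ i) ^ 2) * (inverse r)\<^sup>2))" for k
    by (intro Ck_param_compose[of bump, OF bump_DERIV] Ck_param_diff Ck_param_mult Ck_param_sum Ck_param_power
          Ck_param_coord Ck_param_const continuous_intros) auto
  show thesis
  proof (rule that[of \<psi> "M * 2 / r" "bump 0 (3 / 4)"])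
    show "Ck_domain (Suc 0) \<psi>"
      using Ck_domain_Ck_param[OF Ck[of "Suc 0"]] by (simp only: poly[abs_def])
    show "0 \<le> \<psi> x" "\<psi> x \<le> 1" for x by (simp_all add: \<psi>_def h_def bump_0_bounds)
    show "\<psi> x = 0" if "x \<notin> cball c0 r" for x
    proof -
      have "1 \<le> q x" using that r by (simp add: q_def dist_commute)
      then have "1 \<le> (q x)\<^sup>2" by (rule one_le_power)
      then show ?thesis by (simp add: \<psi>_def h_def bump_def)
    qed
    show "\<psi> x \<le> \<psi> y + M * 2 / r * dist x y" for x y
    proof -
      have "\<bar>q x - q y\<bar> \<le> dist x y / r"
        using abs_dist_diff_le[of x c0 y] r unfolding q_def diff_divide_distrib[symmetric]
        by (simp add: abs_divide divide_right_mono dist_commute)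
      then have "M * 2 * \<bar>q x - q y\<bar> \<le> M * 2 * (dist x y / r)" using M0 by (intro mult_left_mono) auto
      then show ?thesis using h_Lip[OF q0[of x] q0[of y]] by (simp add: \<psi>_def)
    qed
    show "0 \<le> M * 2 / r" using M0 r by simp
    show "0 < bump 0 (3 / 4)" by (simp add: bump_def)
    show "bump 0 (3 / 4) \<le> \<psi> x" if "x \<in> ball c0 (r / 2)" for x
    proof -
      have "q x \<le> 1 / 2" using that r by (simp add: q_def dist_commute field_simps)
      then have "(q x)\<^sup>2 \<le> (1 / 2)\<^sup>2" using q0 by (intro power_mono)
      then have u: "3 / 4 \<le> 1 - (q x)\<^sup>2" by (simp add: power2_eq_square)
      then have "inverse (1 - (q x)\<^sup>2) \<le> inverse (3 / 4)" by (intro le_imp_inverse_le) auto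
      then show ?thesis using u by (simp add: \<psi>_def h_def bump_def inverse_eq_divide)
    qed
  qed
qed

context distortion_curve
begin

text \<open>The bound on minors makes the Jacobian at most a constant times 2^(n lev), so its
  logarithm is at most linear in the level of \<open>g\<close>. This turns level weights into
  logarithms of the Jacobian.\<close>

lemma log_jacobian_le:
  obtains C1 where "0 < C1"
    "\<And>x. 0 \<le> jacobian x \<Longrightarrow> ln (exp 1 + jacobian x) \<le> C1 * (2 + real (lev (g x)))"
proof -
  define B where "B = L * fact CARD('n)"
  have B: "0 \<le> B" using L_nonneg by (simp add: B_def)
  define C1 where "C1 = ln (exp 1 + B) + real CARD('n)"
  have e1: "(1::real) \<le> exp 1" by simp
  have l1: "1 \<le> ln (exp 1 + B)" using B ln_mono[of "exp 1" "exp 1 + B"] by (simp add: add_pos_nonneg)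
  show thesis
  proof (rule that[of C1])
    show "0 < C1" using l1 by (simp add: C1_def)
    fix x assume J: "0 \<le> jacobian x"
    let ?P = "(2 ^ lev (g x)) ^ CARD('n) :: real"
    have "\<bar>jacobian x\<bar> \<le> L * (fact CARD('n) * (\<Prod>l\<in>UNIV. enorm m (Df x l)))"
      unfolding jacobian_def by (rule abs_form_eval_le[where \<phi> = \<phi> and L = L, OF L[OF f_Rm[of x]]])
    also have "\<dots> \<le> L * (fact CARD('n) * (\<Prod>l\<in>(UNIV :: 'n set). 2 ^ lev (g x)))"
      using L_nonneg enorm_Df_le_g[of x] lev_le[of "g x"]
      by (intro mult_left_mono prod_mono) (auto simp: enorm_def intro: order_trans)
    finally have J_le: "jacobian x \<le> B * ?P" by (simp add: B_def)
    have P1: "1 \<le> ?P" by simp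
    have "exp 1 + jacobian x \<le> exp 1 * ?P + B * ?P"
      using J_le mult_left_mono[OF P1, of "exp 1"] exp_ge_zero[of "1::real"] by linarith
    then have "ln (exp 1 + jacobian x) \<le> ln ((exp 1 + B) * ?P)"
      using J by (intro ln_mono) (auto simp: distrib_right add_pos_nonneg)
    also have "\<dots> = ln (exp 1 + B) + real CARD('n) * (real (lev (g x)) * ln 2)"
      using B add_pos_nonneg[of "exp 1" B] by (simp add: ln_mult ln_realpow)
    also have "\<dots> \<le> ln (exp 1 + B) * (2 + real (lev (g x))) + real CARD('n) * (2 + real (lev (g x)))"
    proof (rule add_mono)
      show "ln (exp 1 + B) \<le> ln (exp 1 + B) * (2 + real (lev (g x)))" using l1 by (simp add: algebra_simps)
      have "real (lev (g x)) * ln 2 \<le> real (lev (g x)) * 1"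
        using ln_2_less_1 by (intro mult_left_mono) auto
      then show "real CARD('n) * (real (lev (g x)) * ln 2) \<le> real CARD('n) * (2 + real (lev (g x)))"
        by (intro mult_left_mono) auto
    qed
    finally show "ln (exp 1 + jacobian x) \<le> C1 * (2 + real (lev (g x)))"
      by (simp add: C1_def algebra_simps)
  qed
qed

lemma local_log_integrability:
  assumes a: "0 < a" and small: "L * main_const * absorb_const * (2 * a) \<le> 1 / 2"
  shows "integrable lebesgue (\<lambda>x. indicator (ball c0 (R / 4)) x * (jacobian x * ln (exp 1 + jacobian x) powr a))"
proof -
  \<comment> \<open>With this margin the cut-off function is supported in the closed ball of radius
    \<open>R / 2\<close>, and it is at least \<open>\<beta>\<close> on the ball of radius
    \<open>R / 4\<close>.\<close>
  define s0 where "s0 = R / 4"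
  have s0: "0 < s0" and Rs0: "R - 2 * s0 = R / 2" using R by (auto simp: s0_def)
  obtain \<psi> \<Lambda> \<beta> where cut: "Ck_domain (Suc 0) \<psi>" "\<And>x. 0 \<le> \<psi> x" "\<And>x. \<psi> x \<le> 1" "\<And>x. x \<notin> cball c0 (R / 2) \<Longrightarrow> \<psi> x = 0"
    "\<And>x y. \<psi> x \<le> \<psi> y + \<Lambda> * dist x y" "0 \<le> \<Lambda>" "0 < \<beta>" "\<And>x. x \<in> ball c0 (R / 2 / 2) \<Longrightarrow> \<beta> \<le> \<psi> x"
    by (rule bump_cutoff[of "R / 2" c0]) ((use R in simp), (rule that; assumption))
  have \<psi>_meas: "\<psi> \<in> borel_measurable lebesgue"
    using Ck_domain_continuous[OF cut(1)] by (intro measurable_completion) (simp add: borel_measurable_continuous_onI)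
  obtain C k0 where C: "0 \<le> C"
    "\<And>k. k0 \<le> k \<Longrightarrow>
       \<bar>LINT x|lebesgue. indicator (- U (2 ^ k)) x * (\<psi> x * jacobian x + boundary_term \<psi> x)\<bar>
         \<le> L * main_const * 2 ^ (k * (CARD('n) - 1)) * (LINT x|lebesgue. indicator (high (2 ^ k)) x * (g x * \<psi> x))
            + C * (2 ^ k) powr (real CARD('n) - 1 - gam) * (LINT x|lebesgue. indicator (high (2 ^ k)) x * g x)"
    "\<And>k. k0 \<le> k \<Longrightarrow> AE x in lebesgue. x \<notin> U (2 ^ k) \<longrightarrow> \<bar>boundary_term \<psi> x\<bar> \<le> C * (2 ^ k) powr (real CARD('n) - gam)"
    "\<And>k. k0 \<le> k \<Longrightarrow> measure lebesgue (U (2 ^ k)) \<le> C / 2 ^ k * (LINT x|lebesgue. indicator (high (2 ^ k)) x * g x)"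
    using level_estimate[OF s0 cut(1,2) _ cut(3,5,6)] cut(4) unfolding Rs0 by blast
  interpret level_curve m \<phi> L f Df c0 R Kf lam c \<psi> C k0
  proof unfold_locales
    show "boundary_term \<psi> x = 0" if "x \<notin> cball c0 R" for x
    proof -
      have "x \<notin> cball c0 (R / 2)" using that R by auto
      then have "pderiv_domain l \<psi> x = 0" for l
        by (intro pderiv_domain_zero_outside[OF cut(1) closed_cball cut(4)])
      then show ?thesis by (simp add: boundary_term_def)
    qed
  qed (fact cut(2) cut(3) \<psi>_meas boundary_term_measurable[OF cut(1)] C)+
  obtain C1 where C1: "0 < C1" "\<And>x. 0 \<le> jacobian x \<Longrightarrow> ln (exp 1 + jacobian x) \<le> C1 * (2 + real (lev (g x)))"
    by (rule log_jacobian_le) (rule that; assumption)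
  define E where "E = max 2 (2 * a)"
  have E: "2 * a \<le> E" "2 \<le> E" by (auto simp: E_def)
  have main: "integrable lebesgue (\<lambda>x. C1 powr a / \<beta> * (\<psi> x * jacobian x * (E + real (lev (g x))) powr a))"
    by (intro integrable_mult_right log_integrable[OF a small E])
  show ?thesis
  proof (rule Bochner_Integration.integrable_bound[OF main])
    show "(\<lambda>x. indicator (ball c0 (R / 4)) x * (jacobian x * ln (exp 1 + jacobian x) powr a)) \<in> borel_measurable lebesgue"
      using jacobian_measurable
      by (intro borel_measurable_times borel_measurable_indicator powr_real_measurable borel_measurable_ln
          borel_measurable_add borel_measurable_const) auto
    show "AE x in lebesgue. norm (indicator (ball c0 (R / 4)) x * (jacobian x * ln (exp 1 + jacobian x) powr a))
        \<le> norm (C1 powr a / \<beta> * (\<psi> x * jacobian x * (E + real (lev (g x))) powr a))"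
      using jacobian_nonneg
    proof eventually_elim
      case (elim x)
      have rhs0: "0 \<le> C1 powr a / \<beta> * (\<psi> x * jacobian x * (E + real (lev (g x))) powr a)"
        using elim cut(2,7) by simp
      show ?case
      proof (cases "x \<in> ball c0 (R / 4)")
        case False
        then show ?thesis using rhs0 by (simp add: indicator_def)
      next
        case True
        then have \<beta>: "\<beta> \<le> \<psi> x" by (intro cut(8)) simp
        have ln0: "0 \<le> ln (exp 1 + jacobian x)" using elim by (intro ln_ge_zero) (simp add: add_increasing2)
        have "ln (exp 1 + jacobian x) powr a \<le> (C1 * (E + real (lev (g x)))) powr a"
        proof (rule powr_mono2)
          have "C1 * (2 + real (lev (g x))) \<le> C1 * (E + real (lev (g x)))"
            using C1(1) E by (intro mult_left_mono) auto
          then show "ln (exp 1 + jacobian x) \<le> C1 * (E + real (lev (g x)))"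
            using C1(2)[OF elim] by linarith
        qed (use a ln0 in auto)
        also have "\<dots> = C1 powr a * (E + real (lev (g x))) powr a"
          using C1(1) E by (simp add: powr_mult)
        finally have "jacobian x * ln (exp 1 + jacobian x) powr a \<le> jacobian x * (C1 powr a * (E + real (lev (g x))) powr a)"
          by (rule mult_left_mono[OF _ elim])
        also have "\<dots> \<le> \<psi> x / \<beta> * (jacobian x * (C1 powr a * (E + real (lev (g x))) powr a))"
          using \<beta> cut(7) elim mult_right_mono[of 1 "\<psi> x / \<beta>" "jacobian x * (C1 powr a * (E + real (lev (g x))) powr a)"] by simp
        also have "\<dots> = C1 powr a / \<beta> * (\<psi> x * jacobian x * (E + real (lev (g x))) powr a)"
          by simp
        finally show ?thesis unfolding real_norm_def abs_of_nonneg[OF rhs0] using True elim ln0 by simp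
      qed
    qed
  qed
qed

end

subsection \<open>Higher integrability\<close>

lemma strict_mono_range_eq:
  fixes I J :: "'n::{finite,linorder} \<Rightarrow> nat"
  assumes "strict_mono I" "strict_mono J" "range J \<subseteq> range I"
  shows "J = I"
proof -
  have "card (range I) = card (range J)"
    using assms by (simp add: card_image strict_mono_imp_inj_on)
  then have "range J = range I" using assms(3) by (intro card_subset_eq) auto
  then show ?thesis by (rule strict_mono_range_unique[OF assms(2,1)])
qed

text \<open>For \<open>J\<close> other than \<open>I\<close> some index of \<open>J\<close> is
  missing from \<open>I\<close>, and the corresponding row of the matrix vanishes. Evaluation on
  these unit vectors shows that the comass dominates every coefficient.\<close>

lemma form_eval_basis:
  fixes \<phi> :: "'n::{finite,linorder} form"
  assumes I: "I \<in> multi_indices m"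
  shows "form_eval m \<phi> y (\<lambda>l i. if i = I l then 1 else 0) = \<phi> I y"
proof -
  let ?v = "\<lambda>l i. if i = I l then 1 else 0 :: real"
  have inj: "I k = I l \<longleftrightarrow> k = l" for k l
    using I by (auto simp: multi_indices_def strict_mono_eq)
  have "dx J ?v = (if J = I then 1 else 0)" if J: "J \<in> multi_indices m" for J
  proof (cases "J = I")
    case True
    have "(\<chi> k l. ?v l (I k)) = mat 1" by (simp add: mat_def vec_eq_iff inj)
    then show ?thesis using True by (simp add: dx_def)
  next
    case False
    then obtain k where k: "J k \<notin> range I"
      using strict_mono_range_eq[of I J] I J by (auto simp: multi_indices_def)
    then have "row k (\<chi> k l. ?v l (J k)) = 0" by (auto simp: row_def vec_eq_iff)
    then show ?thesis using False det_zero_row(1)[of k] by (simp add: dx_def)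
  qed
  then have "form_eval m \<phi> y ?v = (\<Sum>J\<in>multi_indices m. if J = I then \<phi> J y else 0)"
    unfolding form_eval_def by (intro sum.cong) auto
  then show ?thesis using I by simp
qed

section \<open>Bounds for the comass and the operator norm\<close>

context
  fixes m :: nat and \<phi> :: "'n::{finite,linorder} form" and L :: real
  assumes L: "\<And>y. y \<in> Rm m \<Longrightarrow> (\<Sum>I\<in>multi_indices m. \<bar>\<phi> I y\<bar>) \<le> L"
begin

lemma comass_set_bounds:
  assumes y: "y \<in> Rm m"
  shows "bdd_above {\<bar>form_eval m \<phi> y v\<bar> | v. \<forall>l. v l \<in> Rm m \<and> enorm m (v l) \<le> 1}"
proof (rule bdd_aboveI)
  fix t assume "t \<in> {\<bar>form_eval m \<phi> y v\<bar> | v. \<forall>l. v l \<in> Rm m \<and> enorm m (v l) \<le> 1}"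
  then obtain v where v: "t = \<bar>form_eval m \<phi> y v\<bar>" "\<And>l. enorm m (v l) \<le> 1" by auto
  have "0 \<le> (\<Sum>I\<in>multi_indices m. \<bar>\<phi> I y\<bar>)" by (intro sum_nonneg) auto
  then have L0: "0 \<le> L" using L[OF y] by linarith
  have "t \<le> L * (fact CARD('n) * (\<Prod>l\<in>UNIV. enorm m (v l)))"
    unfolding v by (rule abs_form_eval_le[where \<phi> = \<phi> and L = L, OF L[OF y]])
  also have "\<dots> \<le> L * (fact CARD('n) * (\<Prod>l\<in>(UNIV :: 'n set). 1))"
    using v(2) L0 by (intro mult_left_mono prod_mono) auto
  finally show "t \<le> L * fact CARD('n)" by simp
qed

lemma comass_ge:
  assumes "y \<in> Rm m" "\<And>l. v l \<in> Rm m" "\<And>l. enorm m (v l) \<le> 1"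
  shows "\<bar>form_eval m \<phi> y v\<bar> \<le> comass m \<phi> y"
  unfolding comass_def using assms by (intro cSup_upper comass_set_bounds) auto

lemma comass_ge_coefficient:
  assumes y: "y \<in> Rm m" and I: "I \<in> multi_indices m"
  shows "\<bar>\<phi> I y\<bar> \<le> comass m \<phi> y"
proof -
  have I_less: "I l < m" for l using I by (auto simp: multi_indices_def)
  have "L2_set (\<lambda>i. if i = I l then 1 else 0 :: real) {..<m} = 1" for l
  proof -
    have "(\<Sum>i<m. (if i = I l then 1 else 0 :: real)\<^sup>2) = (\<Sum>i<m. if i = I l then 1 else 0)"
      by (intro sum.cong) auto
    also have "\<dots> = 1" using I_less by simp
    finally show ?thesis by (simp add: L2_set_def)
  qed
  then show ?thesis
    using comass_ge[OF y, of "\<lambda>l i. if i = I l then 1 else 0"] I_less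
    by (simp add: form_eval_basis[OF I] Rm_iff enorm_def) (metis leD)
qed

lemma inf_norm_le_comass:
  assumes "y \<in> Rm m"
  shows "inf_norm m \<phi> \<le> comass m \<phi> y"
  unfolding inf_norm_def
proof (rule cINF_lower[OF _ assms])
  have "0 \<le> comass m \<phi> z" if "z \<in> Rm m" for z
    using comass_ge[OF that, of "\<lambda>_ _. 0"] by (auto simp: Rm_iff enorm_def L2_set_def)
  then show "bdd_below (comass m \<phi> ` Rm m)" by (intro bdd_belowI[of _ 0]) auto
qed

lemma inf_norm_pos:
  assumes "0 < c" "\<And>y. y \<in> Rm m \<Longrightarrow> \<exists>I\<in>multi_indices m. c < \<bar>\<phi> I y\<bar>"
  shows "0 < inf_norm m \<phi>"
proof -
  have "(\<lambda>_. 0) \<in> Rm m" by (simp add: Rm_iff)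
  then have "c \<le> inf_norm m \<phi>" unfolding inf_norm_def
    using assms(2) comass_ge_coefficient by (intro cINF_greatest) (auto, fastforce)
  then show ?thesis using assms(1) by linarith
qed

end

lemma l1_norm_bound:
  assumes \<phi>: "\<And>I. I \<in> multi_indices m \<Longrightarrow> bounded (\<phi> I ` Rm m)" and y: "y \<in> Rm m"
  shows "(\<Sum>I\<in>multi_indices m. \<bar>\<phi> I y\<bar>) \<le> l1_norm m \<phi>"
proof -
  have "\<exists>B. \<forall>y\<in>Rm m. \<bar>\<phi> I y\<bar> \<le> B" if "I \<in> multi_indices m" for I
    using \<phi>[OF that] by (auto simp: bounded_iff)
  then obtain B where B: "\<And>I y. I \<in> multi_indices m \<Longrightarrow> y \<in> Rm m \<Longrightarrow> \<bar>\<phi> I y\<bar> \<le> B I" by metis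
  have "bdd_above ((\<lambda>y. \<Sum>I\<in>multi_indices m. \<bar>\<phi> I y\<bar>) ` Rm m)"
    using B by (intro bdd_aboveI[of _ "\<Sum>I\<in>multi_indices m. B I"]) (auto intro!: sum_mono)
  then show ?thesis unfolding l1_norm_def by (rule cSUP_upper[OF y])
qed

lemma enorm_linear_le:
  assumes "norm h \<le> 1"
  shows "enorm m (\<lambda>i. \<Sum>l\<in>UNIV. h $ l * A l i) \<le> (\<Sum>l\<in>UNIV. enorm m (A l))"
proof -
  have "enorm m (\<lambda>i. \<Sum>l\<in>UNIV. h $ l * A l i) \<le> (\<Sum>l\<in>UNIV. \<bar>h $ l\<bar> * enorm m (A l))"
    by (rule enorm_sum) simp
  also have "\<dots> \<le> (\<Sum>l\<in>UNIV. 1 * enorm m (A l))"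
    using component_le_norm_cart[of h] assms by (intro sum_mono mult_right_mono) (auto intro: order_trans)
  finally show ?thesis by simp
qed

lemma op_norm_bdd: "bdd_above ((\<lambda>h. enorm m (\<lambda>i. \<Sum>l\<in>UNIV. h $ l * A l i)) ` {h :: (real, 'n::finite) vec. norm h \<le> 1})"
  using enorm_linear_le by (intro bdd_aboveI[of _ "\<Sum>l\<in>UNIV. enorm m (A l)"]) auto

lemma op_norm_ge: "norm h \<le> 1 \<Longrightarrow> enorm m (\<lambda>i. \<Sum>l\<in>UNIV. h $ l * A l i) \<le> op_norm m A"
  unfolding op_norm_def by (intro cSUP_upper op_norm_bdd) auto

lemma op_norm_nonneg: "0 \<le> op_norm m A"
  using op_norm_ge[of 0 m A] enorm_nonneg order_trans by (metis norm_zero zero_le_one)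

lemma enorm_le_op_norm: "enorm m (A l) \<le> op_norm m A"
proof -
  have "(\<lambda>i. \<Sum>k\<in>UNIV. axis l 1 $ k * A k i) = A l"
    by (simp add: axis_def if_distrib[of "\<lambda>c. c * _"] cong: if_cong)
  then show ?thesis using op_norm_ge[of "axis l 1" m A] by simp
qed

text \<open>The image norm is continuous in the vector, so the supremum over the unit ball is
  attained along a countable dense subset, and countable suprema preserve measurability.\<close>

lemma op_norm_measurable:
  fixes A :: "'x \<Rightarrow> 'n::finite \<Rightarrow> nat \<Rightarrow> real"
  assumes "\<And>l i. i < m \<Longrightarrow> (\<lambda>x. A x l i) \<in> borel_measurable M"
  shows "(\<lambda>x. op_norm m (A x)) \<in> borel_measurable M"
proof -
  let ?S = "{h :: (real, 'n) vec. norm h \<le> 1}"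
  let ?F = "\<lambda>B h. enorm m (\<lambda>i. \<Sum>l\<in>UNIV. h $ l * B l i)"
  obtain D where D: "countable D" "D \<subseteq> ?S" "?S \<subseteq> closure D" by (rule separable)
  have "D \<noteq> {}" using D(3) by (auto dest: subsetD[of _ _ 0])
  have bdd: "bdd_above (?F B ` D)" for B
    by (rule bdd_above_mono[OF op_norm_bdd image_mono[OF D(2)]])
  have eq: "op_norm m B = (SUP h\<in>D. ?F B h)" for B :: "'n \<Rightarrow> nat \<Rightarrow> real"
  proof (rule antisym)
    have "closed {h. ?F B h \<le> (SUP h\<in>D. ?F B h)}"
      unfolding enorm_def L2_set_def by (intro closed_Collect_le continuous_intros)
    moreover have "D \<subseteq> {h. ?F B h \<le> (SUP h\<in>D. ?F B h)}"
      using cSUP_upper[OF _ bdd] by auto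
    ultimately have "closure D \<subseteq> {h. ?F B h \<le> (SUP h\<in>D. ?F B h)}" by (rule closure_minimal[rotated])
    then have "?F B h \<le> (SUP h\<in>D. ?F B h)" if "h \<in> ?S" for h using that D(3) by blast
    moreover have "(0 :: (real, 'n) vec) \<in> ?S" by simp
    ultimately show "op_norm m B \<le> (SUP h\<in>D. ?F B h)"
      unfolding op_norm_def by (intro cSUP_least) blast+
    show "(SUP h\<in>D. ?F B h) \<le> op_norm m B"
      using \<open>D \<noteq> {}\<close> D(2) op_norm_ge by (intro cSUP_least) auto
  qed
  show ?thesis
    unfolding eq using assms
    by (intro borel_measurable_cSUP D(1) bdd enorm_measurable borel_measurable_sum borel_measurable_times) auto
qed

lemma L1_loc_if_balls:
  assumes \<Omega>: "open \<Omega>" and u: "\<And>x. x \<in> \<Omega> \<Longrightarrow> \<exists>r>0. u absolutely_integrable_on ball x r"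
  shows "L1_loc \<Omega> u"
  unfolding L1_loc_def
proof (intro allI impI)
  fix K assume K: "compact K \<and> K \<subseteq> \<Omega>"
  then obtain r where r: "\<And>x. x \<in> K \<Longrightarrow> 0 < r x \<and> u absolutely_integrable_on ball x (r x)"
    using u by (metis subsetD)
  have "compact K" using K by blast
  then obtain F where F: "F \<subseteq> K" "finite F" "K \<subseteq> (\<Union>x\<in>F. ball x (r x))"
  proof (rule compactE_image)
    show "K \<subseteq> (\<Union>x\<in>K. ball x (r x))" using r by force
  qed auto
  have "u absolutely_integrable_on (\<Union>x\<in>F. ball x (r x))"
    using F r by (intro set_integrable_UN) auto
  then show "u absolutely_integrable_on K"
    by (rule set_integrable_subset) (use \<open>compact K\<close> F in \<open>auto simp: lmeasurable_compact fmeasurableD\<close>)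
qed

text \<open>Four cases. For bounded \<open>t\<close> there is nothing to gain. If \<open>k\<close>
  exceeds a multiple of log t, the exponential beats the power of \<open>t\<close>. If
  \<open>k\<close> is at most logarithmic and \<open>t \<le> J\<close>, one logarithm pays for
  \<open>k\<close> and the power of the logarithm passes to \<open>J\<close>. If
  \<open>J < t\<close>, then \<open>2 \<le> n\<close> forces \<open>k\<close> to be at least
  \<open>c * t\<close>, and the exponential wins again.\<close>

lemma log_gradient_bound:
  fixes a lam c :: real
  assumes a: "0 < a" and lam: "0 < lam" and c: "0 < c" and n: "2 \<le> n"
  obtains C where "0 \<le> C"
    "\<And>t J k. 0 \<le> t \<Longrightarrow> 0 \<le> J \<Longrightarrow> 1 \<le> k \<Longrightarrow> c * t ^ n \<le> k * J \<Longrightarrow>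
       t ^ n * ln (exp 1 + t) powr (a - 1) \<le> C * (J * ln (exp 1 + J) powr a + exp (lam * k) + 1)"
proof -
  define d where "d = real n + a"
  \<comment> \<open>Chosen so that \<open>M * s < k\<close> makes \<open>exp (lam * k)\<close> at
    least \<open>(exp 1 + t) powr d\<close>; the exponent \<open>d\<close> covers both the power n
    and the logarithmic factor.\<close>
  define M where "M = d / lam"
  have d: "0 \<le> d" "0 \<le> M" using a lam by (auto simp: d_def M_def)
  obtain B where B: "0 < B" "\<And>x. 1 \<le> x \<Longrightarrow> x powr d \<le> B * exp (lam * c * x)"
    using powr_le_exp[of "lam * c" d] lam c d by auto
  define C where "C = ln (exp 1 + 1) powr a + 1 + M / c + B * exp (lam * c * exp 1)"
  have C0: "0 \<le> C" using d c B(1) by (simp add: C_def)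
  show thesis
  proof (rule that[OF C0])
    fix t J k :: real assume t: "0 \<le> t" and J: "0 \<le> J" and k: "1 \<le> k" and le: "c * t ^ n \<le> k * J"
    define s where "s = ln (exp 1 + t)"
    have e_t: "1 \<le> exp 1 + t" using t by (simp add: add_increasing2)
    have s1: "1 \<le> s" using t ln_mono[of "exp 1" "exp 1 + t"] by (simp add: s_def add_pos_nonneg)
    have s_exp: "exp s = exp 1 + t" using e_t by (simp add: s_def)
    have s_le: "s \<le> exp 1 + t" using exp_ge_add_one_self[of s] by (simp add: s_exp)
    have lnJ: "0 \<le> ln (exp 1 + J)" using J by (intro ln_ge_zero) (simp add: add_increasing2)
    have sa: "s powr (a - 1) \<le> s powr a" using s1 by (intro powr_mono) auto
    have sa': "s powr (a - 1) \<le> (exp 1 + t) powr a"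
      using sa powr_mono2[of a s "exp 1 + t"] a s1 s_le by linarith
    have big: "t ^ n * s powr (a - 1) \<le> (exp 1 + t) powr d"
    proof -
      have "t ^ n * s powr (a - 1) \<le> (exp 1 + t) ^ n * (exp 1 + t) powr a"
        using t sa' by (intro mult_mono power_mono) auto
      also have "\<dots> = (exp 1 + t) powr d"
        using e_t by (simp add: d_def powr_add powr_realpow)
      finally show ?thesis .
    qed
    define X where "X = J * ln (exp 1 + J) powr a + exp (lam * k) + 1"
    have JX: "J * ln (exp 1 + J) powr a \<le> X" "exp (lam * k) \<le> X" "1 \<le> X" "0 \<le> X"
      using J by (auto simp: X_def add_increasing)
    have "t ^ n * s powr (a - 1) \<le> C * X"
    proof -
      consider "t \<le> 1" | "1 < t" "M * s < k" | "1 < t" "k \<le> M * s" "t \<le> J" | "1 < t" "J < t" by linarith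
      then have "\<exists>D\<in>{ln (exp 1 + 1) powr a, 1, M / c, B * exp (lam * c * exp 1)}. t ^ n * s powr (a - 1) \<le> D * X"
      proof cases
        case 1
        have "s \<le> ln (exp 1 + 1)" unfolding s_def using 1 e_t by (intro ln_mono) (auto simp: add_pos_nonneg t)
        then have "s powr a \<le> ln (exp 1 + 1) powr a" using s1 a by (intro powr_mono2) auto
        then have "t ^ n * s powr (a - 1) \<le> 1 * ln (exp 1 + 1) powr a"
          using 1 t sa by (intro mult_mono power_le_one) auto
        also have "\<dots> \<le> ln (exp 1 + 1) powr a * X" using mult_left_mono[OF JX(3), of "ln (exp 1 + 1) powr a"] by simp
        finally show ?thesis by blast
      next
        case 2
        have "(exp 1 + t) powr d = exp (s * d)" using e_t by (simp add: powr_def s_def)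
        also have "\<dots> \<le> exp (lam * k)"
          using 2(2) lam by (simp add: M_def field_simps)
        finally show ?thesis using big JX(2) by force
      next
        case 3
        have "t ^ n \<le> k * J / c" using le c by (simp add: field_simps)
        also have "\<dots> \<le> M * s * J / c" using 3 J c by (intro divide_right_mono mult_right_mono) auto
        finally have "t ^ n * s powr (a - 1) \<le> M * s * J / c * s powr (a - 1)" by (rule mult_right_mono) simp
        also have "\<dots> = M / c * (J * s powr a)" using s1 by (simp add: powr_diff)
        also have "\<dots> \<le> M / c * X"
        proof (intro mult_left_mono)
          have "s \<le> ln (exp 1 + J)" unfolding s_def using 3 t by (intro ln_mono) (auto simp: add_pos_nonneg)
          then have "s powr a \<le> ln (exp 1 + J) powr a" using s1 a by (intro powr_mono2) auto
          then have "J * s powr a \<le> J * ln (exp 1 + J) powr a" using J by (rule mult_left_mono)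
          then show "J * s powr a \<le> X" using JX(1) by linarith
        qed (use d c in auto)
        finally show ?thesis by blast
      next
        case 4
        have tn: "t ^ n = t * t ^ (n - 1)" using n by (cases n) auto
        have "k * J \<le> k * t" using 4 k by (intro mult_left_mono) auto
        then have "t * (c * t ^ (n - 1)) \<le> t * k" using le tn by (simp add: mult_ac)
        then have "c * t ^ (n - 1) \<le> k" using 4 by simp
        moreover have "c * t \<le> c * t ^ (n - 1)"
          using 4 n c power_increasing[of 1 "n - 1" t] by (intro mult_left_mono) auto
        ultimately have ct: "c * t \<le> k" by linarith
        have "(exp 1 + t) powr d \<le> B * exp (lam * c * (exp 1 + t))" by (rule B(2)[OF e_t])
        also have "\<dots> = B * exp (lam * c * exp 1) * exp (lam * (c * t))"
          by (simp add: exp_add[symmetric] algebra_simps)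
        also have "\<dots> \<le> B * exp (lam * c * exp 1) * X"
        proof (intro mult_left_mono)
          have "exp (lam * (c * t)) \<le> exp (lam * k)" using ct lam by simp
          then show "exp (lam * (c * t)) \<le> X" using JX(2) by linarith
        qed (use B in auto)
        finally show ?thesis using big by (meson insertCI order_trans)
      qed
      then obtain D where D: "D \<in> {ln (exp 1 + 1) powr a, 1, M / c, B * exp (lam * c * exp 1)}" "t ^ n * s powr (a - 1) \<le> D * X" by blast
      have "0 \<le> M / c" "0 \<le> B * exp (lam * c * exp 1)" "0 \<le> ln (exp 1 + 1) powr a" using d c B(1) by auto
      then have "D \<le> C" using D(1) unfolding C_def by auto
      then have "D * X \<le> C * X" using JX(4) by (rule mult_right_mono)
      then show ?thesis using D(2) by linarith
    qed
    then show "t ^ n * ln (exp 1 + t) powr (a - 1) \<le> C * (J * ln (exp 1 + J) powr a + exp (lam * k) + 1)"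
      by (simp add: s_def X_def)
  qed
qed

text \<open>The reciprocal of 4 times \<open>main_const\<close> times the numerator of
  \<open>absorb_const\<close>, written out so that it visibly depends on n alone. Up to the
  threshold it defines, the factor \<open>L * main_const * absorb_const * (2 * a)\<close> is at most
  1/2.\<close>

definition critical_const :: "'n::{finite,linorder} itself \<Rightarrow> real" where
  "critical_const _ = 1 / (4 * (fact CARD('n) * (2 * (unit_ball_vol (real CARD('n)) / bump_mass TYPE('n))) ^ CARD('n) * (2 * 5 ^ CARD('n)))
     * (4 * 2 ^ (CARD('n) - 1) * real CARD('n) ^ CARD('n) * (2 * real CARD('n))))"

lemma critical_const_pos: "0 < critical_const TYPE('n::{finite,linorder})"
  using bump_mass_pos[where 'n = 'n] by (simp add: critical_const_def)

lemma dx_0: "dx I (\<lambda>_ _. 0) = 0"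
  by (simp add: dx_def det_zero_row(1) row_def vec_eq_iff)

lemma finite_distortion_curve_AE:
  fixes \<phi> :: "'n::{finite,linorder} form"
  assumes \<Omega>: "open \<Omega>" and f: "finite_distortion_curve m \<phi> \<Omega> f Df K"
  shows "AE x in lebesgue. x \<in> \<Omega> \<longrightarrow> 1 \<le> real_of_ereal (K x) \<and>
     comass m \<phi> (f x) * op_norm m (Df x) ^ CARD('n) \<le> real_of_ereal (K x) * star_pullback m \<phi> f Df x"
proof -
  have S: "\<Omega> \<inter> space lebesgue \<in> sets lebesgue" using \<Omega> by auto
  have fin: "AE x in lebesgue. x \<in> \<Omega> \<longrightarrow> K x < \<infinity>"
    and bound: "AE x in lebesgue. x \<in> \<Omega> \<longrightarrow> ereal (comass m \<phi> (f x) * op_norm m (Df x) ^ CARD('n)) \<le> K x * ereal (star_pullback m \<phi> f Df x)"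
    using f unfolding finite_distortion_curve_def AE_restrict_space_iff[OF S] by auto
  have ge1: "1 \<le> K x" if "x \<in> \<Omega>" for x using f that by (auto simp: finite_distortion_curve_def)
  show ?thesis
    using fin bound
  proof eventually_elim
    case (elim x)
    show ?case
    proof
      assume x: "x \<in> \<Omega>"
      then obtain k where "K x = ereal k" using elim(1) ge1[OF x] by (cases "K x") auto
      then show "1 \<le> real_of_ereal (K x) \<and> comass m \<phi> (f x) * op_norm m (Df x) ^ CARD('n) \<le> real_of_ereal (K x) * star_pullback m \<phi> f Df x"
        using elim(2) ge1[OF x] x by simp
    qed
  qed
qed

text \<open>The summation over levels yields a positive exponent \<open>a\<close> up to the
  threshold. Smaller exponents \<open>a'\<close> of either sign follow, since the logarithm of e
  plus a nonnegative number is at least one. Cutting the curve off to a closed ball turns local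
  hypotheses into global integrability.\<close>

lemma local_higher_integrability:
  fixes \<phi> :: "'n::{finite,linorder} form"
  assumes N2: "2 \<le> CARD('n)" and \<Omega>: "open \<Omega>" and \<phi>: "bounded_volume_form m \<phi>"
    and f: "finite_distortion_curve m \<phi> \<Omega> f Df K" and lam: "0 < lam"
    and expK: "L1_loc \<Omega> (\<lambda>x. exp (lam * real_of_ereal (K x)))"
    and R: "0 < R" "cball x0 R \<subseteq> \<Omega>"
    and a: "0 < a" "a \<le> critical_const TYPE('n) * lam * (inf_norm m \<phi> / l1_norm m \<phi>)" "a' \<le> a"
  shows "(\<lambda>x. star_pullback m \<phi> f Df x * ln (exp 1 + star_pullback m \<phi> f Df x) powr a') absolutely_integrable_on ball x0 (R / 4)"
    and "(\<lambda>x. op_norm m (Df x) ^ CARD('n) * ln (exp 1 + op_norm m (Df x)) powr (a' - 1)) absolutely_integrable_on ball x0 (R / 4)"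
proof -
  let ?N = "CARD('n)" and ?J = "star_pullback m \<phi> f Df" and ?B = "ball x0 (R / 4)" and ?cB = "cball x0 R"
  define L where "L = l1_norm m \<phi>"
  define c where "c = inf_norm m \<phi>"
  have smooth: "\<And>I. I \<in> multi_indices m \<Longrightarrow> smooth_target m (\<phi> I)" and closed: "closed_form m \<phi>"
    using \<phi> by (auto simp: bounded_volume_form_def volume_form_def)
  have L: "(\<Sum>I\<in>multi_indices m. \<bar>\<phi> I y\<bar>) \<le> L" if "y \<in> Rm m" for y
    unfolding L_def using \<phi> that by (intro l1_norm_bound) (auto simp: bounded_volume_form_def)
  have c_pos: "0 < c"
  proof -
    obtain e where "0 < e" "\<forall>y\<in>Rm m. \<exists>I\<in>multi_indices m. e < \<bar>\<phi> I y\<bar>"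
      using \<phi> by (auto simp: bounded_volume_form_def)
    then show ?thesis unfolding c_def by (intro inf_norm_pos[where L = L, OF L]) auto
  qed
  have c_le: "c \<le> comass m \<phi> y" if "y \<in> Rm m" for y
    unfolding c_def by (rule inf_norm_le_comass[where L = L, OF L that])
  have W: "W11_loc m \<Omega> f Df" using f by (simp add: finite_distortion_curve_def)
  have fRm: "f x \<in> Rm m" and DfRm: "Df x l \<in> Rm m" if "x \<in> \<Omega>" for x l
    using W that by (auto simp: W11_loc_def)
  have cB: "compact ?cB \<and> ?cB \<subseteq> \<Omega>" using R by simp
  have loc: "integrable lebesgue (\<lambda>x. indicator ?cB x * u x)" if "L1_loc \<Omega> u" for u
    using that cB by (simp add: L1_loc_def set_integrable_def)
  \<comment> \<open>The weak derivative identity survives the cut-off for test functions supported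
    in the open ball, where nothing has changed.\<close>
  define f' where "f' x = (if x \<in> ?cB then f x else (\<lambda>_. 0))" for x
  define Df' where "Df' x = (if x \<in> ?cB then Df x else (\<lambda>_ _. 0))" for x
  define Kf where "Kf x = real_of_ereal (K x)" for x
  have J': "form_eval m \<phi> (f' x) (Df' x) = indicator ?cB x * ?J x" for x
    by (cases "x \<in> ?cB") (simp_all add: f'_def Df'_def star_pullback_def form_eval_def dx_0)
  \<comment> \<open>The comass at \<open>f x\<close> is replaced by its infimum \<open>c\<close>.
    Nonnegativity of the pulled back form is read off from the distortion inequality, as the
    distortion is at least one.\<close>
  have AE: "AE x in lebesgue. x \<in> ?cB \<longrightarrow> 1 \<le> Kf x \<and> c * op_norm m (Df x) ^ ?N \<le> Kf x * ?J x \<and> 0 \<le> ?J x"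
    using finite_distortion_curve_AE[OF \<Omega> f]
  proof eventually_elim
    case (elim x)
    show ?case
    proof
      assume "x \<in> ?cB"
      then have x: "x \<in> \<Omega>" using R by auto
      have K: "1 \<le> Kf x" "comass m \<phi> (f x) * op_norm m (Df x) ^ ?N \<le> Kf x * ?J x" using elim x by (auto simp: Kf_def)
      have "c * op_norm m (Df x) ^ ?N \<le> comass m \<phi> (f x) * op_norm m (Df x) ^ ?N"
        using c_le[OF fRm[OF x]] op_norm_nonneg[of m "Df x"] by (intro mult_right_mono) auto
      then have le: "c * op_norm m (Df x) ^ ?N \<le> Kf x * ?J x" using K(2) by linarith
      have "0 \<le> c * op_norm m (Df x) ^ ?N" using c_pos op_norm_nonneg[of m "Df x"] by simp
      then have "0 \<le> Kf x * ?J x" using le by linarith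
      then have "0 \<le> ?J x" using K(1) by (simp add: zero_le_mult_iff)
      then show "1 \<le> Kf x \<and> c * op_norm m (Df x) ^ ?N \<le> Kf x * ?J x \<and> 0 \<le> ?J x" using K(1) le by blast
    qed
  qed
  interpret cutoff_curve m \<phi> L f' Df' x0 R
  proof
    show "f' x \<in> Rm m" "Df' x l \<in> Rm m" for x l
      using fRm DfRm R by (auto simp: f'_def Df'_def Rm_iff)
    show "integrable lebesgue (\<lambda>x. f' x i)" if "i < m" for i
    proof -
      have "(\<lambda>x. f' x i) = (\<lambda>x. indicator ?cB x * f x i)" by (auto simp: f'_def fun_eq_iff)
      then show ?thesis using W that by (simp only: W11_loc_def loc)
    qed
    show "integrable lebesgue (\<lambda>x. Df' x l i)" if "i < m" for l i
    proof -
      have "(\<lambda>x. Df' x l i) = (\<lambda>x. indicator ?cB x * Df x l i)" by (auto simp: Df'_def fun_eq_iff)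
      then show ?thesis using W that by (simp only: W11_loc_def loc)
    qed
    show "(LINT x|lebesgue. f' x i * pderiv_domain l \<psi> x) = - (LINT x|lebesgue. Df' x l i * \<psi> x)"
      if "i < m" and \<psi>: "test_function (ball x0 R) \<psi>" for i l \<psi>
    proof -
      obtain S where S: "compact S" "S \<subseteq> ball x0 R" "\<And>x. x \<notin> S \<Longrightarrow> \<psi> x = 0"
        using \<psi> unfolding test_function_def by blast
      have Ck: "Ck_domain (Suc 0) \<psi>" using \<psi> unfolding test_function_def by blast
      have pd: "pderiv_domain l \<psi> x = 0" if "x \<notin> S" for x
        by (rule pderiv_domain_zero_outside[OF Ck compact_imp_closed[OF S(1)] S(3) that])
      have S_sub: "x \<in> ?cB" "x \<in> \<Omega>" if "x \<in> S" for x using that S(2) R(2) by (auto simp: subset_iff)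
      have "test_function \<Omega> \<psi>"
        using \<psi> S_sub S(1,3) unfolding test_function_def by blast
      then have "(LINT x:\<Omega>|lebesgue. f x i * pderiv_domain l \<psi> x) = - (LINT x:\<Omega>|lebesgue. Df x l i * \<psi> x)"
        using W \<open>i < m\<close> by (simp only: W11_loc_def weak_pderiv_def)
      moreover have "indicator \<Omega> x *\<^sub>R (f x i * pderiv_domain l \<psi> x) = f' x i * pderiv_domain l \<psi> x" for x
        using pd[of x] S_sub[of x] by (cases "x \<in> S") (auto simp: f'_def)
      moreover have "indicator \<Omega> x *\<^sub>R (Df x l i * \<psi> x) = Df' x l i * \<psi> x" for x
        using S(3)[of x] S_sub[of x] by (cases "x \<in> S") (auto simp: Df'_def)
      ultimately show ?thesis by (simp only: set_lebesgue_integral_def)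
    qed
  qed (use smooth closed L R in \<open>auto simp: f'_def Df'_def\<close>)
  have J_eq: "jacobian x = indicator ?cB x * ?J x" for x by (simp add: jacobian_def J')
  have expK_int: "integrable lebesgue (\<lambda>x. indicator ?cB x * exp (lam * Kf x))"
    unfolding Kf_def by (rule loc[OF expK])
  interpret distortion_curve m \<phi> L f' Df' x0 R Kf lam c
  proof
    show "integrable lebesgue jacobian"
      unfolding J_eq[abs_def] using f by (intro loc) (simp add: finite_distortion_curve_def)
    show "AE x in lebesgue. x \<in> ?cB \<longrightarrow> 0 \<le> jacobian x \<and> 1 \<le> Kf x \<and> c * g x ^ ?N \<le> real ?N ^ ?N * Kf x * jacobian x"
      using AE
    proof eventually_elim
      case (elim x)
      show ?case
      proof
        assume x: "x \<in> ?cB"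
        have "g x \<le> (\<Sum>l\<in>(UNIV :: 'n set). op_norm m (Df x))"
          unfolding g_def using x by (intro sum_mono) (simp add: Df'_def enorm_le_op_norm)
        then have "g x ^ ?N \<le> (real ?N * op_norm m (Df x)) ^ ?N"
          using g_nonneg[of x] by (intro power_mono) auto
        then have "c * g x ^ ?N \<le> c * (real ?N * op_norm m (Df x)) ^ ?N"
          using c_pos by (intro mult_left_mono) auto
        also have "\<dots> = real ?N ^ ?N * (c * op_norm m (Df x) ^ ?N)"
          by (simp add: power_mult_distrib)
        also have "\<dots> \<le> real ?N ^ ?N * (Kf x * ?J x)" using elim x by (intro mult_left_mono) auto
        finally show "0 \<le> jacobian x \<and> 1 \<le> Kf x \<and> c * g x ^ ?N \<le> real ?N ^ ?N * Kf x * jacobian x"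
          using elim x by (simp add: J_eq mult.assoc)
      qed
    qed
  qed (use N2 c_pos lam expK_int in auto)
  have small: "L * main_const * absorb_const * (2 * a) \<le> 1 / 2"
  proof (cases "L = 0")
    case False
    then have "0 < L" using L_nonneg by simp
    define X where "X = 4 * (2::real) ^ (?N - 1) * real ?N ^ ?N * (2 * real ?N)"
    have mX: "0 < main_const" "0 < X" using kap_pos by (auto simp: main_const_def X_def)
    have "critical_const TYPE('n) = 1 / (4 * main_const * X)"
      by (simp add: critical_const_def main_const_def kap_def X_def)
    then have "a \<le> 1 / (4 * main_const * X) * lam * (c / L)" using a(2) by (simp add: c_def L_def)
    then have "a * (4 * main_const * X * L) \<le> lam * c"
      using \<open>0 < L\<close> mX by (simp add: field_simps)
    moreover have "absorb_const = X / (c * lam)" by (simp add: absorb_const_def X_def)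
    moreover have "L * main_const * (X / (c * lam)) * (2 * a) = a * (4 * main_const * X * L) / (2 * (c * lam))"
      using c_pos lam by (simp add: field_simps)
    ultimately show ?thesis using c_pos lam by (simp add: divide_le_eq mult_ac)
  qed simp
  have B_sub: "x \<in> ?B \<Longrightarrow> x \<in> ?cB" for x using R(1) by auto
  have B_sets: "?B \<in> sets lebesgue" by simp
  have J_meas: "jacobian \<in> borel_measurable lebesgue" by (rule jacobian_measurable)
  have main: "integrable lebesgue (\<lambda>x. indicator ?B x * (jacobian x * ln (exp 1 + jacobian x) powr a))"
    by (rule local_log_integrability[OF a(1) small])
  have AE_J: "AE x in lebesgue. x \<in> ?B \<longrightarrow> 1 \<le> Kf x \<and> c * op_norm m (Df x) ^ ?N \<le> Kf x * jacobian x \<and> 0 \<le> jacobian x"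
    using AE by eventually_elim (use B_sub J_eq in auto)
  have ln1: "1 \<le> ln (exp 1 + y)" if "0 \<le> y" for y :: real
    using that ln_mono[of "exp 1" "exp 1 + y"] by (simp add: add_pos_nonneg)
  have "integrable lebesgue (\<lambda>x. indicator ?B x * (jacobian x * ln (exp 1 + jacobian x) powr a'))"
  proof (rule Bochner_Integration.integrable_bound[OF main])
    show "(\<lambda>x. indicator ?B x * (jacobian x * ln (exp 1 + jacobian x) powr a')) \<in> borel_measurable lebesgue"
      using J_meas B_sets
      by (intro borel_measurable_times borel_measurable_indicator powr_real_measurable borel_measurable_ln
          borel_measurable_add borel_measurable_const)
    show "AE x in lebesgue. norm (indicator ?B x * (jacobian x * ln (exp 1 + jacobian x) powr a'))
        \<le> norm (indicator ?B x * (jacobian x * ln (exp 1 + jacobian x) powr a))"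
      using AE_J
    proof eventually_elim
      case (elim x)
      show ?case
      proof (cases "x \<in> ?B")
        case True
        then have J0: "0 \<le> jacobian x" using elim by blast
        have "ln (exp 1 + jacobian x) powr a' \<le> ln (exp 1 + jacobian x) powr a"
          using ln1[OF J0] a(3) by (intro powr_mono) auto
        from mult_left_mono[OF this J0] show ?thesis using J0 by (simp add: abs_mult indicator_def)
      qed simp
    qed
  qed
  also have "(\<lambda>x. indicator ?B x * (jacobian x * ln (exp 1 + jacobian x) powr a'))
     = (\<lambda>x. indicator ?B x *\<^sub>R (?J x * ln (exp 1 + ?J x) powr a'))"
    using B_sub by (auto simp: fun_eq_iff J_eq indicator_def)
  finally show "(\<lambda>x. ?J x * ln (exp 1 + ?J x) powr a') absolutely_integrable_on ?B"
    by (simp only: set_integrable_def)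
  obtain C where C: "0 \<le> C" "\<And>t J k. 0 \<le> t \<Longrightarrow> 0 \<le> J \<Longrightarrow> 1 \<le> k \<Longrightarrow> c * t ^ ?N \<le> k * J \<Longrightarrow>
       t ^ ?N * ln (exp 1 + t) powr (a - 1) \<le> C * (J * ln (exp 1 + J) powr a + exp (lam * k) + 1)"
    using log_gradient_bound[OF a(1) lam c_pos N2] by metis
  have op_meas: "(\<lambda>x. op_norm m (Df' x)) \<in> borel_measurable lebesgue"
    by (intro op_norm_measurable f_Df_measurable(2))
  have dom: "integrable lebesgue (\<lambda>x. C * (indicator ?B x * (jacobian x * ln (exp 1 + jacobian x) powr a)
      + indicator ?cB x * exp (lam * Kf x) + indicator ?B x))"
    using lmeasurable_ball[of x0 "R / 4"] unfolding lmeasurable_iff_integrable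
    by (intro integrable_mult_right Bochner_Integration.integrable_add main expK_int)
  have "integrable lebesgue (\<lambda>x. indicator ?B x * (op_norm m (Df' x) ^ ?N * ln (exp 1 + op_norm m (Df' x)) powr (a' - 1)))"
  proof (rule Bochner_Integration.integrable_bound[OF dom])
    show "(\<lambda>x. indicator ?B x * (op_norm m (Df' x) ^ ?N * ln (exp 1 + op_norm m (Df' x)) powr (a' - 1))) \<in> borel_measurable lebesgue"
      using op_meas B_sets
      by (intro borel_measurable_times borel_measurable_indicator powr_real_measurable borel_measurable_ln
          borel_measurable_add borel_measurable_const borel_measurable_power)
    show "AE x in lebesgue. norm (indicator ?B x * (op_norm m (Df' x) ^ ?N * ln (exp 1 + op_norm m (Df' x)) powr (a' - 1)))
        \<le> norm (C * (indicator ?B x * (jacobian x * ln (exp 1 + jacobian x) powr a)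
      + indicator ?cB x * exp (lam * Kf x) + indicator ?B x))"
      using AE_J
    proof eventually_elim
      case (elim x)
      show ?case
      proof (cases "x \<in> ?B")
        case False
        then show ?thesis by (simp add: indicator_def)
      next
        case True
        let ?t = "op_norm m (Df x)"
        have Df'_eq: "Df' x = Df x" using B_sub[OF True] by (simp add: Df'_def)
        have t0: "0 \<le> ?t" by (rule op_norm_nonneg)
        have J0: "0 \<le> jacobian x" using elim True by blast
        have "ln (exp 1 + ?t) powr (a' - 1) \<le> ln (exp 1 + ?t) powr (a - 1)"
          using ln1[OF t0] a(3) by (intro powr_mono) auto
        then have "?t ^ ?N * ln (exp 1 + ?t) powr (a' - 1) \<le> ?t ^ ?N * ln (exp 1 + ?t) powr (a - 1)"
          using t0 by (intro mult_left_mono) auto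
        also have "\<dots> \<le> C * (jacobian x * ln (exp 1 + jacobian x) powr a + exp (lam * Kf x) + 1)"
          using elim True t0 by (intro C(2)) auto
        finally have "?t ^ ?N * ln (exp 1 + ?t) powr (a' - 1) \<le> C * (jacobian x * ln (exp 1 + jacobian x) powr a + exp (lam * Kf x) + 1)" .
        moreover have "0 \<le> ?t ^ ?N * ln (exp 1 + ?t) powr (a' - 1)" using t0 by simp
        ultimately show ?thesis using True B_sub[OF True] J0 C(1) zero_le_power[OF t0, of ?N] by (simp add: Df'_eq abs_mult)
      qed
    qed
  qed
  also have "(\<lambda>x. indicator ?B x * (op_norm m (Df' x) ^ ?N * ln (exp 1 + op_norm m (Df' x)) powr (a' - 1)))
     = (\<lambda>x. indicator ?B x *\<^sub>R (op_norm m (Df x) ^ ?N * ln (exp 1 + op_norm m (Df x)) powr (a' - 1)))"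
    using B_sub by (auto simp: fun_eq_iff Df'_def indicator_def)
  finally show "(\<lambda>x. op_norm m (Df x) ^ ?N * ln (exp 1 + op_norm m (Df x)) powr (a' - 1)) absolutely_integrable_on ?B"
    by (simp only: set_integrable_def)
qed

theorem theorem1p7:
  assumes "2 \<le> CARD('n::{finite,linorder})"
  shows "\<exists>c1>0. \<forall>m \<ge> CARD('n). \<forall>(\<Omega> :: (real ^ ('n::{finite,linorder})) set) (\<phi> :: 'n form) f Df K (lam :: real).
    open \<Omega> \<and> connected \<Omega> \<and> \<Omega> \<noteq> {} \<and>
    bounded_volume_form m \<phi> \<and>
    finite_distortion_curve m \<phi> \<Omega> f Df K \<and>
    condition_D m \<phi> \<Omega> Df \<and>
    lam > 0 \<and> L1_loc \<Omega> (\<lambda>x. exp (lam * real_of_ereal (K x))) \<longrightarrow>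
    (\<forall>a :: real. a < c1 * lam * (inf_norm m \<phi> / l1_norm m \<phi>) \<longrightarrow>
      L1_loc \<Omega> (\<lambda>x. star_pullback m \<phi> f Df x * ln (exp 1 + star_pullback m \<phi> f Df x) powr a) \<and>
      L1_loc \<Omega> (\<lambda>x. op_norm m (Df x) ^ CARD('n) * ln (exp 1 + op_norm m (Df x)) powr (a - 1)))"
proof (intro exI[of _ "critical_const TYPE('n)"] conjI allI impI critical_const_pos)
  fix m and \<Omega> :: "(real, 'n) vec set" and \<phi> :: "'n form" and f Df K and lam a :: real
  let ?T = "critical_const TYPE('n) * lam * (inf_norm m \<phi> / l1_norm m \<phi>)"
  assume A: "open \<Omega> \<and> connected \<Omega> \<and> \<Omega> \<noteq> {} \<and> bounded_volume_form m \<phi> \<and>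
    finite_distortion_curve m \<phi> \<Omega> f Df K \<and> condition_D m \<phi> \<Omega> Df \<and>
    lam > 0 \<and> L1_loc \<Omega> (\<lambda>x. exp (lam * real_of_ereal (K x)))" and a: "a < ?T"
  have T: "0 < ?T"
  proof -
    obtain e where e: "0 < e" "\<forall>y\<in>Rm m. \<exists>I\<in>multi_indices m. e < \<bar>\<phi> I y\<bar>"
      using A by (auto simp: bounded_volume_form_def)
    have L: "(\<Sum>I\<in>multi_indices m. \<bar>\<phi> I y\<bar>) \<le> l1_norm m \<phi>" if "y \<in> Rm m" for y
      using A that by (intro l1_norm_bound) (auto simp: bounded_volume_form_def)
    have zero: "(\<lambda>_. 0) \<in> Rm m" by (simp add: Rm_iff)
    then obtain I where I: "I \<in> multi_indices m" "e < \<bar>\<phi> I (\<lambda>_. 0)\<bar>" using e(2) by blast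
    have "\<bar>\<phi> I (\<lambda>_. 0)\<bar> \<le> (\<Sum>I\<in>multi_indices m. \<bar>\<phi> I (\<lambda>_. 0)\<bar>)"
      using I(1) by (intro member_le_sum) auto
    then have "0 < l1_norm m \<phi>" using L[OF zero] I(2) e(1) by linarith
    moreover have "0 < inf_norm m \<phi>"
      using e by (intro inf_norm_pos[where L = "l1_norm m \<phi>", OF L]) auto
    ultimately show ?thesis using A critical_const_pos[where 'n = 'n] by simp
  qed
  \<comment> \<open>The given exponent may be zero or negative, whereas the local result starts from
    a positive one; a number \<open>b\<close> strictly between both bounds serves in all
    cases.\<close>
  have "max a 0 < ?T" using T a by (simp only: max_less_iff_conj)
  then obtain b where "max a 0 < b" "b < ?T" using dense by blast
  then have b: "0 < b" "b \<le> ?T" "a \<le> b" by (simp_all only: max_less_iff_conj less_imp_le)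
  have ball: "\<exists>R>0. cball x R \<subseteq> \<Omega>" if "x \<in> \<Omega>" for x
    using A that open_contains_cball[of \<Omega>] by blast
  have loc: "\<exists>r>0. u absolutely_integrable_on ball x r"
    if x: "x \<in> \<Omega>" and u: "\<And>R. 0 < R \<Longrightarrow> cball x R \<subseteq> \<Omega> \<Longrightarrow> u absolutely_integrable_on ball x (R / 4)"
    for u :: "(real, 'n) vec \<Rightarrow> real" and x
  proof -
    obtain R where R: "0 < R" "cball x R \<subseteq> \<Omega>" using ball[OF x] by blast
    show ?thesis by (rule exI[of _ "R / 4"]) (use u[OF R] R in auto)
  qed
  have hyps: "open \<Omega>" "bounded_volume_form m \<phi>" "finite_distortion_curve m \<phi> \<Omega> f Df K" "0 < lam"
    "L1_loc \<Omega> (\<lambda>x. exp (lam * real_of_ereal (K x)))" using A by auto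
  show "L1_loc \<Omega> (\<lambda>x. star_pullback m \<phi> f Df x * ln (exp 1 + star_pullback m \<phi> f Df x) powr a)"
    by (intro L1_loc_if_balls hyps(1) loc local_higher_integrability(1)[OF assms hyps _ _ b])
  show "L1_loc \<Omega> (\<lambda>x. op_norm m (Df x) ^ CARD('n) * ln (exp 1 + op_norm m (Df x)) powr (a - 1))"
    by (intro L1_loc_if_balls hyps(1) loc local_higher_integrability(2)[OF assms hyps _ _ b])
qed

end
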